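(* Let $G$ be a group, $A=\bigoplus_{g\in G}A_g$ an epsilon-strongly $G$-graded ring such that $R:=A_1$ is semiperfect, and let $\mathcal{E}=\{e_1,\dots,e_n\}$ be a set of pairwise orthogonal primitive idempotents of $R$ such that $\{Re_1,\dots,Re_n\}$ is an irredundant set of representatives of the indecomposable projective left $R$-modules. Let $\mathcal{X}\subset\mathcal{E}$ be a non-empty subset, let $$G_{\mathcal{X}}=\{g\in G:\ \text{for every } e_i\in\mathcal{X}\text{ there is } e_j\in\mathcal{X}\text{ such that }A_g\otimes_RRe_i\simeq Re_j\text{ as left }R\text{-modules}\},$$ let $A_{G_{\mathcal{X}}}=\bigoplus_{g\in G_{\mathcal{X}}}A_g$, and let $P$ be a left $R$-module. The following statements hold: (i) If $P$ is a $G$-invariant progenerator in the category of left $R$-modules, then $A$ is graded equivalent to the partial crossed product $\operatorname{END}_A(A\otimes_RP)$. (ii) If $P$ is an $R$-bimodule with $[P]\in\mathtt{PicS}(R)$ and $1\le i\le n$, then either $P\otimes_RRe_i=0$ or $P\otimes_RRe_i\simeq Re_j$ for some $e_j\in\mathcal{E}$. (iii) $G_{\mathcal{X}}$ is a subgroup of $G$. Moreover, if $Q_{\mathcal{X}}:=\bigoplus_{e_i\in\mathcal{X}}Re_i$, then $\operatorname{END}_{A_{G_{\mathcal{X}}}}(A_{G_{\mathcal{X}}}\otimes_RQ_{\mathcal{X}})$ is a partial crossed product. (iv) $G_{\mathcal{E}}=\{g\in G:\epsilon_ge_i=e_i\ \forall e_i\in\mathcal{E}\}=\{g\in G:\epsilon_ge_i\neq0\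 \forall e_i\in\mathcal{E}\}$. (v) $A_{G_{\mathcal{E}}}$ is graded equivalent to the partial crossed product $\operatorname{END}_{A_{G_{\mathcal{E}}}}(A_{G_{\mathcal{E}}}\otimes_RQ_{\mathcal{E}})$, where $Q_{\mathcal{E}}=\bigoplus_{e_i\in\mathcal{E}}Re_i$.
   Context: Rings are associative and unital, modules and bimodules unital. For subsets $X,Y$ of a ring, $XY$ is the set of finite sums of products $xy$. A $G$-graded unital ring $A=\bigoplus_{g\in G}A_g$ (so $A_gA_h\subseteq A_{gh}$) is epsilon-strongly graded if for every $g\in G$ there is $\epsilon_g\in A_gA_{g^{-1}}$ with $\epsilon_ga=a=a\epsilon_{g^{-1}}$ for all $a\in A_g$. The element $\epsilon_g$ is unique, and is a central idempotent of $R=A_1$. $A_{G_{\mathcal{X}}}$ is graded by $G_{\mathcal{X}}$, with identity component $R$. $\operatorname{supp}(A)=\{g\in G:A_g\neq0\}$. A left $R$-module $M$ is $G$-invariant (with respect to $A$) if $A_g\otimes_RM\simeq M$ as left $R$-modules for all $g\in\operatorname{supp}(A)$. The induced module $A\otimes_RM$ is a $G$-graded left $A$-module with components $A_g\otimes_RM$. For a $G$-graded left $A$-module $N=\bigoplus_{g\in G}N_g$ ($A_gN_h\subseteq N_{gh}$), $\operatorname{END}_A(N)=\bigoplus_{l\in G}\operatorname{Mor}_A(N,N)_l$, where $\operatorname{Mor}_A(N,N)_l$ is the group of $A$-linear maps $f:N\to N$ with $f(N_g)\subseteq N_{gl}$ for all $g$; it is a $G$-graded ring with multiplication $uv=v\circ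 u$. (These notions are used for $A_{G_{\mathcal{X}}}$ with the group $G_{\mathcal{X}}$ as well.) Two $G$-graded rings $A,B$ are graded equivalent if there is a graded left $A$-module $P$ which is an $A$-progenerator and such that $\operatorname{END}_A(P)\simeq B$ as graded rings. An $R$-bimodule $P$ is partially invertible if it is finitely generated projective as a left and as a right $R$-module and the maps $l:R\to\operatorname{End}(P_R)$, $l(a)(x)=ax$, and $r:R\to\operatorname{End}({}_RP)$, $r(a)(x)=xa$, are epimorphisms of $R$-bimodules (with $(af)(x)=af(x)$, $(fa)(x)=f(ax)$ on $\operatorname{End}(P_R)$ and $(af)(x)=f(xa)$, $(fa)(x)=f(x)a$ on $\operatorname{End}({}_RP)$). $\mathtt{PicS}(R)$ is the set of isomorphism classes $[P]$ of partially invertible $R$-bimodules. A unital twisted partial action of a group $G$ on a ring $S$ is a triple $(\{D_g\}_{g\in G},\{\alpha_g\}_{g\in G},\{\omega_{g,h}\}_{g,h\in G})$, where $D_g$ is an ideal of $S$ generated by a (possibly zero) central idempotent $1_g$, $\alpha_g:D_{g^{-1}}\to D_g$ is a ring isomorphism, and $\omega_{g,h}$ is a unit of the ring $D_gD_{gh}$, such that for all $g,h,l\in G$: $D_1=S$ and $\alpha_1=\mathrm{id}_S$; $\alpha_g(D_{g^{-1}}D_h)=D_gD_{gh}$; $\alpha_g\circ\alpha_h(t)=\omega_{g,h}\alpha_{gh}(t)\omega_{g,h}^{-1}$ for $t\in D_{h^{-1}}D_{(gh)^{-1}}$; $\omega_{1,g}=\omega_{g,1}=1_g$; $\alpha_g(\omega_{h,l}1_{g^{-1}})\omega_{g,hl}=\omega_{g,h}\omega_{gh,l}$.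 The associated partial crossed product is $S\star_{\alpha,\omega}G=\bigoplus_{g\in G}D_g\delta_g$ with multiplication $(a_g\delta_g)(b_h\delta_h)=a_g\alpha_g(b_h1_{g^{-1}})\omega_{g,h}\delta_{gh}$, graded by $(S\star_{\alpha,\omega}G)_g=D_g\delta_g$. A $G$-graded ring "is a partial crossed product" if it is isomorphic as a graded ring to such an $S\star_{\alpha,\omega}G$; in (i) and (v) it is part of the assertion that the indicated ring is one. *)

theory Defs
  imports "HOL-Algebra.Module" "HOL-Algebra.QuotRing" "HOL-Algebra.Free_Abelian_Groups"
begin

section \<open>Modules over noncommutative rings\<close>

text \<open>
  The library locale \<open>module\<close> requires a commutative ring of scalars. The record type
  \<open>module\<close> and the locale \<open>submodule\<close> do not, and are reused. As in the library, the fields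
  \<open>mult\<close> and \<open>one\<close> of a module record carry no information.
\<close>

locale left_module = R?: ring R + M?: abelian_group M
  for R :: "('a, 'r) ring_scheme" (structure) and M :: "('a, 'b, 'm) module_scheme" (structure) +
  assumes smult_closed:
      "\<lbrakk>a \<in> carrier R; x \<in> carrier M\<rbrakk> \<Longrightarrow> a \<odot>\<^bsub>M\<^esub> x \<in> carrier M"
    and smult_l_distr:
      "\<lbrakk>a \<in> carrier R; b \<in> carrier R; x \<in> carrier M\<rbrakk> \<Longrightarrow>
        (a \<oplus>\<^bsub>R\<^esub> b) \<odot>\<^bsub>M\<^esub> x = a \<odot>\<^bsub>M\<^esub> x \<oplus>\<^bsub>M\<^esub> b \<odot>\<^bsub>M\<^esub> x"
    and smult_r_distr:
      "\<lbrakk>a \<in> carrier R; x \<in> carrier M; y \<in> carrier M\<rbrakk> \<Longrightarrow>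
        a \<odot>\<^bsub>M\<^esub> (x \<oplus>\<^bsub>M\<^esub> y) = a \<odot>\<^bsub>M\<^esub> x \<oplus>\<^bsub>M\<^esub> a \<odot>\<^bsub>M\<^esub> y"
    and smult_assoc1:
      "\<lbrakk>a \<in> carrier R; b \<in> carrier R; x \<in> carrier M\<rbrakk> \<Longrightarrow>
        (a \<otimes>\<^bsub>R\<^esub> b) \<odot>\<^bsub>M\<^esub> x = a \<odot>\<^bsub>M\<^esub> (b \<odot>\<^bsub>M\<^esub> x)"
    and smult_one:
      "x \<in> carrier M \<Longrightarrow> \<one>\<^bsub>R\<^esub> \<odot>\<^bsub>M\<^esub> x = x"

text \<open>Linear maps are extensional functions, so that sets of linear maps are honest Hom groups.\<close>

definition lin_maps ::
  "('a, 'r) ring_scheme \<Rightarrow> ('a, 'b, 'm) module_scheme \<Rightarrow> ('a, 'c, 'n) module_scheme \<Rightarrow> ('b \<Rightarrow> 'c) set"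
  where "lin_maps R M N = {f \<in> carrier M \<rightarrow>\<^sub>E carrier N.
     (\<forall>x\<in>carrier M. \<forall>y\<in>carrier M. f (x \<oplus>\<^bsub>M\<^esub> y) = f x \<oplus>\<^bsub>N\<^esub> f y) \<and>
     (\<forall>a\<in>carrier R. \<forall>x\<in>carrier M. f (a \<odot>\<^bsub>M\<^esub> x) = a \<odot>\<^bsub>N\<^esub> f x)}"

definition module_iso ::
  "('a, 'r) ring_scheme \<Rightarrow> ('a, 'b, 'm) module_scheme \<Rightarrow> ('a, 'c, 'n) module_scheme \<Rightarrow> bool"
  where "module_iso R M N \<longleftrightarrow> (\<exists>f\<in>lin_maps R M N. bij_betw f (carrier M) (carrier N))"

definition regular_module :: "('a, 'r) ring_scheme \<Rightarrow> ('a, 'a) module"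
  where "regular_module R =
    \<lparr>carrier = carrier R, monoid.mult = monoid.mult R, monoid.one = monoid.one R,
     ring.zero = ring.zero R, ring.add = ring.add R, module.smult = monoid.mult R\<rparr>"

definition principal_module :: "('a, 'r) ring_scheme \<Rightarrow> 'a \<Rightarrow> ('a, 'a) module"
  where "principal_module R e = (regular_module R)\<lparr>carrier := {r \<otimes>\<^bsub>R\<^esub> e | r. r \<in> carrier R}\<rparr>"

definition direct_sum :: "'i set \<Rightarrow> ('i \<Rightarrow> ('a, 'b, 'm) module_scheme) \<Rightarrow> ('a, 'i \<Rightarrow> 'b) module"
  where "direct_sum I M =
    \<lparr>carrier = {f \<in> (\<Pi>\<^sub>E i\<in>I. carrier (M i)). finite {i\<in>I. f i \<noteq> \<zero>\<^bsub>M i\<^esub>}},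
     monoid.mult = undefined, monoid.one = undefined,
     ring.zero = (\<lambda>i\<in>I. \<zero>\<^bsub>M i\<^esub>),
     ring.add = (\<lambda>f g. \<lambda>i\<in>I. f i \<oplus>\<^bsub>M i\<^esub> g i),
     module.smult = (\<lambda>a f. \<lambda>i\<in>I. a \<odot>\<^bsub>M i\<^esub> f i)\<rparr>"

definition internal_direct_sum2 ::
  "('a, 'r) ring_scheme \<Rightarrow> ('a, 'b, 'm) module_scheme \<Rightarrow> 'b set \<Rightarrow> 'b set \<Rightarrow> bool"
  where "internal_direct_sum2 R M U V \<longleftrightarrow>
    submodule U R M \<and> submodule V R M \<and> U \<inter> V = {\<zero>\<^bsub>M\<^esub>} \<and>
    carrier M = {u \<oplus>\<^bsub>M\<^esub> v | u v. u \<in> U \<and> v \<in> V}"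

text \<open>
  Projective: isomorphic to a direct summand of a free module. The elements of the module can
  serve as the index set of the free module (the canonical epimorphism from the free module on
  them splits if any epimorphism from a free module does), so that indexing by a set of type
  \<open>'b set\<close> is no restriction.
\<close>

definition projective_module :: "('a, 'r) ring_scheme \<Rightarrow> ('a, 'b, 'm) module_scheme \<Rightarrow> bool"
  where "projective_module R P \<longleftrightarrow> left_module R P \<and>
    (\<exists>(I :: 'b set) U V.
       internal_direct_sum2 R (direct_sum I (\<lambda>_. regular_module R)) U V \<and>
       module_iso R P ((direct_sum I (\<lambda>_. regular_module R))\<lparr>carrier := U\<rparr>))"

definition fin_gen_module :: "('a, 'r) ring_scheme \<Rightarrow> ('a, 'b, 'm) module_scheme \<Rightarrow> bool"
  where "fin_gen_module R P \<longleftrightarrow> left_module R P \<and>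
    (\<exists>S. finite S \<and> S \<subseteq> carrier P \<and>
       carrier P = {finsum P (\<lambda>s. c s \<odot>\<^bsub>P\<^esub> s) S | c. c \<in> S \<rightarrow> carrier R})"

text \<open>
  \<open>P\<close> is a generator iff it generates \<open>R\<close>, that is, \<open>R\<close> is an epimorphic image of some \<open>P\<^sup>n\<close>; it then
  generates every module, as every module is an epimorphic image of a free one.
\<close>

definition generator_module :: "('a, 'r) ring_scheme \<Rightarrow> ('a, 'b, 'm) module_scheme \<Rightarrow> bool"
  where "generator_module R P \<longleftrightarrow> left_module R P \<and>
    (\<exists>n::nat. \<exists>f\<in>lin_maps R (direct_sum {..<n} (\<lambda>_. P)) (regular_module R).
       f ` carrier (direct_sum {..<n} (\<lambda>_. P)) = carrier R)"

definition progenerator :: "('a, 'r) ring_scheme \<Rightarrow> ('a, 'b, 'm) module_scheme \<Rightarrow> bool"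
  where "progenerator R P \<longleftrightarrow>
    fin_gen_module R P \<and> projective_module R P \<and> generator_module R P"

definition indecomposable_module :: "('a, 'r) ring_scheme \<Rightarrow> ('a, 'b, 'm) module_scheme \<Rightarrow> bool"
  where "indecomposable_module R M \<longleftrightarrow> left_module R M \<and> carrier M \<noteq> {\<zero>\<^bsub>M\<^esub>} \<and>
    (\<forall>U V. internal_direct_sum2 R M U V \<longrightarrow> U = {\<zero>\<^bsub>M\<^esub>} \<or> V = {\<zero>\<^bsub>M\<^esub>})"


section \<open>Semiperfect rings\<close>

definition left_ideal :: "'a set \<Rightarrow> ('a, 'r) ring_scheme \<Rightarrow> bool"
  where "left_ideal L R \<longleftrightarrow> submodule L R (regular_module R)"

definition maximal_left_ideal :: "'a set \<Rightarrow> ('a, 'r) ring_scheme \<Rightarrow> bool"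
  where "maximal_left_ideal L R \<longleftrightarrow> left_ideal L R \<and> L \<noteq> carrier R \<and>
    (\<forall>K. left_ideal K R \<and> L \<subseteq> K \<longrightarrow> K = L \<or> K = carrier R)"

definition jacobson_radical :: "('a, 'r) ring_scheme \<Rightarrow> 'a set"
  where "jacobson_radical R = {x \<in> carrier R. \<forall>L. maximal_left_ideal L R \<longrightarrow> x \<in> L}"

definition semisimple_ring :: "('a, 'r) ring_scheme \<Rightarrow> bool"
  where "semisimple_ring R \<longleftrightarrow> ring R \<and>
    (\<forall>L. left_ideal L R \<longrightarrow> (\<exists>L'. internal_direct_sum2 R (regular_module R) L L'))"

definition semiperfect_ring :: "('a, 'r) ring_scheme \<Rightarrow> bool"
  where "semiperfect_ring R \<longleftrightarrow> ring R \<and> semisimple_ring (R Quot jacobson_radical R) \<and>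
    (\<forall>a\<in>carrier R. a \<otimes>\<^bsub>R\<^esub> a \<ominus>\<^bsub>R\<^esub> a \<in> jacobson_radical R \<longrightarrow>
       (\<exists>e\<in>carrier R. e \<otimes>\<^bsub>R\<^esub> e = e \<and> e \<ominus>\<^bsub>R\<^esub> a \<in> jacobson_radical R))"

definition primitive_idempotent :: "('a, 'r) ring_scheme \<Rightarrow> 'a \<Rightarrow> bool"
  where "primitive_idempotent R e \<longleftrightarrow> e \<in> carrier R \<and> e \<otimes>\<^bsub>R\<^esub> e = e \<and> e \<noteq> \<zero>\<^bsub>R\<^esub> \<and>
    (\<forall>f\<in>carrier R. \<forall>f'\<in>carrier R.
       f \<otimes>\<^bsub>R\<^esub> f = f \<and> f' \<otimes>\<^bsub>R\<^esub> f' = f' \<and> f \<otimes>\<^bsub>R\<^esub> f' = \<zero>\<^bsub>R\<^esub> \<and> f' \<otimes>\<^bsub>R\<^esub> f = \<zero>\<^bsub>R\<^esub> \<and> e = f \<oplus>\<^bsub>R\<^esub> f'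
       \<longrightarrow> f = \<zero>\<^bsub>R\<^esub> \<or> f' = \<zero>\<^bsub>R\<^esub>)"

definition pairwise_orthogonal :: "('a, 'r) ring_scheme \<Rightarrow> 'a set \<Rightarrow> bool"
  where "pairwise_orthogonal R E \<longleftrightarrow> (\<forall>e\<in>E. \<forall>f\<in>E. e \<noteq> f \<longrightarrow> e \<otimes>\<^bsub>R\<^esub> f = \<zero>\<^bsub>R\<^esub>)"

text \<open>
  \<open>{Re | e \<in> E}\<close> is an irredundant set of representatives of the indecomposable projective left
  \<open>R\<close>-modules. The second clause ranges over the modules with elements in the type of \<open>R\<close>. Over a
  semiperfect ring every indecomposable projective module is isomorphic to some \<open>Rf\<close> with \<open>f\<close> a
  primitive idempotent, hence to such a module.
\<close>

definition irredundant_indec_proj_reps :: "('a, 'r) ring_scheme \<Rightarrow> 'a set \<Rightarrow> bool"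
  where "irredundant_indec_proj_reps R E \<longleftrightarrow>
    (\<forall>e\<in>E. indecomposable_module R (principal_module R e) \<and>
            projective_module R (principal_module R e)) \<and>
    (\<forall>M :: ('a, 'a) module. indecomposable_module R M \<and> projective_module R M \<longrightarrow>
       (\<exists>e\<in>E. module_iso R M (principal_module R e))) \<and>
    (\<forall>e\<in>E. \<forall>f\<in>E. module_iso R (principal_module R e) (principal_module R f) \<longrightarrow> e = f)"


section \<open>Bimodules and tensor products\<close>

record ('a, 'b) bimodule = "('a, 'b) module" +
  rsmult :: "'b \<Rightarrow> 'a \<Rightarrow> 'b"

text \<open>Right \<open>R\<close>-modules are treated as left modules over the opposite ring.\<close>

definition opposite_ring :: "('a, 'r) ring_scheme \<Rightarrow> ('a, 'r) ring_scheme"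
  where "opposite_ring R = R\<lparr>monoid.mult := \<lambda>x y. y \<otimes>\<^bsub>R\<^esub> x\<rparr>"

definition right_part :: "('a, 'b, 'm) bimodule_scheme \<Rightarrow> ('a, 'b) module"
  where "right_part P =
    \<lparr>carrier = carrier P, monoid.mult = monoid.mult P, monoid.one = monoid.one P,
     ring.zero = ring.zero P, ring.add = ring.add P,
     module.smult = (\<lambda>a x. rsmult P x a)\<rparr>"

definition bimodule :: "('a, 'r) ring_scheme \<Rightarrow> ('a, 'b, 'm) bimodule_scheme \<Rightarrow> bool"
  where "bimodule R P \<longleftrightarrow> left_module R P \<and> left_module (opposite_ring R) (right_part P) \<and>
    (\<forall>a\<in>carrier R. \<forall>b\<in>carrier R. \<forall>x\<in>carrier P.
       rsmult P (a \<odot>\<^bsub>P\<^esub> x) b = a \<odot>\<^bsub>P\<^esub> (rsmult P x b))"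

text \<open>A subset of a ring, with the ring multiplication as left and right action.\<close>

definition sub_bimodule :: "('a, 'r) ring_scheme \<Rightarrow> 'a set \<Rightarrow> ('a, 'a) bimodule"
  where "sub_bimodule A X =
    \<lparr>carrier = X, monoid.mult = monoid.mult A, monoid.one = monoid.one A,
     ring.zero = ring.zero A, ring.add = ring.add A,
     module.smult = monoid.mult A, rsmult = monoid.mult A\<rparr>"

text \<open>
  \<open>X \<otimes>\<^sub>R M\<close> for a right \<open>R\<close>-module \<open>X\<close> and a left \<open>R\<close>-module \<open>M\<close>: the free abelian group on
  \<open>X \<times> M\<close> modulo the bilinear balanced relations. A scalar \<open>s\<close> acting on \<open>X\<close> from the left
  acts on the tensor product by \<open>s(x \<otimes> m) = sx \<otimes> m\<close>; as this action respects the
  relations, the union in \<open>smult\<close> is a union of copies of one and the same coset.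
\<close>

definition tensor_rels ::
  "('a, 'r) ring_scheme \<Rightarrow> ('a, 'b, 'm) bimodule_scheme \<Rightarrow> ('a, 'c, 'n) module_scheme
    \<Rightarrow> ('b \<times> 'c \<Rightarrow>\<^sub>0 int) set"
  where "tensor_rels R X M =
    {frag_of (x \<oplus>\<^bsub>X\<^esub> y, m) - frag_of (x, m) - frag_of (y, m) | x y m.
       x \<in> carrier X \<and> y \<in> carrier X \<and> m \<in> carrier M} \<union>
    {frag_of (x, m \<oplus>\<^bsub>M\<^esub> n) - frag_of (x, m) - frag_of (x, n) | x m n.
       x \<in> carrier X \<and> m \<in> carrier M \<and> n \<in> carrier M} \<union>
    {frag_of (rsmult X x r, m) - frag_of (x, r \<odot>\<^bsub>M\<^esub> m) | x r m.
       x \<in> carrier X \<and> r \<in> carrier R \<and> m \<in> carrier M}"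

definition tensor_kernel ::
  "('a, 'r) ring_scheme \<Rightarrow> ('a, 'b, 'm) bimodule_scheme \<Rightarrow> ('a, 'c, 'n) module_scheme
    \<Rightarrow> ('b \<times> 'c \<Rightarrow>\<^sub>0 int) set"
  where "tensor_kernel R X M =
    generate (free_Abelian_group (carrier X \<times> carrier M)) (tensor_rels R X M)"

definition pure_tensor ::
  "('a, 'r) ring_scheme \<Rightarrow> ('a, 'b, 'm) bimodule_scheme \<Rightarrow> ('a, 'c, 'n) module_scheme
    \<Rightarrow> 'b \<Rightarrow> 'c \<Rightarrow> ('b \<times> 'c \<Rightarrow>\<^sub>0 int) set"
  where "pure_tensor R X M x m =
    tensor_kernel R X M #>\<^bsub>free_Abelian_group (carrier X \<times> carrier M)\<^esub> frag_of (x, m)"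

definition tensor ::
  "('a, 'r) ring_scheme \<Rightarrow> ('a, 'b, 'm) bimodule_scheme \<Rightarrow> ('a, 'c, 'n) module_scheme
    \<Rightarrow> ('a, ('b \<times> 'c \<Rightarrow>\<^sub>0 int) set) module"
  where "tensor R X M =
    (let F = free_Abelian_group (carrier X \<times> carrier M); K = tensor_kernel R X M in
    \<lparr>carrier = carrier (F Mod K), monoid.mult = undefined, monoid.one = undefined,
     ring.zero = \<one>\<^bsub>F Mod K\<^esub>, ring.add = monoid.mult (F Mod K),
     module.smult = (\<lambda>s T. \<Union>c\<in>T. K #>\<^bsub>F\<^esub> frag_extend (\<lambda>(x, m). frag_of (s \<odot>\<^bsub>X\<^esub> x, m)) c)\<rparr>)"


section \<open>Partially invertible bimodules\<close>

definition bimodule_homs ::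
  "('a, 'r) ring_scheme \<Rightarrow> ('a, 'b, 'm) bimodule_scheme \<Rightarrow> ('a, 'c, 'n) bimodule_scheme
    \<Rightarrow> ('b \<Rightarrow> 'c) set"
  where "bimodule_homs R P Q =
    lin_maps R P Q \<inter> lin_maps (opposite_ring R) (right_part P) (right_part Q)"

definition bimodule_epi ::
  "('a, 'r) ring_scheme \<Rightarrow> ('a, 'b, 'm) bimodule_scheme \<Rightarrow> ('a, 'c, 'n) bimodule_scheme
    \<Rightarrow> ('b \<Rightarrow> 'c) \<Rightarrow> bool"
  where "bimodule_epi R P Q f \<longleftrightarrow> f \<in> bimodule_homs R P Q \<and> f ` carrier P = carrier Q"

definition bimodule_iso ::
  "('a, 'r) ring_scheme \<Rightarrow> ('a, 'b, 'm) bimodule_scheme \<Rightarrow> ('a, 'c, 'n) bimodule_scheme \<Rightarrow> bool"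
  where "bimodule_iso R P Q \<longleftrightarrow> (\<exists>f\<in>bimodule_homs R P Q. bij_betw f (carrier P) (carrier Q))"

text \<open>\<open>End(P\<^sub>R)\<close> with \<open>(af)(x) = af(x)\<close>, \<open>(fa)(x) = f(ax)\<close>.\<close>

definition End_right ::
  "('a, 'r) ring_scheme \<Rightarrow> ('a, 'b, 'm) bimodule_scheme \<Rightarrow> ('a, 'b \<Rightarrow> 'b) bimodule"
  where "End_right R P =
    \<lparr>carrier = lin_maps (opposite_ring R) (right_part P) (right_part P),
     monoid.mult = undefined, monoid.one = undefined,
     ring.zero = (\<lambda>x\<in>carrier P. \<zero>\<^bsub>P\<^esub>), ring.add = (\<lambda>f g. \<lambda>x\<in>carrier P. f x \<oplus>\<^bsub>P\<^esub> g x),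
     module.smult = (\<lambda>a f. \<lambda>x\<in>carrier P. a \<odot>\<^bsub>P\<^esub> f x),
     rsmult = (\<lambda>f a. \<lambda>x\<in>carrier P. f (a \<odot>\<^bsub>P\<^esub> x))\<rparr>"

text \<open>\<open>End(\<^sub>RP)\<close> with \<open>(af)(x) = f(xa)\<close>, \<open>(fa)(x) = f(x)a\<close>.\<close>

definition End_left ::
  "('a, 'r) ring_scheme \<Rightarrow> ('a, 'b, 'm) bimodule_scheme \<Rightarrow> ('a, 'b \<Rightarrow> 'b) bimodule"
  where "End_left R P =
    \<lparr>carrier = lin_maps R P P,
     monoid.mult = undefined, monoid.one = undefined,
     ring.zero = (\<lambda>x\<in>carrier P. \<zero>\<^bsub>P\<^esub>), ring.add = (\<lambda>f g. \<lambda>x\<in>carrier P. f x \<oplus>\<^bsub>P\<^esub> g x),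
     module.smult = (\<lambda>a f. \<lambda>x\<in>carrier P. f (rsmult P x a)),
     rsmult = (\<lambda>f a. \<lambda>x\<in>carrier P. rsmult P (f x) a)\<rparr>"

definition partially_invertible ::
  "('a, 'r) ring_scheme \<Rightarrow> ('a, 'b, 'm) bimodule_scheme \<Rightarrow> bool"
  where "partially_invertible R P \<longleftrightarrow> bimodule R P \<and>
    fin_gen_module R P \<and> projective_module R P \<and>
    fin_gen_module (opposite_ring R) (right_part P) \<and>
    projective_module (opposite_ring R) (right_part P) \<and>
    bimodule_epi R (sub_bimodule R (carrier R)) (End_right R P)
      (\<lambda>a\<in>carrier R. \<lambda>x\<in>carrier P. a \<odot>\<^bsub>P\<^esub> x) \<and>
    bimodule_epi R (sub_bimodule R (carrier R)) (End_left R P)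
      (\<lambda>a\<in>carrier R. \<lambda>x\<in>carrier P. rsmult P x a)"

definition bimodule_class ::
  "('a, 'r) ring_scheme \<Rightarrow> ('a, 'b) bimodule \<Rightarrow> ('a, 'b) bimodule set"
  where "bimodule_class R P = {Q. bimodule R Q \<and> bimodule_iso R P Q}"

definition PicS :: "('a, 'r) ring_scheme \<Rightarrow> ('a, 'b) bimodule set set"
  where "PicS R = bimodule_class R ` {P. partially_invertible R P}"


section \<open>Graded rings and modules\<close>

record ('g, 'a) graded_ring = "'a ring" +
  rpart :: "'g \<Rightarrow> 'a set"

record ('g, 'a, 'b) graded_module = "('a, 'b) module" +
  mpart :: "'g \<Rightarrow> 'b set"

definition set_prod :: "('a, 'r) ring_scheme \<Rightarrow> 'a set \<Rightarrow> 'a set \<Rightarrow> 'a set"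
  where "set_prod A X Y =
    {finsum A (\<lambda>i. x i \<otimes>\<^bsub>A\<^esub> y i) {..<n} | (n::nat) x y. \<forall>i<n. x i \<in> X \<and> y i \<in> Y}"

definition sum_of_parts :: "('a, 'r) ring_scheme \<Rightarrow> 'i set \<Rightarrow> ('i \<Rightarrow> 'a set) \<Rightarrow> 'a set"
  where "sum_of_parts M I C = {finsum M f S | f S. finite S \<and> S \<subseteq> I \<and> f \<in> (\<Pi> i\<in>S. C i)}"

text \<open>Only the additive structure matters here, so this applies to rings and to modules.\<close>

definition direct_decomposition :: "('a, 'r) ring_scheme \<Rightarrow> 'i set \<Rightarrow> ('i \<Rightarrow> 'a set) \<Rightarrow> bool"
  where "direct_decomposition M I C \<longleftrightarrow>
    (\<forall>i\<in>I. additive_subgroup (C i) M) \<and>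
    (\<forall>x\<in>carrier M. \<exists>!f. f \<in> (\<Pi>\<^sub>E i\<in>I. C i) \<and> finite {i\<in>I. f i \<noteq> \<zero>\<^bsub>M\<^esub>} \<and>
       x = finsum M f {i\<in>I. f i \<noteq> \<zero>\<^bsub>M\<^esub>})"

definition is_graded_ring :: "('g, 'h) monoid_scheme \<Rightarrow> ('g, 'a) graded_ring \<Rightarrow> bool"
  where "is_graded_ring G A \<longleftrightarrow> group G \<and> ring A \<and>
    direct_decomposition A (carrier G) (rpart A) \<and>
    (\<forall>g\<in>carrier G. \<forall>h\<in>carrier G. set_prod A (rpart A g) (rpart A h) \<subseteq> rpart A (g \<otimes>\<^bsub>G\<^esub> h))"

definition is_graded_module ::
  "('g, 'h) monoid_scheme \<Rightarrow> ('g, 'a) graded_ring \<Rightarrow> ('g, 'a, 'b) graded_module \<Rightarrow> bool"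
  where "is_graded_module G A N \<longleftrightarrow> left_module A N \<and>
    direct_decomposition N (carrier G) (mpart N) \<and>
    (\<forall>g\<in>carrier G. \<forall>h\<in>carrier G. \<forall>a\<in>rpart A g. \<forall>x\<in>mpart N h.
       a \<odot>\<^bsub>N\<^esub> x \<in> mpart N (g \<otimes>\<^bsub>G\<^esub> h))"

definition graded_ring_iso ::
  "('g, 'h) monoid_scheme \<Rightarrow> ('g, 'a) graded_ring \<Rightarrow> ('g, 'b) graded_ring \<Rightarrow> bool"
  where "graded_ring_iso G A B \<longleftrightarrow>
    (\<exists>f\<in>ring_iso A B. \<forall>g\<in>carrier G. f ` rpart A g = rpart B g)"

definition epsilon_strongly_graded ::
  "('g, 'h) monoid_scheme \<Rightarrow> ('g, 'a) graded_ring \<Rightarrow> ('g \<Rightarrow> 'a) \<Rightarrow> bool"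
  where "epsilon_strongly_graded G A \<epsilon> \<longleftrightarrow> is_graded_ring G A \<and>
    (\<forall>g\<in>carrier G. \<epsilon> g \<in> set_prod A (rpart A g) (rpart A (inv\<^bsub>G\<^esub> g)) \<and>
       (\<forall>a\<in>rpart A g. \<epsilon> g \<otimes>\<^bsub>A\<^esub> a = a \<and> a \<otimes>\<^bsub>A\<^esub> \<epsilon> (inv\<^bsub>G\<^esub> g) = a))"

text \<open>The identity component \<open>R = A\<^sub>1\<close> as a ring.\<close>

definition base_ring ::
  "('g, 'h) monoid_scheme \<Rightarrow> ('g, 'a) graded_ring \<Rightarrow> ('g, 'a) graded_ring"
  where "base_ring G A = A\<lparr>carrier := rpart A \<one>\<^bsub>G\<^esub>\<rparr>"

text \<open>\<open>A\<^sub>H = \<Oplus>\<^bsub>h\<in>H\<^esub> A\<^sub>h\<close>, to be read as graded by \<open>G\<lparr>carrier := H\<rparr>\<close>.\<close>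

definition restrict_grading :: "('g, 'a) graded_ring \<Rightarrow> 'g set \<Rightarrow> ('g, 'a) graded_ring"
  where "restrict_grading A H = A\<lparr>carrier := sum_of_parts A H (rpart A)\<rparr>"

definition support :: "('g, 'h) monoid_scheme \<Rightarrow> ('g, 'a) graded_ring \<Rightarrow> 'g set"
  where "support G A = {g \<in> carrier G. rpart A g \<noteq> {\<zero>\<^bsub>A\<^esub>}}"

definition component_tensor ::
  "('g, 'h) monoid_scheme \<Rightarrow> ('g, 'a) graded_ring \<Rightarrow> 'g \<Rightarrow> ('a, 'b, 'm) module_scheme
    \<Rightarrow> ('a, ('a \<times> 'b \<Rightarrow>\<^sub>0 int) set) module"
  where "component_tensor G A g M = tensor (base_ring G A) (sub_bimodule A (rpart A g)) M"

definition G_invariant ::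
  "('g, 'h) monoid_scheme \<Rightarrow> ('g, 'a) graded_ring \<Rightarrow> ('a, 'b, 'm) module_scheme \<Rightarrow> bool"
  where "G_invariant G A M \<longleftrightarrow>
    (\<forall>g\<in>support G A. module_iso (base_ring G A) (component_tensor G A g M) M)"

text \<open>
  \<open>A \<otimes>\<^sub>R M\<close>. As \<open>A\<^sub>g\<close> is a direct summand of \<open>A\<close> as a right \<open>R\<close>-module, \<open>A\<^sub>g \<otimes>\<^sub>R M\<close> is identified
  with its image in \<open>A \<otimes>\<^sub>R M\<close>.
\<close>

definition induced_module ::
  "('g, 'h) monoid_scheme \<Rightarrow> ('g, 'a) graded_ring \<Rightarrow> ('a, 'b, 'm) module_scheme
    \<Rightarrow> ('g, 'a, ('a \<times> 'b \<Rightarrow>\<^sub>0 int) set) graded_module"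
  where "induced_module G A M =
    (let R = base_ring G A; X = sub_bimodule A (carrier A); T = tensor R X M in
     module.extend T
       \<lparr>mpart = (\<lambda>g. generate (add_monoid T)
          {pure_tensor R X M a m | a m. a \<in> rpart A g \<and> m \<in> carrier M})\<rparr>)"

definition Mor ::
  "('g, 'h) monoid_scheme \<Rightarrow> ('g, 'a) graded_ring \<Rightarrow> ('g, 'a, 'b) graded_module \<Rightarrow> 'g \<Rightarrow> ('b \<Rightarrow> 'b) set"
  where "Mor G A N l =
    {f \<in> lin_maps A N N. \<forall>g\<in>carrier G. f ` mpart N g \<subseteq> mpart N (g \<otimes>\<^bsub>G\<^esub> l)}"

text \<open>
  All endomorphisms of \<open>N\<close> with the product \<open>uv = v \<circ> u\<close>; \<open>\<Oplus>\<^sub>l Mor\<^sub>A(N,N)\<^sub>l\<close> is formed inside it.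
\<close>

definition End_ring ::
  "('g, 'h) monoid_scheme \<Rightarrow> ('g, 'a) graded_ring \<Rightarrow> ('g, 'a, 'b) graded_module
    \<Rightarrow> ('g, 'b \<Rightarrow> 'b) graded_ring"
  where "End_ring G A N =
    \<lparr>carrier = lin_maps A N N, monoid.mult = (\<lambda>u v. compose (carrier N) v u),
     monoid.one = (\<lambda>x\<in>carrier N. x), ring.zero = (\<lambda>x\<in>carrier N. \<zero>\<^bsub>N\<^esub>),
     ring.add = (\<lambda>u v. \<lambda>x\<in>carrier N. u x \<oplus>\<^bsub>N\<^esub> v x), rpart = Mor G A N\<rparr>"

definition END ::
  "('g, 'h) monoid_scheme \<Rightarrow> ('g, 'a) graded_ring \<Rightarrow> ('g, 'a, 'b) graded_module
    \<Rightarrow> ('g, 'b \<Rightarrow> 'b) graded_ring"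
  where "END G A N = restrict_grading (End_ring G A N) (carrier G)"

text \<open>
  A progenerator over \<open>A\<close> is isomorphic to a submodule of some \<open>A\<^sup>n\<close>, whose elements are functions
  from indices to \<open>A\<close>, and the grading can be transported along the isomorphism. Letting \<open>P\<close> range
  over modules with elements of type \<open>nat \<Rightarrow> 'a\<close> is therefore no restriction.
\<close>

definition graded_equivalent ::
  "('g, 'h) monoid_scheme \<Rightarrow> ('g, 'a) graded_ring \<Rightarrow> ('g, 'b) graded_ring \<Rightarrow> bool"
  where "graded_equivalent G A B \<longleftrightarrow> is_graded_ring G A \<and> is_graded_ring G B \<and>
    (\<exists>P :: ('g, 'a, nat \<Rightarrow> 'a) graded_module.
       is_graded_module G A P \<and> progenerator A P \<and> graded_ring_iso G (END G A P) B)"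


section \<open>Partial crossed products\<close>

text \<open>
  A unital twisted partial action is given by the idempotents \<open>e g\<close> (written \<open>1\<^sub>g\<close> in the
  literature), the maps \<open>\<alpha> g\<close> and the twist \<open>\<omega> g h\<close>.
\<close>

definition pa_ideal :: "('s, 'r) ring_scheme \<Rightarrow> ('g \<Rightarrow> 's) \<Rightarrow> 'g \<Rightarrow> 's set"
  where "pa_ideal S e g = Idl\<^bsub>S\<^esub> {e g}"

definition pa_ring :: "('s, 'r) ring_scheme \<Rightarrow> ('g \<Rightarrow> 's) \<Rightarrow> 'g \<Rightarrow> ('s, 'r) ring_scheme"
  where "pa_ring S e g = S\<lparr>carrier := pa_ideal S e g, monoid.one := e g\<rparr>"

text \<open>The product ideal \<open>D\<^sub>g D\<^sub>h\<close> as a ring with identity \<open>1\<^sub>g 1\<^sub>h\<close>.\<close>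

definition pa_ring2 :: "('s, 'r) ring_scheme \<Rightarrow> ('g \<Rightarrow> 's) \<Rightarrow> 'g \<Rightarrow> 'g \<Rightarrow> ('s, 'r) ring_scheme"
  where "pa_ring2 S e g h =
    S\<lparr>carrier := set_prod S (pa_ideal S e g) (pa_ideal S e h), monoid.one := e g \<otimes>\<^bsub>S\<^esub> e h\<rparr>"

definition unital_twisted_partial_action ::
  "('g, 'h) monoid_scheme \<Rightarrow> ('s, 'r) ring_scheme \<Rightarrow> ('g \<Rightarrow> 's) \<Rightarrow> ('g \<Rightarrow> 's \<Rightarrow> 's) \<Rightarrow> ('g \<Rightarrow> 'g \<Rightarrow> 's)
    \<Rightarrow> bool"
  where "unital_twisted_partial_action G S e \<alpha> \<omega> \<longleftrightarrow> group G \<and> ring S \<and>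
    (\<forall>g\<in>carrier G. e g \<in> carrier S \<and> e g \<otimes>\<^bsub>S\<^esub> e g = e g \<and>
       (\<forall>s\<in>carrier S. e g \<otimes>\<^bsub>S\<^esub> s = s \<otimes>\<^bsub>S\<^esub> e g)) \<and>
    (\<forall>g\<in>carrier G. \<alpha> g \<in> ring_iso (pa_ring S e (inv\<^bsub>G\<^esub> g)) (pa_ring S e g)) \<and>
    (\<forall>g\<in>carrier G. \<forall>h\<in>carrier G. \<omega> g h \<in> Units (pa_ring2 S e g (g \<otimes>\<^bsub>G\<^esub> h))) \<and>
    pa_ideal S e \<one>\<^bsub>G\<^esub> = carrier S \<and> (\<forall>s\<in>carrier S. \<alpha> \<one>\<^bsub>G\<^esub> s = s) \<and>
    (\<forall>g\<in>carrier G. \<forall>h\<in>carrier G.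
       \<alpha> g ` set_prod S (pa_ideal S e (inv\<^bsub>G\<^esub> g)) (pa_ideal S e h) =
         set_prod S (pa_ideal S e g) (pa_ideal S e (g \<otimes>\<^bsub>G\<^esub> h))) \<and>
    (\<forall>g\<in>carrier G. \<forall>h\<in>carrier G.
       \<forall>t\<in>set_prod S (pa_ideal S e (inv\<^bsub>G\<^esub> h)) (pa_ideal S e (inv\<^bsub>G\<^esub> (g \<otimes>\<^bsub>G\<^esub> h))).
         \<alpha> g (\<alpha> h t) =
           \<omega> g h \<otimes>\<^bsub>S\<^esub> \<alpha> (g \<otimes>\<^bsub>G\<^esub> h) t \<otimes>\<^bsub>S\<^esub> inv\<^bsub>pa_ring2 S e g (g \<otimes>\<^bsub>G\<^esub> h)\<^esub> \<omega> g h) \<and>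
    (\<forall>g\<in>carrier G. \<omega> \<one>\<^bsub>G\<^esub> g = e g \<and> \<omega> g \<one>\<^bsub>G\<^esub> = e g) \<and>
    (\<forall>g\<in>carrier G. \<forall>h\<in>carrier G. \<forall>l\<in>carrier G.
       \<alpha> g (\<omega> h l \<otimes>\<^bsub>S\<^esub> e (inv\<^bsub>G\<^esub> g)) \<otimes>\<^bsub>S\<^esub> \<omega> g (h \<otimes>\<^bsub>G\<^esub> l) = \<omega> g h \<otimes>\<^bsub>S\<^esub> \<omega> (g \<otimes>\<^bsub>G\<^esub> h) l)"

text \<open>
  The element \<open>\<Sum>\<^sub>g a\<^sub>g \<delta>\<^sub>g\<close> is the finitely supported function \<open>g \<mapsto> a\<^sub>g\<close>, extensional on \<open>carrier G\<close>.
\<close>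

definition partial_crossed_product ::
  "('g, 'h) monoid_scheme \<Rightarrow> ('s, 'r) ring_scheme \<Rightarrow> ('g \<Rightarrow> 's) \<Rightarrow> ('g \<Rightarrow> 's \<Rightarrow> 's) \<Rightarrow> ('g \<Rightarrow> 'g \<Rightarrow> 's)
    \<Rightarrow> ('g, 'g \<Rightarrow> 's) graded_ring"
  where "partial_crossed_product G S e \<alpha> \<omega> =
    (let B = {a \<in> (\<Pi>\<^sub>E g\<in>carrier G. pa_ideal S e g). finite {g\<in>carrier G. a g \<noteq> \<zero>\<^bsub>S\<^esub>}} in
    \<lparr>carrier = B,
     monoid.mult = (\<lambda>a b. \<lambda>k\<in>carrier G.
       finsum S (\<lambda>(g, h). a g \<otimes>\<^bsub>S\<^esub> \<alpha> g (b h \<otimes>\<^bsub>S\<^esub> e (inv\<^bsub>G\<^esub> g)) \<otimes>\<^bsub>S\<^esub> \<omega> g h)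
         {(g, h). g \<in> carrier G \<and> h \<in> carrier G \<and> g \<otimes>\<^bsub>G\<^esub> h = k \<and> a g \<noteq> \<zero>\<^bsub>S\<^esub> \<and> b h \<noteq> \<zero>\<^bsub>S\<^esub>}),
     monoid.one = (\<lambda>g\<in>carrier G. if g = \<one>\<^bsub>G\<^esub> then \<one>\<^bsub>S\<^esub> else \<zero>\<^bsub>S\<^esub>),
     ring.zero = (\<lambda>g\<in>carrier G. \<zero>\<^bsub>S\<^esub>),
     ring.add = (\<lambda>a b. \<lambda>g\<in>carrier G. a g \<oplus>\<^bsub>S\<^esub> b g),
     rpart = (\<lambda>g. {a \<in> B. \<forall>h\<in>carrier G. h \<noteq> g \<longrightarrow> a h = \<zero>\<^bsub>S\<^esub>})\<rparr>)"

text \<open>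
  If \<open>B \<simeq> S \<star> G\<close> as graded rings, then \<open>S\<close> is isomorphic to the identity component of \<open>B\<close>, so
  letting \<open>S\<close> range over rings with elements in the type of \<open>B\<close> is no restriction.
\<close>

definition is_partial_crossed_product ::
  "('g, 'h) monoid_scheme \<Rightarrow> ('g, 'b) graded_ring \<Rightarrow> bool"
  where "is_partial_crossed_product G B \<longleftrightarrow> is_graded_ring G B \<and>
    (\<exists>(S :: 'b ring) e \<alpha> \<omega>. unital_twisted_partial_action G S e \<alpha> \<omega> \<and>
       graded_ring_iso G B (partial_crossed_product G S e \<alpha> \<omega>))"


section \<open>The groups \<open>G\<^sub>X\<close>\<close>

definition G_sub :: "('g, 'h) monoid_scheme \<Rightarrow> ('g, 'a) graded_ring \<Rightarrow> 'a set \<Rightarrow> 'g set"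
  where "G_sub G A X = {g \<in> carrier G. \<forall>e\<in>X. \<exists>f\<in>X.
    module_iso (base_ring G A)
      (component_tensor G A g (principal_module (base_ring G A) e))
      (principal_module (base_ring G A) f)}"

definition Q_sum :: "('a, 'r) ring_scheme \<Rightarrow> 'a set \<Rightarrow> ('a, 'a \<Rightarrow> 'a) module"
  where "Q_sum R X = direct_sum X (principal_module R)"

text \<open>\<open>END(A \<otimes>\<^sub>R M)\<close>, where \<open>R\<close> is the identity component of \<open>A\<close>.\<close>

definition END_induced ::
  "('g, 'h) monoid_scheme \<Rightarrow> ('g, 'a) graded_ring \<Rightarrow> ('a, 'b, 'm) module_scheme
    \<Rightarrow> ('g, ('a \<times> 'b \<Rightarrow>\<^sub>0 int) set \<Rightarrow> ('a \<times> 'b \<Rightarrow>\<^sub>0 int) set) graded_ring"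
  where "END_induced G A M = END G A (induced_module G A M)"

end

theory Submission
  imports Defs
begin

text \<open>
  A graded ring in which every homogeneous component is zero or contains a unit, the degrees of the
  second kind forming a subgroup, is a partial crossed product: conjugation by the chosen units is
  the partial action, their products give the twist, and each \<open>1\<^sub>g\<close> is \<open>0\<close> or \<open>1\<close>. So (i), (iii)
  and (v) require units of degree \<open>g\<close> in \<open>END(A \<otimes>\<^sub>R P)\<close>. For a \<open>G\<close>-invariant progenerator
  \<open>\<epsilon>\<^sub>g = 1\<close> on the support, and the isomorphism \<open>P \<simeq> A\<^sub>g \<otimes>\<^sub>R P\<close> extends \<open>A\<close>-linearly to a unit. For
  \<open>Q\<^sub>X\<close> one uses that \<open>A\<^sub>g \<otimes>\<^sub>R Re \<simeq> Rf\<close> means \<open>uv = f\<close> and \<open>vu = e\<close> for some \<open>u\<close> in \<open>A\<^sub>g\<close> and \<open>v\<close> in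
  \<open>A\<close> of degree \<open>g\<^sup>-\<^sup>1\<close>. By irredundancy and finiteness, \<open>g\<close> in \<open>G\<^sub>X\<close> permutes \<open>X\<close>, so \<open>G\<^sub>X\<close> is a subgroup, and the
  \<open>u\<close> and \<open>v\<close> assemble to a unit of degree \<open>g\<close> and its inverse.

  Since \<open>A \<otimes>\<^sub>R P\<close> inherits from \<open>P\<close> a finite dual basis in degree \<open>1\<close> and a trace ideal containing \<open>1\<close>,
  it is a graded progenerator. Parts (ii) and (iv) use that \<open>eRe\<close> is local for \<open>e\<close> primitive: if \<open>e\<close> is a
  sum of elements factoring through some \<open>Rf\<^sub>k\<close>, where \<open>1\<close> is the sum of the primitive \<open>f\<^sub>k\<close>, then one summand
  lies outside the radical and is invertible in \<open>eRe\<close>.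
\<close>

section \<open>Additive maps and finite sums\<close>

text \<open>The argument for (i) does not carry over to (iii). For a proper subset \<open>X\<close>
  the module \<open>Q_X\<close> need not be a generator, so 1 may fail to lie in the product of the
  components of degrees g^-1 and g, and an R-isomorphism from the degree-one part onto the degree-g
  part has no evident A-linear inverse. The units are therefore built by hand, from a permutation of
  a dual basis. Finite dual bases do the bookkeeping throughout: they turn membership in a graded
  component into membership of finitely many coordinates in A_g, they supply explicit inverses for
  maps out of tensor products, and they copy an induced module into A^n, the shape in which a graded
  equivalence has to be witnessed. That the ring is nonzero enters twice: the support must contain
  the neutral element, and n distinct names for basis elements must exist among the elements of the
  copy's type. It is nonzero because \<open>E\<close> has a member.\<close>

definition additive_map :: "('a, 'm) ring_scheme \<Rightarrow> ('b, 'n) ring_scheme \<Rightarrow> ('a \<Rightarrow> 'b) \<Rightarrow> bool"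
  where "additive_map M N f \<longleftrightarrow> f \<in> carrier M \<rightarrow> carrier N \<and>
    (\<forall>x\<in>carrier M. \<forall>y\<in>carrier M. f (x \<oplus>\<^bsub>M\<^esub> y) = f x \<oplus>\<^bsub>N\<^esub> f y)"

lemma additive_mapI:
  assumes "\<And>x. x \<in> carrier M \<Longrightarrow> f x \<in> carrier N"
    and "\<And>x y. x \<in> carrier M \<Longrightarrow> y \<in> carrier M \<Longrightarrow> f (x \<oplus>\<^bsub>M\<^esub> y) = f x \<oplus>\<^bsub>N\<^esub> f y"
  shows "additive_map M N f"
  using assms by (simp add: additive_map_def)

lemma additive_mapD:
  assumes "additive_map M N f"
  shows "x \<in> carrier M \<Longrightarrow> f x \<in> carrier N"
    and "x \<in> carrier M \<Longrightarrow> y \<in> carrier M \<Longrightarrow> f (x \<oplus>\<^bsub>M\<^esub> y) = f x \<oplus>\<^bsub>N\<^esub> f y"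
  using assms by (auto simp: additive_map_def)

lemma (in abelian_group) minus_zero_iff:
  "x \<in> carrier G \<Longrightarrow> y \<in> carrier G \<Longrightarrow> x \<ominus> y = \<zero> \<longleftrightarrow> x = y"
  by (metis a_minus_def add.inv_closed minus_equality minus_minus r_neg)

lemma additive_map_zero:
  assumes "abelian_group M" "abelian_group N" "additive_map M N f"
  shows "f \<zero>\<^bsub>M\<^esub> = \<zero>\<^bsub>N\<^esub>"
proof -
  interpret M: abelian_group M by fact
  interpret N: abelian_group N by fact
  have "f \<zero>\<^bsub>M\<^esub> \<oplus>\<^bsub>N\<^esub> f \<zero>\<^bsub>M\<^esub> = f \<zero>\<^bsub>M\<^esub>"
    using additive_mapD(2)[OF assms(3), of "\<zero>\<^bsub>M\<^esub>" "\<zero>\<^bsub>M\<^esub>"] by simp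
  then show ?thesis using additive_mapD(1)[OF assms(3)] by (metis M.zero_closed N.add.l_cancel_one)
qed

lemma additive_map_neg:
  assumes "abelian_group M" "abelian_group N" "additive_map M N f" "x \<in> carrier M"
  shows "f (\<ominus>\<^bsub>M\<^esub> x) = \<ominus>\<^bsub>N\<^esub> f x"
proof -
  interpret M: abelian_group M by fact
  interpret N: abelian_group N by fact
  have "f (\<ominus>\<^bsub>M\<^esub> x) \<oplus>\<^bsub>N\<^esub> f x = \<zero>\<^bsub>N\<^esub>"
    using additive_mapD(2)[OF assms(3), of "\<ominus>\<^bsub>M\<^esub> x" x] assms additive_map_zero[OF assms(1-3)]
    by (simp add: M.l_neg)
  then show ?thesis using additive_mapD(1)[OF assms(3)] assms(4)
    by (simp add: N.minus_equality)
qed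

lemma additive_map_finsum:
  assumes "abelian_group M" "abelian_group N" "additive_map M N f" "g \<in> I \<rightarrow> carrier M"
  shows "f (finsum M g I) = finsum N (\<lambda>i. f (g i)) I"
proof -
  interpret M: abelian_group M by fact
  interpret N: abelian_group N by fact
  note f = additive_mapD[OF assms(3)]
  show ?thesis using assms(4)
  proof (induction I rule: infinite_finite_induct)
    case (insert i I)
    then have "finsum M g I \<in> carrier M" "(\<lambda>i. f (g i)) \<in> I \<rightarrow> carrier N" "g i \<in> carrier M"
      using f(1) by (auto intro: M.finsum_closed)
    then show ?case using insert f by (simp add: M.finsum_insert N.finsum_insert Pi_def)
  qed (simp_all add: additive_map_zero[OF assms(1-3)])
qed

text \<open>\<open>finsum\<close> depends on the whole record, so one and the same sum taken in a
  ring, in its degree-one part, in a submodule or in the regular module gives different terms. This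
  lemma moves between them.\<close>

lemma finsum_same:
  assumes "abelian_monoid M" "abelian_monoid M'" "carrier M' \<subseteq> carrier M"
    and "add M' = add M" "\<zero>\<^bsub>M'\<^esub> = \<zero>\<^bsub>M\<^esub>" "f \<in> I \<rightarrow> carrier M'"
  shows "finsum M' f I = finsum M f I"
proof -
  interpret M: abelian_monoid M by fact
  interpret M': abelian_monoid M' by fact
  show ?thesis using assms(6)
  proof (induction I rule: infinite_finite_induct)
    case (insert i I)
    then have "f \<in> I \<rightarrow> carrier M" "f i \<in> carrier M" "f \<in> I \<rightarrow> carrier M'" "f i \<in> carrier M'"
      using assms(3) by auto
    then show ?case using insert assms(4) by (simp add: M.finsum_insert M'.finsum_insert)
  qed (simp_all add: assms(5))
qed

context abelian_monoid
begin

lemma finsum_single: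
  assumes "finite I" "i \<in> I" "f i \<in> carrier G" "\<And>j. j \<in> I \<Longrightarrow> j \<noteq> i \<Longrightarrow> f j = \<zero>"
  shows "finsum G f I = f i"
proof -
  have "finsum G f I = finsum G f {i}"
  proof (rule add.finprod_mono_neutral_cong_right)
    show "f \<in> I \<rightarrow> carrier G" using assms(3,4) by (metis Pi_I zero_closed)
  qed (use assms in auto)
  then show ?thesis using assms by simp
qed

lemma finsum_Times:
  assumes "finite I" "finite J" "\<And>i j. i \<in> I \<Longrightarrow> j \<in> J \<Longrightarrow> f (i, j) \<in> carrier G"
  shows "finsum G (\<lambda>i. finsum G (\<lambda>j. f (i, j)) J) I = finsum G f (I \<times> J)"
  using assms(1,3)
proof (induction I)
  case (insert i I)
  have "insert i I \<times> J = (Pair i ` J) \<union> (I \<times> J)" by auto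
  then have "finsum G f (insert i I \<times> J) = finsum G f (Pair i ` J) \<oplus> finsum G f (I \<times> J)"
    using insert assms(2) by (simp, intro finsum_Un_disjoint) auto
  also have "finsum G f (Pair i ` J) = finsum G (\<lambda>j. f (i, j)) J"
    using insert by (intro finsum_reindex) (auto simp: inj_on_def)
  also have "finsum G f (I \<times> J) = finsum G (\<lambda>i. finsum G (\<lambda>j. f (i, j)) J) I" using insert by simp
  finally show ?case using insert by (simp add: finsum_insert Pi_def finsum_closed)
qed simp

lemma finsum_in_subset:
  assumes "\<zero> \<in> H" "\<And>x y. x \<in> H \<Longrightarrow> y \<in> H \<Longrightarrow> x \<oplus> y \<in> H" "H \<subseteq> carrier G" "f \<in> I \<rightarrow> H"
  shows "finsum G f I \<in> H"
  using assms(4)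
proof (induction I rule: infinite_finite_induct)
  case (insert i I)
  then have "f \<in> I \<rightarrow> carrier G" "f i \<in> carrier G" using assms(3) by auto
  then show ?case using insert assms(2) by (simp add: finsum_insert)
qed (simp_all add: assms(1))

end

lemma additive_subgroupD:
  assumes "additive_subgroup H M" "abelian_group M"
  shows "H \<subseteq> carrier M" "\<zero>\<^bsub>M\<^esub> \<in> H" "x \<in> H \<Longrightarrow> y \<in> H \<Longrightarrow> x \<oplus>\<^bsub>M\<^esub> y \<in> H" "x \<in> H \<Longrightarrow> \<ominus>\<^bsub>M\<^esub> x \<in> H"
proof -
  interpret M: abelian_group M by fact
  interpret H: subgroup H "add_monoid M" using assms(1) by (simp add: additive_subgroup_def)
  show "H \<subseteq> carrier M" "\<zero>\<^bsub>M\<^esub> \<in> H" "x \<in> H \<Longrightarrow> y \<in> H \<Longrightarrow> x \<oplus>\<^bsub>M\<^esub> y \<in> H"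
    using H.subset H.one_closed H.m_closed by auto
  show "x \<in> H \<Longrightarrow> \<ominus>\<^bsub>M\<^esub> x \<in> H" using H.m_inv_closed[of x] by (simp add: a_inv_def)
qed

lemma additive_subgroupI':
  assumes "abelian_group M" "H \<subseteq> carrier M" "\<zero>\<^bsub>M\<^esub> \<in> H"
    and "\<And>x y. x \<in> H \<Longrightarrow> y \<in> H \<Longrightarrow> x \<oplus>\<^bsub>M\<^esub> y \<in> H" "\<And>x. x \<in> H \<Longrightarrow> \<ominus>\<^bsub>M\<^esub> x \<in> H"
  shows "additive_subgroup H M"
proof -
  interpret M: abelian_group M by fact
  show ?thesis unfolding additive_subgroup_def
    by (rule group.subgroupI[OF M.a_group]) (use assms in \<open>auto simp: a_inv_def[symmetric]\<close>)
qed

lemma abelian_group_restrict: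
  assumes "abelian_group M" "additive_subgroup H M"
  shows "abelian_group (M\<lparr>carrier := H\<rparr>)"
proof -
  interpret M: abelian_group M by fact
  note H = additive_subgroupD[OF assms(2,1)]
  show ?thesis
    proof (rule abelian_groupI)
    fix x assume "x \<in> carrier (M\<lparr>carrier := H\<rparr>)"
    then show "\<exists>y\<in>carrier (M\<lparr>carrier := H\<rparr>). y \<oplus>\<^bsub>M\<lparr>carrier := H\<rparr>\<^esub> x = \<zero>\<^bsub>M\<lparr>carrier := H\<rparr>\<^esub>"
      using H by (intro bexI[of _ "\<ominus>\<^bsub>M\<^esub> x"]) (auto simp: M.l_neg subset_iff)
  qed (use H in \<open>auto simp: M.a_ac subset_iff\<close>)
qed

section \<open>Direct decompositions\<close>

text \<open>Uniqueness of decompositions reduces to uniqueness for zero. The finite set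
  \<open>S\<close> is arbitrary and need not be a support, which keeps supports out of the
  applications.\<close>

definition independent_parts :: "('a, 'r) ring_scheme \<Rightarrow> 'i set \<Rightarrow> ('i \<Rightarrow> 'a set) \<Rightarrow> bool"
  where "independent_parts M I C \<longleftrightarrow> (\<forall>S f. finite S \<and> S \<subseteq> I \<and> f \<in> (\<Pi> i\<in>S. C i) \<and>
    finsum M f S = \<zero>\<^bsub>M\<^esub> \<longrightarrow> (\<forall>i\<in>S. f i = \<zero>\<^bsub>M\<^esub>))"

lemma direct_decompositionI:
  assumes M: "abelian_group M" and sub: "\<And>i. i \<in> I \<Longrightarrow> additive_subgroup (C i) M"
    and sum: "carrier M \<subseteq> sum_of_parts M I C" and ind: "independent_parts M I C"
  shows "direct_decomposition M I C"
  unfolding direct_decomposition_def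
proof (intro conjI ballI)
  interpret M: abelian_group M by fact
  note C = additive_subgroupD[OF sub M]
  fix x assume "x \<in> carrier M"
  then obtain f S where S: "finite S" "S \<subseteq> I" "f \<in> (\<Pi> i\<in>S. C i)" "x = finsum M f S"
    using sum by (force simp: sum_of_parts_def)
  define g where "g = (\<lambda>i\<in>I. if i \<in> S then f i else \<zero>\<^bsub>M\<^esub>)"
  have g1: "g \<in> (\<Pi>\<^sub>E i\<in>I. C i)" using S C by (auto simp: g_def)
  have g2: "finite {i\<in>I. g i \<noteq> \<zero>\<^bsub>M\<^esub>}" by (rule finite_subset[OF _ S(1)]) (auto simp: g_def)
  have "f \<in> S \<rightarrow> carrier M" using S C by blast
  then have g3: "x = finsum M g {i\<in>I. g i \<noteq> \<zero>\<^bsub>M\<^esub>}" unfolding S(4)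
    using S by (intro M.add.finprod_mono_neutral_cong_right) (auto simp: g_def)
  show "\<exists>!f. f \<in> (\<Pi>\<^sub>E i\<in>I. C i) \<and> finite {i\<in>I. f i \<noteq> \<zero>\<^bsub>M\<^esub>} \<and> x = finsum M f {i\<in>I. f i \<noteq> \<zero>\<^bsub>M\<^esub>}"
  proof (rule ex1I[of _ g])
    fix h assume h: "h \<in> (\<Pi>\<^sub>E i\<in>I. C i) \<and> finite {i\<in>I. h i \<noteq> \<zero>\<^bsub>M\<^esub>} \<and> x = finsum M h {i\<in>I. h i \<noteq> \<zero>\<^bsub>M\<^esub>}"
    \<comment> \<open>Over the union of both supports the two sums run through the same indices and
      can be subtracted term by term.\<close>
    let ?T = "{i\<in>I. h i \<noteq> \<zero>\<^bsub>M\<^esub>} \<union> {i\<in>I. g i \<noteq> \<zero>\<^bsub>M\<^esub>}"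
    have hc: "h \<in> I \<rightarrow> carrier M" and gc: "g \<in> I \<rightarrow> carrier M" using h g1 C by blast+
    have 1: "x = finsum M h ?T" using h g2 hc
      by (subst conjunct2[OF conjunct2[OF h]], intro M.add.finprod_mono_neutral_cong_left) auto
    have 2: "x = finsum M g ?T" using h g2 gc
      by (subst g3, intro M.add.finprod_mono_neutral_cong_left) auto
    let ?d = "\<lambda>i. h i \<ominus>\<^bsub>M\<^esub> g i"
    have "additive_map M M (\<lambda>z. \<ominus>\<^bsub>M\<^esub> z)" by (rule additive_mapI) (auto simp: M.minus_add)
    then have "\<ominus>\<^bsub>M\<^esub> finsum M g ?T = finsum M (\<lambda>i. \<ominus>\<^bsub>M\<^esub> g i) ?T"
      using gc by (intro additive_map_finsum[OF M M]) auto
    moreover have "finsum M ?d ?T = finsum M h ?T \<oplus>\<^bsub>M\<^esub> finsum M (\<lambda>i. \<ominus>\<^bsub>M\<^esub> g i) ?T"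
      unfolding a_minus_def using hc gc by (intro M.finsum_addf) auto
    ultimately have "finsum M ?d ?T = \<zero>\<^bsub>M\<^esub>" using 1 2 \<open>x \<in> carrier M\<close> by (metis M.r_neg)
    moreover have "?d \<in> (\<Pi> i\<in>?T. C i)" using h g1 C
      unfolding a_minus_def by (fastforce simp: PiE_iff)
    ultimately have "\<forall>i\<in>?T. ?d i = \<zero>\<^bsub>M\<^esub>" using ind h g2 unfolding independent_parts_def by blast
    then have "h i = g i" if "i \<in> I" for i
    proof (cases "i \<in> ?T")
      case True
      then have "h i \<ominus>\<^bsub>M\<^esub> g i = \<zero>\<^bsub>M\<^esub>" using \<open>\<forall>i\<in>?T. ?d i = \<zero>\<^bsub>M\<^esub>\<close> by blast
      moreover have "h i \<in> carrier M" "g i \<in> carrier M" using that hc gc by auto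
      ultimately show ?thesis by (simp only: M.minus_zero_iff)
    qed (use that in auto)
    then show "h = g" using h g1 by (intro PiE_ext) auto
  qed (use g1 g2 g3 in auto)
qed (use sub in auto)

lemma direct_decompositionD:
  assumes M: "abelian_group M" and d: "direct_decomposition M I C"
  shows "\<And>i. i \<in> I \<Longrightarrow> additive_subgroup (C i) M"
    and "sum_of_parts M I C = carrier M" and "independent_parts M I C"
proof -
  interpret M: abelian_group M by fact
  show sub: "\<And>i. i \<in> I \<Longrightarrow> additive_subgroup (C i) M" using d by (auto simp: direct_decomposition_def)
  note C = additive_subgroupD[OF sub M]
  show "sum_of_parts M I C = carrier M"
  proof
    show "sum_of_parts M I C \<subseteq> carrier M" using C by (fastforce simp: sum_of_parts_def intro!: M.finsum_closed)
    show "carrier M \<subseteq> sum_of_parts M I C"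
    proof
      fix x assume "x \<in> carrier M"
      then obtain f where "f \<in> (\<Pi>\<^sub>E i\<in>I. C i)" "finite {i\<in>I. f i \<noteq> \<zero>\<^bsub>M\<^esub>}" "x = finsum M f {i\<in>I. f i \<noteq> \<zero>\<^bsub>M\<^esub>}"
        using d unfolding direct_decomposition_def by blast
      then show "x \<in> sum_of_parts M I C" unfolding sum_of_parts_def
        by (auto intro!: exI[of _ f] exI[of _ "{i\<in>I. f i \<noteq> \<zero>\<^bsub>M\<^esub>}"])
    qed
  qed
  show "independent_parts M I C" unfolding independent_parts_def
  proof (intro allI impI)
    fix S f assume S: "finite S \<and> S \<subseteq> I \<and> f \<in> (\<Pi> i\<in>S. C i) \<and> finsum M f S = \<zero>\<^bsub>M\<^esub>"
    define g where "g = (\<lambda>i\<in>I. if i \<in> S then f i else \<zero>\<^bsub>M\<^esub>)"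
    have g1: "g \<in> (\<Pi>\<^sub>E i\<in>I. C i)" using S C by (auto simp: g_def)
    have g2: "finite {i\<in>I. g i \<noteq> \<zero>\<^bsub>M\<^esub>}" by (rule finite_subset[of _ S]) (auto simp: g_def S)
    have "f \<in> S \<rightarrow> carrier M" using S C by blast
    then have "finsum M f S = finsum M g {i\<in>I. g i \<noteq> \<zero>\<^bsub>M\<^esub>}"
      using S by (intro M.add.finprod_mono_neutral_cong_right) (auto simp: g_def)
    then have g3: "\<zero>\<^bsub>M\<^esub> = finsum M g {i\<in>I. g i \<noteq> \<zero>\<^bsub>M\<^esub>}" using S by simp
    \<comment> \<open>The zero family represents zero as well, with empty support; uniqueness
      identifies \<open>g\<close> with it.\<close>
    let ?z = "\<lambda>i\<in>I. \<zero>\<^bsub>M\<^esub>"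
    have e: "{i\<in>I. ?z i \<noteq> \<zero>\<^bsub>M\<^esub>} = {}" by auto
    have z1: "?z \<in> (\<Pi>\<^sub>E i\<in>I. C i)" using C by auto
    have z2: "finite {i\<in>I. ?z i \<noteq> \<zero>\<^bsub>M\<^esub>}" "\<zero>\<^bsub>M\<^esub> = finsum M ?z {i\<in>I. ?z i \<noteq> \<zero>\<^bsub>M\<^esub>}" unfolding e by simp_all
    have "\<exists>!f. f \<in> (\<Pi>\<^sub>E i\<in>I. C i) \<and> finite {i\<in>I. f i \<noteq> \<zero>\<^bsub>M\<^esub>} \<and> \<zero>\<^bsub>M\<^esub> = finsum M f {i\<in>I. f i \<noteq> \<zero>\<^bsub>M\<^esub>}"
      using d M.zero_closed unfolding direct_decomposition_def by blast
    then have "g = ?z" using g1 g2 g3 z1 z2 by blast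
    then have "g i = \<zero>\<^bsub>M\<^esub>" if "i \<in> S" for i using that S by auto
    then show "\<forall>i\<in>S. f i = \<zero>\<^bsub>M\<^esub>" using S unfolding g_def by (metis (mono_tags, lifting) restrict_apply' subsetD)
  qed
qed

section \<open>Modules\<close>

context left_module
begin

lemma additive_smult_l: "x \<in> carrier M \<Longrightarrow> additive_map R M (\<lambda>a. a \<odot>\<^bsub>M\<^esub> x)"
  by (rule additive_mapI) (auto simp: smult_closed smult_l_distr)

lemma additive_smult_r: "a \<in> carrier R \<Longrightarrow> additive_map M M (\<lambda>x. a \<odot>\<^bsub>M\<^esub> x)"
  by (rule additive_mapI) (auto simp: smult_closed smult_r_distr)

lemma smult_l_null: "x \<in> carrier M \<Longrightarrow> \<zero>\<^bsub>R\<^esub> \<odot>\<^bsub>M\<^esub> x = \<zero>\<^bsub>M\<^esub>"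
  using additive_map_zero[OF R.abelian_group_axioms M.abelian_group_axioms additive_smult_l] .

lemma smult_r_null: "a \<in> carrier R \<Longrightarrow> a \<odot>\<^bsub>M\<^esub> \<zero>\<^bsub>M\<^esub> = \<zero>\<^bsub>M\<^esub>"
  using additive_map_zero[OF M.abelian_group_axioms M.abelian_group_axioms additive_smult_r] .

lemma finsum_smult_l:
  "x \<in> carrier M \<Longrightarrow> c \<in> I \<rightarrow> carrier R \<Longrightarrow> finsum R c I \<odot>\<^bsub>M\<^esub> x = finsum M (\<lambda>i. c i \<odot>\<^bsub>M\<^esub> x) I"
  using additive_map_finsum[OF R.abelian_group_axioms M.abelian_group_axioms additive_smult_l] .

lemma finsum_smult_r:
  "a \<in> carrier R \<Longrightarrow> y \<in> I \<rightarrow> carrier M \<Longrightarrow> a \<odot>\<^bsub>M\<^esub> finsum M y I = finsum M (\<lambda>i. a \<odot>\<^bsub>M\<^esub> y i) I"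
  using additive_map_finsum[OF M.abelian_group_axioms M.abelian_group_axioms additive_smult_r] .

lemma smult_neg: "a \<in> carrier R \<Longrightarrow> x \<in> carrier M \<Longrightarrow> a \<odot>\<^bsub>M\<^esub> (\<ominus>\<^bsub>M\<^esub> x) = \<ominus>\<^bsub>M\<^esub> (a \<odot>\<^bsub>M\<^esub> x)"
  using additive_map_neg[OF M.abelian_group_axioms M.abelian_group_axioms additive_smult_r] .

lemma neg_smult: "a \<in> carrier R \<Longrightarrow> x \<in> carrier M \<Longrightarrow> (\<ominus>\<^bsub>R\<^esub> a) \<odot>\<^bsub>M\<^esub> x = \<ominus>\<^bsub>M\<^esub> (a \<odot>\<^bsub>M\<^esub> x)"
  using additive_map_neg[OF R.abelian_group_axioms M.abelian_group_axioms additive_smult_l] .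

lemma submoduleI:
  assumes "H \<subseteq> carrier M" "\<zero>\<^bsub>M\<^esub> \<in> H" "\<And>x y. x \<in> H \<Longrightarrow> y \<in> H \<Longrightarrow> x \<oplus>\<^bsub>M\<^esub> y \<in> H"
    and "\<And>a x. a \<in> carrier R \<Longrightarrow> x \<in> H \<Longrightarrow> a \<odot>\<^bsub>M\<^esub> x \<in> H"
  shows "submodule H R M"
proof -
  have "\<ominus>\<^bsub>M\<^esub> x \<in> H" if "x \<in> H" for x
    using assms(4)[of "\<ominus>\<^bsub>R\<^esub> \<one>\<^bsub>R\<^esub>" x] that assms(1) neg_smult[of "\<one>\<^bsub>R\<^esub>" x] smult_one[of x] by auto
  then have "additive_subgroup H M"
    by (intro additive_subgroupI' M.abelian_group_axioms assms)
  then show ?thesis using assms(4) by (simp add: submodule_def submodule_axioms_def additive_subgroup_def)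
qed

lemma submoduleD:
  assumes "submodule H R M"
  shows "H \<subseteq> carrier M" "\<zero>\<^bsub>M\<^esub> \<in> H" "x \<in> H \<Longrightarrow> y \<in> H \<Longrightarrow> x \<oplus>\<^bsub>M\<^esub> y \<in> H" "x \<in> H \<Longrightarrow> \<ominus>\<^bsub>M\<^esub> x \<in> H"
    and "a \<in> carrier R \<Longrightarrow> x \<in> H \<Longrightarrow> a \<odot>\<^bsub>M\<^esub> x \<in> H" and "additive_subgroup H M"
proof -
  show s: "additive_subgroup H M" using assms by (simp add: submodule_def additive_subgroup_def)
  show "H \<subseteq> carrier M" "\<zero>\<^bsub>M\<^esub> \<in> H" "x \<in> H \<Longrightarrow> y \<in> H \<Longrightarrow> x \<oplus>\<^bsub>M\<^esub> y \<in> H" "x \<in> H \<Longrightarrow> \<ominus>\<^bsub>M\<^esub> x \<in> H"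
    using additive_subgroupD[OF s M.abelian_group_axioms] by auto
  show "a \<in> carrier R \<Longrightarrow> x \<in> H \<Longrightarrow> a \<odot>\<^bsub>M\<^esub> x \<in> H" using submodule.smult_closed[OF assms] .
qed

lemma left_module_submodule:
  assumes "submodule H R M"
  shows "left_module R (M\<lparr>carrier := H\<rparr>)"
proof -
  note H = submoduleD[OF assms]
  interpret H: abelian_group "M\<lparr>carrier := H\<rparr>"
    by (rule abelian_group_restrict[OF M.abelian_group_axioms H(6)])
  show ?thesis
    by unfold_locales (use H in \<open>auto simp: smult_l_distr smult_r_distr smult_assoc1 smult_one subset_iff\<close>)
qed

lemma finsum_submodule:
  assumes "submodule H R M" "f \<in> I \<rightarrow> H"
  shows "finsum (M\<lparr>carrier := H\<rparr>) f I = finsum M f I"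
proof -
  interpret H: left_module R "M\<lparr>carrier := H\<rparr>" by (rule left_module_submodule[OF assms(1)])
  show ?thesis
    by (rule finsum_same[OF M.abelian_monoid_axioms H.M.abelian_monoid_axioms])
      (use assms submoduleD[OF assms(1)] in auto)
qed

end

lemma left_moduleI:
  assumes "ring R" "abelian_group M"
    and "\<And>a x. \<lbrakk>a \<in> carrier R; x \<in> carrier M\<rbrakk> \<Longrightarrow> a \<odot>\<^bsub>M\<^esub> x \<in> carrier M"
    and "\<And>a b x. \<lbrakk>a \<in> carrier R; b \<in> carrier R; x \<in> carrier M\<rbrakk> \<Longrightarrow>
        (a \<oplus>\<^bsub>R\<^esub> b) \<odot>\<^bsub>M\<^esub> x = a \<odot>\<^bsub>M\<^esub> x \<oplus>\<^bsub>M\<^esub> b \<odot>\<^bsub>M\<^esub> x"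
    and "\<And>a x y. \<lbrakk>a \<in> carrier R; x \<in> carrier M; y \<in> carrier M\<rbrakk> \<Longrightarrow>
        a \<odot>\<^bsub>M\<^esub> (x \<oplus>\<^bsub>M\<^esub> y) = a \<odot>\<^bsub>M\<^esub> x \<oplus>\<^bsub>M\<^esub> a \<odot>\<^bsub>M\<^esub> y"
    and "\<And>a b x. \<lbrakk>a \<in> carrier R; b \<in> carrier R; x \<in> carrier M\<rbrakk> \<Longrightarrow>
        (a \<otimes>\<^bsub>R\<^esub> b) \<odot>\<^bsub>M\<^esub> x = a \<odot>\<^bsub>M\<^esub> (b \<odot>\<^bsub>M\<^esub> x)"
    and "\<And>x. x \<in> carrier M \<Longrightarrow> \<one>\<^bsub>R\<^esub> \<odot>\<^bsub>M\<^esub> x = x"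
  shows "left_module R M"
  using assms by (simp add: left_module_def left_module_axioms_def)

lemma regular_module_simps [simp]:
  "carrier (regular_module R) = carrier R" "\<zero>\<^bsub>regular_module R\<^esub> = \<zero>\<^bsub>R\<^esub>"
  "add (regular_module R) = add R" "smult (regular_module R) = mult R"
  by (simp_all add: regular_module_def)

lemma left_module_regular:
  assumes "ring R"
  shows "left_module R (regular_module R)"
proof -
  interpret ring R by fact
  show ?thesis
    by (rule left_moduleI[OF assms abelian_groupI])
      (auto simp: a_ac m_assoc l_distr r_distr intro: bexI[of _ "\<ominus>\<^bsub>R\<^esub> _"] l_neg)
qed

lemma finsum_regular:
  assumes "ring R" "f \<in> I \<rightarrow> carrier R"
  shows "finsum (regular_module R) f I = finsum R f I"
proof -
  interpret ring R by fact
  interpret M: left_module R "regular_module R" by (rule left_module_regular[OF assms(1)])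
  show ?thesis by (rule finsum_same[OF abelian_monoid_axioms M.M.abelian_monoid_axioms]) (use assms in auto)
qed

subsection \<open>Linear maps\<close>

lemma lin_mapsI:
  assumes "left_module R M"
    and "\<And>x. x \<in> carrier M \<Longrightarrow> f x \<in> carrier N"
    and "\<And>x y. x \<in> carrier M \<Longrightarrow> y \<in> carrier M \<Longrightarrow> f (x \<oplus>\<^bsub>M\<^esub> y) = f x \<oplus>\<^bsub>N\<^esub> f y"
    and "\<And>a x. a \<in> carrier R \<Longrightarrow> x \<in> carrier M \<Longrightarrow> f (a \<odot>\<^bsub>M\<^esub> x) = a \<odot>\<^bsub>N\<^esub> f x"
  shows "restrict f (carrier M) \<in> lin_maps R M N"
proof -
  interpret left_module R M by fact
  show ?thesis using assms by (auto simp: lin_maps_def smult_closed)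
qed

lemma lin_mapsD:
  assumes "f \<in> lin_maps R M N"
  shows "x \<in> carrier M \<Longrightarrow> f x \<in> carrier N"
    and "x \<in> carrier M \<Longrightarrow> y \<in> carrier M \<Longrightarrow> f (x \<oplus>\<^bsub>M\<^esub> y) = f x \<oplus>\<^bsub>N\<^esub> f y"
    and "a \<in> carrier R \<Longrightarrow> x \<in> carrier M \<Longrightarrow> f (a \<odot>\<^bsub>M\<^esub> x) = a \<odot>\<^bsub>N\<^esub> f x"
    and "additive_map M N f" and "f \<in> carrier M \<rightarrow>\<^sub>E carrier N"
  using assms by (auto simp: lin_maps_def additive_map_def)

lemma lin_maps_eqI:
  assumes "f \<in> lin_maps R M N" "g \<in> lin_maps R M N" "\<And>x. x \<in> carrier M \<Longrightarrow> f x = g x"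
  shows "f = g"
  using lin_mapsD(5)[OF assms(1)] lin_mapsD(5)[OF assms(2)] assms(3) by (intro PiE_ext) auto

lemma lin_maps_compose:
  assumes "left_module R M" "f \<in> lin_maps R M N" "g \<in> lin_maps R N P"
  shows "compose (carrier M) g f \<in> lin_maps R M P"
  unfolding compose_def
  by (rule lin_mapsI) (use assms lin_mapsD[OF assms(2)] lin_mapsD[OF assms(3)] in auto)

lemma lin_maps_inv:
  assumes "left_module R M" "left_module R N" "f \<in> lin_maps R M N" "bij_betw f (carrier M) (carrier N)"
  shows "restrict (inv_into (carrier M) f) (carrier N) \<in> lin_maps R N M"
proof -
  interpret M: left_module R M by fact
  interpret N: left_module R N by fact
  note f = lin_mapsD[OF assms(3)]
  let ?g = "inv_into (carrier M) f"
  have g: "?g y \<in> carrier M" "f (?g y) = y" if "y \<in> carrier N" for y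
    using assms(4) that by (auto simp: bij_betw_def intro: inv_into_into f_inv_into_f)
  have i: "\<And>x. x \<in> carrier M \<Longrightarrow> ?g (f x) = x" using assms(4) by (simp add: bij_betw_inv_into_left)
  show ?thesis
  proof (rule lin_mapsI[OF assms(2)])
    fix x y assume "x \<in> carrier N" "y \<in> carrier N"
    then show "?g (x \<oplus>\<^bsub>N\<^esub> y) = ?g x \<oplus>\<^bsub>M\<^esub> ?g y"
      using i[of "?g x \<oplus>\<^bsub>M\<^esub> ?g y"] g f by (simp add: M.M.a_closed)
  next
    fix a x assume "a \<in> carrier R" "x \<in> carrier N"
    then show "?g (a \<odot>\<^bsub>N\<^esub> x) = a \<odot>\<^bsub>M\<^esub> ?g x"
      using i[of "a \<odot>\<^bsub>M\<^esub> ?g x"] g f by (simp add: M.smult_closed)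
  qed (use g in auto)
qed

lemma module_isoI:
  assumes "left_module R M"
    and "\<And>x. x \<in> carrier M \<Longrightarrow> f x \<in> carrier N"
    and "\<And>x y. x \<in> carrier M \<Longrightarrow> y \<in> carrier M \<Longrightarrow> f (x \<oplus>\<^bsub>M\<^esub> y) = f x \<oplus>\<^bsub>N\<^esub> f y"
    and "\<And>a x. a \<in> carrier R \<Longrightarrow> x \<in> carrier M \<Longrightarrow> f (a \<odot>\<^bsub>M\<^esub> x) = a \<odot>\<^bsub>N\<^esub> f x"
    and "\<And>y. y \<in> carrier N \<Longrightarrow> g y \<in> carrier M" "\<And>y. y \<in> carrier N \<Longrightarrow> f (g y) = y"
    and "\<And>x. x \<in> carrier M \<Longrightarrow> g (f x) = x"
  shows "module_iso R M N"
  unfolding module_iso_def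
proof (rule bexI)
  show "restrict f (carrier M) \<in> lin_maps R M N" by (rule lin_mapsI[OF assms(1-4)])
  show "bij_betw (restrict f (carrier M)) (carrier M) (carrier N)"
    by (rule bij_betw_byWitness[where f' = g]) (use assms in auto)
qed

lemma module_iso_sym:
  assumes "left_module R M" "left_module R N" "module_iso R M N"
  shows "module_iso R N M"
proof -
  obtain f where f: "f \<in> lin_maps R M N" "bij_betw f (carrier M) (carrier N)"
    using assms(3) by (auto simp: module_iso_def)
  have "bij_betw (restrict (inv_into (carrier M) f) (carrier N)) (carrier N) (carrier M)"
    using bij_betw_inv_into[OF f(2)] by (simp add: bij_betw_restrict_eq)
  then show ?thesis unfolding module_iso_def using lin_maps_inv[OF assms(1,2) f] by blast
qed

lemma module_iso_trans:
  assumes "left_module R M" "module_iso R M N" "module_iso R N P"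
  shows "module_iso R M P"
proof -
  obtain f g where f: "f \<in> lin_maps R M N" "bij_betw f (carrier M) (carrier N)"
    and g: "g \<in> lin_maps R N P" "bij_betw g (carrier N) (carrier P)"
    using assms by (auto simp: module_iso_def)
  have "bij_betw (compose (carrier M) g f) (carrier M) (carrier P)"
    using bij_betw_compose[OF f(2) g(2)] .
  then show ?thesis unfolding module_iso_def using lin_maps_compose[OF assms(1) f(1) g(1)] by blast
qed

subsection \<open>Direct sums\<close>

lemma direct_sum_simps [simp]:
  "carrier (direct_sum I M) = {f \<in> (\<Pi>\<^sub>E i\<in>I. carrier (M i)). finite {i\<in>I. f i \<noteq> \<zero>\<^bsub>M i\<^esub>}}"
  "\<zero>\<^bsub>direct_sum I M\<^esub> = (\<lambda>i\<in>I. \<zero>\<^bsub>M i\<^esub>)"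
  "f \<oplus>\<^bsub>direct_sum I M\<^esub> g = (\<lambda>i\<in>I. f i \<oplus>\<^bsub>M i\<^esub> g i)"
  "a \<odot>\<^bsub>direct_sum I M\<^esub> f = (\<lambda>i\<in>I. a \<odot>\<^bsub>M i\<^esub> f i)"
  by (simp_all add: direct_sum_def)

lemma left_module_direct_sum:
  assumes "ring R" "\<And>i. i \<in> I \<Longrightarrow> left_module R (M i)"
  shows "left_module R (direct_sum I M)"
proof -
  interpret R: ring R by fact
  let ?S = "direct_sum I M"
  have ab: "\<And>i. i \<in> I \<Longrightarrow> abelian_group (M i)" using assms(2) by (simp add: left_module_def)
  note g = abelian_groupE[OF ab]
  note m = left_module.smult_closed[OF assms(2)] left_module.smult_l_distr[OF assms(2)]
    left_module.smult_r_distr[OF assms(2)] left_module.smult_assoc1[OF assms(2)]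
    left_module.smult_one[OF assms(2)] left_module.smult_r_null[OF assms(2)]
  have add: "f \<oplus>\<^bsub>?S\<^esub> f' \<in> carrier ?S" if "f \<in> carrier ?S" "f' \<in> carrier ?S" for f f'
  proof -
    have "finite ({i\<in>I. f i \<noteq> \<zero>\<^bsub>M i\<^esub>} \<union> {i\<in>I. f' i \<noteq> \<zero>\<^bsub>M i\<^esub>})" using that by simp
    then have "finite {i\<in>I. f i \<oplus>\<^bsub>M i\<^esub> f' i \<noteq> \<zero>\<^bsub>M i\<^esub>}"
      by (rule rev_finite_subset) (use g in auto)
    then show ?thesis using that by (auto intro!: g(1) cong: conj_cong)
  qed
  have sm: "a \<odot>\<^bsub>?S\<^esub> f \<in> carrier ?S" if "f \<in> carrier ?S" "a \<in> carrier R" for f a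
  proof -
    have "finite {i\<in>I. f i \<noteq> \<zero>\<^bsub>M i\<^esub>}" using that by simp
    then have "finite {i\<in>I. a \<odot>\<^bsub>M i\<^esub> f i \<noteq> \<zero>\<^bsub>M i\<^esub>}"
      by (rule rev_finite_subset) (use m that in auto)
    then show ?thesis using that by (auto intro!: m(1) cong: conj_cong)
  qed
  show ?thesis
  proof (rule left_moduleI[OF assms(1) abelian_groupI])
    show "\<zero>\<^bsub>?S\<^esub> \<in> carrier ?S" using g(2) by (auto cong: conj_cong)
  next
    fix f assume f: "f \<in> carrier ?S"
    \<comment> \<open>The inverse of \<open>f\<close> is its multiple by -1, whose finite support is
      already known from \<open>sm\<close>.\<close>
    have "(\<ominus>\<^bsub>R\<^esub> \<one>\<^bsub>R\<^esub>) \<odot>\<^bsub>M i\<^esub> f i \<oplus>\<^bsub>M i\<^esub> f i = \<zero>\<^bsub>M i\<^esub>" if "i \<in> I" for i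
    proof -
      have "f i \<in> carrier (M i)" using f that by auto
      then show ?thesis using m(2)[OF that, of "\<ominus>\<^bsub>R\<^esub> \<one>\<^bsub>R\<^esub>" "\<one>\<^bsub>R\<^esub>" "f i"] m(5)[OF that]
          left_module.smult_l_null[OF assms(2)[OF that]] by (simp add: R.l_neg)
    qed
    then have "((\<ominus>\<^bsub>R\<^esub> \<one>\<^bsub>R\<^esub>) \<odot>\<^bsub>?S\<^esub> f) \<oplus>\<^bsub>?S\<^esub> f = \<zero>\<^bsub>?S\<^esub>" by auto
    then show "\<exists>y\<in>carrier ?S. y \<oplus>\<^bsub>?S\<^esub> f = \<zero>\<^bsub>?S\<^esub>" using sm[OF f, of "\<ominus>\<^bsub>R\<^esub> \<one>\<^bsub>R\<^esub>"] by blast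
  next
    fix f assume f: "f \<in> carrier ?S"
    then show "\<zero>\<^bsub>?S\<^esub> \<oplus>\<^bsub>?S\<^esub> f = f" using g(5) by (force simp: PiE_iff extensional_def)
    show "\<one>\<^bsub>R\<^esub> \<odot>\<^bsub>?S\<^esub> f = f" using f m(5) by (force simp: PiE_iff extensional_def)
  qed (use add sm m g in \<open>auto simp: Pi_iff PiE_iff intro!: restrict_ext\<close>)
qed

lemma finsum_direct_sum:
  assumes "left_module R (direct_sum I M)" "\<And>i. i \<in> I \<Longrightarrow> left_module R (M i)"
    and "F \<in> J \<rightarrow> carrier (direct_sum I M)" "i \<in> I"
  shows "finsum (direct_sum I M) F J i = finsum (M i) (\<lambda>j. F j i) J"
proof -
  interpret S: left_module R "direct_sum I M" by fact
  interpret Mi: left_module R "M i" using assms by blast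
  have "additive_map (direct_sum I M) (M i) (\<lambda>f. f i)"
    by (rule additive_mapI) (use assms(4) in auto)
  from additive_map_finsum[OF S.M.abelian_group_axioms Mi.M.abelian_group_axioms this assms(3)]
  show ?thesis .
qed

subsection \<open>Dual bases and generating families\<close>

text \<open>Such data exist exactly for finitely generated projective modules. Both properties are
  handled in this form because elements and coordinate maps can be tensored and transported
  explicitly. The index type is free, so a basis may be numbered or indexed by module elements as
  required.\<close>

definition dual_basis ::
  "('a, 'r) ring_scheme \<Rightarrow> ('a, 'b, 'm) module_scheme \<Rightarrow> 'i set \<Rightarrow> ('i \<Rightarrow> 'b) \<Rightarrow> ('i \<Rightarrow> 'b \<Rightarrow> 'a) \<Rightarrow> bool"
  where "dual_basis R M I p \<phi> \<longleftrightarrow> finite I \<and> p \<in> I \<rightarrow> carrier M \<and>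
    (\<forall>i\<in>I. \<phi> i \<in> lin_maps R M (regular_module R)) \<and>
    (\<forall>x\<in>carrier M. x = finsum M (\<lambda>i. \<phi> i x \<odot>\<^bsub>M\<^esub> p i) I)"

lemma dual_basisD:
  assumes "dual_basis R M I p \<phi>"
  shows "finite I" "i \<in> I \<Longrightarrow> p i \<in> carrier M" "i \<in> I \<Longrightarrow> x \<in> carrier M \<Longrightarrow> \<phi> i x \<in> carrier R"
    and "i \<in> I \<Longrightarrow> x \<in> carrier M \<Longrightarrow> y \<in> carrier M \<Longrightarrow> \<phi> i (x \<oplus>\<^bsub>M\<^esub> y) = \<phi> i x \<oplus>\<^bsub>R\<^esub> \<phi> i y"
    and "i \<in> I \<Longrightarrow> a \<in> carrier R \<Longrightarrow> x \<in> carrier M \<Longrightarrow> \<phi> i (a \<odot>\<^bsub>M\<^esub> x) = a \<otimes>\<^bsub>R\<^esub> \<phi> i x"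
    and "x \<in> carrier M \<Longrightarrow> finsum M (\<lambda>i. \<phi> i x \<odot>\<^bsub>M\<^esub> p i) I = x"
    and "i \<in> I \<Longrightarrow> \<phi> i \<in> lin_maps R M (regular_module R)"
    and "i \<in> I \<Longrightarrow> additive_map M R (\<phi> i)"
proof -
  note * = assms[unfolded dual_basis_def]
  show "finite I" "i \<in> I \<Longrightarrow> p i \<in> carrier M" "i \<in> I \<Longrightarrow> \<phi> i \<in> lin_maps R M (regular_module R)"
    "x \<in> carrier M \<Longrightarrow> finsum M (\<lambda>i. \<phi> i x \<odot>\<^bsub>M\<^esub> p i) I = x" using * by auto
  note ** = lin_mapsD[of "\<phi> i" R M "regular_module R"]
  show "i \<in> I \<Longrightarrow> x \<in> carrier M \<Longrightarrow> \<phi> i x \<in> carrier R"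
    "i \<in> I \<Longrightarrow> x \<in> carrier M \<Longrightarrow> y \<in> carrier M \<Longrightarrow> \<phi> i (x \<oplus>\<^bsub>M\<^esub> y) = \<phi> i x \<oplus>\<^bsub>R\<^esub> \<phi> i y"
    "i \<in> I \<Longrightarrow> a \<in> carrier R \<Longrightarrow> x \<in> carrier M \<Longrightarrow> \<phi> i (a \<odot>\<^bsub>M\<^esub> x) = a \<otimes>\<^bsub>R\<^esub> \<phi> i x"
    "i \<in> I \<Longrightarrow> additive_map M R (\<phi> i)"
    using * ** by (auto simp: additive_map_def)
qed

lemma dual_basis_linear_eq:
  assumes "left_module R M" "left_module R N" "dual_basis R M I p \<phi>"
    and "f \<in> lin_maps R M N" "x \<in> carrier M"
  shows "f x = finsum N (\<lambda>i. \<phi> i x \<odot>\<^bsub>N\<^esub> f (p i)) I"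
proof -
  interpret M: left_module R M by fact
  interpret N: left_module R N by fact
  note d = dual_basisD[OF assms(3)]
  note f = lin_mapsD[OF assms(4)]
  have "f x = f (finsum M (\<lambda>i. \<phi> i x \<odot>\<^bsub>M\<^esub> p i) I)" using d assms(5) by simp
  also have "\<dots> = finsum N (\<lambda>i. f (\<phi> i x \<odot>\<^bsub>M\<^esub> p i)) I"
    by (rule additive_map_finsum[OF M.M.abelian_group_axioms N.M.abelian_group_axioms f(4)])
      (use d assms(5) in \<open>auto intro!: M.smult_closed\<close>)
  also have "\<dots> = finsum N (\<lambda>i. \<phi> i x \<odot>\<^bsub>N\<^esub> f (p i)) I"
    using d f assms(5) by (intro N.M.finsum_cong') (auto intro!: N.smult_closed)
  finally show ?thesis .
qed

text \<open>\<open>N\<close> is a retract of \<open>M\<close> with retraction \<open>F\<close>;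
  coordinates in \<open>N\<close> are taken after the section \<open>K\<close>.\<close>

lemma dual_basis_transport:
  assumes M: "left_module R M" and N: "left_module R N"
    and F: "F \<in> lin_maps R M N" and K: "K \<in> lin_maps R N M" and FK: "\<And>y. y \<in> carrier N \<Longrightarrow> F (K y) = y"
    and db: "dual_basis R M I p \<phi>"
  shows "dual_basis R N I (\<lambda>i. F (p i)) (\<lambda>i. compose (carrier N) (\<phi> i) K)"
  unfolding dual_basis_def
proof (intro conjI ballI)
  interpret M: left_module R M by fact
  interpret N: left_module R N by fact
  note d = dual_basisD[OF db] and f = lin_mapsD[OF F] and k = lin_mapsD[OF K]
  show "finite I" "(\<lambda>i. F (p i)) \<in> I \<rightarrow> carrier N" using d f by auto
  show "compose (carrier N) (\<phi> i) K \<in> lin_maps R N (regular_module R)" if "i \<in> I" for i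
    by (rule lin_maps_compose[OF N K d(7)[OF that]])
  fix y assume y: "y \<in> carrier N"
  have Ky: "K y \<in> carrier M" using k(1)[OF y] .
  have "y = F (finsum M (\<lambda>i. \<phi> i (K y) \<odot>\<^bsub>M\<^esub> p i) I)" using d(6)[OF Ky] FK[OF y] by simp
  also have "\<dots> = finsum N (\<lambda>i. F (\<phi> i (K y) \<odot>\<^bsub>M\<^esub> p i)) I"
    by (rule additive_map_finsum[OF M.M.abelian_group_axioms N.M.abelian_group_axioms f(4)])
      (use d(2,3) Ky in \<open>auto intro!: M.smult_closed\<close>)
  also have "\<dots> = finsum N (\<lambda>i. compose (carrier N) (\<phi> i) K y \<odot>\<^bsub>N\<^esub> F (p i)) I"
    using d(2,3) Ky f(1,3) y by (intro N.M.finsum_cong') (auto simp: compose_def intro!: N.smult_closed)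
  finally show "y = finsum N (\<lambda>i. compose (carrier N) (\<phi> i) K y \<odot>\<^bsub>N\<^esub> F (p i)) I" .
qed

text \<open>The values \<open>q\<close> are arbitrary because the coordinate maps are linear. The
  resulting map need not send \<open>p i\<close> to \<open>q i\<close>: the \<open>p i\<close> may
  satisfy relations, and the value at \<open>p i\<close> is the sum of the \<open>q j\<close> with
  coefficients \<open>\<phi> j (p i)\<close>.\<close>

lemma dual_basis_extend:
  assumes "left_module R M" "left_module R N" "dual_basis R M I p \<phi>" "q \<in> I \<rightarrow> carrier N"
  shows "(\<lambda>x\<in>carrier M. finsum N (\<lambda>i. \<phi> i x \<odot>\<^bsub>N\<^esub> q i) I) \<in> lin_maps R M N"
proof -
  interpret M: left_module R M by fact
  interpret N: left_module R N by fact
  note d = dual_basisD[OF assms(3)]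
  note q = funcset_mem[OF assms(4)]
  show ?thesis
  proof (rule lin_mapsI[OF assms(1)])
    fix x y assume "x \<in> carrier M" "y \<in> carrier M"
    then show "finsum N (\<lambda>i. \<phi> i (x \<oplus>\<^bsub>M\<^esub> y) \<odot>\<^bsub>N\<^esub> q i) I =
      finsum N (\<lambda>i. \<phi> i x \<odot>\<^bsub>N\<^esub> q i) I \<oplus>\<^bsub>N\<^esub> finsum N (\<lambda>i. \<phi> i y \<odot>\<^bsub>N\<^esub> q i) I"
      using d q by (subst N.M.finsum_addf[symmetric])
        (auto intro!: N.M.finsum_cong' N.smult_closed simp: N.smult_l_distr)
  next
    fix a x assume "a \<in> carrier R" "x \<in> carrier M"
    then show "finsum N (\<lambda>i. \<phi> i (a \<odot>\<^bsub>M\<^esub> x) \<odot>\<^bsub>N\<^esub> q i) I = a \<odot>\<^bsub>N\<^esub> finsum N (\<lambda>i. \<phi> i x \<odot>\<^bsub>N\<^esub> q i) I"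
      using d q by (subst N.finsum_smult_r)
        (auto intro!: N.M.finsum_cong' N.smult_closed simp: N.smult_assoc1)
  qed (use d q in \<open>auto intro!: N.M.finsum_closed N.smult_closed\<close>)
qed

lemma dual_basis_reindex:
  assumes "dual_basis R M I p \<phi>" "left_module R M" "bij_betw h J I"
  shows "dual_basis R M J (p \<circ> h) (\<phi> \<circ> h)"
proof -
  interpret M: left_module R M by fact
  note d = dual_basisD[OF assms(1)]
  have h: "h ` J = I" "inj_on h J" using assms(3) by (auto simp: bij_betw_def)
  have "finsum M (\<lambda>j. \<phi> (h j) x \<odot>\<^bsub>M\<^esub> p (h j)) J = x" if "x \<in> carrier M" for x
  proof -
    have "finsum M (\<lambda>i. \<phi> i x \<odot>\<^bsub>M\<^esub> p i) (h ` J) = finsum M (\<lambda>j. \<phi> (h j) x \<odot>\<^bsub>M\<^esub> p (h j)) J"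
      by (rule M.M.finsum_reindex) (use h d that in \<open>auto intro!: M.smult_closed\<close>)
    then show ?thesis using d(6)[OF that] h by simp
  qed
  then show ?thesis using d h bij_betw_finite[OF assms(3)] unfolding dual_basis_def by auto
qed

text \<open>Since \<open>p\<close> may repeat values, coefficients cannot be attached to the
  elements of its image directly. Instead the span of the image is shown to be a submodule
  containing every \<open>p i\<close>, hence every expansion.\<close>

lemma dual_basis_fin_gen:
  assumes "left_module R M" "dual_basis R M I p \<phi>"
  shows "fin_gen_module R M"
proof -
  interpret M: left_module R M by fact
  note d = dual_basisD[OF assms(2)]
  define S where "S = p ` I"
  have S: "finite S" "S \<subseteq> carrier M" using d by (auto simp: S_def)
  let ?H = "{finsum M (\<lambda>s. c s \<odot>\<^bsub>M\<^esub> s) S | c. c \<in> S \<rightarrow> carrier R}"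
  have "submodule ?H R M"
  proof (rule M.submoduleI)
    show "?H \<subseteq> carrier M" using S by (auto intro!: M.M.finsum_closed M.smult_closed)
    have "finsum M (\<lambda>s. \<zero>\<^bsub>R\<^esub> \<odot>\<^bsub>M\<^esub> s) S = \<zero>\<^bsub>M\<^esub>"
      using S by (intro M.M.add.finprod_one_eqI) (auto simp: M.smult_l_null)
    then show "\<zero>\<^bsub>M\<^esub> \<in> ?H" by (auto intro!: exI[of _ "\<lambda>_. \<zero>\<^bsub>R\<^esub>"])
  next
    fix x y assume "x \<in> ?H" "y \<in> ?H"
    then obtain c c' where c: "c \<in> S \<rightarrow> carrier R" "x = finsum M (\<lambda>s. c s \<odot>\<^bsub>M\<^esub> s) S"
      and c': "c' \<in> S \<rightarrow> carrier R" "y = finsum M (\<lambda>s. c' s \<odot>\<^bsub>M\<^esub> s) S" by blast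
    have "x \<oplus>\<^bsub>M\<^esub> y = finsum M (\<lambda>s. c s \<odot>\<^bsub>M\<^esub> s \<oplus>\<^bsub>M\<^esub> c' s \<odot>\<^bsub>M\<^esub> s) S"
      unfolding c c' using c c' S by (intro M.M.finsum_addf[symmetric]) (auto intro!: M.smult_closed)
    also have "\<dots> = finsum M (\<lambda>s. (c s \<oplus>\<^bsub>R\<^esub> c' s) \<odot>\<^bsub>M\<^esub> s) S"
      using c c' S by (intro M.M.finsum_cong') (auto intro!: M.smult_closed M.smult_l_distr[symmetric])
    finally show "x \<oplus>\<^bsub>M\<^esub> y \<in> ?H" using c c' by (auto intro!: exI[of _ "\<lambda>s. c s \<oplus>\<^bsub>R\<^esub> c' s"])
  next
    fix a x assume a: "a \<in> carrier R" "x \<in> ?H"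
    then obtain c where c: "c \<in> S \<rightarrow> carrier R" "x = finsum M (\<lambda>s. c s \<odot>\<^bsub>M\<^esub> s) S" by blast
    have "a \<odot>\<^bsub>M\<^esub> x = finsum M (\<lambda>s. a \<odot>\<^bsub>M\<^esub> (c s \<odot>\<^bsub>M\<^esub> s)) S"
      unfolding c using c a S by (intro M.finsum_smult_r) (auto intro!: M.smult_closed)
    also have "\<dots> = finsum M (\<lambda>s. (a \<otimes>\<^bsub>R\<^esub> c s) \<odot>\<^bsub>M\<^esub> s) S"
      using c a S by (intro M.M.finsum_cong') (auto intro!: M.smult_closed M.smult_assoc1[symmetric])
    finally show "a \<odot>\<^bsub>M\<^esub> x \<in> ?H" using c a by (auto intro!: exI[of _ "\<lambda>s. a \<otimes>\<^bsub>R\<^esub> c s"])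
  qed
  note H = M.submoduleD[OF this]
  have p: "p i \<in> ?H" if "i \<in> I" for i
  proof -
    have pS: "p i \<in> S" using that by (simp add: S_def)
    have "finsum M (\<lambda>s. (if s = p i then \<one>\<^bsub>R\<^esub> else \<zero>\<^bsub>R\<^esub>) \<odot>\<^bsub>M\<^esub> s) S = (if p i = p i then \<one>\<^bsub>R\<^esub> else \<zero>\<^bsub>R\<^esub>) \<odot>\<^bsub>M\<^esub> p i"
      using S pS by (intro M.M.finsum_single) (auto intro!: M.smult_closed simp: M.smult_l_null)
    then show ?thesis using pS S by (auto simp: M.smult_one intro!: exI[of _ "\<lambda>s. if s = p i then \<one>\<^bsub>R\<^esub> else \<zero>\<^bsub>R\<^esub>"])
  qed
  have "x \<in> ?H" if "x \<in> carrier M" for x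
  proof -
    have "finsum M (\<lambda>i. \<phi> i x \<odot>\<^bsub>M\<^esub> p i) I \<in> ?H"
      by (rule M.M.finsum_in_subset[OF H(2,3,1)]) (use H(5) p d that in auto)
    then show ?thesis using d(6)[OF that] by simp
  qed
  then have "carrier M = ?H" using H(1) by blast
  then show ?thesis unfolding fin_gen_module_def using S assms(1) by blast
qed

text \<open>The coordinate map \<open>\<tau>\<close> into the free module on \<open>I\<close> is
  split by \<open>\<sigma>\<close>. So the module is isomorphic to the image of
  \<open>\<tau>\<close>, and the kernel of \<open>\<sigma>\<close> is a complement.\<close>

lemma dual_basis_projective:
  fixes I :: "'b set" and M :: "('a, 'b, 'm) module_scheme"
  assumes "left_module R M" "dual_basis R M I p \<phi>"
  shows "projective_module R M"
proof -
  interpret M: left_module R M by fact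
  let ?F = "direct_sum I (\<lambda>_. regular_module R)"
  note d = dual_basisD[OF assms(2)]
  note reg = left_module_regular[OF M.R.ring_axioms]
  interpret F: left_module R ?F by (rule left_module_direct_sum[OF M.R.ring_axioms reg])
  have cF: "carrier ?F = (\<Pi>\<^sub>E i\<in>I. carrier R)" using d(1) by auto
  define \<tau> where "\<tau> x = (\<lambda>i\<in>I. \<phi> i x)" for x
  define \<sigma> where "\<sigma> f = finsum M (\<lambda>i. f i \<odot>\<^bsub>M\<^esub> p i) I" for f
  have t: "\<tau> x \<in> carrier ?F" if "x \<in> carrier M" for x
    unfolding cF \<tau>_def using d(3) that by auto
  have ta: "\<tau> (x \<oplus>\<^bsub>M\<^esub> y) = \<tau> x \<oplus>\<^bsub>?F\<^esub> \<tau> y" if "x \<in> carrier M" "y \<in> carrier M" for x y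
    using d(4) that by (auto simp: \<tau>_def)
  have ts: "\<tau> (a \<odot>\<^bsub>M\<^esub> x) = a \<odot>\<^bsub>?F\<^esub> \<tau> x" if "a \<in> carrier R" "x \<in> carrier M" for a x
    using d(5) that by (auto simp: \<tau>_def)
  have s: "\<sigma> f \<in> carrier M" if "f \<in> carrier ?F" for f
    using that d(2) unfolding \<sigma>_def cF by (auto intro!: M.M.finsum_closed M.smult_closed)
  have sa: "\<sigma> (f \<oplus>\<^bsub>?F\<^esub> g) = \<sigma> f \<oplus>\<^bsub>M\<^esub> \<sigma> g" if "f \<in> carrier ?F" "g \<in> carrier ?F" for f g
    using that d(2) unfolding \<sigma>_def cF
    by (subst M.M.finsum_addf[symmetric]) (auto simp: PiE_iff Pi_iff M.smult_l_distr intro!: M.M.finsum_cong' M.smult_closed)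
  have ss: "\<sigma> (a \<odot>\<^bsub>?F\<^esub> f) = a \<odot>\<^bsub>M\<^esub> \<sigma> f" if "a \<in> carrier R" "f \<in> carrier ?F" for a f
    using that d(2) unfolding \<sigma>_def cF
    by (subst M.finsum_smult_r) (auto simp: PiE_iff Pi_iff M.smult_assoc1 intro!: M.M.finsum_cong' M.smult_closed)
  have st: "\<sigma> (\<tau> x) = x" if "x \<in> carrier M" for x
  proof -
    have "\<sigma> (\<tau> x) = finsum M (\<lambda>i. \<phi> i x \<odot>\<^bsub>M\<^esub> p i) I"
      unfolding \<sigma>_def \<tau>_def using that d by (intro M.M.finsum_cong') (auto intro!: M.smult_closed)
    then show ?thesis using d(6)[OF that] by simp
  qed
  have tm: "additive_map M ?F \<tau>" and sm: "additive_map ?F M \<sigma>" using t ta s sa by (auto simp: additive_map_def)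
  note t0 = additive_map_zero[OF M.M.abelian_group_axioms F.M.abelian_group_axioms tm]
  note s0 = additive_map_zero[OF F.M.abelian_group_axioms M.M.abelian_group_axioms sm]
  note tn = additive_map_neg[OF M.M.abelian_group_axioms F.M.abelian_group_axioms tm]
  note sn = additive_map_neg[OF F.M.abelian_group_axioms M.M.abelian_group_axioms sm]
  let ?U = "\<tau> ` carrier M" and ?V = "{f \<in> carrier ?F. \<sigma> f = \<zero>\<^bsub>M\<^esub>}"
  have U: "submodule ?U R ?F"
  proof (rule F.submoduleI)
    show "?U \<subseteq> carrier ?F" using t by blast
    show "\<zero>\<^bsub>?F\<^esub> \<in> ?U" using t0 M.M.zero_closed by (metis imageI)
    show "x \<oplus>\<^bsub>?F\<^esub> y \<in> ?U" if "x \<in> ?U" "y \<in> ?U" for x y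
    proof -
      obtain m n where "m \<in> carrier M" "n \<in> carrier M" "x = \<tau> m" "y = \<tau> n" using \<open>x \<in> ?U\<close> \<open>y \<in> ?U\<close> by blast
      then show ?thesis using image_eqI[of _ \<tau>, OF ta[symmetric, of m n] M.M.a_closed] by blast
    qed
    show "a \<odot>\<^bsub>?F\<^esub> x \<in> ?U" if "a \<in> carrier R" "x \<in> ?U" for a x
    proof -
      obtain m where "m \<in> carrier M" "x = \<tau> m" using \<open>x \<in> ?U\<close> by blast
      then show ?thesis using image_eqI[of _ \<tau>, OF ts[symmetric, of a m] M.smult_closed] \<open>a \<in> carrier R\<close> by blast
    qed
  qed
  have V: "submodule ?V R ?F"
  proof (rule F.submoduleI)
    show "\<zero>\<^bsub>?F\<^esub> \<in> ?V" using s0 F.M.zero_closed by blast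
    show "x \<oplus>\<^bsub>?F\<^esub> y \<in> ?V" if "x \<in> ?V" "y \<in> ?V" for x y
      using that sa[of x y] F.M.a_closed[of x y] by (simp del: direct_sum_simps)
    show "a \<odot>\<^bsub>?F\<^esub> x \<in> ?V" if "a \<in> carrier R" "x \<in> ?V" for a x
      using that ss[of a x] F.smult_closed[of a x] M.smult_r_null by (simp del: direct_sum_simps)
  qed blast
  have "\<zero>\<^bsub>?F\<^esub> \<in> ?U" "\<zero>\<^bsub>?F\<^esub> \<in> ?V" using U V F.submoduleD(2) by blast+
  moreover have "x = \<zero>\<^bsub>?F\<^esub>" if "x \<in> ?U \<inter> ?V" for x using that t0 st by force
  ultimately have "?U \<inter> ?V = {\<zero>\<^bsub>?F\<^esub>}" by blast
  moreover have "f \<in> {u \<oplus>\<^bsub>?F\<^esub> v | u v. u \<in> ?U \<and> v \<in> ?V}" if f: "f \<in> carrier ?F" for f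
  proof -
    have fs: "\<tau> (\<sigma> f) \<in> carrier ?F" using s t f by blast
    have "f = \<tau> (\<sigma> f) \<oplus>\<^bsub>?F\<^esub> (\<ominus>\<^bsub>?F\<^esub> \<tau> (\<sigma> f) \<oplus>\<^bsub>?F\<^esub> f)"
      using fs f by (metis F.M.r_neg2)
    moreover have "\<ominus>\<^bsub>?F\<^esub> \<tau> (\<sigma> f) \<oplus>\<^bsub>?F\<^esub> f \<in> ?V"
    proof -
      have "\<sigma> (\<ominus>\<^bsub>?F\<^esub> \<tau> (\<sigma> f) \<oplus>\<^bsub>?F\<^esub> f) = \<ominus>\<^bsub>M\<^esub> \<sigma> f \<oplus>\<^bsub>M\<^esub> \<sigma> f"
        using fs f by (subst sa) (auto simp: sn st s F.M.a_inv_closed simp del: direct_sum_simps)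
      then show ?thesis using fs f s by (auto simp: M.M.l_neg F.M.a_inv_closed F.M.a_closed simp del: direct_sum_simps)
    qed
    ultimately show ?thesis using s f by blast
  qed
  moreover have "{u \<oplus>\<^bsub>?F\<^esub> v | u v. u \<in> ?U \<and> v \<in> ?V} \<subseteq> carrier ?F"
    using t F.M.a_closed by blast
  ultimately have "internal_direct_sum2 R ?F ?U ?V"
    using U V unfolding internal_direct_sum2_def by blast
  moreover have "module_iso R M (?F\<lparr>carrier := ?U\<rparr>)"
    by (rule module_isoI[where f = \<tau> and g = \<sigma>, OF assms(1)])
      (use t ta ts s st in \<open>auto simp del: direct_sum_simps\<close>)
  ultimately show ?thesis unfolding projective_module_def using assms(1) by blast
qed

text \<open>The free module may have infinite rank, but finitely many generators involve only
  finitely many coordinates \<open>T\<close>. The coordinates in \<open>T\<close>, paired with the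
  projections of the unit vectors to the summand \<open>U\<close>, form the dual basis.\<close>

lemma projective_dual_basis:
  fixes M :: "('a, 'b, 'm) module_scheme"
  assumes "fin_gen_module R M" "projective_module R M"
  obtains I :: "'b set" and p \<phi> where "dual_basis R M I p \<phi>"
proof -
  have lm: "left_module R M" using assms(1) by (simp add: fin_gen_module_def)
  interpret M: left_module R M by fact
  note reg = left_module_regular[OF M.R.ring_axioms]
  interpret reg: left_module R "regular_module R" by (rule reg)
  obtain S where S: "finite S" "S \<subseteq> carrier M"
    and span: "carrier M = {finsum M (\<lambda>s. c s \<odot>\<^bsub>M\<^esub> s) S | c. c \<in> S \<rightarrow> carrier R}"
    using assms(1) by (auto simp: fin_gen_module_def)
  obtain J :: "'b set" and U V where dec: "internal_direct_sum2 R (direct_sum J (\<lambda>_. regular_module R)) U V"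
    and iso: "module_iso R M ((direct_sum J (\<lambda>_. regular_module R))\<lparr>carrier := U\<rparr>)"
    using assms(2) unfolding projective_module_def by blast
  let ?F = "direct_sum J (\<lambda>_. regular_module R)"
  interpret F: left_module R ?F by (rule left_module_direct_sum[OF M.R.ring_axioms reg])
  have U: "submodule U R ?F" and V: "submodule V R ?F" and UV: "U \<inter> V = {\<zero>\<^bsub>?F\<^esub>}"
    "carrier ?F = {u \<oplus>\<^bsub>?F\<^esub> v | u v. u \<in> U \<and> v \<in> V}" using dec by (auto simp: internal_direct_sum2_def)
  note u = F.submoduleD[OF U] and v = F.submoduleD[OF V]
  interpret U: left_module R "?F\<lparr>carrier := U\<rparr>" by (rule F.left_module_submodule[OF U])
  obtain \<theta> where \<theta>: "\<theta> \<in> lin_maps R M (?F\<lparr>carrier := U\<rparr>)" "bij_betw \<theta> (carrier M) U"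
    using iso by (auto simp: module_iso_def)
  note t = lin_mapsD[OF \<theta>(1), simplified]
  have tU: "\<And>x. x \<in> carrier M \<Longrightarrow> \<theta> x \<in> U" using lin_mapsD(1)[OF \<theta>(1)] by simp
  have tF: "\<And>x. x \<in> carrier M \<Longrightarrow> \<theta> x \<in> carrier ?F" using tU u(1) by blast
  define T where "T = (\<Union>s\<in>S. {j\<in>J. \<theta> s j \<noteq> \<zero>\<^bsub>R\<^esub>})"
  have T: "finite T" "T \<subseteq> J" using S tF by (auto simp: T_def)
  define \<delta> where "\<delta> i = (\<lambda>j\<in>J. if j = i then \<one>\<^bsub>R\<^esub> else \<zero>\<^bsub>R\<^esub>)" for i
  have \<delta>: "\<delta> i \<in> carrier ?F" for i
    by (auto simp: \<delta>_def intro: finite_subset[of _ "{i}"])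
  have "\<exists>a b. a \<in> U \<and> b \<in> V \<and> \<delta> i = a \<oplus>\<^bsub>?F\<^esub> b" for i using \<delta>[of i] UV(2) by blast
  then obtain a b where ab: "\<And>i. a i \<in> U" "\<And>i. b i \<in> V" "\<And>i. \<delta> i = a i \<oplus>\<^bsub>?F\<^esub> b i" by metis
  define p where "p i = inv_into (carrier M) \<theta> (a i)" for i
  have p: "p i \<in> carrier M" "\<theta> (p i) = a i" for i
    using \<theta>(2) ab(1)[of i] unfolding p_def by (auto simp: bij_betw_def intro: inv_into_into f_inv_into_f)
  define \<phi> where "\<phi> i = (\<lambda>x\<in>carrier M. \<theta> x i)" for i
  have \<phi>: "\<phi> i \<in> lin_maps R M (regular_module R)" if "i \<in> J" for i
    unfolding \<phi>_def using tF that t(2,3) by (intro lin_mapsI lm) auto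
  \<comment> \<open>Outside \<open>T\<close> the coordinates of the generators vanish, hence by
    linearity those of every element.\<close>
  have supp: "\<theta> x j = \<zero>\<^bsub>R\<^esub>" if x: "x \<in> carrier M" and j: "j \<in> J" "j \<notin> T" for x j
  proof -
    obtain c where c: "c \<in> S \<rightarrow> carrier R" "x = finsum M (\<lambda>s. c s \<odot>\<^bsub>M\<^esub> s) S" using x span by blast
    have cs: "c s \<odot>\<^bsub>M\<^esub> s \<in> carrier M" if "s \<in> S" for s using c S that by (auto intro!: M.smult_closed)
    have sj: "\<theta> s j = \<zero>\<^bsub>R\<^esub>" if "s \<in> S" for s using j that by (auto simp: T_def)
    have "additive_map M R (\<phi> j)" using lin_mapsD(4)[OF \<phi>[OF j(1)]] by (auto simp: additive_map_def)
    from additive_map_finsum[OF M.M.abelian_group_axioms M.R.abelian_group_axioms this, of "\<lambda>s. c s \<odot>\<^bsub>M\<^esub> s" S]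
    have "\<phi> j x = finsum R (\<lambda>s. \<phi> j (c s \<odot>\<^bsub>M\<^esub> s)) S" using c cs by auto
    also have "\<dots> = \<zero>\<^bsub>R\<^esub>"
    proof (intro M.R.add.finprod_one_eqI)
      fix s assume s: "s \<in> S"
      then have "\<phi> j (c s \<odot>\<^bsub>M\<^esub> s) = c s \<otimes>\<^bsub>R\<^esub> \<phi> j s"
        using lin_mapsD(3)[OF \<phi>[OF j(1)], of "c s" s] c S by auto
      moreover have "\<phi> j s = \<zero>\<^bsub>R\<^esub>" "c s \<in> carrier R" using sj[OF s] s S c by (auto simp: \<phi>_def)
      ultimately show "\<phi> j (c s \<odot>\<^bsub>M\<^esub> s) = \<zero>\<^bsub>R\<^esub>" by simp
    qed
    finally show ?thesis using x by (simp add: \<phi>_def)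
  qed
  have "finsum M (\<lambda>i. \<phi> i x \<odot>\<^bsub>M\<^esub> p i) T = x" if x: "x \<in> carrier M" for x
  proof -
    let ?y = "finsum M (\<lambda>i. \<phi> i x \<odot>\<^bsub>M\<^esub> p i) T"
    have c: "\<phi> i x \<in> carrier R" if "i \<in> T" for i using lin_mapsD(1)[OF \<phi>] T x that by auto
    have cx: "\<phi> i x \<odot>\<^bsub>M\<^esub> p i \<in> carrier M" if "i \<in> T" for i using c p that by (simp add: M.smult_closed)
    have y: "?y \<in> carrier M" using cx by (auto intro!: M.M.finsum_closed)
    have "\<theta> ?y = finsum (?F\<lparr>carrier := U\<rparr>) (\<lambda>i. \<theta> (\<phi> i x \<odot>\<^bsub>M\<^esub> p i)) T"
      by (rule additive_map_finsum[OF M.M.abelian_group_axioms U.M.abelian_group_axioms lin_mapsD(4)[OF \<theta>(1)]])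
        (use cx in auto)
    also have "\<dots> = finsum ?F (\<lambda>i. \<theta> (\<phi> i x \<odot>\<^bsub>M\<^esub> p i)) T"
      by (rule F.finsum_submodule[OF U]) (use cx tU in auto)
    also have "\<dots> = finsum ?F (\<lambda>i. \<phi> i x \<odot>\<^bsub>?F\<^esub> a i) T"
      by (rule F.M.finsum_cong') (use c lin_mapsD(3)[OF \<theta>(1)] p ab u F.smult_closed in \<open>auto simp del: direct_sum_simps\<close>)
    finally have ty: "\<theta> ?y = finsum ?F (\<lambda>i. \<phi> i x \<odot>\<^bsub>?F\<^esub> a i) T" .
    have "\<theta> x = finsum ?F (\<lambda>i. \<phi> i x \<odot>\<^bsub>?F\<^esub> \<delta> i) T"
    proof (rule PiE_ext[of _ J "\<lambda>_. carrier R"])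
      show "\<theta> x \<in> (\<Pi>\<^sub>E i\<in>J. carrier R)" using tF[OF x] by auto
      have "finsum ?F (\<lambda>i. \<phi> i x \<odot>\<^bsub>?F\<^esub> \<delta> i) T \<in> carrier ?F"
        by (rule F.M.finsum_closed) (use c \<delta> F.smult_closed in \<open>auto simp del: direct_sum_simps\<close>)
      then show "finsum ?F (\<lambda>i. \<phi> i x \<odot>\<^bsub>?F\<^esub> \<delta> i) T \<in> (\<Pi>\<^sub>E i\<in>J. carrier R)" by simp
      fix j assume j: "j \<in> J"
      have "finsum ?F (\<lambda>i. \<phi> i x \<odot>\<^bsub>?F\<^esub> \<delta> i) T j = finsum (regular_module R) (\<lambda>i. (\<phi> i x \<odot>\<^bsub>?F\<^esub> \<delta> i) j) T"
        by (rule finsum_direct_sum[OF F.left_module_axioms reg])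
          (use c \<delta> F.smult_closed j in \<open>auto simp del: direct_sum_simps\<close>)
      also have "\<dots> = \<theta> x j"
      proof (cases "j \<in> T")
        case True
        have "finsum (regular_module R) (\<lambda>i. (\<phi> i x \<odot>\<^bsub>?F\<^esub> \<delta> i) j) T = (\<phi> j x \<odot>\<^bsub>?F\<^esub> \<delta> j) j"
          by (rule reg.M.finsum_single) (use T True c j in \<open>auto simp: \<delta>_def\<close>)
        then show ?thesis using j c True x by (simp add: \<delta>_def) (simp add: \<phi>_def)
      next
        case False
        have "finsum (regular_module R) (\<lambda>i. (\<phi> i x \<odot>\<^bsub>?F\<^esub> \<delta> i) j) T = \<zero>\<^bsub>R\<^esub>"
          using False c j by (subst reg.M.add.finprod_one_eqI) (auto simp: \<delta>_def)
        then show ?thesis using supp[OF x j False] by simp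
      qed
      finally show "\<theta> x j = finsum ?F (\<lambda>i. \<phi> i x \<odot>\<^bsub>?F\<^esub> \<delta> i) T j" by simp
    qed
    also have "\<dots> = finsum ?F (\<lambda>i. \<phi> i x \<odot>\<^bsub>?F\<^esub> a i \<oplus>\<^bsub>?F\<^esub> \<phi> i x \<odot>\<^bsub>?F\<^esub> b i) T"
      by (rule F.M.finsum_cong') (use c ab u v F.smult_closed F.smult_r_distr F.M.a_closed in \<open>auto simp del: direct_sum_simps simp: subset_iff\<close>)
    also have "\<dots> = finsum ?F (\<lambda>i. \<phi> i x \<odot>\<^bsub>?F\<^esub> a i) T \<oplus>\<^bsub>?F\<^esub> finsum ?F (\<lambda>i. \<phi> i x \<odot>\<^bsub>?F\<^esub> b i) T"
      by (rule F.M.finsum_addf) (use c ab u v F.smult_closed in \<open>auto simp del: direct_sum_simps simp: subset_iff\<close>)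
    finally have tx: "\<theta> x = \<theta> ?y \<oplus>\<^bsub>?F\<^esub> finsum ?F (\<lambda>i. \<phi> i x \<odot>\<^bsub>?F\<^esub> b i) T" using ty by simp
    \<comment> \<open>The \<open>V\<close>-part of the expansion of \<open>\<theta> x\<close> is
      also a difference of two elements of \<open>U\<close>, so it vanishes, and injectivity of
      \<open>\<theta>\<close> identifies \<open>x\<close> with \<open>?y\<close>.\<close>
    have bV: "finsum ?F (\<lambda>i. \<phi> i x \<odot>\<^bsub>?F\<^esub> b i) T \<in> V" (is "?b \<in> V")
      by (rule F.M.finsum_in_subset[OF v(2,3,1)]) (use v(5) ab c in auto)
    have "?b = \<ominus>\<^bsub>?F\<^esub> \<theta> ?y \<oplus>\<^bsub>?F\<^esub> \<theta> x" 
      by (subst tx) (rule F.M.r_neg1[OF tF[OF y] subsetD[OF v(1) bV], symmetric])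
    then have "?b \<in> U" using u tU x y by simp
    then have "?b = \<zero>\<^bsub>?F\<^esub>" using bV UV(1) by blast
    then have "\<theta> x = \<theta> ?y \<oplus>\<^bsub>?F\<^esub> \<zero>\<^bsub>?F\<^esub>" using tx by (simp only:)
    then have "\<theta> x = \<theta> ?y" using F.M.r_zero[OF tF[OF y]] by (simp only:)
    then show ?thesis using \<theta>(2) x y by (auto simp: bij_betw_def inj_on_def)
  qed
  then have "dual_basis R M T p \<phi>" unfolding dual_basis_def using T p \<phi> by auto
  then show ?thesis by (rule that)
qed

text \<open>The trace ideal of \<open>M\<close> contains the identity.\<close>

definition trace_one :: "('a, 'r) ring_scheme \<Rightarrow> ('a, 'b, 'm) module_scheme \<Rightarrow> bool"
  where "trace_one R M \<longleftrightarrow> (\<exists>(n::nat) f x. (\<forall>j<n. f j \<in> lin_maps R M (regular_module R) \<and> x j \<in> carrier M) \<and>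
    finsum R (\<lambda>j. f j (x j)) {..<n} = \<one>\<^bsub>R\<^esub>)"

text \<open>A preimage of 1 under an epimorphism from the n-th power is cut into its n coordinates;
  the restrictions of the epimorphism to the factors are the functionals.\<close>

lemma generator_trace_one:
  assumes "generator_module R M"
  shows "trace_one R M"
proof -
  have lm: "left_module R M" using assms by (simp add: generator_module_def)
  interpret M: left_module R M by fact
  obtain n :: nat and F where F: "F \<in> lin_maps R (direct_sum {..<n} (\<lambda>_. M)) (regular_module R)"
    "F ` carrier (direct_sum {..<n} (\<lambda>_. M)) = carrier R" using assms by (auto simp: generator_module_def)
  let ?S = "direct_sum {..<n} (\<lambda>_. M)"
  interpret S: left_module R ?S by (rule left_module_direct_sum[OF M.R.ring_axioms lm])
  note F' = lin_mapsD[OF F(1)]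
  obtain x where x: "x \<in> carrier ?S" "F x = \<one>\<^bsub>R\<^esub>"
  proof -
    have "\<one>\<^bsub>R\<^esub> \<in> F ` carrier ?S" using F(2) by simp
    then show thesis using that by (force simp del: direct_sum_simps)
  qed
  define \<iota> where "\<iota> j m = (\<lambda>k\<in>{..<n}. if k = j then m else \<zero>\<^bsub>M\<^esub>)" for j and m
  have \<iota>: "\<iota> j m \<in> carrier ?S" if "m \<in> carrier M" for j m using that by (auto simp: \<iota>_def)
  define f where "f j = (\<lambda>m\<in>carrier M. F (\<iota> j m))" for j
  have f: "f j \<in> lin_maps R M (regular_module R)" for j
    unfolding f_def
  proof (rule lin_mapsI[OF lm])
    fix m m' assume m: "m \<in> carrier M" "m' \<in> carrier M"
    have "\<iota> j (m \<oplus>\<^bsub>M\<^esub> m') = \<iota> j m \<oplus>\<^bsub>?S\<^esub> \<iota> j m'" using m by (auto simp: \<iota>_def)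
    then show "F (\<iota> j (m \<oplus>\<^bsub>M\<^esub> m')) = F (\<iota> j m) \<oplus>\<^bsub>regular_module R\<^esub> F (\<iota> j m')"
      using F'(2) \<iota> m by (simp del: direct_sum_simps)
  next
    fix a m assume m: "a \<in> carrier R" "m \<in> carrier M"
    have "\<iota> j (a \<odot>\<^bsub>M\<^esub> m) = a \<odot>\<^bsub>?S\<^esub> \<iota> j m" using m by (auto simp: \<iota>_def M.smult_r_null)
    then show "F (\<iota> j (a \<odot>\<^bsub>M\<^esub> m)) = a \<odot>\<^bsub>regular_module R\<^esub> F (\<iota> j m)"
      using F'(3) \<iota> m by (simp del: direct_sum_simps)
  qed (use F'(1) \<iota> in \<open>auto simp del: direct_sum_simps\<close>)
  have xj: "x j \<in> carrier M" if "j < n" for j using x that by auto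
  have "x = finsum ?S (\<lambda>j. \<iota> j (x j)) {..<n}"
  proof (rule PiE_ext[of _ "{..<n}" "\<lambda>_. carrier M"])
    show "x \<in> (\<Pi>\<^sub>E i\<in>{..<n}. carrier M)" using x by simp
    have "finsum ?S (\<lambda>j. \<iota> j (x j)) {..<n} \<in> carrier ?S"
      by (rule S.M.finsum_closed) (use \<iota> xj in \<open>auto simp del: direct_sum_simps\<close>)
    then show "finsum ?S (\<lambda>j. \<iota> j (x j)) {..<n} \<in> (\<Pi>\<^sub>E i\<in>{..<n}. carrier M)" by simp
    fix k assume k: "k \<in> {..<n}"
    have "finsum ?S (\<lambda>j. \<iota> j (x j)) {..<n} k = finsum M (\<lambda>j. \<iota> j (x j) k) {..<n}"
      by (rule finsum_direct_sum[OF S.left_module_axioms lm]) (use k xj \<iota> in \<open>auto simp del: direct_sum_simps\<close>)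
    also have "\<dots> = \<iota> k (x k) k"
      by (rule M.M.finsum_single) (use k xj in \<open>auto simp: \<iota>_def\<close>)
    finally show "x k = finsum ?S (\<lambda>j. \<iota> j (x j)) {..<n} k" using k by (simp add: \<iota>_def)
  qed
  then have "\<one>\<^bsub>R\<^esub> = F (finsum ?S (\<lambda>j. \<iota> j (x j)) {..<n})" using x by simp
  also have "\<dots> = finsum R (\<lambda>j. F (\<iota> j (x j))) {..<n}"
    by (rule additive_map_finsum[OF S.M.abelian_group_axioms M.R.abelian_group_axioms])
      (use F' \<iota> xj in \<open>auto simp: additive_map_def simp del: direct_sum_simps\<close>)
  also have "\<dots> = finsum R (\<lambda>j. f j (x j)) {..<n}"
    by (rule M.R.finsum_cong') (use F'(1) f \<iota> xj lin_mapsD(1)[OF f] in \<open>auto simp: f_def simp del: direct_sum_simps\<close>)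
  finally show ?thesis unfolding trace_one_def using f xj
    by (intro exI[of _ n] exI[of _ f] exI[of _ x]) simp
qed

text \<open>The functionals add up to a map on the n-th power, and \<open>r\<close> is the image of
  the tuple with entries \<open>r\<close> times \<open>x j\<close>.\<close>

lemma trace_one_generator:
  assumes lm: "left_module R M" and "trace_one R M"
  shows "generator_module R M"
proof -
  interpret M: left_module R M by fact
  obtain n :: nat and f x where f: "\<And>j. j < n \<Longrightarrow> f j \<in> lin_maps R M (regular_module R)"
    and x: "\<And>j. j < n \<Longrightarrow> x j \<in> carrier M" and 1: "finsum R (\<lambda>j. f j (x j)) {..<n} = \<one>\<^bsub>R\<^esub>"
    using assms(2) unfolding trace_one_def by blast
  let ?S = "direct_sum {..<n} (\<lambda>_. M)"
  interpret S: left_module R ?S by (rule left_module_direct_sum[OF M.R.ring_axioms lm])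
  define F where "F y = finsum R (\<lambda>j. f j (y j)) {..<n}" for y
  have y: "y j \<in> carrier M" if "y \<in> carrier ?S" "j < n" for y j using that by auto
  note f' = lin_mapsD[OF f, simplified]
  have F: "restrict F (carrier ?S) \<in> lin_maps R ?S (regular_module R)"
  proof (rule lin_mapsI[OF S.left_module_axioms])
    fix u v assume u: "u \<in> carrier ?S" and v: "v \<in> carrier ?S"
    have "F (u \<oplus>\<^bsub>?S\<^esub> v) = finsum R (\<lambda>j. f j (u j) \<oplus>\<^bsub>R\<^esub> f j (v j)) {..<n}"
      unfolding F_def using y[OF u] y[OF v] f' by (intro M.R.finsum_cong') auto
    then show "F (u \<oplus>\<^bsub>?S\<^esub> v) = F u \<oplus>\<^bsub>regular_module R\<^esub> F v"
      unfolding F_def using y[OF u] y[OF v] f' by (subst (asm) M.R.finsum_addf) auto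
  next
    fix a u assume a: "a \<in> carrier R" and u: "u \<in> carrier ?S"
    have "F (a \<odot>\<^bsub>?S\<^esub> u) = finsum R (\<lambda>j. a \<otimes>\<^bsub>R\<^esub> f j (u j)) {..<n}"
      unfolding F_def using y[OF u] a f' by (intro M.R.finsum_cong') auto
    then show "F (a \<odot>\<^bsub>?S\<^esub> u) = a \<odot>\<^bsub>regular_module R\<^esub> F u"
      unfolding F_def using y[OF u] a f' by (subst (asm) M.R.finsum_rdistr[symmetric]) auto
  qed (use f' y in \<open>auto simp: F_def intro!: M.R.finsum_closed simp del: direct_sum_simps\<close>)
  have "r \<in> restrict F (carrier ?S) ` carrier ?S" if r: "r \<in> carrier R" for r
  proof (rule image_eqI)
    let ?y = "\<lambda>j\<in>{..<n}. r \<odot>\<^bsub>M\<^esub> x j"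
    show yS: "?y \<in> carrier ?S" using x r by (auto simp: M.smult_closed)
    have "F ?y = finsum R (\<lambda>j. r \<otimes>\<^bsub>R\<^esub> f j (x j)) {..<n}"
      unfolding F_def using x r f' by (intro M.R.finsum_cong') auto
    also have "\<dots> = r" using x r f' 1 by (subst M.R.finsum_rdistr[symmetric]) auto
    finally show "r = restrict F (carrier ?S) ?y" using yS by simp
  qed
  then have "restrict F (carrier ?S) ` carrier ?S = carrier R"
    using lin_mapsD(1)[OF F] unfolding regular_module_simps by blast
  then show ?thesis unfolding generator_module_def using lm F by blast
qed

lemma progeneratorI:
  fixes I :: "'b set" and M :: "('a, 'b, 'm) module_scheme"
  assumes "left_module R M" "dual_basis R M I p \<phi>" "trace_one R M"
  shows "progenerator R M"
  unfolding progenerator_def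
  using dual_basis_fin_gen[OF assms(1,2)] dual_basis_projective[OF assms(1,2)] trace_one_generator[OF assms(1,3)] by blast

section \<open>Semiperfect rings\<close>

lemma left_ideal_iff:
  assumes "ring R"
  shows "left_ideal L R \<longleftrightarrow> L \<subseteq> carrier R \<and> \<zero>\<^bsub>R\<^esub> \<in> L \<and> (\<forall>x\<in>L. \<forall>y\<in>L. x \<oplus>\<^bsub>R\<^esub> y \<in> L) \<and>
    (\<forall>a\<in>carrier R. \<forall>x\<in>L. a \<otimes>\<^bsub>R\<^esub> x \<in> L)"
proof -
  interpret M: left_module R "regular_module R" by (rule left_module_regular[OF assms])
  show ?thesis unfolding left_ideal_def
    by (rule iffI) (use M.submoduleD in force, use M.submoduleI[of L] in auto)
qed

section \<open>Maximal left ideals and the Jacobson radical\<close>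

context ring
begin

lemma add_diff: "x \<in> carrier R \<Longrightarrow> y \<in> carrier R \<Longrightarrow> y \<oplus> (x \<ominus> y) = x"
  by (simp add: a_minus_def a_comm[of x] r_neg2)

lemma diff_diff: "x \<in> carrier R \<Longrightarrow> y \<in> carrier R \<Longrightarrow> x \<ominus> (x \<ominus> y) = y"
  by (simp add: a_minus_def minus_add r_neg2)

lemma left_idealD:
  assumes "left_ideal L R"
  shows "L \<subseteq> carrier R" "\<zero> \<in> L" "x \<in> L \<Longrightarrow> y \<in> L \<Longrightarrow> x \<oplus> y \<in> L" "a \<in> carrier R \<Longrightarrow> x \<in> L \<Longrightarrow> a \<otimes> x \<in> L"
    and "x \<in> L \<Longrightarrow> \<ominus> x \<in> L" "x \<in> L \<Longrightarrow> y \<in> L \<Longrightarrow> x \<ominus> y \<in> L"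
proof -
  note * = assms[unfolded left_ideal_iff[OF ring_axioms]]
  show 1: "L \<subseteq> carrier R" "\<zero> \<in> L" "x \<in> L \<Longrightarrow> y \<in> L \<Longrightarrow> x \<oplus> y \<in> L" "a \<in> carrier R \<Longrightarrow> x \<in> L \<Longrightarrow> a \<otimes> x \<in> L"
    for x y a using * by auto
  show 2: "\<ominus> x \<in> L" if "x \<in> L" for x
  proof -
    have "(\<ominus> \<one>) \<otimes> x = \<ominus> x" using 1(1) that l_minus[of \<one> x] by auto
    then show ?thesis using 1(4)[of "\<ominus> \<one>" x] that by simp
  qed
  show "x \<in> L \<Longrightarrow> y \<in> L \<Longrightarrow> x \<ominus> y \<in> L" using 1(3)[of x "\<ominus> y"] 2[of y] by (simp add: a_minus_def)
qed

lemma left_idealI: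
  assumes "L \<subseteq> carrier R" "\<zero> \<in> L" "\<And>x y. x \<in> L \<Longrightarrow> y \<in> L \<Longrightarrow> x \<oplus> y \<in> L"
    and "\<And>a x. a \<in> carrier R \<Longrightarrow> x \<in> L \<Longrightarrow> a \<otimes> x \<in> L"
  shows "left_ideal L R"
  using assms by (simp add: left_ideal_iff[OF ring_axioms])

text \<open>This is Ra + L, the enlargement behind all later arguments by maximality or by
  complements.\<close>

lemma left_ideal_add:
  assumes "left_ideal L R" "a \<in> carrier R"
  defines "K \<equiv> {r \<otimes> a \<oplus> x | r x. r \<in> carrier R \<and> x \<in> L}"
  shows "left_ideal K R" and "L \<subseteq> K" and "a \<in> K"
proof -
  note L = left_idealD[OF assms(1)]
  show "left_ideal K R"
  proof (rule left_idealI)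
    show "K \<subseteq> carrier R" unfolding K_def using L assms(2) by auto
    have "\<zero> = \<zero> \<otimes> a \<oplus> \<zero>" using assms(2) by simp
    then show "\<zero> \<in> K" unfolding K_def using L(2) zero_closed by blast
  next
    fix x y assume "x \<in> K" "y \<in> K"
    then obtain r u s v where *: "r \<in> carrier R" "u \<in> L" "x = r \<otimes> a \<oplus> u" "s \<in> carrier R" "v \<in> L" "y = s \<otimes> a \<oplus> v"
      unfolding K_def by blast
    then have "x \<oplus> y = (r \<oplus> s) \<otimes> a \<oplus> (u \<oplus> v)" using assms(2) L(1) by (auto simp: l_distr a_ac subset_iff)
    then show "x \<oplus> y \<in> K" unfolding K_def using * L(3) by blast
  next
    fix b x assume b: "b \<in> carrier R" and "x \<in> K"
    then obtain r u where *: "r \<in> carrier R" "u \<in> L" "x = r \<otimes> a \<oplus> u" unfolding K_def by blast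
    then have "b \<otimes> x = (b \<otimes> r) \<otimes> a \<oplus> b \<otimes> u" using assms(2) L(1) b by (auto simp: r_distr m_assoc subset_iff)
    then show "b \<otimes> x \<in> K" unfolding K_def using * b L(4) by blast
  qed
  show "L \<subseteq> K"
  proof
    fix x assume x: "x \<in> L"
    then have "x = \<zero> \<otimes> a \<oplus> x" using L(1) assms(2) by auto
    then show "x \<in> K" unfolding K_def using x zero_closed by blast
  qed
  have "a = \<one> \<otimes> a \<oplus> \<zero>" using assms(2) by simp
  then show "a \<in> K" unfolding K_def using L(2) one_closed by blast
qed

text \<open>Zorn's lemma is applied to left ideals that omit 1, a condition that visibly passes to
  unions of chains.\<close>

lemma maximal_left_ideal_exists:
  assumes "left_ideal L R" "\<one> \<notin> L"
  obtains K where "maximal_left_ideal K R" "L \<subseteq> K"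
proof -
  let ?A = "{K. left_ideal K R \<and> L \<subseteq> K \<and> \<one> \<notin> K}"
  have "\<exists>M\<in>?A. \<forall>X\<in>?A. M \<subseteq> X \<longrightarrow> X = M"
  proof (rule subset_Zorn_nonempty)
    show "?A \<noteq> {}" using assms by blast
    fix C assume C: "C \<noteq> {}" "subset.chain ?A C"
    then have CA: "C \<subseteq> ?A" and ch: "\<And>X Y. X \<in> C \<Longrightarrow> Y \<in> C \<Longrightarrow> X \<subseteq> Y \<or> Y \<subseteq> X"
      by (auto simp: subset_chain_def)
    have "left_ideal (\<Union>C) R"
    proof (rule left_idealI)
      show "\<Union>C \<subseteq> carrier R" using CA left_idealD(1) by blast
      show "\<zero> \<in> \<Union>C" using CA C(1) left_idealD(2) by blast
    next
      fix x y assume "x \<in> \<Union>C" "y \<in> \<Union>C"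
      then obtain X where "X \<in> C" "x \<in> X" "y \<in> X" using ch by blast
      then show "x \<oplus> y \<in> \<Union>C" using CA left_idealD(3) by blast
    next
      fix a x assume "a \<in> carrier R" "x \<in> \<Union>C"
      then show "a \<otimes> x \<in> \<Union>C" using CA left_idealD(4) by blast
    qed
    then show "\<Union>C \<in> ?A" using C CA by blast
  qed
  then obtain K where K': "K \<in> ?A" "\<forall>X\<in>?A. K \<subseteq> X \<longrightarrow> X = K" by (rule bexE)
  then have K: "left_ideal K R" "L \<subseteq> K" "\<one> \<notin> K" by simp_all
  have max: "X = K" if "left_ideal X R" "K \<subseteq> X" "\<one> \<notin> X" for X
    using K'(2)[THEN bspec, of X, THEN mp] that K by auto
  have "X = K \<or> X = carrier R" if X: "left_ideal X R" "K \<subseteq> X" for X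
  proof (cases "\<one> \<in> X")
    case True
    then have "x \<in> X" if "x \<in> carrier R" for x using left_idealD(4)[OF X(1) that True] that by simp
    then show ?thesis using left_idealD(1)[OF X(1)] by blast
  qed (use max X in blast)
  then have "maximal_left_ideal K R" using K by (auto simp: maximal_left_ideal_def)
  then show thesis using K that by blast
qed

abbreviation "J \<equiv> jacobson_radical R"

lemma jacobson_left_ideal: "left_ideal J R"
proof (rule left_idealI)
  have L: "\<And>L. maximal_left_ideal L R \<Longrightarrow> left_ideal L R" by (simp add: maximal_left_ideal_def)
  show "J \<subseteq> carrier R" "\<zero> \<in> J" using left_idealD(2)[OF L] by (auto simp: jacobson_radical_def)
  show "x \<oplus> y \<in> J" if "x \<in> J" "y \<in> J" for x y
    using that left_idealD(3)[OF L] by (auto simp: jacobson_radical_def)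
  show "a \<otimes> x \<in> J" if "a \<in> carrier R" "x \<in> J" for a x
    using that left_idealD(4)[OF L] by (auto simp: jacobson_radical_def)
qed

lemmas J = left_idealD[OF jacobson_left_ideal]

lemma J_closed [simp]: "x \<in> J \<Longrightarrow> x \<in> carrier R"
  using J(1) by blast

text \<open>The radical is defined by maximal left ideals, so closure on the right needs an
  argument. If a maximal left ideal \<open>L\<close> omits \<open>x \<otimes> r\<close>, the
  elements that right multiplication by \<open>r\<close> carries into \<open>L\<close> again form a
  maximal left ideal, and this one omits \<open>x\<close>.\<close>

lemma J_right:
  assumes "x \<in> J" "r \<in> carrier R"
  shows "x \<otimes> r \<in> J"
proof -
  have "x \<otimes> r \<in> L" if mL: "maximal_left_ideal L R" for L
  proof (rule ccontr)
    assume n: "x \<otimes> r \<notin> L"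
    have Li: "left_ideal L R" using mL by (simp add: maximal_left_ideal_def)
    note L = left_idealD[OF Li]
    let ?K = "{y \<in> carrier R. y \<otimes> r \<in> L}"
    have K: "left_ideal ?K R"
      by (rule left_idealI) (use L assms(2) in \<open>auto simp: l_distr m_assoc\<close>)
    have "maximal_left_ideal ?K R" unfolding maximal_left_ideal_def
    proof (intro conjI K allI impI)
      show "?K \<noteq> carrier R" using n assms J_closed by blast
      fix K' assume K': "left_ideal K' R \<and> ?K \<subseteq> K'"
      show "K' = ?K \<or> K' = carrier R"
      proof (cases "K' \<subseteq> ?K")
        case False
        then obtain y where y: "y \<in> K'" "y \<otimes> r \<notin> L" "y \<in> carrier R" using left_idealD(1) K' by blast
        let ?L' = "{s \<otimes> (y \<otimes> r) \<oplus> z | s z. s \<in> carrier R \<and> z \<in> L}"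
        note L' = left_ideal_add[OF Li, of "y \<otimes> r"]
        \<comment> \<open>Maximality makes R(yr) + L the whole ring. Writing zr as s(yr) + w puts z
          - sy into \<open>?K\<close>, and hence z into \<open>K'\<close>.\<close>
        have "?L' = carrier R" using mL L' y assms(2) unfolding maximal_left_ideal_def by blast
        then have "z \<in> K'" if z: "z \<in> carrier R" for z
        proof -
          have "z \<otimes> r \<in> ?L'" using \<open>?L' = carrier R\<close> z assms(2) by simp
          then obtain s w where sw: "s \<in> carrier R" "w \<in> L" "z \<otimes> r = s \<otimes> (y \<otimes> r) \<oplus> w" by blast
          have wc: "w \<in> carrier R" using sw L(1) by blast
          have "(z \<ominus> s \<otimes> y) \<otimes> r = z \<otimes> r \<ominus> s \<otimes> (y \<otimes> r)"
            using z sw(1) y assms(2) by (simp add: a_minus_def l_distr l_minus m_assoc)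
          also have "\<dots> = w" using sw y wc assms(2) by (simp add: a_minus_def a_ac r_neg r_neg1)
          finally have "z \<ominus> s \<otimes> y \<in> ?K" using sw z y by auto
          then have "z \<ominus> s \<otimes> y \<in> K'" using K' by blast
          moreover have "s \<otimes> y \<in> K'" using K' y sw left_idealD(4) by blast
          ultimately have "(z \<ominus> s \<otimes> y) \<oplus> s \<otimes> y \<in> K'" using K' left_idealD(3) by blast
          moreover have "(z \<ominus> s \<otimes> y) \<oplus> s \<otimes> y = z" using z sw(1) y(3) by (simp add: a_minus_def a_assoc l_neg)
          ultimately show ?thesis by simp
        qed
        then show ?thesis using K' left_idealD(1) by blast
      qed (use K' in blast)
    qed
    then have "x \<in> ?K" using assms(1) unfolding jacobson_radical_def by blast
    then show False using n by simp
  qed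
  then show ?thesis unfolding jacobson_radical_def using J_closed[OF assms(1)] assms(2)
    by (intro CollectI conjI allI impI m_closed)
qed

text \<open>No maximal left ideal contains 1 + j, which gives a left inverse \<open>v\<close>. Since
  \<open>v\<close> is again 1 plus a radical element, it has a left inverse too, and this must be 1
  + j.\<close>

lemma J_unit:
  assumes "j \<in> J"
  obtains v where "v \<in> carrier R" "v \<otimes> (\<one> \<oplus> j) = \<one>" "(\<one> \<oplus> j) \<otimes> v = \<one>"
proof -
  have left: "\<exists>v\<in>carrier R. v \<otimes> (\<one> \<oplus> j) = \<one>" if j: "j \<in> J" for j
  proof (rule ccontr)
    assume n: "\<not> ?thesis"
    have z: "left_ideal {\<zero>} R" by (rule left_idealI) auto
    have c: "\<one> \<oplus> j \<in> carrier R" using j by simp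
    note L = left_ideal_add[OF z c]
    have "\<one> \<notin> {r \<otimes> (\<one> \<oplus> j) \<oplus> x |r x. r \<in> carrier R \<and> x \<in> {\<zero>}}" using n c by auto
    from maximal_left_ideal_exists[OF L(1) this] obtain K where K: "maximal_left_ideal K R" "\<one> \<oplus> j \<in> K"
      using L(3) by blast
    then have Ki: "left_ideal K R" and jK: "j \<in> K" using j unfolding maximal_left_ideal_def jacobson_radical_def by blast+
    have "\<one> \<oplus> j \<ominus> j \<in> K" using left_idealD(6)[OF Ki K(2) jK] .
    moreover have "\<one> \<oplus> j \<ominus> j = \<one>" using j by (simp add: a_minus_def a_assoc r_neg)
    ultimately have "\<one> \<in> K" by simp
    then have "carrier R \<subseteq> K" using left_idealD(4)[OF Ki] by (metis r_one subsetI)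
    then show False using K(1) left_idealD(1)[OF Ki] by (auto simp: maximal_left_ideal_def)
  qed
  from left[OF assms] obtain v where v: "v \<in> carrier R" "v \<otimes> (\<one> \<oplus> j) = \<one>" by blast
  have "v \<oplus> v \<otimes> j = \<one>" using v assms by (simp add: r_distr)
  then have "v = \<one> \<oplus> \<ominus> (v \<otimes> j)" using v assms by (metis J_closed add.inv_solve_right m_closed one_closed)
  moreover have "\<ominus> (v \<otimes> j) \<in> J" using J v assms by blast
  ultimately obtain w where w: "w \<in> carrier R" "w \<otimes> v = \<one>" using left by metis
  have "w = w \<otimes> (v \<otimes> (\<one> \<oplus> j))" using v w assms by simp
  also have "\<dots> = \<one> \<oplus> j" using v w assms by (subst m_assoc[symmetric]) auto
  finally show thesis using that v w by blast
qed

text \<open>The unit 1 - f annihilates \<open>f\<close>.\<close>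

lemma J_idempotent:
  assumes "f \<in> J" "f \<otimes> f = f"
  shows "f = \<zero>"
proof -
  have "\<ominus> f \<in> J" using J assms by blast
  then obtain v where v: "v \<in> carrier R" "v \<otimes> (\<one> \<oplus> \<ominus> f) = \<one>" using J_unit by metis
  have "(\<one> \<oplus> \<ominus> f) \<otimes> f = \<zero>" using assms by (simp add: l_distr l_minus r_neg)
  then have "v \<otimes> ((\<one> \<oplus> \<ominus> f) \<otimes> f) = \<zero>" using v by simp
  then have "v \<otimes> (\<one> \<oplus> \<ominus> f) \<otimes> f = \<zero>" using v(1) assms(1) by (subst m_assoc) auto
  then show ?thesis unfolding v(2) using assms by simp
qed

end

section \<open>Lifting idempotents, local corners and primitive decompositions of 1\<close>

locale semiperfect = ring R for R (structure) +
  assumes semiperfect: "semiperfect_ring R"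
begin

lemma carrier_Quot_J: "carrier (R Quot J) = a_rcosets J"
  by (simp add: FactRing_def)

lemma J_ideal: "ideal J R"
  by (rule idealI[OF ring_axioms])
    (use J J_right in \<open>auto intro!: additive_subgroup.a_subgroup additive_subgroupI' abelian_group_axioms\<close>)

text \<open>Semisimplicity of R/J, pulled back to left ideals of \<open>R\<close> that contain the
  radical. Later arguments then compute with elements of \<open>R\<close> modulo \<open>J\<close>
  and never with cosets.\<close>

lemma J_complement:
  assumes "left_ideal L R" "J \<subseteq> L"
  obtains L' where "left_ideal L' R" "J \<subseteq> L'" "L \<inter> L' = J" "\<And>x. x \<in> carrier R \<Longrightarrow> \<exists>u\<in>L. \<exists>v\<in>L'. x = u \<oplus> v"
proof -
  let ?Q = "R Quot J" and ?c = "\<lambda>x. J +> x"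
  interpret J: ideal J R by (rule J_ideal)
  interpret Q: ring ?Q by (rule J.quotient_is_ring)
  interpret h: ring_hom_ring R ?Q ?c by (rule J.rcos_ring_hom_ring)
  note L = left_idealD[OF assms(1)]
  have surj: "\<exists>x\<in>carrier R. X = ?c x" if "X \<in> carrier ?Q" for X
  proof -
    have "X \<in> a_rcosets J" using that unfolding carrier_Quot_J .
    then show ?thesis unfolding A_RCOSETS_def' by blast
  qed
  have eq: "?c x = ?c y \<longleftrightarrow> x \<ominus> y \<in> J" if "x \<in> carrier R" "y \<in> carrier R" for x y
    using quotient_eq_iff_same_a_r_cos[OF J_ideal that] by simp
  have q: "left_ideal (?c ` L) ?Q" unfolding left_ideal_iff[OF Q.ring_axioms]
  proof (intro conjI ballI)
    show "?c ` L \<subseteq> carrier ?Q" using L(1) h.hom_closed by blast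
    show "\<zero>\<^bsub>?Q\<^esub> \<in> ?c ` L" using L(2) h.hom_zero by (metis imageI)
    show "x \<oplus>\<^bsub>?Q\<^esub> y \<in> ?c ` L" if "x \<in> ?c ` L" "y \<in> ?c ` L" for x y
      using that L h.hom_add by (smt (verit) imageE imageI subsetD)
    show "x \<otimes>\<^bsub>?Q\<^esub> y \<in> ?c ` L" if "x \<in> carrier ?Q" "y \<in> ?c ` L" for x y
      using that L h.hom_mult surj by (smt (verit) imageE imageI subsetD)
  qed
  interpret M: left_module ?Q "regular_module ?Q" by (rule left_module_regular[OF Q.ring_axioms])
  obtain K where K: "internal_direct_sum2 ?Q (regular_module ?Q) (?c ` L) K"
    using semiperfect q unfolding semiperfect_ring_def semisimple_ring_def by blast
  then have Ki: "left_ideal K ?Q" and cap: "?c ` L \<inter> K = {\<zero>\<^bsub>?Q\<^esub>}"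
    and sum: "carrier ?Q = {u \<oplus>\<^bsub>?Q\<^esub> v | u v. u \<in> ?c ` L \<and> v \<in> K}"
    by (auto simp: internal_direct_sum2_def left_ideal_def)
  note K = Q.left_idealD[OF Ki]
  let ?L' = "{x \<in> carrier R. ?c x \<in> K}"
  have z: "?c x = \<zero>\<^bsub>?Q\<^esub> \<longleftrightarrow> x \<in> J" if "x \<in> carrier R" for x
    using eq[OF that zero_closed] that h.hom_zero by (simp add: a_minus_def)
  have 1: "left_ideal ?L' R"
  proof (rule left_idealI)
    show "\<zero> \<in> ?L'" using K(2) h.hom_zero zero_closed by (simp del: h.hom_zero)
    show "x \<oplus> y \<in> ?L'" if "x \<in> ?L'" "y \<in> ?L'" for x y
      using that K(3)[of "?c x" "?c y"] h.hom_add[of x y] a_closed[of x y] by simp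
    show "a \<otimes> x \<in> ?L'" if "a \<in> carrier R" "x \<in> ?L'" for a x
      using that K(4)[of "?c a" "?c x"] h.hom_mult[of a x] m_closed[of a x] h.hom_closed[of a] by simp
  qed blast
  have 2: "J \<subseteq> ?L'"
  proof
    fix x assume "x \<in> J"
    then have "x \<in> carrier R" "?c x = \<zero>\<^bsub>?Q\<^esub>" using z J_closed by blast+
    then show "x \<in> ?L'" using K(2) by simp
  qed
  have 3: "L \<inter> ?L' = J"
  proof
    show "J \<subseteq> L \<inter> ?L'" using 2 assms(2) by blast
    show "L \<inter> ?L' \<subseteq> J"
    proof
      fix x assume "x \<in> L \<inter> ?L'"
      then have x: "x \<in> carrier R" "?c x \<in> ?c ` L" "?c x \<in> K" by simp_all
      then have "?c x = \<zero>\<^bsub>?Q\<^esub>" using cap by (metis IntI singletonD)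
      then show "x \<in> J" using z[OF x(1)] by (rule iffD1[rotated])
    qed
  qed
  have 4: "\<exists>u\<in>L. \<exists>v\<in>?L'. x = u \<oplus> v" if x: "x \<in> carrier R" for x
  proof -
    have "?c x \<in> carrier ?Q" using x h.hom_closed by blast
    then obtain u V where u: "u \<in> L" "V \<in> K" "?c x = ?c u \<oplus>\<^bsub>?Q\<^esub> V" unfolding sum by blast
    then obtain v where v: "v \<in> carrier R" "V = ?c v" using surj K(1) by blast
    have uc: "u \<in> carrier R" using u L by blast
    have "?c x = ?c (u \<oplus> v)" using u v uc h.hom_add by simp
    then have "x \<ominus> (u \<oplus> v) \<in> J" using eq[OF x a_closed[OF uc v(1)]] by (rule iffD1[rotated])
    moreover have "x = u \<oplus> (v \<oplus> (x \<ominus> (u \<oplus> v)))" 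
      using add_diff[OF x a_closed[OF uc v(1)]] a_assoc[OF uc v(1), of "x \<ominus> (u \<oplus> v)"] x uc v(1) by simp
    moreover have "v \<in> ?L'" using u v by simp
    ultimately show ?thesis using u(1) 2 left_idealD(3)[OF 1] by blast
  qed
  show thesis by (rule that[OF 1 2 3 4])
qed

text \<open>Semiperfectness lifts \<open>a\<close> to an idempotent \<open>f\<close> of
  \<open>R\<close>, not of eRe. Conjugating \<open>f\<close> by a unit congruent to 1 gives an
  idempotent fixed under right multiplication by \<open>e\<close>, and left multiplication by
  \<open>e\<close> then moves it into eRe.\<close>

lemma lift_idempotent_corner:
  assumes e: "e \<in> carrier R" "e \<otimes> e = e" and a: "a \<in> carrier R" "e \<otimes> a = a" "a \<otimes> e = a"
    and idem: "a \<otimes> a \<ominus> a \<in> J"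
  obtains g where "g \<in> carrier R" "g \<otimes> g = g" "e \<otimes> g = g" "g \<otimes> e = g" "g \<ominus> a \<in> J"
proof -
  obtain f where f: "f \<in> carrier R" "f \<otimes> f = f" "f \<ominus> a \<in> J"
    using semiperfect a(1) idem unfolding semiperfect_ring_def by blast
  define j where "j = f \<ominus> a"
  have j: "j \<in> J" "j \<in> carrier R" "f = a \<oplus> j"
    using f a unfolding j_def by (simp_all add: add_diff)
  have "f \<otimes> e \<oplus> \<ominus> f = j \<otimes> e \<oplus> \<ominus> j"
    unfolding j(3) using a(1,3) e j(2) by (simp add: l_distr minus_add a_ac r_neg1 r_neg2)
  then have fe: "f \<otimes> e \<oplus> \<ominus> f \<in> J" using J_right J j(1) e(1) by simp
  obtain v where v: "v \<in> carrier R" "v \<otimes> (\<one> \<oplus> (f \<otimes> e \<oplus> \<ominus> f)) = \<one>" "(\<one> \<oplus> (f \<otimes> e \<oplus> \<ominus> f)) \<otimes> v = \<one>"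
    using J_unit[OF fe] by blast
  \<comment> \<open>fe - f lies in the radical because ae = a, so u = 1 + fe - f is a unit. It is
    chosen for fu = fe, which makes the conjugate \<open>h\<close> of \<open>f\<close> end in
    \<open>e\<close>.\<close>
  define u where "u = \<one> \<oplus> (f \<otimes> e \<oplus> \<ominus> f)"
  have u: "u \<in> carrier R" unfolding u_def using f e by simp
  have vu: "v \<otimes> u = \<one>" and uv: "u \<otimes> v = \<one>" using v u_def by auto
  have fu: "f \<otimes> u = f \<otimes> e" unfolding u_def using f(1,2) e(1)
    by (simp add: r_distr r_minus m_assoc[symmetric] a_ac r_neg r_neg1 r_neg2)
  define h where "h = v \<otimes> f \<otimes> e"
  have h: "h \<in> carrier R" unfolding h_def using v f e by simp
  have hu: "h = v \<otimes> (f \<otimes> u)" unfolding h_def using fu v f e by (simp add: m_assoc)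
  have he: "h \<otimes> e = h" unfolding h_def using v f e by (simp add: m_assoc)
  have hh: "h \<otimes> h = h"
  proof -
    have "h \<otimes> h = v \<otimes> (f \<otimes> u) \<otimes> (v \<otimes> (f \<otimes> u))" using hu by simp
    also have "\<dots> = v \<otimes> (f \<otimes> ((u \<otimes> v) \<otimes> (f \<otimes> u)))" using v(1) f(1) u by (simp add: m_assoc)
    also have "\<dots> = v \<otimes> ((f \<otimes> f) \<otimes> u)" using v(1) f(1) u uv by (simp add: m_assoc)
    also have "\<dots> = h" using hu f(2) by simp
    finally show ?thesis .
  qed
  define g where "g = e \<otimes> h"
  have g: "g \<in> carrier R" unfolding g_def using h e by simp
  have "g \<otimes> g = e \<otimes> ((h \<otimes> e) \<otimes> h)" unfolding g_def using h e(1) by (simp add: m_assoc)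
  then have gg: "g \<otimes> g = g" unfolding g_def using he hh by simp
  have eg: "e \<otimes> g = g" unfolding g_def using e h by (simp add: m_assoc[symmetric])
  have ge: "g \<otimes> e = g" unfolding g_def using e h he by (simp add: m_assoc)
  have "g \<ominus> a \<in> J"
  proof -
    define k where "k = f \<otimes> e \<oplus> \<ominus> f"
    have k: "k \<in> J" "k \<in> carrier R" using fe by (auto simp: k_def)
    have "v \<oplus> v \<otimes> k = \<one>" using vu v(1) k unfolding u_def k_def[symmetric] by (simp add: r_distr)
    then have v1: "v = \<one> \<oplus> \<ominus> (v \<otimes> k)" using v(1) k(2) by (metis add.inv_solve_right m_closed one_closed)
    \<comment> \<open>\<open>v\<close> is 1 plus the radical element \<open>l\<close>; expanding e(1
      + l)(a + j)e leaves \<open>a\<close> and terms with a factor \<open>l\<close> or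
      \<open>j\<close>.\<close>
    define l where "l = \<ominus> (v \<otimes> k)"
    have l: "l \<in> J" "l \<in> carrier R" "v = \<one> \<oplus> l" using J k v(1) v1 unfolding l_def by auto
    have "g = e \<otimes> ((\<one> \<oplus> l) \<otimes> (a \<oplus> j) \<otimes> e)" unfolding g_def h_def l(3)[symmetric] j(3)[symmetric] ..
    also have "\<dots> = a \<oplus> (e \<otimes> j \<otimes> e \<oplus> (e \<otimes> l \<otimes> a \<oplus> e \<otimes> l \<otimes> j \<otimes> e))"
      using l(2) j(2) a e by (simp add: l_distr r_distr m_assoc a_ac)
    finally have "g \<ominus> a = e \<otimes> j \<otimes> e \<oplus> (e \<otimes> l \<otimes> a \<oplus> e \<otimes> l \<otimes> j \<otimes> e)"
      using l(2) j(2) a(1) e(1) by (simp add: a_minus_def a_ac r_neg1 r_neg2)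
    also have "\<dots> \<in> J"
      using J(3,4) J_right l(1,2) j(1,2) a(1) e(1) by (intro J(3) J_right J(4)) auto
    finally show ?thesis .
  qed
  then show thesis using that g gg eg ge by blast
qed

text \<open>This is the locality of eRe. A complement of Ra + J modulo \<open>J\<close> yields r
  with a - ara in the radical, so era is idempotent modulo \<open>J\<close>. It lifts to an
  idempotent of eRe, which is 0 or \<open>e\<close> by primitivity, and 0 would put \<open>a\<close>
  into the radical. Hence era is congruent to \<open>e\<close> and can be inverted.\<close>

lemma primitive_local:
  assumes e: "primitive_idempotent R e" and a: "a \<in> carrier R" "e \<otimes> a = a" "a \<otimes> e = a" "a \<notin> J"
  obtains y where "y \<in> carrier R" "e \<otimes> y = y" "y \<otimes> e = y" "y \<otimes> a = e"
proof -
  have ec: "e \<in> carrier R" and ee: "e \<otimes> e = e" using e by (auto simp: primitive_idempotent_def)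
  note L = left_ideal_add[OF jacobson_left_ideal a(1)]
  let ?L = "{r \<otimes> a \<oplus> x |r x. r \<in> carrier R \<and> x \<in> J}"
  obtain L' where L': "left_ideal L' R" "J \<subseteq> L'" "?L \<inter> L' = J"
    "\<And>x. x \<in> carrier R \<Longrightarrow> \<exists>u\<in>?L. \<exists>v\<in>L'. x = u \<oplus> v"
    by (rule J_complement[OF L(1,2)]) (rule that)
  note l' = left_idealD[OF L'(1)]
  obtain u v where u: "u \<in> ?L" and v: "v \<in> L'" and uv: "\<one> = u \<oplus> v" using L'(4)[OF one_closed] by blast
  obtain r j where r: "r \<in> carrier R" and j: "j \<in> J" and u': "u = r \<otimes> a \<oplus> j" using u by blast
  define w where "w = j \<oplus> v"
  have w: "w \<in> L'" "w \<in> carrier R" and rw: "\<one> = r \<otimes> a \<oplus> w"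
    using j v L'(2) l' uv u' r a(1) unfolding w_def by (auto simp: a_assoc subset_iff)
  have "a = a \<otimes> (r \<otimes> a \<oplus> w)" by (subst rw[symmetric]) (simp add: a(1))
  then have "a = a \<otimes> r \<otimes> a \<oplus> a \<otimes> w" using r w a(1) by (simp add: r_distr m_assoc)
  then have aw: "a \<otimes> w = a \<ominus> a \<otimes> r \<otimes> a"
    using r w a(1) by (metis a_minus_def add.inv_solve_left m_closed a_comm a_inv_closed)
  have "a \<otimes> w \<in> ?L"
    using left_idealD(6)[OF L(1) L(3) left_idealD(4)[OF L(1) _ L(3)], of "a \<otimes> r"] aw r a(1) by simp
  then have awJ: "a \<otimes> w \<in> J" using L'(3) l'(4)[OF a(1) w(1)] by blast
  define x where "x = e \<otimes> r \<otimes> a"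
  have x: "x \<in> carrier R" "e \<otimes> x = x" "x \<otimes> e = x"
    unfolding x_def using ec ee r a by (simp_all add: m_assoc[symmetric], simp add: m_assoc)
  have axa: "a \<otimes> x = a \<otimes> r \<otimes> a" unfolding x_def using ec r a by (simp add: m_assoc[symmetric])
  have "x \<otimes> x \<ominus> x = \<ominus> ((e \<otimes> r) \<otimes> (a \<otimes> w))"
  proof -
    have "x \<otimes> x = e \<otimes> r \<otimes> (a \<otimes> x)" using x_def ec r a(1) by (simp add: m_assoc)
    then have "x \<otimes> x = e \<otimes> r \<otimes> (a \<otimes> r \<otimes> a)" using axa by simp
    then show ?thesis unfolding aw using ec r a(1)
      by (simp add: x_def a_minus_def r_distr r_minus minus_add m_assoc a_ac)
  qed
  then have "x \<otimes> x \<ominus> x \<in> J" using awJ J ec r by simp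
  then obtain g where g: "g \<in> carrier R" "g \<otimes> g = g" "e \<otimes> g = g" "g \<otimes> e = g" "g \<ominus> x \<in> J"
    using lift_idempotent_corner[OF ec ee x] by blast
  let ?f = "e \<ominus> g"
  have f: "?f \<in> carrier R" "?f \<otimes> ?f = ?f" "g \<otimes> ?f = \<zero>" "?f \<otimes> g = \<zero>" "e = g \<oplus> ?f"
    using ec ee g(1-4) by (auto simp: a_minus_def l_distr r_distr l_minus r_minus minus_add a_ac r_neg r_neg1 r_neg2)
  have "g = \<zero> \<or> ?f = \<zero>" using e f g unfolding primitive_idempotent_def by blast
  then have "g = \<zero> \<or> g = e" using minus_zero_iff ec g(1) by metis
  moreover have "g \<noteq> \<zero>"
  proof
    assume "g = \<zero>"
    then have "\<ominus> x \<in> J" using g(5) x by (simp add: a_minus_def)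
    then have "x \<in> J" using J(5)[of "\<ominus> x"] x by simp
    then have "a \<otimes> r \<otimes> a \<in> J" using J(4)[OF a(1)] axa by metis
    then have "a \<otimes> w \<oplus> a \<otimes> r \<otimes> a \<in> J" using awJ J by blast
    then show False using a(1,4) r unfolding aw by (simp add: a_minus_def a_assoc l_neg)
  qed
  ultimately have exJ: "e \<ominus> x \<in> J" using g(5) by auto
  define k where "k = e \<ominus> x"
  have k: "k \<in> J" "k \<in> carrier R" "x = e \<ominus> k" "k \<otimes> e = k"
    
    using exJ x ec ee unfolding k_def by (simp_all add: diff_diff) (simp add: a_minus_def l_distr l_minus)
  obtain v where v: "v \<in> carrier R" "v \<otimes> (\<one> \<oplus> \<ominus> k) = \<one>" using J_unit[OF J(5)[OF k(1)]] by blast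
  have "(\<one> \<oplus> \<ominus> k) \<otimes> e = x" using k ec by (simp add: l_distr l_minus a_minus_def)
  then have "v \<otimes> x = v \<otimes> (\<one> \<oplus> \<ominus> k) \<otimes> e" using v(1) k ec by (simp add: m_assoc)
  then have vx: "v \<otimes> x = e" using v ec by simp
  show thesis
  proof
    \<comment> \<open>\<open>v\<close> inverts 1 - k on the left and x = (1 - k)e, so vx = e; the
      extra factors \<open>e\<close> move the left inverse into the corner.\<close>
    let ?y = "e \<otimes> v \<otimes> e \<otimes> r \<otimes> e"
    show "?y \<in> carrier R" using ec v r by simp
    show "e \<otimes> ?y = ?y" using ec ee v r by (simp add: m_assoc[symmetric])
    show "?y \<otimes> e = ?y" using ec ee v r by (simp add: m_assoc)
    have "?y \<otimes> a = e \<otimes> (v \<otimes> (e \<otimes> r \<otimes> (e \<otimes> a)))" using ec v(1) r a(1) by (simp add: m_assoc)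
    then show "?y \<otimes> a = e" using a(2) vx x_def ee by simp
  qed
qed

lemma primitive_not_J: "primitive_idempotent R e \<Longrightarrow> e \<notin> J"
  using J_idempotent by (auto simp: primitive_idempotent_def)

text \<open>If 1 were no such sum, repeated splitting would give an infinite strictly descending
  chain of idempotents \<open>E n\<close>. The left ideals R(1 - E n) + J ascend, and a complement
  of their union modulo \<open>J\<close> forces the difference of two consecutive \<open>E n\<close>
  into the radical, which contains no nonzero idempotent. Only primitivity and the sum are recorded,
  since later arguments expand 1 and nothing else.\<close>

lemma one_sum_primitive:
  obtains n :: nat and f where "\<And>k. k < n \<Longrightarrow> primitive_idempotent R (f k)" "finsum R f {..<n} = \<one>"
proof -
  define good where "good x \<longleftrightarrow> (\<exists>(n::nat) f. (\<forall>k<n. primitive_idempotent R (f k)) \<and> finsum R f {..<n} = x)" for x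
  have good_add: "good (x \<oplus> y)" if "good x" "good y" for x y
  proof -
    obtain n f where f: "\<And>k. k < n \<Longrightarrow> primitive_idempotent R (f k)" "finsum R f {..<n::nat} = x"
      using \<open>good x\<close> unfolding good_def by blast
    obtain m g where g: "\<And>k. k < m \<Longrightarrow> primitive_idempotent R (g k)" "finsum R g {..<m::nat} = y"
      using \<open>good y\<close> unfolding good_def by blast
    have c: "\<And>k. k < n \<Longrightarrow> f k \<in> carrier R" "\<And>k. k < m \<Longrightarrow> g k \<in> carrier R"
      using f g by (auto simp: primitive_idempotent_def)
    let ?h = "\<lambda>k. if k < n then f k else g (k - n)"
    have "finsum R ?h ({..<n} \<union> {n..<n+m}) = finsum R ?h {..<n} \<oplus> finsum R ?h {n..<n+m}"
      by (rule finsum_Un_disjoint) (use c in auto)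
    moreover have "finsum R ?h {..<n} = x" unfolding f(2)[symmetric] by (rule finsum_cong') (use c in auto)
    moreover have "finsum R ?h ((\<lambda>k. k + n) ` {..<m}) = finsum R (\<lambda>k. ?h (k + n)) {..<m}"
      by (rule finsum_reindex) (use c in auto)
    moreover have "finsum R (\<lambda>k. ?h (k + n)) {..<m} = y" unfolding g(2)[symmetric] by (rule finsum_cong') (use c in auto)
    moreover have "(\<lambda>k. k + n) ` {..<m} = {n..<n+m}"
    proof (intro equalityI subsetI)
      fix i assume "i \<in> {n..<n+m}"
      then have "i = (i - n) + n" "i - n < m" by auto
      then show "i \<in> (\<lambda>k. k + n) ` {..<m}" by blast
    qed auto
    moreover have "{..<n} \<union> {n..<n+m} = {..<n+m}" by auto
    ultimately have "finsum R ?h {..<n+m} = x \<oplus> y" by simp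
    then show ?thesis unfolding good_def using f(1) g(1) by (intro exI[of _ "n+m"] exI[of _ ?h]) auto
  qed
  have good_zero: "good \<zero>" unfolding good_def by (rule exI[of _ 0]) auto
  have good_prim: "good x" if "primitive_idempotent R x" for x
  proof -
    have "x \<in> carrier R" using that by (simp add: primitive_idempotent_def)
    then show ?thesis unfolding good_def using that
      by (intro exI[of _ "1::nat"] exI[of _ "\<lambda>_. x"]) (simp add: lessThan_Suc)
  qed
  have "good \<one>"
  proof (rule ccontr)
    assume bad: "\<not> good \<one>"
    let ?P = "\<lambda>e. e \<in> carrier R \<and> e \<otimes> e = e \<and> \<not> good e"
    let ?Q = "\<lambda>e e'. e \<otimes> e' = e' \<and> e' \<otimes> e = e' \<and> e \<noteq> e'"
    have step: "\<exists>e'. ?P e' \<and> ?Q e e'" if e: "?P e" for e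
    proof -
      have "\<not> primitive_idempotent R e" "e \<noteq> \<zero>" using e good_prim good_zero by auto
      then obtain f f' where f: "f \<in> carrier R" "f' \<in> carrier R" "f \<otimes> f = f" "f' \<otimes> f' = f'"
        "f \<otimes> f' = \<zero>" "f' \<otimes> f = \<zero>" "e = f \<oplus> f'" "f \<noteq> \<zero>" "f' \<noteq> \<zero>"
        using e unfolding primitive_idempotent_def by blast
      have "\<not> good f \<or> \<not> good f'" using good_add f(7) e by blast
      moreover have "?Q e f" "?Q e f'" using f by (auto simp: l_distr r_distr)
      ultimately show ?thesis using f by blast
    qed
    \<comment> \<open>Of the two summands of a bad idempotent at least one is bad, so dependent
      choice continues the chain.\<close>
    obtain E :: "nat \<Rightarrow> 'a" where E: "\<And>n. ?P (E n)" "\<And>n. ?Q (E n) (E (Suc n))"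
      using dependent_nat_choice[of "\<lambda>_. ?P" "\<lambda>_. ?Q"] step bad by (metis l_one one_closed)
    have Ec: "E n \<in> carrier R" and EE: "E n \<otimes> E n = E n" for n using E(1) by auto
    have down: "E m \<otimes> E n = E n \<and> E n \<otimes> E m = E n" if "m \<le> n" for m n
      using that
    proof (induction rule: dec_induct)
      case base then show ?case using EE by simp
    next
      case (step n)
      have "E m \<otimes> E (Suc n) = E m \<otimes> (E n \<otimes> E (Suc n))" using E(2) by simp
      also have "\<dots> = E (Suc n)" using step.IH E(2) Ec by (metis m_assoc)
      finally have 1: "E m \<otimes> E (Suc n) = E (Suc n)" .
      have "E (Suc n) \<otimes> E m = E (Suc n) \<otimes> E n \<otimes> E m" using E(2) by simp
      also have "\<dots> = E (Suc n)" using step.IH E(2) Ec by (metis m_assoc)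
      finally show ?case using 1 by simp
    qed
    let ?d = "\<lambda>n. \<one> \<ominus> E n"
    have dc: "?d n \<in> carrier R" for n using Ec by simp
    have dd: "?d m \<otimes> ?d n = ?d m" if "m \<le> n" for m n
      using down[OF that] Ec by (simp add: a_minus_def l_distr r_distr l_minus r_minus minus_add a_ac r_neg r_neg1 r_neg2)
    let ?K = "\<lambda>n. {r \<otimes> ?d n \<oplus> x | r x. r \<in> carrier R \<and> x \<in> J}"
    note K = left_ideal_add[OF jacobson_left_ideal dc]
    have mono: "?K m \<subseteq> ?K n" if "m \<le> n" for m n
    proof -
      have "r \<otimes> ?d m \<oplus> x = (r \<otimes> ?d m) \<otimes> ?d n \<oplus> x" if "r \<in> carrier R" for r x
        using dd[OF \<open>m \<le> n\<close>] dc that by (simp add: m_assoc)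
      then show ?thesis using dc by blast
    qed
    let ?L = "\<Union>n. ?K n"
    have L: "left_ideal ?L R"
    proof (rule left_idealI)
      show "?L \<subseteq> carrier R" using left_idealD(1)[OF K(1)] by blast
      show "\<zero> \<in> ?L" using left_idealD(2)[OF K(1)] by blast
    next
      fix x y assume "x \<in> ?L" "y \<in> ?L"
      then obtain m n where "x \<in> ?K m" "y \<in> ?K n" by blast
      then have "x \<in> ?K (max m n)" "y \<in> ?K (max m n)" 
        using subsetD[OF mono[of m "max m n"]] subsetD[OF mono[of n "max m n"]] by (simp_all only: max.cobounded1 max.cobounded2)
      then have "x \<oplus> y \<in> ?K (max m n)" using left_idealD(3)[OF K(1)] by blast
      then show "x \<oplus> y \<in> ?L" by blast
    next
      fix a x assume "a \<in> carrier R" "x \<in> ?L"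
      then obtain n where "x \<in> ?K n" by blast
      then have "a \<otimes> x \<in> ?K n" using left_idealD(4)[OF K(1)] \<open>a \<in> carrier R\<close> by blast
      then show "a \<otimes> x \<in> ?L" by blast
    qed
    have "J \<subseteq> ?L" using K(2) by blast
    then obtain L' where L': "left_ideal L' R" "?L \<inter> L' = J" "\<And>x. x \<in> carrier R \<Longrightarrow> \<exists>u\<in>?L. \<exists>v\<in>L'. x = u \<oplus> v"
      by (rule J_complement[OF L]) (rule that)
    obtain u v where u: "u \<in> ?L" and v: "v \<in> L'" and uv: "\<one> = u \<oplus> v" using L'(3)[OF one_closed] by blast
    obtain n where un: "u \<in> ?K n" using u by blast
    have uc: "u \<in> carrier R" and vc: "v \<in> carrier R" using u v left_idealD(1)[OF L] left_idealD(1)[OF L'(1)] by blast+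
    \<comment> \<open>One step beyond \<open>n\<close>: \<open>E n\<close> is killed by 1 - E n, so
      \<open>u \<otimes> E n\<close> is in the radical, while the product of 1 - E (n+1) with
      \<open>E n\<close> is the difference of the two idempotents.\<close>
    let ?s = "Suc n"
    have ds: "?d ?s \<in> ?L" using K(3) by blast
    have dvu: "?d ?s \<otimes> v = ?d ?s \<ominus> ?d ?s \<otimes> u"
    proof -
      have "?d ?s = ?d ?s \<otimes> u \<oplus> ?d ?s \<otimes> v" using uv r_distr[OF uc vc dc] r_one[OF dc] by metis
      then show ?thesis using uc vc dc by (metis a_minus_def add.inv_solve_left m_closed a_comm a_inv_closed)
    qed
    have "?d ?s \<otimes> v \<in> ?L" unfolding dvu by (rule left_idealD(6)[OF L ds left_idealD(4)[OF L dc u]])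
    then have dv: "?d ?s \<otimes> v \<in> J" using left_idealD(4)[OF L'(1) dc v] L'(2) by blast
    obtain r j where r: "r \<in> carrier R" "j \<in> J" "u = r \<otimes> ?d n \<oplus> j" using un by blast
    have dE: "?d n \<otimes> E n = \<zero>" using Ec EE by (simp add: a_minus_def l_distr l_minus r_neg)
    have jc: "j \<in> carrier R" using r(2) by simp
    have "u \<otimes> E n = r \<otimes> ?d n \<otimes> E n \<oplus> j \<otimes> E n"
      unfolding r(3) using r(1) jc Ec[of n] dc[of n] by (intro l_distr m_closed)
    also have "r \<otimes> ?d n \<otimes> E n = \<zero>" using r(1) Ec[of n] dc[of n] dE by (subst m_assoc) simp_all
    finally have uE: "u \<otimes> E n = j \<otimes> E n" using jc Ec[of n] by simp
    have f: "?d ?s \<otimes> E n = E n \<ominus> E ?s" using down[of n ?s] Ec by (simp add: a_minus_def l_distr l_minus)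
    have "?d ?s \<otimes> E n = ?d ?s \<otimes> (u \<otimes> E n) \<oplus> ?d ?s \<otimes> v \<otimes> E n"
    proof -
      have "E n = (u \<oplus> v) \<otimes> E n" using uv Ec by (metis l_one)
      then have "E n = u \<otimes> E n \<oplus> v \<otimes> E n" using uc vc Ec by (simp add: l_distr)
      then have "?d ?s \<otimes> E n = ?d ?s \<otimes> (u \<otimes> E n \<oplus> v \<otimes> E n)" by simp
      then show ?thesis using uc vc Ec[of n] dc[of ?s] by (simp add: r_distr m_assoc)
    qed
    also have "\<dots> \<in> J" unfolding uE by (intro J(3) J_right J(4) dv r(2) Ec dc)
    finally have fJ: "E n \<ominus> E ?s \<in> J" using f by simp
    have "(E n \<ominus> E ?s) \<otimes> (E n \<ominus> E ?s) = E n \<ominus> E ?s"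
      using down[of n ?s] Ec EE by (simp add: a_minus_def l_distr r_distr l_minus r_minus minus_add a_ac r_neg r_neg1 r_neg2)
    then have "E n \<ominus> E ?s = \<zero>" using J_idempotent fJ by blast
    then show False using E(2)[of n] minus_zero_iff Ec by metis
  qed
  then show thesis using that unfolding good_def by blast
qed

end

section \<open>Tensor products\<close>

text \<open>The quotient of the free abelian group needs two abelian groups and actions that stay in
  the carriers; module laws enter with \<open>tensor_module\<close>.\<close>

locale tensor_product = X: abelian_group X + M: abelian_group M
  for R :: "('a, 'r) ring_scheme" and X :: "('a, 'b, 'm) bimodule_scheme"
    and M :: "('a, 'c, 'n) module_scheme" +
  assumes rsmult_closed: "x \<in> carrier X \<Longrightarrow> r \<in> carrier R \<Longrightarrow> rsmult X x r \<in> carrier X"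
    and smult_closed: "r \<in> carrier R \<Longrightarrow> m \<in> carrier M \<Longrightarrow> r \<odot>\<^bsub>M\<^esub> m \<in> carrier M"
begin

abbreviation "S \<equiv> carrier X \<times> carrier M"
abbreviation "K \<equiv> tensor_kernel R X M"
abbreviation "T \<equiv> tensor R X M"
abbreviation "pt \<equiv> pure_tensor R X M"
abbreviation "cos c \<equiv> K #>\<^bsub>free_Abelian_group S\<^esub> c"

lemma rels_keys: "c \<in> tensor_rels R X M \<Longrightarrow> Poly_Mapping.keys c \<subseteq> S"
  unfolding tensor_rels_def
  by (auto simp: rsmult_closed smult_closed dest!: subsetD[OF keys_diff])

lemma K_keys: "c \<in> K \<Longrightarrow> Poly_Mapping.keys c \<subseteq> S"
  unfolding tensor_kernel_def
proof (induction rule: generate.induct)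
  case (eng h1 h2)
  then show ?case using keys_add[of h1 h2] by auto
qed (use rels_keys in \<open>auto simp: rels_keys\<close>)

lemma K_zero: "0 \<in> K"
  using generate.one[of "free_Abelian_group S" "tensor_rels R X M"] by (simp add: tensor_kernel_def)

lemma K_incl: "c \<in> tensor_rels R X M \<Longrightarrow> c \<in> K"
  unfolding tensor_kernel_def by (rule generate.incl)

lemma K_add: "c \<in> K \<Longrightarrow> d \<in> K \<Longrightarrow> c + d \<in> K"
  using generate.eng[of c "free_Abelian_group S" "tensor_rels R X M" d] by (simp add: tensor_kernel_def)

text \<open>Inversion in \<open>free_Abelian_group\<close> is negation for elements supported in the
  index set, which is where \<open>rels_keys\<close> comes in.\<close>

lemma K_neg: "c \<in> K \<Longrightarrow> - c \<in> K"
proof -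
  have "c \<in> K \<Longrightarrow> - c \<in> K" for c
    unfolding tensor_kernel_def
  proof (induction rule: generate.induct)
    case one show ?case using generate.one[of "free_Abelian_group S" "tensor_rels R X M"] by simp
  next
    case (incl h)
    then show ?case using generate.inv[OF incl, of "free_Abelian_group S"] rels_keys by simp
  next
    case (inv h)
    then show ?case using generate.incl[OF inv, of "free_Abelian_group S"] rels_keys by simp
  next
    case (eng h1 h2)
    have "- (h1 + h2) = - h1 + - h2" by simp
    then show ?case using generate.eng[OF eng.IH] by simp
  qed
  then show "c \<in> K \<Longrightarrow> - c \<in> K" .
qed

lemma K_diff: "c \<in> K \<Longrightarrow> d \<in> K \<Longrightarrow> c - d \<in> K"
  using K_add[of c "- d"] K_neg[of d] by simp

lemma cos_eq: "cos c = (\<lambda>k. k + c) ` K"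
  by (auto simp: r_coset_def)

lemma cos_eq_iff: "cos c = cos d \<longleftrightarrow> c - d \<in> K"
proof
  assume "cos c = cos d"
  moreover have "0 + c \<in> cos c" unfolding cos_eq using K_zero by blast
  ultimately obtain k where "k \<in> K" "0 + c = k + d" unfolding cos_eq by auto
  then have "c - d = k" by simp
  then show "c - d \<in> K" using \<open>k \<in> K\<close> by simp
next
  assume k: "c - d \<in> K"
  show "cos c = cos d" unfolding cos_eq
  proof (intro equalityI subsetI)
    fix x assume "x \<in> (\<lambda>k. k + c) ` K"
    then obtain l where "l \<in> K" "x = l + c" by blast
    then have "x = (l + (c - d)) + d" by simp
    then show "x \<in> (\<lambda>k. k + d) ` K" using K_add[OF \<open>l \<in> K\<close> k] by blast
  next
    fix x assume "x \<in> (\<lambda>k. k + d) ` K"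
    then obtain l where "l \<in> K" "x = l + d" by blast
    then have "x = (l - (c - d)) + c" by simp
    then show "x \<in> (\<lambda>k. k + c) ` K" using K_diff[OF \<open>l \<in> K\<close> k] by blast
  qed
qed

lemma carrier_T: "carrier T = {cos c | c. Poly_Mapping.keys c \<subseteq> S}"
  by (auto simp: tensor_def FactGroup_def RCOSETS_def Let_def)

lemma cos_closed: "Poly_Mapping.keys c \<subseteq> S \<Longrightarrow> cos c \<in> carrier T"
  unfolding carrier_T by blast

lemma zero_T: "\<zero>\<^bsub>T\<^esub> = cos 0"
  by (simp add: tensor_def FactGroup_def Let_def cos_eq)

lemma add_T: "cos c \<oplus>\<^bsub>T\<^esub> cos d = cos (c + d)"
proof -
  have "cos c \<oplus>\<^bsub>T\<^esub> cos d = cos c <#>\<^bsub>free_Abelian_group S\<^esub> cos d"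
    by (simp add: tensor_def FactGroup_def Let_def)
  also have "\<dots> = (\<lambda>k. k + (c + d)) ` K" unfolding cos_eq set_mult_def
  proof (intro equalityI subsetI)
    fix x assume "x \<in> (\<Union>h\<in>(\<lambda>k. k + c) ` K. \<Union>k\<in>(\<lambda>k. k + d) ` K. {h \<otimes>\<^bsub>free_Abelian_group S\<^esub> k})"
    then obtain k l where "k \<in> K" "l \<in> K" "x = (k + l) + (c + d)" by (auto simp: ac_simps)
    then show "x \<in> (\<lambda>k. k + (c + d)) ` K" using K_add by blast
  next
    fix x assume "x \<in> (\<lambda>k. k + (c + d)) ` K"
    then obtain k where k: "k \<in> K" "x = (k + c) + (0 + d)" by (auto simp: ac_simps)
    have "0 + d \<in> (\<lambda>k. k + d) ` K" "k + c \<in> (\<lambda>k. k + c) ` K" using k K_zero by blast+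
    then show "x \<in> (\<Union>h\<in>(\<lambda>k. k + c) ` K. \<Union>k\<in>(\<lambda>k. k + d) ` K. {h \<otimes>\<^bsub>free_Abelian_group S\<^esub> k})"
      using k(2) by (simp only: mult_free_Abelian_group) blast
  qed
  finally show ?thesis by (simp add: cos_eq)
qed

lemma abelian_group_T: "abelian_group T"
proof (rule abelian_groupI)
  fix x y z
  assume "x \<in> carrier T" "y \<in> carrier T"
  then obtain c d where c: "x = cos c" "Poly_Mapping.keys c \<subseteq> S" and d: "y = cos d" "Poly_Mapping.keys d \<subseteq> S"
    unfolding carrier_T by blast
  have "Poly_Mapping.keys (c + d) \<subseteq> S" using c d keys_add[of c d] by blast
  then show "x \<oplus>\<^bsub>T\<^esub> y \<in> carrier T" using c d by (simp add: add_T cos_closed)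
  show "x \<oplus>\<^bsub>T\<^esub> y = y \<oplus>\<^bsub>T\<^esub> x" using c d by (simp add: add_T add.commute)
  assume "z \<in> carrier T"
  then obtain e where "z = cos e" unfolding carrier_T by blast
  then show "x \<oplus>\<^bsub>T\<^esub> y \<oplus>\<^bsub>T\<^esub> z = x \<oplus>\<^bsub>T\<^esub> (y \<oplus>\<^bsub>T\<^esub> z)" using c d by (simp add: add_T add.assoc)
next
  show "\<zero>\<^bsub>T\<^esub> \<in> carrier T" unfolding zero_T by (rule cos_closed) simp
next
  fix x assume "x \<in> carrier T"
  then obtain c where c: "x = cos c" "Poly_Mapping.keys c \<subseteq> S" unfolding carrier_T by blast
  show "\<zero>\<^bsub>T\<^esub> \<oplus>\<^bsub>T\<^esub> x = x" by (simp add: c zero_T add_T)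
  have "cos (- c) \<in> carrier T" using c by (intro cos_closed) simp
  then show "\<exists>y\<in>carrier T. y \<oplus>\<^bsub>T\<^esub> x = \<zero>\<^bsub>T\<^esub>" by (intro bexI[of _ "cos (- c)"]) (simp_all add: c zero_T add_T)
qed

sublocale T: abelian_group T
  by (rule abelian_group_T)

lemma pt_closed: "x \<in> carrier X \<Longrightarrow> m \<in> carrier M \<Longrightarrow> pt x m \<in> carrier T"
  unfolding pure_tensor_def by (rule cos_closed) simp

lemma cos_diff:
  assumes "Poly_Mapping.keys c \<subseteq> S" "Poly_Mapping.keys d \<subseteq> S"
  shows "cos (c - d) = cos c \<ominus>\<^bsub>T\<^esub> cos d"
proof -
  have n: "cos (- d) \<in> carrier T" using assms by (intro cos_closed) simp
  have "cos (- d) \<oplus>\<^bsub>T\<^esub> cos d = \<zero>\<^bsub>T\<^esub>" by (simp add: add_T zero_T)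
  then have "\<ominus>\<^bsub>T\<^esub> cos d = cos (- d)" using n cos_closed[OF assms(2)] by (simp add: T.minus_equality)
  then show ?thesis by (simp add: a_minus_def add_T)
qed

text \<open>The inductive step is a difference, which covers sums and negatives at once and matches
  induction on free abelian groups.\<close>

lemma tensor_induct [consumes 1, case_names diff pure]:
  assumes "t \<in> carrier T"
    and "\<And>u v. u \<in> carrier T \<Longrightarrow> v \<in> carrier T \<Longrightarrow> P u \<Longrightarrow> P v \<Longrightarrow> P (u \<ominus>\<^bsub>T\<^esub> v)"
    and "\<And>x m. x \<in> carrier X \<Longrightarrow> m \<in> carrier M \<Longrightarrow> P (pt x m)"
  shows "P t"
proof -
  obtain c where c: "t = cos c" "Poly_Mapping.keys c \<subseteq> S" using assms(1) unfolding carrier_T by blast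
  have p: "P (pt \<zero>\<^bsub>X\<^esub> \<zero>\<^bsub>M\<^esub>)" "pt \<zero>\<^bsub>X\<^esub> \<zero>\<^bsub>M\<^esub> \<in> carrier T" using assms(3) pt_closed by simp_all
  \<comment> \<open>Zero is obtained as a pure tensor minus itself.\<close>
  have "pt \<zero>\<^bsub>X\<^esub> \<zero>\<^bsub>M\<^esub> \<ominus>\<^bsub>T\<^esub> pt \<zero>\<^bsub>X\<^esub> \<zero>\<^bsub>M\<^esub> = \<zero>\<^bsub>T\<^esub>" using p by (simp add: T.minus_zero_iff)
  then have z: "P (cos 0)" using assms(2)[OF p(2,2,1,1)] by (simp add: zero_T)
  show ?thesis unfolding c(1) using c(2)
  proof (rule free_Abelian_group_induct)
    show "P (cos 0)" by (rule z)
    show "P (cos (x - y))" if "Poly_Mapping.keys x \<subseteq> S" "Poly_Mapping.keys y \<subseteq> S" "P (cos x)" "P (cos y)" for x y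
      using assms(2)[of "cos x" "cos y"] that by (simp add: cos_diff cos_closed)
    show "P (cos (frag_of a))" if "a \<in> S" for a
      using assms(3) that unfolding pure_tensor_def by (cases a) auto
  qed
qed

lemma pt_add_l:
  assumes "x \<in> carrier X" "y \<in> carrier X" "m \<in> carrier M"
  shows "pt (x \<oplus>\<^bsub>X\<^esub> y) m = pt x m \<oplus>\<^bsub>T\<^esub> pt y m"
proof -
  have "frag_of (x \<oplus>\<^bsub>X\<^esub> y, m) - frag_of (x, m) - frag_of (y, m) \<in> K"
    by (rule K_incl) (use assms in \<open>auto simp: tensor_rels_def\<close>)
  then show ?thesis unfolding pure_tensor_def add_T cos_eq_iff by (simp add: diff_diff_eq)
qed

lemma pt_add_r:
  assumes "x \<in> carrier X" "m \<in> carrier M" "n \<in> carrier M"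
  shows "pt x (m \<oplus>\<^bsub>M\<^esub> n) = pt x m \<oplus>\<^bsub>T\<^esub> pt x n"
proof -
  have "frag_of (x, m \<oplus>\<^bsub>M\<^esub> n) - frag_of (x, m) - frag_of (x, n) \<in> K"
    by (rule K_incl) (use assms in \<open>auto simp: tensor_rels_def\<close>)
  then show ?thesis unfolding pure_tensor_def add_T cos_eq_iff by (simp add: diff_diff_eq)
qed

lemma pt_balanced:
  assumes "x \<in> carrier X" "m \<in> carrier M" "r \<in> carrier R"
  shows "pt (rsmult X x r) m = pt x (r \<odot>\<^bsub>M\<^esub> m)"
proof -
  have "frag_of (rsmult X x r, m) - frag_of (x, r \<odot>\<^bsub>M\<^esub> m) \<in> K"
    by (rule K_incl) (use assms in \<open>auto simp: tensor_rels_def\<close>)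
  then show ?thesis unfolding pure_tensor_def cos_eq_iff .
qed

lemma additive_pt_r: "x \<in> carrier X \<Longrightarrow> additive_map M T (pt x)"
  by (rule additive_mapI) (auto simp: pt_closed pt_add_r)

lemma pt_finsum_r: "x \<in> carrier X \<Longrightarrow> f \<in> I \<rightarrow> carrier M \<Longrightarrow> pt x (finsum M f I) = finsum T (\<lambda>i. pt x (f i)) I"
  by (rule additive_map_finsum[OF M.abelian_group_axioms T.abelian_group_axioms additive_pt_r])

text \<open>The target is any abelian group of any type, so that maps into modules, rings and other
  tensor products are all obtained from here.\<close>

lemma tensor_universal:
  fixes W :: "('d, 'w) ring_scheme"
  assumes W: "abelian_group W"
    and b: "\<And>x m. x \<in> carrier X \<Longrightarrow> m \<in> carrier M \<Longrightarrow> b x m \<in> carrier W"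
    and bl: "\<And>x y m. x \<in> carrier X \<Longrightarrow> y \<in> carrier X \<Longrightarrow> m \<in> carrier M \<Longrightarrow> b (x \<oplus>\<^bsub>X\<^esub> y) m = b x m \<oplus>\<^bsub>W\<^esub> b y m"
    and br: "\<And>x m n. x \<in> carrier X \<Longrightarrow> m \<in> carrier M \<Longrightarrow> n \<in> carrier M \<Longrightarrow> b x (m \<oplus>\<^bsub>M\<^esub> n) = b x m \<oplus>\<^bsub>W\<^esub> b x n"
    and bb: "\<And>x m r. x \<in> carrier X \<Longrightarrow> m \<in> carrier M \<Longrightarrow> r \<in> carrier R \<Longrightarrow> b (rsmult X x r) m = b x (r \<odot>\<^bsub>M\<^esub> m)"
  obtains h where "additive_map T W h" "\<And>x m. x \<in> carrier X \<Longrightarrow> m \<in> carrier M \<Longrightarrow> h (pt x m) = b x m"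
proof -
  interpret W: abelian_group W by fact
  have "case_prod b ` S \<subseteq> carrier (add_monoid W)" using b by auto
  then obtain h where h: "h \<in> hom (free_Abelian_group S) (add_monoid W)" "\<And>z. z \<in> S \<Longrightarrow> h (frag_of z) = case_prod b z"
    by (rule comm_group.free_Abelian_group_universal[OF W.a_comm_group]) (rule that)
  have hc: "h c \<in> carrier W" if "Poly_Mapping.keys c \<subseteq> S" for c
    using h(1) that by (auto simp: hom_def)
  have ha: "h (c + d) = h c \<oplus>\<^bsub>W\<^esub> h d" if "Poly_Mapping.keys c \<subseteq> S" "Poly_Mapping.keys d \<subseteq> S" for c d
    using h(1) that by (auto simp: hom_def)
  have h0: "h 0 = \<zero>\<^bsub>W\<^esub>" using ha[of 0 0] hc[of 0] by simp
  have hn: "h (- c) = \<ominus>\<^bsub>W\<^esub> h c" if "Poly_Mapping.keys c \<subseteq> S" for c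
    using ha[of "- c" c] hc[of c] hc[of "- c"] that h0 by (simp add: W.minus_equality)
  have hd: "h (c - d) = h c \<ominus>\<^bsub>W\<^esub> h d" if "Poly_Mapping.keys c \<subseteq> S" "Poly_Mapping.keys d \<subseteq> S" for c d
    using ha[of c "- d"] hn[of d] that by (simp add: a_minus_def)
  have hp: "h (frag_of (x, m)) = b x m" if "x \<in> carrier X" "m \<in> carrier M" for x m using h(2) that by simp
  have three: "h (frag_of z - frag_of z' - frag_of z'') = \<zero>\<^bsub>W\<^esub>"
    if "z \<in> S" "z' \<in> S" "z'' \<in> S" "h (frag_of z) = h (frag_of z') \<oplus>\<^bsub>W\<^esub> h (frag_of z'')" for z z' z''
  proof -
    have k: "Poly_Mapping.keys (frag_of z - frag_of z') \<subseteq> S" using that keys_diff[of "frag_of z" "frag_of z'"] by auto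
    have c: "h (frag_of z') \<in> carrier W" "h (frag_of z'') \<in> carrier W" using hc that by simp_all
    show ?thesis using that k c by (simp add: hd a_minus_def W.a_ac W.r_neg W.r_neg1 W.r_neg2)
  qed
  have rel: "h c = \<zero>\<^bsub>W\<^esub>" if "c \<in> tensor_rels R X M" for c
    using that unfolding tensor_rels_def
  proof (elim UnE)
    assume "c \<in> {frag_of (rsmult X x r, m) - frag_of (x, r \<odot>\<^bsub>M\<^esub> m) |x r m. x \<in> carrier X \<and> r \<in> carrier R \<and> m \<in> carrier M}"
    then obtain x r m where *: "x \<in> carrier X" "r \<in> carrier R" "m \<in> carrier M"
      "c = frag_of (rsmult X x r, m) - frag_of (x, r \<odot>\<^bsub>M\<^esub> m)" by blast
    then have "h c = b (rsmult X x r) m \<ominus>\<^bsub>W\<^esub> b x (r \<odot>\<^bsub>M\<^esub> m)" by (simp add: hd hp rsmult_closed smult_closed)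
    then show ?thesis using * bb b[of x "r \<odot>\<^bsub>M\<^esub> m"] by (simp add: W.minus_zero_iff smult_closed)
  next
    assume "c \<in> {frag_of (x \<oplus>\<^bsub>X\<^esub> y, m) - frag_of (x, m) - frag_of (y, m) |x y m. x \<in> carrier X \<and> y \<in> carrier X \<and> m \<in> carrier M}"
    then obtain x y m where *: "x \<in> carrier X" "y \<in> carrier X" "m \<in> carrier M"
      "c = frag_of (x \<oplus>\<^bsub>X\<^esub> y, m) - frag_of (x, m) - frag_of (y, m)" by blast
    then show ?thesis by (auto intro!: three simp: hp bl)
  next
    assume "c \<in> {frag_of (x, m \<oplus>\<^bsub>M\<^esub> n) - frag_of (x, m) - frag_of (x, n) |x m n. x \<in> carrier X \<and> m \<in> carrier M \<and> n \<in> carrier M}"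
    then obtain x m n where *: "x \<in> carrier X" "m \<in> carrier M" "n \<in> carrier M"
      "c = frag_of (x, m \<oplus>\<^bsub>M\<^esub> n) - frag_of (x, m) - frag_of (x, n)" by blast
    then show ?thesis by (auto intro!: three simp: hp br)
  qed
  have hK: "h c = \<zero>\<^bsub>W\<^esub>" if "c \<in> K" for c
  proof -
    have "c \<in> generate (free_Abelian_group S) (tensor_rels R X M) \<Longrightarrow> h c = \<zero>\<^bsub>W\<^esub>" for c
    proof (induction rule: generate.induct)
      case (eng h1 h2)
      have "Poly_Mapping.keys h1 \<subseteq> S" "Poly_Mapping.keys h2 \<subseteq> S"
        using eng.hyps K_keys unfolding tensor_kernel_def by blast+
      then show ?case using eng.IH by (simp add: ha)
    qed (use rel rels_keys in \<open>simp_all add: h0 hn\<close>)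
    then show ?thesis using that unfolding tensor_kernel_def by blast
  qed
  \<comment> \<open>\<open>h\<close> vanishes on \<open>K\<close>, so it takes a single value on
    each coset.\<close>
  define g where "g t = the_elem (h ` t)" for t
  have g: "g (cos c) = h c" if "Poly_Mapping.keys c \<subseteq> S" for c
  proof -
    have "h (k + c) = h c" if "k \<in> K" for k using ha[OF K_keys[OF that] \<open>Poly_Mapping.keys c \<subseteq> S\<close>] hK[OF that] hc[OF \<open>Poly_Mapping.keys c \<subseteq> S\<close>] by simp
    then have "h ` cos c = {h c}" unfolding cos_eq using K_zero by force
    then show ?thesis by (simp add: g_def)
  qed
  show thesis
  proof (rule that)
    show "additive_map T W g"
    proof (rule additive_mapI)
      fix x assume "x \<in> carrier T"
      then obtain c where c: "x = cos c" "Poly_Mapping.keys c \<subseteq> S" unfolding carrier_T by blast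
      then show "g x \<in> carrier W" using g hc by simp
      fix y assume "y \<in> carrier T"
      then obtain d where d: "y = cos d" "Poly_Mapping.keys d \<subseteq> S" unfolding carrier_T by blast
      have "Poly_Mapping.keys (c + d) \<subseteq> S" using c d keys_add[of c d] by blast
      then show "g (x \<oplus>\<^bsub>T\<^esub> y) = g x \<oplus>\<^bsub>W\<^esub> g y" using c d g ha by (simp add: add_T)
    qed
    show "g (pt x m) = b x m" if "x \<in> carrier X" "m \<in> carrier M" for x m
      unfolding pure_tensor_def using that g[of "frag_of (x, m)"] hp by simp
  qed
qed

text \<open>With this, identities between maps on a tensor product are checked on pure tensors, and
  representatives of cosets do not reappear.\<close>

lemma tensor_map_eqI:
  assumes "abelian_group W" "additive_map T W f" "additive_map T W g"
    and "\<And>x m. x \<in> carrier X \<Longrightarrow> m \<in> carrier M \<Longrightarrow> f (pt x m) = g (pt x m)" and "t \<in> carrier T"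
  shows "f t = g t"
  using assms(5)
proof (induction rule: tensor_induct)
  case (diff u v)
  interpret W: abelian_group W by fact
  show ?case using diff additive_mapD[OF assms(2)] additive_mapD[OF assms(3)]
      additive_map_neg[OF T.abelian_group_axioms assms(1,2)] additive_map_neg[OF T.abelian_group_axioms assms(1,3)]
    by (simp add: a_minus_def)
qed (use assms(4) in auto)

section \<open>The left action on a tensor product\<close>

context
  fixes s
  assumes s_closed: "\<And>x. x \<in> carrier X \<Longrightarrow> s \<odot>\<^bsub>X\<^esub> x \<in> carrier X"
    and s_add: "\<And>x y. x \<in> carrier X \<Longrightarrow> y \<in> carrier X \<Longrightarrow> s \<odot>\<^bsub>X\<^esub> (x \<oplus>\<^bsub>X\<^esub> y) = s \<odot>\<^bsub>X\<^esub> x \<oplus>\<^bsub>X\<^esub> s \<odot>\<^bsub>X\<^esub> y"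
    and s_rsmult: "\<And>x r. x \<in> carrier X \<Longrightarrow> r \<in> carrier R \<Longrightarrow> s \<odot>\<^bsub>X\<^esub> rsmult X x r = rsmult X (s \<odot>\<^bsub>X\<^esub> x) r"
begin

abbreviation (input) "scal c \<equiv> frag_extend (\<lambda>(x, m). frag_of (s \<odot>\<^bsub>X\<^esub> x, m)) c"

lemma scal_keys: "Poly_Mapping.keys c \<subseteq> S \<Longrightarrow> Poly_Mapping.keys (scal c) \<subseteq> S"
proof -
  assume c: "Poly_Mapping.keys c \<subseteq> S"
  have "(\<Union>z\<in>Poly_Mapping.keys c. Poly_Mapping.keys (case z of (x, m) \<Rightarrow> frag_of (s \<odot>\<^bsub>X\<^esub> x, m))) \<subseteq> S"
    using c s_closed by (auto split: prod.splits)
  then show ?thesis using keys_frag_extend by (rule order.trans[rotated])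
qed

text \<open>An additive operator on \<open>X\<close> that commutes with the right action carries
  each defining relation to one of the same kind, so it descends to the quotient.\<close>

lemma scal_rels: "c \<in> tensor_rels R X M \<Longrightarrow> scal c \<in> tensor_rels R X M"
  unfolding tensor_rels_def
proof (elim UnE)
  assume "c \<in> {frag_of (rsmult X x r, m) - frag_of (x, r \<odot>\<^bsub>M\<^esub> m) |x r m. x \<in> carrier X \<and> r \<in> carrier R \<and> m \<in> carrier M}"
  then obtain x r m where *: "x \<in> carrier X" "r \<in> carrier R" "m \<in> carrier M"
    "c = frag_of (rsmult X x r, m) - frag_of (x, r \<odot>\<^bsub>M\<^esub> m)" by blast
  have "scal c = frag_of (rsmult X (s \<odot>\<^bsub>X\<^esub> x) r, m) - frag_of (s \<odot>\<^bsub>X\<^esub> x, r \<odot>\<^bsub>M\<^esub> m)"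
    using * by (simp add: frag_extend_diff s_rsmult)
  then show "scal c \<in> C \<union> D \<union> {frag_of (rsmult X x r, m) - frag_of (x, r \<odot>\<^bsub>M\<^esub> m) |x r m. x \<in> carrier X \<and> r \<in> carrier R \<and> m \<in> carrier M}" for C D
    using * s_closed by blast
next
  assume "c \<in> {frag_of (x \<oplus>\<^bsub>X\<^esub> y, m) - frag_of (x, m) - frag_of (y, m) |x y m. x \<in> carrier X \<and> y \<in> carrier X \<and> m \<in> carrier M}"
  then obtain x y m where *: "x \<in> carrier X" "y \<in> carrier X" "m \<in> carrier M"
    "c = frag_of (x \<oplus>\<^bsub>X\<^esub> y, m) - frag_of (x, m) - frag_of (y, m)" by blast
  have "scal c = frag_of (s \<odot>\<^bsub>X\<^esub> x \<oplus>\<^bsub>X\<^esub> s \<odot>\<^bsub>X\<^esub> y, m) - frag_of (s \<odot>\<^bsub>X\<^esub> x, m) - frag_of (s \<odot>\<^bsub>X\<^esub> y, m)"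
    using * by (simp add: frag_extend_diff s_add)
  then show "scal c \<in> {frag_of (x \<oplus>\<^bsub>X\<^esub> y, m) - frag_of (x, m) - frag_of (y, m) |x y m. x \<in> carrier X \<and> y \<in> carrier X \<and> m \<in> carrier M} \<union> C \<union> D" for C D
    using * s_closed by blast
next
  assume "c \<in> {frag_of (x, m \<oplus>\<^bsub>M\<^esub> n) - frag_of (x, m) - frag_of (x, n) |x m n. x \<in> carrier X \<and> m \<in> carrier M \<and> n \<in> carrier M}"
  then obtain x m n where *: "x \<in> carrier X" "m \<in> carrier M" "n \<in> carrier M"
    "c = frag_of (x, m \<oplus>\<^bsub>M\<^esub> n) - frag_of (x, m) - frag_of (x, n)" by blast
  have "scal c = frag_of (s \<odot>\<^bsub>X\<^esub> x, m \<oplus>\<^bsub>M\<^esub> n) - frag_of (s \<odot>\<^bsub>X\<^esub> x, m) - frag_of (s \<odot>\<^bsub>X\<^esub> x, n)"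
    using * by (simp add: frag_extend_diff)
  then show "scal c \<in> C \<union> {frag_of (x, m \<oplus>\<^bsub>M\<^esub> n) - frag_of (x, m) - frag_of (x, n) |x m n. x \<in> carrier X \<and> m \<in> carrier M \<and> n \<in> carrier M} \<union> D" for C D
    using * s_closed by blast
qed

lemma scal_K: "c \<in> K \<Longrightarrow> scal c \<in> K"
proof -
  have "c \<in> generate (free_Abelian_group S) (tensor_rels R X M) \<Longrightarrow> scal c \<in> K" for c
  proof (induction rule: generate.induct)
    case (inv h)
    then show ?case using K_neg[OF K_incl[OF scal_rels[OF inv]]] rels_keys[OF inv] by (simp add: frag_extend_minus)
  next
    case (eng h1 h2)
    then show ?case by (simp add: frag_extend_add K_add)
  qed (use K_zero K_incl scal_rels in auto)
  then show "c \<in> K \<Longrightarrow> scal c \<in> K" unfolding tensor_kernel_def .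
qed

lemma smult_T_cos: "s \<odot>\<^bsub>T\<^esub> cos c = cos (scal c)"
proof -
  have "s \<odot>\<^bsub>T\<^esub> cos c = (\<Union>d\<in>cos c. cos (scal d))" by (simp add: tensor_def Let_def)
  moreover have "cos (scal d) = cos (scal c)" if "d \<in> cos c" for d
  proof -
    obtain k where "k \<in> K" "d = k + c" using \<open>d \<in> cos c\<close> unfolding cos_eq by blast
    then show ?thesis unfolding cos_eq_iff using scal_K by (simp add: frag_extend_add)
  qed
  moreover have "c \<in> cos c" unfolding cos_eq using K_zero by force
  ultimately show ?thesis by blast
qed

lemma smult_pt: "x \<in> carrier X \<Longrightarrow> m \<in> carrier M \<Longrightarrow> s \<odot>\<^bsub>T\<^esub> pt x m = pt (s \<odot>\<^bsub>X\<^esub> x) m"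
  unfolding pure_tensor_def smult_T_cos by simp

lemma smult_T_additive: "additive_map T T (\<lambda>t. s \<odot>\<^bsub>T\<^esub> t)"
proof (rule additive_mapI)
  fix x assume "x \<in> carrier T"
  then obtain c where c: "x = cos c" "Poly_Mapping.keys c \<subseteq> S" unfolding carrier_T by blast
  then show "s \<odot>\<^bsub>T\<^esub> x \<in> carrier T" by (simp add: smult_T_cos cos_closed scal_keys)
  fix y assume "y \<in> carrier T"
  then obtain d where d: "y = cos d" "Poly_Mapping.keys d \<subseteq> S" unfolding carrier_T by blast
  show "s \<odot>\<^bsub>T\<^esub> (x \<oplus>\<^bsub>T\<^esub> y) = s \<odot>\<^bsub>T\<^esub> x \<oplus>\<^bsub>T\<^esub> s \<odot>\<^bsub>T\<^esub> y"
    using c d by (simp add: smult_T_cos add_T frag_extend_add)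
qed

end

end

text \<open>The ring \<open>B\<close> acting from the left is kept apart from the ring
  \<open>R\<close> over which the tensor product is formed: it is \<open>A\<close> for induced
  modules, and \<open>R\<close> for single components and for bimodules.\<close>

locale tensor_module = tensor_product R X M + SX: left_module B X
  for R :: "('a, 'r) ring_scheme" and X :: "('a, 'b, 'm) bimodule_scheme"
    and M :: "('a, 'c, 'n) module_scheme" and B :: "('a, 's) ring_scheme" +
  assumes commute: "s \<in> carrier B \<Longrightarrow> x \<in> carrier X \<Longrightarrow> r \<in> carrier R \<Longrightarrow>
    s \<odot>\<^bsub>X\<^esub> rsmult X x r = rsmult X (s \<odot>\<^bsub>X\<^esub> x) r"
begin

lemma smult_pure:
  "s \<in> carrier B \<Longrightarrow> x \<in> carrier X \<Longrightarrow> m \<in> carrier M \<Longrightarrow> s \<odot>\<^bsub>T\<^esub> pt x m = pt (s \<odot>\<^bsub>X\<^esub> x) m"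
  using smult_pt[of s] by (simp add: SX.smult_closed SX.smult_r_distr commute)

lemma smult_additive: "s \<in> carrier B \<Longrightarrow> additive_map T T (\<lambda>t. s \<odot>\<^bsub>T\<^esub> t)"
  using smult_T_additive[of s] by (simp add: SX.smult_closed SX.smult_r_distr commute)

sublocale TM: left_module B T
proof (rule left_moduleI[OF SX.R.ring_axioms abelian_group_T])
  note s = additive_mapD[OF smult_additive]
  show "a \<odot>\<^bsub>T\<^esub> x \<in> carrier T" if "a \<in> carrier B" "x \<in> carrier T" for a x using s that by blast
  show "a \<odot>\<^bsub>T\<^esub> (x \<oplus>\<^bsub>T\<^esub> y) = a \<odot>\<^bsub>T\<^esub> x \<oplus>\<^bsub>T\<^esub> a \<odot>\<^bsub>T\<^esub> y"
    if "a \<in> carrier B" "x \<in> carrier T" "y \<in> carrier T" for a x y using s that by blast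
  note eq = tensor_map_eqI[OF abelian_group_T]
  show "(a \<oplus>\<^bsub>B\<^esub> b) \<odot>\<^bsub>T\<^esub> x = a \<odot>\<^bsub>T\<^esub> x \<oplus>\<^bsub>T\<^esub> b \<odot>\<^bsub>T\<^esub> x"
    if "a \<in> carrier B" "b \<in> carrier B" "x \<in> carrier T" for a b x
  proof (rule eq[OF smult_additive _ _ that(3)])
    show "additive_map T T (\<lambda>x. a \<odot>\<^bsub>T\<^esub> x \<oplus>\<^bsub>T\<^esub> b \<odot>\<^bsub>T\<^esub> x)"
      by (rule additive_mapI) (use that s in \<open>auto simp: T.a_ac\<close>)
  qed (use that in \<open>auto simp: smult_pure SX.smult_l_distr SX.smult_closed pt_add_l\<close>)
  show "(a \<otimes>\<^bsub>B\<^esub> b) \<odot>\<^bsub>T\<^esub> x = a \<odot>\<^bsub>T\<^esub> (b \<odot>\<^bsub>T\<^esub> x)"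
    if "a \<in> carrier B" "b \<in> carrier B" "x \<in> carrier T" for a b x
  proof (rule eq[OF smult_additive _ _ that(3)])
    show "additive_map T T (\<lambda>x. a \<odot>\<^bsub>T\<^esub> (b \<odot>\<^bsub>T\<^esub> x))"
      by (rule additive_mapI) (use that s in auto)
  qed (use that in \<open>auto simp: smult_pure SX.smult_assoc1 SX.smult_closed\<close>)
  show "\<one>\<^bsub>B\<^esub> \<odot>\<^bsub>T\<^esub> x = x" if "x \<in> carrier T" for x
  proof (rule eq[OF smult_additive _ _ that])
    show "additive_map T T (\<lambda>x. x)" by (rule additive_mapI) auto
  qed (auto simp: smult_pure SX.smult_one)
qed

end

subsection \<open>Bimodules\<close>

lemma opposite_ring_simps [simp]:
  "carrier (opposite_ring R) = carrier R" "x \<otimes>\<^bsub>opposite_ring R\<^esub> y = y \<otimes>\<^bsub>R\<^esub> x"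
  "\<one>\<^bsub>opposite_ring R\<^esub> = \<one>\<^bsub>R\<^esub>" "\<zero>\<^bsub>opposite_ring R\<^esub> = \<zero>\<^bsub>R\<^esub>" "add (opposite_ring R) = add R"
  by (simp_all add: opposite_ring_def)

lemma right_part_simps [simp]:
  "carrier (right_part P) = carrier P" "\<zero>\<^bsub>right_part P\<^esub> = \<zero>\<^bsub>P\<^esub>" "add (right_part P) = add P"
  "a \<odot>\<^bsub>right_part P\<^esub> x = rsmult P x a"
  by (simp_all add: right_part_def)

lemma sub_bimodule_simps [simp]:
  "carrier (sub_bimodule A X) = X" "\<zero>\<^bsub>sub_bimodule A X\<^esub> = \<zero>\<^bsub>A\<^esub>" "add (sub_bimodule A X) = add A"
  "smult (sub_bimodule A X) = mult A" "rsmult (sub_bimodule A X) = mult A"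
  by (simp_all add: sub_bimodule_def)

lemma principal_module_simps [simp]:
  "carrier (principal_module R e) = {r \<otimes>\<^bsub>R\<^esub> e | r. r \<in> carrier R}"
  "\<zero>\<^bsub>principal_module R e\<^esub> = \<zero>\<^bsub>R\<^esub>" "add (principal_module R e) = add R"
  "smult (principal_module R e) = mult R"
  by (simp_all add: principal_module_def)

lemma (in ring) principal_carrier_iff:
  assumes "e \<in> carrier R" "e \<otimes> e = e"
  shows "x \<in> carrier (principal_module R e) \<longleftrightarrow> x \<in> carrier R \<and> x \<otimes> e = x"
proof
  assume "x \<in> carrier (principal_module R e)"
  then obtain r where "r \<in> carrier R" "x = r \<otimes> e" by auto
  then show "x \<in> carrier R \<and> x \<otimes> e = x" using assms by (simp add: m_assoc)
next
  assume "x \<in> carrier R \<and> x \<otimes> e = x"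
  then show "x \<in> carrier (principal_module R e)" by (auto intro!: exI[of _ x])
qed

lemma (in ring) left_module_principal:
  assumes "e \<in> carrier R"
  shows "left_module R (principal_module R e)"
proof -
  interpret M: left_module R "regular_module R" by (rule left_module_regular[OF ring_axioms])
  have "submodule {r \<otimes> e | r. r \<in> carrier R} R (regular_module R)"
  proof (rule M.submoduleI)
    have "\<zero> = \<zero> \<otimes> e" using assms by simp
    then show "\<zero>\<^bsub>regular_module R\<^esub> \<in> {r \<otimes> e | r. r \<in> carrier R}" unfolding regular_module_simps using zero_closed by blast
    show "x \<oplus>\<^bsub>regular_module R\<^esub> y \<in> {r \<otimes> e | r. r \<in> carrier R}"
      if x: "x \<in> {r \<otimes> e | r. r \<in> carrier R}" and y: "y \<in> {r \<otimes> e | r. r \<in> carrier R}" for x y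
    proof -
      obtain r where "r \<in> carrier R" "x = r \<otimes> e" using x by (elim CollectE exE conjE)
      moreover obtain s where "s \<in> carrier R" "y = s \<otimes> e" using y by (elim CollectE exE conjE)
      ultimately have "x \<oplus>\<^bsub>regular_module R\<^esub> y = (r \<oplus> s) \<otimes> e" "r \<oplus> s \<in> carrier R"
        using assms by (simp_all add: l_distr)
      then show ?thesis by blast
    qed
    show "a \<odot>\<^bsub>regular_module R\<^esub> x \<in> {r \<otimes> e | r. r \<in> carrier R}"
      if "a \<in> carrier R" and x: "x \<in> {r \<otimes> e | r. r \<in> carrier R}" for a x
    proof -
      obtain r where "r \<in> carrier R" "x = r \<otimes> e" using x by (elim CollectE exE conjE)
      then have "a \<odot>\<^bsub>regular_module R\<^esub> x = (a \<otimes> r) \<otimes> e" "a \<otimes> r \<in> carrier R"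
        using assms \<open>a \<in> carrier R\<close> m_assoc[of a r e] m_closed[of a r] unfolding regular_module_simps by simp_all
      then show ?thesis by blast
    qed
  qed (use assms in auto)
  then show ?thesis unfolding principal_module_def by (rule M.left_module_submodule)
qed

lemma bimoduleD:
  assumes "bimodule R P"
  shows "left_module R P" and "left_module (opposite_ring R) (right_part P)"
    and "a \<in> carrier R \<Longrightarrow> b \<in> carrier R \<Longrightarrow> x \<in> carrier P \<Longrightarrow> rsmult P (a \<odot>\<^bsub>P\<^esub> x) b = a \<odot>\<^bsub>P\<^esub> rsmult P x b"
    and "b \<in> carrier R \<Longrightarrow> x \<in> carrier P \<Longrightarrow> rsmult P x b \<in> carrier P"
    and "b \<in> carrier R \<Longrightarrow> x \<in> carrier P \<Longrightarrow> y \<in> carrier P \<Longrightarrow> rsmult P (x \<oplus>\<^bsub>P\<^esub> y) b = rsmult P x b \<oplus>\<^bsub>P\<^esub> rsmult P y b"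
    and "a \<in> carrier R \<Longrightarrow> b \<in> carrier R \<Longrightarrow> x \<in> carrier P \<Longrightarrow> rsmult P x (a \<oplus>\<^bsub>R\<^esub> b) = rsmult P x a \<oplus>\<^bsub>P\<^esub> rsmult P x b"
    and "a \<in> carrier R \<Longrightarrow> b \<in> carrier R \<Longrightarrow> x \<in> carrier P \<Longrightarrow> rsmult P x (a \<otimes>\<^bsub>R\<^esub> b) = rsmult P (rsmult P x a) b"
    and "x \<in> carrier P \<Longrightarrow> rsmult P x \<one>\<^bsub>R\<^esub> = x"
proof -
  show 1: "left_module R P" and 2: "left_module (opposite_ring R) (right_part P)"
    using assms by (auto simp: bimodule_def)
  show "a \<in> carrier R \<Longrightarrow> b \<in> carrier R \<Longrightarrow> x \<in> carrier P \<Longrightarrow> rsmult P (a \<odot>\<^bsub>P\<^esub> x) b = a \<odot>\<^bsub>P\<^esub> rsmult P x b"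
    using assms by (auto simp: bimodule_def)
  interpret r: left_module "opposite_ring R" "right_part P" by (rule 2)
  show "b \<in> carrier R \<Longrightarrow> x \<in> carrier P \<Longrightarrow> rsmult P x b \<in> carrier P"
    "b \<in> carrier R \<Longrightarrow> x \<in> carrier P \<Longrightarrow> y \<in> carrier P \<Longrightarrow> rsmult P (x \<oplus>\<^bsub>P\<^esub> y) b = rsmult P x b \<oplus>\<^bsub>P\<^esub> rsmult P y b"
    "a \<in> carrier R \<Longrightarrow> b \<in> carrier R \<Longrightarrow> x \<in> carrier P \<Longrightarrow> rsmult P x (a \<oplus>\<^bsub>R\<^esub> b) = rsmult P x a \<oplus>\<^bsub>P\<^esub> rsmult P x b"
    "a \<in> carrier R \<Longrightarrow> b \<in> carrier R \<Longrightarrow> x \<in> carrier P \<Longrightarrow> rsmult P x (a \<otimes>\<^bsub>R\<^esub> b) = rsmult P (rsmult P x a) b"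
    "x \<in> carrier P \<Longrightarrow> rsmult P x \<one>\<^bsub>R\<^esub> = x"
    using r.smult_closed[of b x] r.smult_r_distr[of b x y] r.smult_l_distr[of a b x] r.smult_assoc1[of b a x]
      r.smult_one[of x] by auto
qed

lemma tensor_module_bimodule:
  assumes "bimodule R P" "left_module R M"
  shows "tensor_module R P M R"
proof -
  interpret P: left_module R P using bimoduleD(1)[OF assms(1)] .
  interpret M: left_module R M by fact
  show ?thesis
    by unfold_locales (use bimoduleD[OF assms(1)] in \<open>auto simp: M.smult_closed\<close>)
qed

lemma submodule_right_multiples:
  assumes "bimodule R P" "e \<in> carrier R"
  shows "submodule {rsmult P x e | x. x \<in> carrier P} R P"
proof -
  note b = bimoduleD[OF assms(1)]
  interpret P: left_module R P by (rule b(1))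
  have z: "rsmult P \<zero>\<^bsub>P\<^esub> e = \<zero>\<^bsub>P\<^esub>"
    using left_module.smult_r_null[OF b(2)] assms(2) by auto
  show ?thesis
  proof (rule P.submoduleI)
    show "{rsmult P x e |x. x \<in> carrier P} \<subseteq> carrier P" using b(4) assms(2) by auto
    show "\<zero>\<^bsub>P\<^esub> \<in> {rsmult P x e |x. x \<in> carrier P}" using z P.M.zero_closed by (metis (mono_tags, lifting) mem_Collect_eq)
    show "u \<oplus>\<^bsub>P\<^esub> v \<in> {rsmult P x e |x. x \<in> carrier P}"
      if uv: "u \<in> {rsmult P x e |x. x \<in> carrier P}" "v \<in> {rsmult P x e |x. x \<in> carrier P}" for u v
    proof -
      obtain x y where "x \<in> carrier P" "y \<in> carrier P" "u = rsmult P x e" "v = rsmult P y e" using uv by blast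
      then show ?thesis using b(5)[OF assms(2), of x y, symmetric] P.M.a_closed[of x y] by auto
    qed
    show "a \<odot>\<^bsub>P\<^esub> u \<in> {rsmult P x e |x. x \<in> carrier P}"
      if a: "a \<in> carrier R" and u: "u \<in> {rsmult P x e |x. x \<in> carrier P}" for a u
    proof -
      obtain x where "x \<in> carrier P" "u = rsmult P x e" using u by blast
      then show ?thesis using b(3)[OF a assms(2), of x, symmetric] P.smult_closed[OF a, of x] by auto
    qed
  qed
qed

text \<open>The isomorphism sends \<open>x \<otimes> m\<close> to xm, and its inverse sends u to
  \<open>u \<otimes> e\<close>. They are inverse to each other because m = me in Re, so balancing
  turns \<open>x \<otimes> m\<close> into \<open>xm \<otimes> e\<close>.\<close>

lemma tensor_principal:
  assumes P: "bimodule R P" and e: "e \<in> carrier R" "e \<otimes>\<^bsub>R\<^esub> e = e"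
  shows "module_iso R (tensor R P (principal_module R e)) (P\<lparr>carrier := {rsmult P x e | x. x \<in> carrier P}\<rparr>)"
    and "left_module R (tensor R P (principal_module R e))"
proof -
  note b = bimoduleD[OF P]
  interpret P: left_module R P by (rule b(1))
  interpret M: left_module R "principal_module R e" by (rule P.R.left_module_principal[OF e(1)])
  interpret tensor_module R P "principal_module R e" R
    by (rule tensor_module_bimodule[OF P M.left_module_axioms])
  show "left_module R T" by (rule TM.left_module_axioms)
  let ?H = "{rsmult P x e | x. x \<in> carrier P}"
  let ?PH = "P\<lparr>carrier := ?H\<rparr>"
  interpret H: left_module R "?PH"
    by (rule P.left_module_submodule[OF submodule_right_multiples[OF P e(1)]])
  have m: "m \<in> carrier R" "m \<otimes>\<^bsub>R\<^esub> e = m" if "m \<in> carrier (principal_module R e)" for m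
    using that P.R.principal_carrier_iff[OF e] by blast+
  have eM: "e \<in> carrier (principal_module R e)" using P.R.principal_carrier_iff[OF e] e by blast
  have xe: "rsmult P u e = u" "u \<in> carrier P" if "u \<in> ?H" for u using that b(4,7) e by (auto simp flip: b(7))
  obtain h where h: "additive_map T ?PH h"
    and hp: "\<And>x m. x \<in> carrier P \<Longrightarrow> m \<in> carrier (principal_module R e) \<Longrightarrow> h (pt x m) = rsmult P x m"
  proof (rule tensor_universal[OF H.M.abelian_group_axioms, of "rsmult P"])
    fix x m assume xm: "x \<in> carrier P" "m \<in> carrier (principal_module R e)"
    have "rsmult P x m = rsmult P (rsmult P x m) e" using b(7)[of m e x] m[OF xm(2)] xm(1) e by simp
    then show "rsmult P x m \<in> carrier ?PH" using b(4)[OF m(1)[OF xm(2)] xm(1)] by auto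
  next
    fix x y m assume "x \<in> carrier P" "y \<in> carrier P" "m \<in> carrier (principal_module R e)"
    then show "rsmult P (x \<oplus>\<^bsub>P\<^esub> y) m = rsmult P x m \<oplus>\<^bsub>?PH\<^esub> rsmult P y m" 
      using b(5)[of m x y] m(1)[of m] by simp
  next
    fix x n m assume "x \<in> carrier P" "m \<in> carrier (principal_module R e)" "n \<in> carrier (principal_module R e)"
    then show "rsmult P x (m \<oplus>\<^bsub>principal_module R e\<^esub> n) = rsmult P x m \<oplus>\<^bsub>?PH\<^esub> rsmult P x n"
      using b(6)[of m n x] m(1)[of m] m(1)[of n] by simp
  next
    fix x m r assume "x \<in> carrier P" "m \<in> carrier (principal_module R e)" "r \<in> carrier R"
    then show "rsmult P (rsmult P x r) m = rsmult P x (r \<odot>\<^bsub>principal_module R e\<^esub> m)"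
      using b(7)[of r m x] m(1)[of m] unfolding principal_module_simps(4) by simp
  qed (rule that)
  have cH: "carrier ?PH = ?H" "add ?PH = add P" by simp_all
  note h' = additive_mapD[OF h, unfolded cH]
  have hP: "additive_map T P h"
    by (rule additive_mapI) (use h' xe(2) in blast)+
  note principal_module_simps(1) [simp del]
  have lin: "h (a \<odot>\<^bsub>T\<^esub> t) = a \<odot>\<^bsub>P\<^esub> h t" if a: "a \<in> carrier R" and t: "t \<in> carrier T" for a t
  proof (rule tensor_map_eqI[OF P.M.abelian_group_axioms _ _ _ t])
    show "additive_map T P (\<lambda>t. h (a \<odot>\<^bsub>T\<^esub> t))"
      by (rule additive_mapI) (use a additive_mapD[OF hP] TM.smult_closed TM.smult_r_distr in auto)
    show "additive_map T P (\<lambda>t. a \<odot>\<^bsub>P\<^esub> h t)"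
      by (rule additive_mapI) (use a additive_mapD[OF hP] P.smult_closed P.smult_r_distr in auto)
    show "h (a \<odot>\<^bsub>T\<^esub> pt x m) = a \<odot>\<^bsub>P\<^esub> h (pt x m)" if "x \<in> carrier P" "m \<in> carrier (principal_module R e)" for x m
      using that a b(3)[OF a m(1)[OF that(2)] that(1)] by (simp add: smult_pure hp P.smult_closed)
  qed
  show "module_iso R T ?PH"
  proof (rule module_isoI[where f = h and g = "\<lambda>u. pt u e", OF TM.left_module_axioms])
    show "pt u e \<in> carrier T" if "u \<in> carrier ?PH" for u
      using xe(2)[of u] that eM pt_closed unfolding cH by blast
    show "h (pt u e) = u" if "u \<in> carrier ?PH" for u
      using xe[of u] that hp[OF _ eM, of u] unfolding cH by simp
    show "pt (h t) e = t" if t: "t \<in> carrier T" for t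
    proof (rule tensor_map_eqI[OF abelian_group_T _ _ _ t])
      show "additive_map T T (\<lambda>t. pt (h t) e)"
        by (rule additive_mapI) (use additive_mapD[OF hP] eM in \<open>auto simp: pt_closed pt_add_l\<close>)
      show "additive_map T T (\<lambda>t. t)" by (rule additive_mapI) auto
      show "pt (h (pt x m)) e = pt x m" if "x \<in> carrier P" "m \<in> carrier (principal_module R e)" for x m
        using that eM m[OF that(2)] pt_balanced[of x e m] by (simp add: hp)
    qed
    show "h t \<in> carrier ?PH" if "t \<in> carrier T" for t using h'(1)[OF that] unfolding cH .
    show "h (t \<oplus>\<^bsub>T\<^esub> u) = h t \<oplus>\<^bsub>?PH\<^esub> h u" if "t \<in> carrier T" "u \<in> carrier T" for t u
      using h'(2)[OF that] unfolding cH .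
    show "h (a \<odot>\<^bsub>T\<^esub> t) = a \<odot>\<^bsub>?PH\<^esub> h t" if "a \<in> carrier R" "t \<in> carrier T" for a t
      using lin[OF that] by simp
  qed
qed

section \<open>Graded rings and modules\<close>

lemma set_prod_incl:
  assumes "abelian_group A" "x \<in> X" "y \<in> Y" "x \<otimes>\<^bsub>A\<^esub> y \<in> carrier A"
  shows "x \<otimes>\<^bsub>A\<^esub> y \<in> set_prod A X Y"
proof -
  interpret A: abelian_group A by fact
  have "finsum A (\<lambda>i. x \<otimes>\<^bsub>A\<^esub> y) {..<Suc 0} = x \<otimes>\<^bsub>A\<^esub> y" using assms(4) by (simp add: lessThan_Suc)
  then show ?thesis unfolding set_prod_def using assms(2,3)
    by (intro CollectI exI[of _ "Suc 0"] exI[of _ "\<lambda>_. x"] exI[of _ "\<lambda>_. y"]) simp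
qed

text \<open>An induction principle: with \<open>H\<close> the set of elements that have some
  additive property, it is enough to test products. \<open>sum_of_parts_least\<close> does the same
  for homogeneous elements.\<close>

lemma set_prod_subset:
  assumes "additive_subgroup H A" "abelian_group A" "\<And>x y. x \<in> X \<Longrightarrow> y \<in> Y \<Longrightarrow> x \<otimes>\<^bsub>A\<^esub> y \<in> H"
  shows "set_prod A X Y \<subseteq> H"
proof -
  interpret A: abelian_group A by fact
  note H = additive_subgroupD[OF assms(1,2)]
  show ?thesis unfolding set_prod_def
    by (auto intro!: A.finsum_in_subset[OF H(2,3,1)] assms(3))
qed

lemma sum_of_parts_incl:
  assumes "abelian_group M" "i \<in> I" "x \<in> C i" "x \<in> carrier M"
  shows "x \<in> sum_of_parts M I C"
proof -
  interpret M: abelian_group M by fact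
  show ?thesis unfolding sum_of_parts_def
    by (rule CollectI, rule exI[of _ "\<lambda>_. x"], rule exI[of _ "{i}"]) (use assms in auto)
qed

lemma sum_of_parts_subgroup:
  assumes M: "abelian_group M" and sub: "\<And>i. i \<in> I \<Longrightarrow> additive_subgroup (C i) M"
  shows "additive_subgroup (sum_of_parts M I C) M"
proof -
  interpret M: abelian_group M by fact
  note C = additive_subgroupD[OF sub M]
  have ext: "\<exists>f'. (\<forall>i\<in>S'. f' i \<in> C i) \<and> finsum M f' S' = finsum M f S"
    if "finite S'" "S \<subseteq> S'" "S' \<subseteq> I" "f \<in> (\<Pi> i\<in>S. C i)" for S S' f
  proof (intro exI conjI)
    let ?f = "\<lambda>i. if i \<in> S then f i else \<zero>\<^bsub>M\<^esub>"
    show 1: "\<forall>i\<in>S'. ?f i \<in> C i" using that C by auto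
    show "finsum M ?f S' = finsum M f S"
      using that 1 C by (intro M.add.finprod_mono_neutral_cong_right) (auto simp: subset_iff Pi_iff)
  qed
  show ?thesis
  proof (rule additive_subgroupI'[OF M])
    show "sum_of_parts M I C \<subseteq> carrier M" using C by (fastforce simp: sum_of_parts_def intro!: M.finsum_closed)
    show "\<zero>\<^bsub>M\<^esub> \<in> sum_of_parts M I C" unfolding sum_of_parts_def
      by (rule CollectI, rule exI, rule exI[of _ "{}"]) auto
  next
    fix x y assume "x \<in> sum_of_parts M I C" "y \<in> sum_of_parts M I C"
    then obtain f S g U where f: "finite S" "S \<subseteq> I" "f \<in> (\<Pi> i\<in>S. C i)" "x = finsum M f S"
      and g: "finite U" "U \<subseteq> I" "g \<in> (\<Pi> i\<in>U. C i)" "y = finsum M g U" by (auto simp: sum_of_parts_def)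
    obtain f' where f': "\<forall>i\<in>S \<union> U. f' i \<in> C i" "finsum M f' (S \<union> U) = x"
      using ext[of "S \<union> U" S f] f g by auto
    obtain g' where g': "\<forall>i\<in>S \<union> U. g' i \<in> C i" "finsum M g' (S \<union> U) = y"
      using ext[of "S \<union> U" U g] f g by auto
    have "x \<oplus>\<^bsub>M\<^esub> y = finsum M (\<lambda>i. f' i \<oplus>\<^bsub>M\<^esub> g' i) (S \<union> U)"
      unfolding f'(2)[symmetric] g'(2)[symmetric] using f' g' C f g
      by (intro M.finsum_addf[symmetric]) (auto simp: subset_iff)
    then show "x \<oplus>\<^bsub>M\<^esub> y \<in> sum_of_parts M I C" unfolding sum_of_parts_def using f' g' C f g
      by (intro CollectI exI[of _ "\<lambda>i. f' i \<oplus>\<^bsub>M\<^esub> g' i"] exI[of _ "S \<union> U"]) (auto simp: subset_iff)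
  next
    fix x assume "x \<in> sum_of_parts M I C"
    then obtain f S where f: "finite S" "S \<subseteq> I" "f \<in> (\<Pi> i\<in>S. C i)" "x = finsum M f S" by (auto simp: sum_of_parts_def)
    have fc: "f \<in> S \<rightarrow> carrier M" using f C by blast
    have "\<ominus>\<^bsub>M\<^esub> x = finsum M (\<lambda>i. \<ominus>\<^bsub>M\<^esub> f i) S" unfolding f
      by (rule additive_map_finsum[OF M M _ fc]) (auto intro!: additive_mapI simp: M.minus_add)
    then show "\<ominus>\<^bsub>M\<^esub> x \<in> sum_of_parts M I C" unfolding sum_of_parts_def using f C
      by (intro CollectI exI[of _ "\<lambda>i. \<ominus>\<^bsub>M\<^esub> f i"] exI[of _ S]) (auto simp: subset_iff Pi_iff)
  qed
qed

lemma sum_of_parts_least: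
  assumes "abelian_group M" "additive_subgroup H M" "\<And>i. i \<in> I \<Longrightarrow> C i \<subseteq> H"
  shows "sum_of_parts M I C \<subseteq> H"
proof -
  interpret M: abelian_group M by fact
  note H = additive_subgroupD[OF assms(2,1)]
  show ?thesis unfolding sum_of_parts_def
    by (auto intro!: M.finsum_in_subset[OF H(2,3,1)]) (use assms(3) in blast)
qed

text \<open>Two rings arise by cutting homogeneous parts out of a larger ring: the restriction of
  \<open>A\<close> to a subgroup of degrees, and the sum of the \<open>Mor\<close> inside the ring
  of all endomorphisms. The larger ring itself need not be graded.\<close>

lemma is_graded_ring_restrict:
  fixes B :: "('g, 'b) graded_ring"
  assumes G: "group G" and B: "ring B"
    and sub: "\<And>g. g \<in> carrier G \<Longrightarrow> additive_subgroup (rpart B g) B"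
    and mult: "\<And>g h x y. g \<in> carrier G \<Longrightarrow> h \<in> carrier G \<Longrightarrow> x \<in> rpart B g \<Longrightarrow> y \<in> rpart B h \<Longrightarrow> x \<otimes>\<^bsub>B\<^esub> y \<in> rpart B (g \<otimes>\<^bsub>G\<^esub> h)"
    and one: "\<one>\<^bsub>B\<^esub> \<in> rpart B \<one>\<^bsub>G\<^esub>" and ind: "independent_parts B (carrier G) (rpart B)"
  shows "is_graded_ring G (restrict_grading B (carrier G))"
proof -
  interpret G: group G by fact
  interpret B: ring B by fact
  let ?C = "sum_of_parts B (carrier G) (rpart B)"
  let ?B = "B\<lparr>carrier := ?C\<rparr>"
  have C: "additive_subgroup ?C B" by (rule sum_of_parts_subgroup[OF B.abelian_group_axioms sub])
  note c = additive_subgroupD[OF C B.abelian_group_axioms]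
  note s = additive_subgroupD[OF sub B.abelian_group_axioms]
  have inc: "rpart B g \<subseteq> ?C" if "g \<in> carrier G" for g
    using sum_of_parts_incl[OF B.abelian_group_axioms that] s(1)[OF that] by blast
  have mc: "x \<otimes>\<^bsub>B\<^esub> y \<in> ?C" if x: "x \<in> ?C" and y: "y \<in> ?C" for x y
  proof -
    \<comment> \<open>Closure under products is additive in each factor; it is shown for a
      homogeneous left factor, then for a general one.\<close>
    have 1: "?C \<subseteq> {y \<in> carrier B. x \<otimes>\<^bsub>B\<^esub> y \<in> ?C}" if "g \<in> carrier G" "x \<in> rpart B g" for x g
    proof (rule sum_of_parts_least[OF B.abelian_group_axioms])
      have xc: "x \<in> carrier B" using that s(1) by blast
      show "additive_subgroup {y \<in> carrier B. x \<otimes>\<^bsub>B\<^esub> y \<in> ?C} B"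
        by (rule additive_subgroupI'[OF B.abelian_group_axioms])
          (use c xc in \<open>auto simp: B.r_distr B.r_minus\<close>)
      show "rpart B h \<subseteq> {y \<in> carrier B. x \<otimes>\<^bsub>B\<^esub> y \<in> ?C}" if h: "h \<in> carrier G" for h
        using mult[OF \<open>g \<in> carrier G\<close> h \<open>x \<in> rpart B g\<close>] inc[of "g \<otimes>\<^bsub>G\<^esub> h"] s(1)[OF h] \<open>g \<in> carrier G\<close> h by auto
    qed
    have yc: "y \<in> carrier B" using y c(1) by blast
    have "?C \<subseteq> {x \<in> carrier B. x \<otimes>\<^bsub>B\<^esub> y \<in> ?C}"
    proof (rule sum_of_parts_least[OF B.abelian_group_axioms])
      show "additive_subgroup {x \<in> carrier B. x \<otimes>\<^bsub>B\<^esub> y \<in> ?C} B"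
        by (rule additive_subgroupI'[OF B.abelian_group_axioms])
          (use c yc in \<open>auto simp: B.l_distr B.l_minus\<close>)
      show "rpart B h \<subseteq> {x \<in> carrier B. x \<otimes>\<^bsub>B\<^esub> y \<in> ?C}" if h: "h \<in> carrier G" for h
        using 1[OF h] y s(1)[OF h] by blast
    qed
    then show ?thesis using x by blast
  qed
  have o: "\<one>\<^bsub>B\<^esub> \<in> ?C" using inc[OF G.one_closed] one by blast
  have ab: "abelian_group ?B" by (rule abelian_group_restrict[OF B.abelian_group_axioms C])
  have cB: "x \<in> carrier B" if "x \<in> ?C" for x using c(1) that by blast
  have r: "ring ?B"
    by (rule ringI[OF ab monoidI])
      (use mc o cB in \<open>auto simp: B.m_assoc B.l_distr B.r_distr\<close>)
  interpret B': ring ?B by (rule r)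
  have fs: "finsum ?B f S = finsum B f S" if "f \<in> S \<rightarrow> ?C" for f and S :: "'x set"
    by (rule finsum_same[OF B.abelian_monoid_axioms B'.abelian_monoid_axioms]) (use c(1) that in auto)
  have fs': "finsum ?B f S = finsum B f S" if "S \<subseteq> carrier G" "f \<in> (\<Pi> g\<in>S. rpart B g)" for f S
    by (rule finsum_same[OF B.abelian_monoid_axioms B'.abelian_monoid_axioms]) (use c(1) that inc in \<open>auto simp: Pi_iff subset_iff\<close>)
  have sub': "additive_subgroup (rpart B g) ?B" if g: "g \<in> carrier G" for g
  proof (rule additive_subgroupI'[OF ab])
    fix x assume x: "x \<in> rpart B g"
    then have "\<ominus>\<^bsub>?B\<^esub> x = \<ominus>\<^bsub>B\<^esub> x"
      using inc[OF g] s(4)[OF g x] B.l_neg[of x] s(1)[OF g] by (intro B'.minus_equality) auto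
    then show "\<ominus>\<^bsub>?B\<^esub> x \<in> rpart B g" using s(4)[OF g x] by simp
  qed (use inc[OF g] s[OF g] in auto)
  have "direct_decomposition ?B (carrier G) (rpart B)"
  proof (rule direct_decompositionI[OF ab sub'])
    show "carrier ?B \<subseteq> sum_of_parts ?B (carrier G) (rpart B)"
    proof
      fix x assume "x \<in> carrier ?B"
      then obtain f S where f: "finite S" "S \<subseteq> carrier G" "f \<in> (\<Pi> i\<in>S. rpart B i)" "x = finsum B f S"
        by (auto simp: sum_of_parts_def)
      then show "x \<in> sum_of_parts ?B (carrier G) (rpart B)" 
        unfolding sum_of_parts_def[of ?B] using fs'[OF f(2,3), symmetric] by blast
    qed
    show "independent_parts ?B (carrier G) (rpart B)"
      using ind unfolding independent_parts_def by (auto simp: fs')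
  qed
  moreover have "set_prod ?B (rpart B g) (rpart B h) \<subseteq> rpart B (g \<otimes>\<^bsub>G\<^esub> h)" if "g \<in> carrier G" "h \<in> carrier G" for g h
    by (rule set_prod_subset[OF sub' ab]) (use that mult in auto)
  ultimately show ?thesis using G r unfolding is_graded_ring_def restrict_grading_def by simp
qed

subsection \<open>Endomorphism rings\<close>

lemma End_ring_simps [simp]:
  "carrier (End_ring G A N) = lin_maps A N N"
  "u \<otimes>\<^bsub>End_ring G A N\<^esub> v = compose (carrier N) v u"
  "\<one>\<^bsub>End_ring G A N\<^esub> = (\<lambda>x\<in>carrier N. x)"
  "\<zero>\<^bsub>End_ring G A N\<^esub> = (\<lambda>x\<in>carrier N. \<zero>\<^bsub>N\<^esub>)"
  "u \<oplus>\<^bsub>End_ring G A N\<^esub> v = (\<lambda>x\<in>carrier N. u x \<oplus>\<^bsub>N\<^esub> v x)"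
  "rpart (End_ring G A N) = Mor G A N"
  by (simp_all add: End_ring_def)

lemma ring_End_ring:
  assumes "left_module A N"
  shows "ring (End_ring G A N)"
proof -
  interpret N: left_module A N by fact
  let ?E = "End_ring G A N"
  have add: "(\<lambda>x\<in>carrier N. u x \<oplus>\<^bsub>N\<^esub> v x) \<in> lin_maps A N N" if "u \<in> lin_maps A N N" "v \<in> lin_maps A N N" for u v
    using lin_mapsD[OF that(1)] lin_mapsD[OF that(2)]
    by (intro lin_mapsI[OF assms]) (auto simp: N.M.a_ac N.smult_r_distr)
  have zero: "(\<lambda>x\<in>carrier N. \<zero>\<^bsub>N\<^esub>) \<in> lin_maps A N N"
    by (intro lin_mapsI[OF assms]) (auto simp: N.smult_r_null)
  have one: "(\<lambda>x\<in>carrier N. x) \<in> lin_maps A N N"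
    by (intro lin_mapsI[OF assms]) auto
  have neg: "(\<lambda>x\<in>carrier N. \<ominus>\<^bsub>N\<^esub> u x) \<in> lin_maps A N N" if "u \<in> lin_maps A N N" for u
    using lin_mapsD[OF that] by (intro lin_mapsI[OF assms]) (auto simp: N.M.minus_add N.smult_neg)
  have comp: "compose (carrier N) v u \<in> lin_maps A N N" if "u \<in> lin_maps A N N" "v \<in> lin_maps A N N" for u v
    using lin_maps_compose[OF assms that] .
  show ?thesis
  proof (rule ringI[OF abelian_groupI monoidI])
    fix u assume u: "u \<in> carrier ?E"
    then show "\<exists>v\<in>carrier ?E. v \<oplus>\<^bsub>?E\<^esub> u = \<zero>\<^bsub>?E\<^esub>"
      using neg[of u] lin_mapsD(1)[of u A N N] by (intro bexI[of _ "\<lambda>x\<in>carrier N. \<ominus>\<^bsub>N\<^esub> u x"]) (auto simp: N.M.l_neg)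
    have "u \<in> extensional (carrier N)" using u by (auto simp: lin_maps_def PiE_def)
    then show "\<zero>\<^bsub>?E\<^esub> \<oplus>\<^bsub>?E\<^esub> u = u" "\<one>\<^bsub>?E\<^esub> \<otimes>\<^bsub>?E\<^esub> u = u" "u \<otimes>\<^bsub>?E\<^esub> \<one>\<^bsub>?E\<^esub> = u"
      using u lin_mapsD(1)[of u A N N] by (auto simp: compose_def extensional_def fun_eq_iff)
  next
    fix u v assume u: "u \<in> carrier ?E" and v: "v \<in> carrier ?E"
    show "u \<oplus>\<^bsub>?E\<^esub> v = v \<oplus>\<^bsub>?E\<^esub> u"
      using u v lin_mapsD(1)[of u A N N] lin_mapsD(1)[of v A N N] by (auto intro!: restrict_ext simp: N.M.a_comm)
    fix w assume w: "w \<in> carrier ?E"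
    show "u \<oplus>\<^bsub>?E\<^esub> v \<oplus>\<^bsub>?E\<^esub> w = u \<oplus>\<^bsub>?E\<^esub> (v \<oplus>\<^bsub>?E\<^esub> w)"
      using u v w lin_mapsD(1)[of _ A N N] by (auto intro!: restrict_ext simp: N.M.a_assoc)
    show "u \<otimes>\<^bsub>?E\<^esub> v \<otimes>\<^bsub>?E\<^esub> w = u \<otimes>\<^bsub>?E\<^esub> (v \<otimes>\<^bsub>?E\<^esub> w)"
      using u lin_mapsD(1)[of u A N N] by (auto intro!: restrict_ext simp: compose_def)
    show "(u \<oplus>\<^bsub>?E\<^esub> v) \<otimes>\<^bsub>?E\<^esub> w = u \<otimes>\<^bsub>?E\<^esub> w \<oplus>\<^bsub>?E\<^esub> v \<otimes>\<^bsub>?E\<^esub> w"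
      using u v w lin_mapsD(1,2)[of _ A N N] by (auto intro!: restrict_ext simp: compose_def)
    show "w \<otimes>\<^bsub>?E\<^esub> (u \<oplus>\<^bsub>?E\<^esub> v) = w \<otimes>\<^bsub>?E\<^esub> u \<oplus>\<^bsub>?E\<^esub> w \<otimes>\<^bsub>?E\<^esub> v"
      using u v w lin_mapsD(1,2)[of _ A N N] by (auto intro!: restrict_ext simp: compose_def)
  qed (use add zero one comp in auto)
qed

lemma finsum_End_ring:
  assumes "left_module A N" "F \<in> S \<rightarrow> lin_maps A N N" "x \<in> carrier N"
  shows "finsum (End_ring G A N) F S x = finsum N (\<lambda>i. F i x) S"
proof -
  interpret N: left_module A N by fact
  interpret E: ring "End_ring G A N" by (rule ring_End_ring[OF assms(1)])
  have "additive_map (End_ring G A N) N (\<lambda>f. f x)"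
    by (rule additive_mapI) (use assms(3) lin_mapsD(1)[of _ A N N] in auto)
  from additive_map_finsum[OF E.abelian_group_axioms N.M.abelian_group_axioms this] assms(2)
  show ?thesis by simp
qed

text \<open>As products are composed from left to right, degree l followed by degree h gives lh.
  Independence holds because the terms of a vanishing sum, applied to an element of degree g, land
  in the distinct degrees gl.\<close>

lemma is_graded_ring_END:
  assumes G: "group G" and N: "is_graded_module G A N"
  shows "is_graded_ring G (END G A N)"
proof -
  interpret G: group G by fact
  have lm: "left_module A N" and dd: "direct_decomposition N (carrier G) (mpart N)"
    using N by (auto simp: is_graded_module_def)
  interpret N: left_module A N by (rule lm)
  let ?E = "End_ring G A N"
  interpret E: ring ?E by (rule ring_End_ring[OF lm])
  note d = direct_decompositionD[OF N.M.abelian_group_axioms dd]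
  note s = additive_subgroupD[OF d(1) N.M.abelian_group_axioms]
  have neg: "\<ominus>\<^bsub>?E\<^esub> u = (\<lambda>x\<in>carrier N. \<ominus>\<^bsub>N\<^esub> u x)" if u: "u \<in> lin_maps A N N" for u
  proof (rule E.minus_equality)
    show "(\<lambda>x\<in>carrier N. \<ominus>\<^bsub>N\<^esub> u x) \<oplus>\<^bsub>?E\<^esub> u = \<zero>\<^bsub>?E\<^esub>" using lin_mapsD(1)[OF u] by (auto simp: N.M.l_neg)
    show "(\<lambda>x\<in>carrier N. \<ominus>\<^bsub>N\<^esub> u x) \<in> carrier ?E"
      using lin_mapsD[OF u] by (auto intro!: lin_mapsI[OF lm] simp: N.M.minus_add N.smult_neg)
  qed (use u in simp)
  show ?thesis unfolding END_def
  proof (rule is_graded_ring_restrict[OF G E.ring_axioms])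
    fix l assume l: "l \<in> carrier G"
    have c: "x \<in> mpart N g \<Longrightarrow> x \<in> carrier N" if "g \<in> carrier G" for g x using s(1)[OF that] by blast
    show "additive_subgroup (rpart ?E l) ?E"
    proof (rule additive_subgroupI'[OF E.abelian_group_axioms])
      show "rpart ?E l \<subseteq> carrier ?E" by (auto simp: Mor_def)
      show "\<zero>\<^bsub>?E\<^esub> \<in> rpart ?E l" using E.zero_closed s(2) l c by (auto simp: Mor_def)
      show "u \<oplus>\<^bsub>?E\<^esub> v \<in> rpart ?E l" if "u \<in> rpart ?E l" "v \<in> rpart ?E l" for u v
      proof -
        have u: "u \<in> lin_maps A N N" "\<And>g x. g \<in> carrier G \<Longrightarrow> x \<in> mpart N g \<Longrightarrow> u x \<in> mpart N (g \<otimes>\<^bsub>G\<^esub> l)"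
          and v: "v \<in> lin_maps A N N" "\<And>g x. g \<in> carrier G \<Longrightarrow> x \<in> mpart N g \<Longrightarrow> v x \<in> mpart N (g \<otimes>\<^bsub>G\<^esub> l)"
          using that unfolding End_ring_simps Mor_def by blast+
        have "u \<oplus>\<^bsub>?E\<^esub> v \<in> carrier ?E" using E.a_closed u v by simp
        then show ?thesis using u(2) v(2) s(3) l c by (auto simp: Mor_def)
      qed
      show "\<ominus>\<^bsub>?E\<^esub> u \<in> rpart ?E l" if "u \<in> rpart ?E l" for u
      proof -
        have u: "u \<in> lin_maps A N N" "\<And>g x. g \<in> carrier G \<Longrightarrow> x \<in> mpart N g \<Longrightarrow> u x \<in> mpart N (g \<otimes>\<^bsub>G\<^esub> l)"
          using that unfolding End_ring_simps Mor_def by blast+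
        have "\<ominus>\<^bsub>?E\<^esub> u \<in> carrier ?E" using E.a_inv_closed u by simp
        then show ?thesis using u s(4) l c unfolding neg[OF u(1)] by (auto simp: Mor_def)
      qed
    qed
    fix h u v assume h: "h \<in> carrier G" and uv: "u \<in> rpart ?E l" "v \<in> rpart ?E h"
    have u: "u \<in> lin_maps A N N" "\<And>g x. g \<in> carrier G \<Longrightarrow> x \<in> mpart N g \<Longrightarrow> u x \<in> mpart N (g \<otimes>\<^bsub>G\<^esub> l)"
      and v: "v \<in> lin_maps A N N" "\<And>g x. g \<in> carrier G \<Longrightarrow> x \<in> mpart N g \<Longrightarrow> v x \<in> mpart N (g \<otimes>\<^bsub>G\<^esub> h)"
      using uv unfolding End_ring_simps Mor_def by blast+
    have "u \<otimes>\<^bsub>?E\<^esub> v \<in> carrier ?E" using E.m_closed u v by simp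
    moreover have "(u \<otimes>\<^bsub>?E\<^esub> v) x \<in> mpart N (g \<otimes>\<^bsub>G\<^esub> (l \<otimes>\<^bsub>G\<^esub> h))" if g: "g \<in> carrier G" and x: "x \<in> mpart N g" for g x
      using v(2)[of "g \<otimes>\<^bsub>G\<^esub> l" "u x"] u(2)[OF g x] g l h c[OF g x] by (simp add: compose_def G.m_assoc)
    ultimately show "u \<otimes>\<^bsub>?E\<^esub> v \<in> rpart ?E (l \<otimes>\<^bsub>G\<^esub> h)" unfolding End_ring_simps(6) Mor_def by auto
  next
    show "\<one>\<^bsub>?E\<^esub> \<in> rpart ?E \<one>\<^bsub>G\<^esub>" using E.one_closed s(1) by (fastforce simp: Mor_def)
    show "independent_parts ?E (carrier G) (rpart ?E)" unfolding independent_parts_def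
    proof (intro allI impI)
      fix S F assume SF: "finite S \<and> S \<subseteq> carrier G \<and> F \<in> (\<Pi> i\<in>S. rpart ?E i) \<and> finsum ?E F S = \<zero>\<^bsub>?E\<^esub>"
      then have FM: "F l \<in> Mor G A N l" if "l \<in> S" for l using that by (auto simp: Pi_iff)
      have F: "F l \<in> lin_maps A N N" "\<And>g x. g \<in> carrier G \<Longrightarrow> x \<in> mpart N g \<Longrightarrow> F l x \<in> mpart N (g \<otimes>\<^bsub>G\<^esub> l)"
        if "l \<in> S" for l using FM[OF that] unfolding Mor_def by blast+
      have 0: "F l x = \<zero>\<^bsub>N\<^esub>" if g: "g \<in> carrier G" and x: "x \<in> mpart N g" and l: "l \<in> S" for g x l
      proof -
        have xN: "x \<in> carrier N" using s(1)[OF g] x by blast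
        have *: "finsum N (\<lambda>i. F i x) S = \<zero>\<^bsub>N\<^esub>"
          using finsum_End_ring[OF lm, of F S x G] SF F(1) xN by auto
        have inj: "inj_on (\<lambda>l. g \<otimes>\<^bsub>G\<^esub> l) S" using SF g by (metis G.inj_on_cmult inj_on_subset)
        \<comment> \<open>Independence in \<open>N\<close> is indexed by degrees, so the values are
          reindexed from l to k = gl.\<close>
        let ?f = "\<lambda>k. F (inv\<^bsub>G\<^esub> g \<otimes>\<^bsub>G\<^esub> k) x"
        have bck: "inv\<^bsub>G\<^esub> g \<otimes>\<^bsub>G\<^esub> (g \<otimes>\<^bsub>G\<^esub> l) = l" if "l \<in> S" for l
          using that SF g by (auto simp: G.m_assoc[symmetric] subset_iff)
        have fx: "F l x \<in> mpart N (g \<otimes>\<^bsub>G\<^esub> l)" if "l \<in> S" for l using F(2)[OF that g x] .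
        have fN: "F l x \<in> carrier N" if "l \<in> S" for l using lin_mapsD(1)[OF F(1)[OF that] xN] .
        have gl: "g \<otimes>\<^bsub>G\<^esub> l \<in> carrier G" if "l \<in> S" for l using that g SF by auto
        have "finsum N ?f ((\<lambda>l. g \<otimes>\<^bsub>G\<^esub> l) ` S) = finsum N (\<lambda>l. ?f (g \<otimes>\<^bsub>G\<^esub> l)) S"
          by (rule N.M.finsum_reindex[OF _ inj]) (use bck fN in auto)
        also have "\<dots> = finsum N (\<lambda>i. F i x) S"
          by (rule N.M.finsum_cong') (use bck fN in auto)
        finally have "finsum N ?f ((\<lambda>l. g \<otimes>\<^bsub>G\<^esub> l) ` S) = \<zero>\<^bsub>N\<^esub>" using * by simp
        moreover have "?f \<in> (\<Pi> k\<in>(\<lambda>l. g \<otimes>\<^bsub>G\<^esub> l) ` S. mpart N k)" using fx bck by auto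
        moreover have "finite ((\<lambda>l. g \<otimes>\<^bsub>G\<^esub> l) ` S)" "(\<lambda>l. g \<otimes>\<^bsub>G\<^esub> l) ` S \<subseteq> carrier G" using SF gl by auto
        ultimately have "\<forall>k\<in>(\<lambda>l. g \<otimes>\<^bsub>G\<^esub> l) ` S. ?f k = \<zero>\<^bsub>N\<^esub>"
          using d(3) unfolding independent_parts_def by blast
        then show ?thesis using l bck by force
      qed
      show "\<forall>l\<in>S. F l = \<zero>\<^bsub>?E\<^esub>"
      proof
        fix l assume l: "l \<in> S"
        show "F l = \<zero>\<^bsub>?E\<^esub>"
        proof (rule lin_maps_eqI[OF F(1)[OF l]])
          show "\<zero>\<^bsub>?E\<^esub> \<in> lin_maps A N N" using E.zero_closed by simp
          fix x assume x: "x \<in> carrier N"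
          have "sum_of_parts N (carrier G) (mpart N) \<subseteq> {x \<in> carrier N. F l x = \<zero>\<^bsub>N\<^esub>}"
          proof (rule sum_of_parts_least[OF N.M.abelian_group_axioms])
            note am = lin_mapsD(4)[OF F(1)[OF l]]
            show "additive_subgroup {x \<in> carrier N. F l x = \<zero>\<^bsub>N\<^esub>} N"
              by (rule additive_subgroupI'[OF N.M.abelian_group_axioms])
                (use lin_mapsD[OF F(1)[OF l]] additive_map_zero[OF N.M.abelian_group_axioms N.M.abelian_group_axioms am]
                  additive_map_neg[OF N.M.abelian_group_axioms N.M.abelian_group_axioms am] in auto)
            show "mpart N g \<subseteq> {x \<in> carrier N. F l x = \<zero>\<^bsub>N\<^esub>}" if "g \<in> carrier G" for g
              using 0[OF that _ l] s(1)[OF that] by auto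
          qed
          then show "F l x = \<zero>\<^bsub>?E\<^esub> x" using d(2) x by auto
        qed
      qed
    qed
  qed
qed

lemma set_prodE:
  assumes "z \<in> set_prod A X Y"
  obtains n x y where "\<And>i. i < n \<Longrightarrow> x i \<in> X" "\<And>i. i < n \<Longrightarrow> y i \<in> Y"
    "finsum A (\<lambda>i. x i \<otimes>\<^bsub>A\<^esub> y i) {..<n::nat} = z"
  using assms unfolding set_prod_def by blast

lemma ring_opposite:
  assumes "ring R"
  shows "ring (opposite_ring R)"
proof -
  interpret ring R by fact
  show ?thesis
  proof (rule ringI[OF abelian_groupI monoidI])
    show "\<exists>y\<in>carrier (opposite_ring R). y \<oplus>\<^bsub>opposite_ring R\<^esub> x = \<zero>\<^bsub>opposite_ring R\<^esub>"
      if "x \<in> carrier (opposite_ring R)" for x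
      using that by (intro bexI[of _ "\<ominus>\<^bsub>R\<^esub> x"]) (simp_all add: l_neg)
  qed (simp_all add: a_ac m_assoc l_distr r_distr)
qed

subsection \<open>Graded modules with a homogeneous dual basis\<close>

lemma base_ring_simps [simp]:
  "carrier (base_ring G A) = rpart A \<one>\<^bsub>G\<^esub>" "mult (base_ring G A) = mult A" "one (base_ring G A) = one A"
  "\<zero>\<^bsub>base_ring G A\<^esub> = \<zero>\<^bsub>A\<^esub>" "add (base_ring G A) = add A"
  by (simp_all add: base_ring_def)

text \<open>A common setting for \<open>A\<close>, its restrictions to subgroups and endomorphism
  rings. That 1 has neutral degree makes the degree-one part a unital ring.\<close>

locale graded_unital =
  fixes G :: "('g, 'h) monoid_scheme" and A :: "('g, 'a) graded_ring" (structure)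
  assumes graded: "is_graded_ring G A" and one_part: "\<one> \<in> rpart A \<one>\<^bsub>G\<^esub>"
begin

sublocale G: group G
  using graded by (simp add: is_graded_ring_def)

sublocale A: ring A
  using graded by (simp add: is_graded_ring_def)

abbreviation "R \<equiv> base_ring G A"

lemma part_decomposition: "direct_decomposition A (carrier G) (rpart A)"
  using graded by (simp add: is_graded_ring_def)

lemmas part_subgroup = direct_decompositionD(1)[OF A.abelian_group_axioms part_decomposition]
lemmas part_sum = direct_decompositionD(2)[OF A.abelian_group_axioms part_decomposition]
lemmas part_ind = direct_decompositionD(3)[OF A.abelian_group_axioms part_decomposition]
lemmas part = additive_subgroupD[OF part_subgroup A.abelian_group_axioms]

lemma part_closed: "g \<in> carrier G \<Longrightarrow> x \<in> rpart A g \<Longrightarrow> x \<in> carrier A"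
  using part(1) by blast

lemma part_mult:
  assumes "g \<in> carrier G" "h \<in> carrier G" "x \<in> rpart A g" "y \<in> rpart A h"
  shows "x \<otimes> y \<in> rpart A (g \<otimes>\<^bsub>G\<^esub> h)"
proof -
  have "x \<otimes> y \<in> set_prod A (rpart A g) (rpart A h)"
    by (rule set_prod_incl[OF A.abelian_group_axioms assms(3,4)]) (use assms part_closed in auto)
  then show ?thesis using graded assms(1,2) unfolding is_graded_ring_def by blast
qed

lemma part_mult_l: "g \<in> carrier G \<Longrightarrow> r \<in> rpart A \<one>\<^bsub>G\<^esub> \<Longrightarrow> x \<in> rpart A g \<Longrightarrow> r \<otimes> x \<in> rpart A g"
  using part_mult[of "\<one>\<^bsub>G\<^esub>" g r x] by simp

lemma part_mult_r: "g \<in> carrier G \<Longrightarrow> r \<in> rpart A \<one>\<^bsub>G\<^esub> \<Longrightarrow> x \<in> rpart A g \<Longrightarrow> x \<otimes> r \<in> rpart A g"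
  using part_mult[of g "\<one>\<^bsub>G\<^esub>" x r] by simp

lemma part_finsum: "g \<in> carrier G \<Longrightarrow> f \<in> I \<rightarrow> rpart A g \<Longrightarrow> finsum A f I \<in> rpart A g"
  using A.finsum_in_subset[OF part(2,3,1)] by blast

lemma ring_R: "ring R"
proof -
  have "abelian_group R" unfolding base_ring_def
    by (rule abelian_group_restrict[OF A.abelian_group_axioms part_subgroup]) simp
  then show ?thesis
    by (rule ringI[OF _ monoidI])
      (use one_part part_mult_l part_closed[OF G.one_closed] in \<open>auto simp: A.m_assoc A.l_distr A.r_distr\<close>)
qed

sublocale R: ring R
  by (rule ring_R)

lemma R_closed: "r \<in> rpart A \<one>\<^bsub>G\<^esub> \<Longrightarrow> r \<in> carrier A"
  using part_closed by blast

lemma finsum_R: "f \<in> I \<rightarrow> rpart A \<one>\<^bsub>G\<^esub> \<Longrightarrow> finsum R f I = finsum A f I"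
  by (rule finsum_same[OF A.abelian_monoid_axioms R.abelian_monoid_axioms]) (use part_closed in auto)

lemma bimodule_sub:
  assumes Y: "additive_subgroup Y A"
    and l: "\<And>r y. r \<in> rpart A \<one>\<^bsub>G\<^esub> \<Longrightarrow> y \<in> Y \<Longrightarrow> r \<otimes> y \<in> Y"
    and r: "\<And>r y. r \<in> rpart A \<one>\<^bsub>G\<^esub> \<Longrightarrow> y \<in> Y \<Longrightarrow> y \<otimes> r \<in> Y"
  shows "bimodule R (sub_bimodule A Y)"
proof -
  have ab: "abelian_group (A\<lparr>carrier := Y\<rparr>)" by (rule abelian_group_restrict[OF A.abelian_group_axioms Y])
  note g = abelian_groupE[OF ab, simplified]
  note op = ring_opposite[OF ring_R]
  have Yc: "y \<in> carrier A" if "y \<in> Y" for y using additive_subgroupD(1)[OF Y A.abelian_group_axioms] that by blast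
  have ab1: "abelian_group (sub_bimodule A Y)" and ab2: "abelian_group (right_part (sub_bimodule A Y))"
    using g by (auto intro!: abelian_groupI)
  show ?thesis unfolding bimodule_def
  proof (intro conjI ballI)
    show "left_module R (sub_bimodule A Y)"
      by (rule left_moduleI[OF ring_R ab1]) (use l Yc R_closed in \<open>auto simp: A.l_distr A.r_distr A.m_assoc\<close>)
    show "left_module (opposite_ring R) (right_part (sub_bimodule A Y))"
      by (rule left_moduleI[OF op ab2]) (use r Yc R_closed in \<open>auto simp: A.l_distr A.r_distr A.m_assoc\<close>)
  qed (use Yc R_closed in \<open>auto simp: A.m_assoc\<close>)
qed

lemma bimodule_part: "g \<in> carrier G \<Longrightarrow> bimodule R (sub_bimodule A (rpart A g))"
  by (rule bimodule_sub[OF part_subgroup]) (auto simp: part_mult_l part_mult_r)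

lemma carrier_subgroup: "additive_subgroup (carrier A) A"
  by (rule additive_subgroupI'[OF A.abelian_group_axioms]) auto

lemma bimodule_A: "bimodule R (sub_bimodule A (carrier A))"
  by (rule bimodule_sub[OF carrier_subgroup]) (auto simp: R_closed)

end

text \<open>The last clause lets the coordinates determine the grading, so that questions about
  degrees in the module become questions about elements of \<open>A\<close>. The clause before it
  places the basis elements in degree one.\<close>

definition graded_dual_basis ::
  "('g, 'h) monoid_scheme \<Rightarrow> ('g, 'a) graded_ring \<Rightarrow> ('g, 'a, 'b) graded_module \<Rightarrow>
    'i set \<Rightarrow> ('i \<Rightarrow> 'b) \<Rightarrow> ('i \<Rightarrow> 'b \<Rightarrow> 'a) \<Rightarrow> bool"
  where "graded_dual_basis G A N I p \<phi> \<longleftrightarrow> left_module A N \<and> dual_basis A N I p \<phi> \<and>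
    (\<forall>i\<in>I. \<forall>j\<in>I. \<phi> j (p i) \<in> rpart A \<one>\<^bsub>G\<^esub>) \<and>
    (\<forall>g\<in>carrier G. mpart N g = {x \<in> carrier N. \<forall>i\<in>I. \<phi> i x \<in> rpart A g})"

locale graded_basis = graded_unital G A
  for G :: "('g, 'h) monoid_scheme" and A :: "('g, 'a) graded_ring" (structure) +
  fixes N :: "('g, 'a, 'b) graded_module" and I :: "'i set" and p \<phi>
  assumes gdb: "graded_dual_basis G A N I p \<phi>"
begin

sublocale N: left_module A N
  using gdb by (simp add: graded_dual_basis_def)

lemma db: "dual_basis A N I p \<phi>"
  using gdb by (simp add: graded_dual_basis_def)

lemmas d = dual_basisD[OF db]

lemma \<phi>_p: "i \<in> I \<Longrightarrow> j \<in> I \<Longrightarrow> \<phi> j (p i) \<in> rpart A \<one>\<^bsub>G\<^esub>"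
  using gdb by (simp add: graded_dual_basis_def)

lemma mpart_iff: "g \<in> carrier G \<Longrightarrow> x \<in> mpart N g \<longleftrightarrow> x \<in> carrier N \<and> (\<forall>i\<in>I. \<phi> i x \<in> rpart A g)"
  using gdb by (simp add: graded_dual_basis_def)

lemma mpart_closed: "g \<in> carrier G \<Longrightarrow> x \<in> mpart N g \<Longrightarrow> x \<in> carrier N"
  using mpart_iff by blast

lemma p_part: "i \<in> I \<Longrightarrow> p i \<in> mpart N \<one>\<^bsub>G\<^esub>"
  using mpart_iff[of "\<one>\<^bsub>G\<^esub>"] \<phi>_p d(2) by simp

lemma mpart_subgroup:
  assumes g: "g \<in> carrier G"
  shows "additive_subgroup (mpart N g) N"
proof (rule additive_subgroupI'[OF N.M.abelian_group_axioms])
  have z: "\<phi> i \<zero>\<^bsub>N\<^esub> = \<zero>" if "i \<in> I" for i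
    by (rule additive_map_zero[OF N.M.abelian_group_axioms A.abelian_group_axioms d(8)[OF that]])
  have n: "\<phi> i (\<ominus>\<^bsub>N\<^esub> x) = \<ominus> \<phi> i x" if "i \<in> I" "x \<in> carrier N" for i x
    by (rule additive_map_neg[OF N.M.abelian_group_axioms A.abelian_group_axioms d(8)[OF that(1)] that(2)])
  show "mpart N g \<subseteq> carrier N" using mpart_closed g by blast
  show "\<zero>\<^bsub>N\<^esub> \<in> mpart N g" using z part(2) g by (simp add: mpart_iff)
  show "x \<oplus>\<^bsub>N\<^esub> y \<in> mpart N g" if "x \<in> mpart N g" "y \<in> mpart N g" for x y
    using that g part(3) by (simp add: mpart_iff d(4))
  show "\<ominus>\<^bsub>N\<^esub> x \<in> mpart N g" if "x \<in> mpart N g" for x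
    using that g part(4) by (simp add: mpart_iff n)
qed

lemmas mpart = additive_subgroupD[OF mpart_subgroup N.M.abelian_group_axioms]

lemma smult_mpart:
  assumes "g \<in> carrier G" "h \<in> carrier G" "a \<in> rpart A g" "x \<in> mpart N h"
  shows "a \<odot>\<^bsub>N\<^esub> x \<in> mpart N (g \<otimes>\<^bsub>G\<^esub> h)"
  using assms part_mult part_closed by (simp add: mpart_iff N.smult_closed d(5))

lemma smult_p: "g \<in> carrier G \<Longrightarrow> a \<in> rpart A g \<Longrightarrow> i \<in> I \<Longrightarrow> a \<odot>\<^bsub>N\<^esub> p i \<in> mpart N g"
  using smult_mpart[of g "\<one>\<^bsub>G\<^esub>" a "p i"] p_part by simp

text \<open>Homogeneous elements span because \<open>A\<close> is spanned by its components and
  homogeneous multiples of the \<open>p i\<close> are homogeneous; independence is tested in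
  \<open>A\<close>, one coordinate at a time.\<close>

lemma graded_module: "is_graded_module G A N"
  unfolding is_graded_module_def
proof (intro conjI ballI N.left_module_axioms)
  have sub: "additive_subgroup (sum_of_parts N (carrier G) (mpart N)) N"
    by (rule sum_of_parts_subgroup[OF N.M.abelian_group_axioms mpart_subgroup])
  note s = additive_subgroupD[OF sub N.M.abelian_group_axioms]
  show "direct_decomposition N (carrier G) (mpart N)"
  proof (rule direct_decompositionI[OF N.M.abelian_group_axioms mpart_subgroup])
    have ap: "a \<odot>\<^bsub>N\<^esub> p i \<in> sum_of_parts N (carrier G) (mpart N)" if i: "i \<in> I" and a: "a \<in> carrier A" for i a
    proof -
      have "sum_of_parts A (carrier G) (rpart A) \<subseteq> {a \<in> carrier A. a \<odot>\<^bsub>N\<^esub> p i \<in> sum_of_parts N (carrier G) (mpart N)}"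
      proof (rule sum_of_parts_least[OF A.abelian_group_axioms])
        show "additive_subgroup {a \<in> carrier A. a \<odot>\<^bsub>N\<^esub> p i \<in> sum_of_parts N (carrier G) (mpart N)} A"
          by (rule additive_subgroupI'[OF A.abelian_group_axioms])
            (use s d(2)[OF i] in \<open>auto simp: N.smult_l_null N.smult_l_distr N.neg_smult\<close>)
        show "rpart A g \<subseteq> {a \<in> carrier A. a \<odot>\<^bsub>N\<^esub> p i \<in> sum_of_parts N (carrier G) (mpart N)}"
          if g: "g \<in> carrier G" for g
          using part_closed[OF g] smult_p[OF g _ i] mpart_closed[OF g]
            sum_of_parts_incl[OF N.M.abelian_group_axioms g, of _ "mpart N"] by blast
      qed
      then show ?thesis using a part_sum by blast
    qed
    show "carrier N \<subseteq> sum_of_parts N (carrier G) (mpart N)"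
    proof
      fix x assume x: "x \<in> carrier N"
      have "finsum N (\<lambda>i. \<phi> i x \<odot>\<^bsub>N\<^esub> p i) I \<in> sum_of_parts N (carrier G) (mpart N)"
        by (rule N.M.finsum_in_subset[OF s(2,3,1)]) (use ap d(3) x in auto)
      then show "x \<in> sum_of_parts N (carrier G) (mpart N)" using d(6)[OF x] by simp
    qed
    show "independent_parts N (carrier G) (mpart N)" unfolding independent_parts_def
    proof (intro allI impI)
      fix S f assume S: "finite S \<and> S \<subseteq> carrier G \<and> f \<in> (\<Pi> i\<in>S. mpart N i) \<and> finsum N f S = \<zero>\<^bsub>N\<^esub>"
      then have f: "f g \<in> mpart N g" "g \<in> carrier G" if "g \<in> S" for g using that by auto
      have fc: "f \<in> S \<rightarrow> carrier N" using f mpart_closed by blast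
      have "\<phi> i (f g) = \<zero>" if i: "i \<in> I" and g: "g \<in> S" for i g
      proof -
        have "finsum A (\<lambda>g. \<phi> i (f g)) S = \<phi> i \<zero>\<^bsub>N\<^esub>"
          using additive_map_finsum[OF N.M.abelian_group_axioms A.abelian_group_axioms d(8)[OF i] fc] S by simp
        then have "finsum A (\<lambda>g. \<phi> i (f g)) S = \<zero>"
          using additive_map_zero[OF N.M.abelian_group_axioms A.abelian_group_axioms d(8)[OF i]] by simp
        moreover have "(\<lambda>g. \<phi> i (f g)) \<in> (\<Pi> g\<in>S. rpart A g)" using f mpart_iff i by auto
        ultimately show ?thesis using part_ind S g unfolding independent_parts_def by blast
      qed
      then have "f g = \<zero>\<^bsub>N\<^esub>" if g: "g \<in> S" for g
      proof -
        have "f g = finsum N (\<lambda>i. \<phi> i (f g) \<odot>\<^bsub>N\<^esub> p i) I" using d(6) fc g by force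
        also have "\<dots> = \<zero>\<^bsub>N\<^esub>"
          using \<open>\<And>i g. i \<in> I \<Longrightarrow> g \<in> S \<Longrightarrow> \<phi> i (f g) = \<zero>\<close> g d(2)
          by (intro N.M.add.finprod_one_eqI) (simp add: N.smult_l_null)
        finally show ?thesis .
      qed
      then show "\<forall>g\<in>S. f g = \<zero>\<^bsub>N\<^esub>" by blast
    qed
  qed
qed (use smult_mpart in blast)

text \<open>If x has degree g, each coefficient \<open>\<phi> i x\<close> has degree g, and its
  multiple of \<open>q i\<close> has degree gl.\<close>

lemma Mor_extend:
  assumes l: "l \<in> carrier G" and q: "\<And>i. i \<in> I \<Longrightarrow> q i \<in> mpart N l"
  shows "(\<lambda>x\<in>carrier N. finsum N (\<lambda>i. \<phi> i x \<odot>\<^bsub>N\<^esub> q i) I) \<in> Mor G A N l"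
  unfolding Mor_def
proof (intro CollectI conjI ballI subsetI)
  show "(\<lambda>x\<in>carrier N. finsum N (\<lambda>i. \<phi> i x \<odot>\<^bsub>N\<^esub> q i) I) \<in> lin_maps A N N"
    by (rule dual_basis_extend[OF N.left_module_axioms N.left_module_axioms db])
      (use q mpart_closed[OF l] in blast)
  fix g y assume g: "g \<in> carrier G" and y: "y \<in> (\<lambda>x\<in>carrier N. finsum N (\<lambda>i. \<phi> i x \<odot>\<^bsub>N\<^esub> q i) I) ` mpart N g"
  then obtain x where x: "x \<in> mpart N g" "y = finsum N (\<lambda>i. \<phi> i x \<odot>\<^bsub>N\<^esub> q i) I"
    using mpart_closed[OF g] by auto
  have gl: "g \<otimes>\<^bsub>G\<^esub> l \<in> carrier G" using g l by simp
  show "y \<in> mpart N (g \<otimes>\<^bsub>G\<^esub> l)" unfolding x(2)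
    by (rule N.M.finsum_in_subset[OF mpart(2,3,1)[OF gl]])
      (use x(1) q l g smult_mpart in \<open>auto simp: mpart_iff\<close>)
qed

lemma lin_maps_eq_on_p:
  assumes "f \<in> lin_maps A N N" "g \<in> lin_maps A N N" "\<And>i. i \<in> I \<Longrightarrow> f (p i) = g (p i)"
  shows "f = g"
proof (rule lin_maps_eqI[OF assms(1,2)])
  fix x assume x: "x \<in> carrier N"
  have "f x = finsum N (\<lambda>i. \<phi> i x \<odot>\<^bsub>N\<^esub> f (p i)) I"
    by (rule dual_basis_linear_eq[OF N.left_module_axioms N.left_module_axioms db assms(1) x])
  also have "\<dots> = finsum N (\<lambda>i. \<phi> i x \<odot>\<^bsub>N\<^esub> g (p i)) I"
    using assms(3) lin_mapsD(1)[OF assms(2)] d(2,3) x by (intro N.M.finsum_cong') (auto simp: N.smult_closed)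
  also have "\<dots> = g x"
    by (rule dual_basis_linear_eq[OF N.left_module_axioms N.left_module_axioms db assms(2) x, symmetric])
  finally show "f x = g x" .
qed

lemma left_module_mpart:
  assumes g: "g \<in> carrier G"
  shows "left_module R (N\<lparr>carrier := mpart N g\<rparr>)"
proof (rule left_moduleI[OF ring_R abelian_group_restrict[OF N.M.abelian_group_axioms mpart_subgroup[OF g]]])
  show "a \<odot>\<^bsub>N\<lparr>carrier := mpart N g\<rparr>\<^esub> x \<in> carrier (N\<lparr>carrier := mpart N g\<rparr>)"
    if "a \<in> carrier R" "x \<in> carrier (N\<lparr>carrier := mpart N g\<rparr>)" for a x
    using that smult_mpart[of "\<one>\<^bsub>G\<^esub>" g a x] g by simp
qed (use mpart_closed[OF g] R_closed in \<open>auto simp: N.smult_l_distr N.smult_r_distr N.smult_assoc1 N.smult_one\<close>)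

text \<open>
  An \<open>R\<close>-isomorphism from degree \<open>1\<close> to degree \<open>g\<close> extends \<open>A\<close>-linearly. The extension of
  its inverse \<open>\<psi>\<close> sends \<open>p\<^sub>i\<close> to \<open>\<Sum> b\<^sub>k \<psi>(a\<^sub>k p\<^sub>i)\<close>, where \<open>1 = \<Sum> b\<^sub>k a\<^sub>k\<close>.
\<close>

lemma Mor_unit:
  assumes g: "g \<in> carrier G" and one: "\<one> \<in> set_prod A (rpart A (inv\<^bsub>G\<^esub> g)) (rpart A g)"
    and iso: "module_iso R (N\<lparr>carrier := mpart N \<one>\<^bsub>G\<^esub>\<rparr>) (N\<lparr>carrier := mpart N g\<rparr>)"
  obtains u v where "u \<in> Mor G A N g" "v \<in> Mor G A N (inv\<^bsub>G\<^esub> g)"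
    "compose (carrier N) v u = (\<lambda>x\<in>carrier N. x)" "compose (carrier N) u v = (\<lambda>x\<in>carrier N. x)"
proof -
  let ?N1 = "N\<lparr>carrier := mpart N \<one>\<^bsub>G\<^esub>\<rparr>" and ?Ng = "N\<lparr>carrier := mpart N g\<rparr>"
  have ig: "inv\<^bsub>G\<^esub> g \<in> carrier G" using g by simp
  note c1 = mpart_closed[OF G.one_closed] and cg = mpart_closed[OF g]
  interpret N1: left_module R ?N1 by (rule left_module_mpart) simp
  interpret Ng: left_module R ?Ng by (rule left_module_mpart[OF g])
  obtain \<theta> where \<theta>: "\<theta> \<in> lin_maps R ?N1 ?Ng" "bij_betw \<theta> (mpart N \<one>\<^bsub>G\<^esub>) (mpart N g)"
    using iso by (auto simp: module_iso_def)
  define \<psi> where "\<psi> = restrict (inv_into (mpart N \<one>\<^bsub>G\<^esub>) \<theta>) (mpart N g)"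
  have \<psi>: "\<psi> \<in> lin_maps R ?Ng ?N1"
    using lin_maps_inv[OF N1.left_module_axioms Ng.left_module_axioms \<theta>(1)] \<theta>(2) by (simp add: \<psi>_def)
  have t: "\<theta> x \<in> mpart N g" "\<psi> (\<theta> x) = x" if "x \<in> mpart N \<one>\<^bsub>G\<^esub>" for x
    using \<theta>(2) that by (auto simp: \<psi>_def bij_betw_inv_into_left bij_betw_apply)
  have y: "\<psi> x \<in> mpart N \<one>\<^bsub>G\<^esub>" "\<theta> (\<psi> x) = x" if "x \<in> mpart N g" for x
    using \<theta>(2) that by (auto simp: \<psi>_def bij_betw_inv_into_right bij_betw_def inv_into_into)
  obtain n b a where ba: "\<And>k. k < n \<Longrightarrow> b k \<in> rpart A (inv\<^bsub>G\<^esub> g)" "\<And>k. k < n \<Longrightarrow> a k \<in> rpart A g"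
    and sum: "finsum A (\<lambda>k. b k \<otimes> a k) {..<n::nat} = \<one>"
    using one by (rule set_prodE) (rule that)
  have bc: "\<And>k. k < n \<Longrightarrow> b k \<in> carrier A" and ac: "\<And>k. k < n \<Longrightarrow> a k \<in> carrier A"
    using ba part_closed g ig by blast+
  define u where "u = (\<lambda>x\<in>carrier N. finsum N (\<lambda>i. \<phi> i x \<odot>\<^bsub>N\<^esub> \<theta> (p i)) I)"
  define w where "w i = finsum N (\<lambda>k. b k \<odot>\<^bsub>N\<^esub> \<psi> (a k \<odot>\<^bsub>N\<^esub> p i)) {..<n}" for i
  define v where "v = (\<lambda>x\<in>carrier N. finsum N (\<lambda>i. \<phi> i x \<odot>\<^bsub>N\<^esub> w i) I)"
  have ap: "a k \<odot>\<^bsub>N\<^esub> p i \<in> mpart N g" if "k < n" "i \<in> I" for k i using smult_p[OF g ba(2)[OF that(1)] that(2)] .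
  have w: "w i \<in> mpart N (inv\<^bsub>G\<^esub> g)" if i: "i \<in> I" for i
    unfolding w_def
  proof (rule N.M.finsum_in_subset[OF mpart(2,3,1)[OF ig]])
    show "(\<lambda>k. b k \<odot>\<^bsub>N\<^esub> \<psi> (a k \<odot>\<^bsub>N\<^esub> p i)) \<in> {..<n} \<rightarrow> mpart N (inv\<^bsub>G\<^esub> g)"
      using smult_mpart[OF ig G.one_closed ba(1) y(1)[OF ap[OF _ i]]] ig by auto
  qed
  have u: "u \<in> Mor G A N g" unfolding u_def by (rule Mor_extend[OF g]) (use t p_part in blast)
  have v: "v \<in> Mor G A N (inv\<^bsub>G\<^esub> g)" unfolding v_def by (rule Mor_extend[OF ig w])
  have ul: "u \<in> lin_maps A N N" and vl: "v \<in> lin_maps A N N" using u v by (auto simp: Mor_def)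
  note uD = lin_mapsD[OF ul] and vD = lin_mapsD[OF vl]
  \<comment> \<open>For elements of degree one the coordinates lie in \<open>R\<close>, so
    R-linearity of \<open>\<theta>\<close> is enough to compute the A-linear map
    \<open>u\<close>.\<close>
  have u1: "u x = \<theta> x" if x: "x \<in> mpart N \<one>\<^bsub>G\<^esub>" for x
  proof -
    have xc: "x \<in> carrier N" using c1 x by blast
    have \<phi>x: "\<phi> i x \<in> rpart A \<one>\<^bsub>G\<^esub>" if "i \<in> I" for i using x that mpart_iff[OF G.one_closed] by blast
    have "\<theta> x = \<theta> (finsum N (\<lambda>i. \<phi> i x \<odot>\<^bsub>N\<^esub> p i) I)" using d(6)[OF xc] by simp
    also have "finsum N (\<lambda>i. \<phi> i x \<odot>\<^bsub>N\<^esub> p i) I = finsum ?N1 (\<lambda>i. \<phi> i x \<odot>\<^bsub>N\<^esub> p i) I"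
      by (rule finsum_same[symmetric, OF N.M.abelian_monoid_axioms N1.M.abelian_monoid_axioms])
        (use c1 smult_p[OF G.one_closed] \<phi>x in auto)
    also have "\<theta> \<dots> = finsum ?Ng (\<lambda>i. \<theta> (\<phi> i x \<odot>\<^bsub>N\<^esub> p i)) I"
      by (rule additive_map_finsum[OF N1.M.abelian_group_axioms Ng.M.abelian_group_axioms lin_mapsD(4)[OF \<theta>(1)]])
        (use smult_p[OF G.one_closed] \<phi>x in auto)
    also have "\<dots> = finsum N (\<lambda>i. \<theta> (\<phi> i x \<odot>\<^bsub>N\<^esub> p i)) I"
      by (rule finsum_same[OF N.M.abelian_monoid_axioms Ng.M.abelian_monoid_axioms])
        (use cg t(1) smult_p[OF G.one_closed] \<phi>x in auto)
    also have "\<dots> = finsum N (\<lambda>i. \<phi> i x \<odot>\<^bsub>N\<^esub> \<theta> (p i)) I"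
    proof (rule N.M.finsum_cong')
      show "\<theta> (\<phi> i x \<odot>\<^bsub>N\<^esub> p i) = \<phi> i x \<odot>\<^bsub>N\<^esub> \<theta> (p i)" if "i \<in> I" for i
        using lin_mapsD(3)[OF \<theta>(1), of "\<phi> i x" "p i"] \<phi>x[OF that] p_part[OF that] by simp
    qed (use t(1) cg p_part \<phi>x R_closed in \<open>auto intro!: N.smult_closed\<close>)
    finally show ?thesis using xc by (simp add: u_def)
  qed
  have vg: "v x = \<psi> x" if x: "x \<in> mpart N g" for x
  proof -
    have xc: "x \<in> carrier N" using cg x by blast
    have \<phi>x: "\<phi> i x \<in> rpart A g" if "i \<in> I" for i using x that mpart_iff[OF g] by blast
    have \<phi>b: "\<phi> i x \<otimes> b k \<in> rpart A \<one>\<^bsub>G\<^esub>" if "i \<in> I" "k < n" for i k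
      using part_mult[OF g ig \<phi>x ba(1)] that g by simp
    let ?K = "I \<times> {..<n}"
    \<comment> \<open>Inserting 1 as the sum of the \<open>b k \<otimes> a k\<close> rewrites x with
      coefficients \<open>\<phi> i x \<otimes> b k\<close> from \<open>R\<close> in front of
      elements of degree g, so that the R-linear map \<open>\<psi>\<close> applies.\<close>
    define F where "F = (\<lambda>(i, k). (\<phi> i x \<otimes> b k) \<odot>\<^bsub>N\<^esub> (a k \<odot>\<^bsub>N\<^esub> p i))"
    have Fg: "F z \<in> mpart N g" if "z \<in> ?K" for z
      using that smult_mpart[OF G.one_closed g \<phi>b ap] g by (auto simp: F_def)
    note double = N.M.finsum_Times[OF d(1) finite_lessThan]
    have "x = finsum N (\<lambda>i. finsum N (\<lambda>k. F (i, k)) {..<n}) I"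
    proof -
      have "finsum N (\<lambda>k. F (i, k)) {..<n} = \<phi> i x \<odot>\<^bsub>N\<^esub> p i" if i: "i \<in> I" for i
      proof -
        note pi = d(2)[OF i]
        have fx: "\<phi> i x \<in> carrier A" using d(3)[OF i xc] .
        have "finsum N (\<lambda>k. F (i, k)) {..<n} = finsum N (\<lambda>k. (\<phi> i x \<otimes> (b k \<otimes> a k)) \<odot>\<^bsub>N\<^esub> p i) {..<n}"
          using pi fx bc ac by (intro N.M.finsum_cong') (auto simp: F_def N.smult_assoc1 A.m_assoc N.smult_closed)
        also have "\<dots> = finsum A (\<lambda>k. \<phi> i x \<otimes> (b k \<otimes> a k)) {..<n} \<odot>\<^bsub>N\<^esub> p i"
          using pi fx bc ac by (intro N.finsum_smult_l[symmetric]) auto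
        also have "finsum A (\<lambda>k. \<phi> i x \<otimes> (b k \<otimes> a k)) {..<n} = \<phi> i x \<otimes> finsum A (\<lambda>k. b k \<otimes> a k) {..<n}"
          using fx bc ac by (intro A.finsum_rdistr[symmetric]) auto
        finally show ?thesis using sum fx by simp
      qed
      then have "finsum N (\<lambda>i. finsum N (\<lambda>k. F (i, k)) {..<n}) I = finsum N (\<lambda>i. \<phi> i x \<odot>\<^bsub>N\<^esub> p i) I"
        using d xc by (intro N.M.finsum_cong') (auto intro!: N.smult_closed)
      then show ?thesis using d(6)[OF xc] by simp
    qed
    also have "\<dots> = finsum N F ?K" by (rule double) (use Fg cg in blast)
    also have "\<dots> = finsum ?Ng F ?K"
      by (rule finsum_same[symmetric, OF N.M.abelian_monoid_axioms Ng.M.abelian_monoid_axioms]) (use Fg cg in auto)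
    finally have "\<psi> x = \<psi> (finsum ?Ng F ?K)" by simp
    also have "\<dots> = finsum ?N1 (\<lambda>z. \<psi> (F z)) ?K"
      by (rule additive_map_finsum[OF Ng.M.abelian_group_axioms N1.M.abelian_group_axioms lin_mapsD(4)[OF \<psi>]])
        (use Fg in auto)
    also have "\<dots> = finsum N (\<lambda>z. \<psi> (F z)) ?K"
      by (rule finsum_same[OF N.M.abelian_monoid_axioms N1.M.abelian_monoid_axioms]) (use Fg c1 y in auto)
    also have "\<dots> = finsum N (\<lambda>i. finsum N (\<lambda>k. \<psi> (F (i, k))) {..<n}) I"
      by (rule double[symmetric]) (use Fg c1 y in blast)
    also have "\<dots> = finsum N (\<lambda>i. \<phi> i x \<odot>\<^bsub>N\<^esub> w i) I"
    proof (rule N.M.finsum_cong')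
      show "finsum N (\<lambda>k. \<psi> (F (i, k))) {..<n} = \<phi> i x \<odot>\<^bsub>N\<^esub> w i" if i: "i \<in> I" for i
      proof -
        have fx: "\<phi> i x \<in> carrier A" using d(3)[OF i xc] .
        have yc: "\<psi> (a k \<odot>\<^bsub>N\<^esub> p i) \<in> carrier N" if "k < n" for k using y(1)[OF ap[OF that i]] c1 by blast
        have "\<psi> (F (i, k)) = \<phi> i x \<odot>\<^bsub>N\<^esub> (b k \<odot>\<^bsub>N\<^esub> \<psi> (a k \<odot>\<^bsub>N\<^esub> p i))" if k: "k < n" for k
          using lin_mapsD(3)[OF \<psi>, of "\<phi> i x \<otimes> b k" "a k \<odot>\<^bsub>N\<^esub> p i"] \<phi>b[OF i k] ap[OF k i] fx bc[OF k] yc[OF k]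
          by (simp add: F_def N.smult_assoc1)
        then have "finsum N (\<lambda>k. \<psi> (F (i, k))) {..<n} = finsum N (\<lambda>k. \<phi> i x \<odot>\<^bsub>N\<^esub> (b k \<odot>\<^bsub>N\<^esub> \<psi> (a k \<odot>\<^bsub>N\<^esub> p i))) {..<n}"
          using fx bc yc by (intro N.M.finsum_cong') (auto intro!: N.smult_closed)
        also have "\<dots> = \<phi> i x \<odot>\<^bsub>N\<^esub> w i" unfolding w_def
          using fx bc yc by (intro N.finsum_smult_r[symmetric]) (auto intro!: N.smult_closed)
        finally show ?thesis .
      qed
    qed (use d(3)[OF _ xc] w mpart_closed[OF ig] in \<open>auto intro!: N.smult_closed\<close>)
    finally show ?thesis using xc by (simp add: v_def)
  qed
  have id: "(\<lambda>x\<in>carrier N. x) \<in> lin_maps A N N" by (rule lin_mapsI[OF N.left_module_axioms]) auto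
  show thesis
  proof (rule that[OF u v])
    show "compose (carrier N) v u = (\<lambda>x\<in>carrier N. x)"
    proof (rule lin_maps_eq_on_p[OF lin_maps_compose[OF N.left_module_axioms ul vl] id])
      show "compose (carrier N) v u (p i) = (\<lambda>x\<in>carrier N. x) (p i)" if "i \<in> I" for i
        using u1[OF p_part[OF that]] vg[OF t(1)[OF p_part[OF that]]] t(2)[OF p_part[OF that]] d(2)[OF that]
        by (simp add: compose_def)
    qed
    show "compose (carrier N) u v = (\<lambda>x\<in>carrier N. x)"
    proof (rule lin_maps_eq_on_p[OF lin_maps_compose[OF N.left_module_axioms vl ul] id])
      fix i assume i: "i \<in> I"
      note pi = d(2)[OF i]
      have uv: "u (v (a k \<odot>\<^bsub>N\<^esub> p i)) = a k \<odot>\<^bsub>N\<^esub> p i" if "k < n" for k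
        using vg[OF ap[OF that i]] u1[OF y(1)[OF ap[OF that i]]] y(2)[OF ap[OF that i]] by simp
      \<comment> \<open>\<open>u\<close> after \<open>v\<close> is so far known to be the identity
        on elements of degree g; the expansion of \<open>p i\<close> through the multiples by
        \<open>a k\<close> leads back to these.\<close>
      have pe: "p i = finsum N (\<lambda>k. b k \<odot>\<^bsub>N\<^esub> (a k \<odot>\<^bsub>N\<^esub> p i)) {..<n}"
      proof -
        have "p i = finsum A (\<lambda>k. b k \<otimes> a k) {..<n} \<odot>\<^bsub>N\<^esub> p i" using sum pi by (simp add: N.smult_one)
        also have "\<dots> = finsum N (\<lambda>k. (b k \<otimes> a k) \<odot>\<^bsub>N\<^esub> p i) {..<n}"
          using pi bc ac by (intro N.finsum_smult_l) auto
        also have "\<dots> = finsum N (\<lambda>k. b k \<odot>\<^bsub>N\<^esub> (a k \<odot>\<^bsub>N\<^esub> p i)) {..<n}"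
          using pi bc ac by (intro N.M.finsum_cong') (auto simp: N.smult_assoc1 intro!: N.smult_closed)
        finally show ?thesis .
      qed
      let ?c = "compose (carrier N) u v"
      note cD = lin_mapsD[OF lin_maps_compose[OF N.left_module_axioms vl ul]]
      have "?c (finsum N (\<lambda>k. b k \<odot>\<^bsub>N\<^esub> (a k \<odot>\<^bsub>N\<^esub> p i)) {..<n}) = finsum N (\<lambda>k. ?c (b k \<odot>\<^bsub>N\<^esub> (a k \<odot>\<^bsub>N\<^esub> p i))) {..<n}"
        by (rule additive_map_finsum[OF N.M.abelian_group_axioms N.M.abelian_group_axioms cD(4)])
          (use bc ac pi in \<open>auto intro!: N.smult_closed\<close>)
      also have "\<dots> = finsum N (\<lambda>k. b k \<odot>\<^bsub>N\<^esub> (a k \<odot>\<^bsub>N\<^esub> p i)) {..<n}"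
      proof (rule N.M.finsum_cong')
        show "?c (b k \<odot>\<^bsub>N\<^esub> (a k \<odot>\<^bsub>N\<^esub> p i)) = b k \<odot>\<^bsub>N\<^esub> (a k \<odot>\<^bsub>N\<^esub> p i)" if "k \<in> {..<n}" for k
          using cD(3)[of "b k" "a k \<odot>\<^bsub>N\<^esub> p i"] uv[of k] bc[of k] ac[of k] pi that
          by (simp add: N.smult_closed) (simp add: compose_def N.smult_closed)
      qed (use bc ac pi in \<open>auto intro!: N.smult_closed\<close>)
      finally show "?c (p i) = (\<lambda>x\<in>carrier N. x) (p i)" using pe pi by simp
    qed
  qed
qed

end

subsection \<open>Induced modules\<close>

lemma induced_module_simps [simp]:
  "carrier (induced_module G A P) = carrier (tensor (base_ring G A) (sub_bimodule A (carrier A)) P)"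
  "\<zero>\<^bsub>induced_module G A P\<^esub> = \<zero>\<^bsub>tensor (base_ring G A) (sub_bimodule A (carrier A)) P\<^esub>"
  "add (induced_module G A P) = add (tensor (base_ring G A) (sub_bimodule A (carrier A)) P)"
  "smult (induced_module G A P) = smult (tensor (base_ring G A) (sub_bimodule A (carrier A)) P)"
  "mpart (induced_module G A P) g = generate (add_monoid (tensor (base_ring G A) (sub_bimodule A (carrier A)) P))
    {pure_tensor (base_ring G A) (sub_bimodule A (carrier A)) P a m | a m. a \<in> rpart A g \<and> m \<in> carrier P}"
  by (simp_all add: induced_module_def module.extend_def Let_def)

lemma left_module_cong:
  assumes "left_module A M" "carrier M' = carrier M" "\<zero>\<^bsub>M'\<^esub> = \<zero>\<^bsub>M\<^esub>" "add M' = add M" "smult M' = smult M"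
  shows "left_module A M'"
proof -
  interpret M: left_module A M by fact
  have "abelian_group M'"
    using abelian_groupE[OF M.M.abelian_group_axioms] by (intro abelian_groupI) (auto simp: assms(2-4))
  then show ?thesis
    by (rule left_moduleI[OF M.R.ring_axioms])
      (auto simp: assms(2-5) M.smult_closed M.smult_l_distr M.smult_r_distr M.smult_assoc1 M.smult_one)
qed

context graded_unital
begin

context
  fixes P :: "('a, 'p, 'm) module_scheme"
  assumes P: "left_module R P"
begin

interpretation P: left_module R P by (rule P)

lemma tensor_module_A: "tensor_module R (sub_bimodule A (carrier A)) P A"
proof -
  interpret tensor_module R "sub_bimodule A (carrier A)" P R
    by (rule tensor_module_bimodule[OF bimodule_A P])
  interpret L: left_module A "sub_bimodule A (carrier A)"
    by (rule left_moduleI[OF A.ring_axioms X.abelian_group_axioms])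
      (auto simp: A.l_distr A.r_distr A.m_assoc)
  show ?thesis by unfold_locales (auto simp: A.m_assoc R_closed)
qed

interpretation AP: tensor_module R "sub_bimodule A (carrier A)" P A
  by (rule tensor_module_A)

abbreviation "N \<equiv> induced_module G A P"

lemma left_module_induced: "left_module A N"
  by (rule left_module_cong[OF AP.TM.left_module_axioms]) simp_all

context
  fixes I :: "'i set" and p \<phi>
  assumes P_basis: "dual_basis R P I p \<phi>"
begin

text \<open>The basis elements are \<open>\<one> \<otimes> p i\<close>, and the functionals send
  \<open>a \<otimes> m\<close> to a times \<open>\<phi> i m\<close>. The second conclusion keeps
  this formula at hand, since the functionals come from the universal property.\<close>

lemma induced_basis_ex:
  obtains \<phi>' where "graded_dual_basis G A N I (\<lambda>i. AP.pt \<one> (p i)) \<phi>'"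
    "\<And>i a m. i \<in> I \<Longrightarrow> a \<in> carrier A \<Longrightarrow> m \<in> carrier P \<Longrightarrow> \<phi>' i (AP.pt a m) = a \<otimes> \<phi> i m"
proof -
  note d = dual_basisD[OF P_basis, simplified]
  have \<phi>A: "\<phi> i m \<in> carrier A" if "i \<in> I" "m \<in> carrier P" for i m using d(3)[OF that] R_closed by blast
  have "\<exists>h. additive_map AP.T A h \<and> (\<forall>a\<in>carrier A. \<forall>m\<in>carrier P. h (AP.pt a m) = a \<otimes> \<phi> i m)" if i: "i \<in> I" for i
  proof (rule AP.tensor_universal[OF A.abelian_group_axioms, of "\<lambda>a m. a \<otimes> \<phi> i m"])
    fix h assume "additive_map AP.T A h"
      "\<And>x m. x \<in> carrier (sub_bimodule A (carrier A)) \<Longrightarrow> m \<in> carrier P \<Longrightarrow> h (AP.pt x m) = x \<otimes> \<phi> i m"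
    then show ?thesis by auto
  qed (use \<phi>A[OF i] d(4,5)[OF i] R_closed in \<open>auto simp: A.l_distr A.r_distr A.m_assoc\<close>)
  then obtain h where h: "\<And>i. i \<in> I \<Longrightarrow> additive_map AP.T A (h i)"
    and hp: "\<And>i a m. i \<in> I \<Longrightarrow> a \<in> carrier A \<Longrightarrow> m \<in> carrier P \<Longrightarrow> h i (AP.pt a m) = a \<otimes> \<phi> i m" by metis
  note hD = additive_mapD[OF h]
  have hs: "h i (a \<odot>\<^bsub>AP.T\<^esub> t) = a \<otimes> h i t" if i: "i \<in> I" and a: "a \<in> carrier A" and t: "t \<in> carrier AP.T" for i a t
  proof (rule AP.tensor_map_eqI[OF A.abelian_group_axioms _ _ _ t])
    show "additive_map AP.T A (\<lambda>t. h i (a \<odot>\<^bsub>AP.T\<^esub> t))"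
      by (rule additive_mapI) (use hD[OF i] a AP.TM.smult_closed AP.TM.smult_r_distr in auto)
    show "additive_map AP.T A (\<lambda>t. a \<otimes> h i t)"
      by (rule additive_mapI) (use hD[OF i] a in \<open>auto simp: A.r_distr\<close>)
    show "h i (a \<odot>\<^bsub>AP.T\<^esub> AP.pt x m) = a \<otimes> h i (AP.pt x m)"
      if "x \<in> carrier (sub_bimodule A (carrier A))" "m \<in> carrier P" for x m
      using that a i \<phi>A by (simp add: AP.smult_pure hp A.m_assoc)
  qed
  define \<phi>' where "\<phi>' i = restrict (h i) (carrier AP.T)" for i
  have e: "\<phi>' i t = h i t" if "t \<in> carrier AP.T" for i t using that by (simp add: \<phi>'_def)
  have lin: "\<phi>' i \<in> lin_maps A N (regular_module A)" if "i \<in> I" for i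
    using lin_mapsI[OF left_module_induced, of "h i" "regular_module A"] hD[OF that] hs[OF that] unfolding \<phi>'_def by simp
  let ?q = "\<lambda>i. AP.pt \<one> (p i)"
  have q: "?q i \<in> carrier AP.T" if "i \<in> I" for i using AP.pt_closed d(2)[OF that] by simp
  have aq: "a \<odot>\<^bsub>AP.T\<^esub> ?q i = AP.pt a (p i)" if "i \<in> I" "a \<in> carrier A" for i a
    using that d(2) by (simp add: AP.smult_pure)
  have ex: "finsum AP.T (\<lambda>i. h i t \<odot>\<^bsub>AP.T\<^esub> ?q i) I = t" if t: "t \<in> carrier AP.T" for t
  proof (rule AP.tensor_map_eqI[OF AP.abelian_group_T _ _ _ t])
    show "additive_map AP.T AP.T (\<lambda>t. finsum AP.T (\<lambda>i. h i t \<odot>\<^bsub>AP.T\<^esub> ?q i) I)"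
    proof (rule additive_mapI)
      fix s t assume st: "s \<in> carrier AP.T" "t \<in> carrier AP.T"
      show "finsum AP.T (\<lambda>i. h i (s \<oplus>\<^bsub>AP.T\<^esub> t) \<odot>\<^bsub>AP.T\<^esub> ?q i) I =
        finsum AP.T (\<lambda>i. h i s \<odot>\<^bsub>AP.T\<^esub> ?q i) I \<oplus>\<^bsub>AP.T\<^esub> finsum AP.T (\<lambda>i. h i t \<odot>\<^bsub>AP.T\<^esub> ?q i) I"
      proof -
        have "finsum AP.T (\<lambda>i. h i (s \<oplus>\<^bsub>AP.T\<^esub> t) \<odot>\<^bsub>AP.T\<^esub> ?q i) I =
          finsum AP.T (\<lambda>i. h i s \<odot>\<^bsub>AP.T\<^esub> ?q i \<oplus>\<^bsub>AP.T\<^esub> h i t \<odot>\<^bsub>AP.T\<^esub> ?q i) I"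
        proof (rule AP.T.finsum_cong')
          show "h i (s \<oplus>\<^bsub>AP.T\<^esub> t) \<odot>\<^bsub>AP.T\<^esub> ?q i = h i s \<odot>\<^bsub>AP.T\<^esub> ?q i \<oplus>\<^bsub>AP.T\<^esub> h i t \<odot>\<^bsub>AP.T\<^esub> ?q i" if "i \<in> I" for i
            using st hD[OF that] q[OF that] by (simp add: AP.TM.smult_l_distr)
        qed (use st hD q in \<open>auto intro!: AP.TM.smult_closed\<close>)
        also have "\<dots> = finsum AP.T (\<lambda>i. h i s \<odot>\<^bsub>AP.T\<^esub> ?q i) I \<oplus>\<^bsub>AP.T\<^esub> finsum AP.T (\<lambda>i. h i t \<odot>\<^bsub>AP.T\<^esub> ?q i) I"
          by (rule AP.T.finsum_addf) (use st hD q in \<open>auto intro!: AP.TM.smult_closed\<close>)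
        finally show ?thesis .
      qed
    qed (use hD q in \<open>auto intro!: AP.T.finsum_closed AP.TM.smult_closed\<close>)
    show "additive_map AP.T AP.T (\<lambda>t. t)" by (rule additive_mapI) auto
    fix a m assume am: "a \<in> carrier (sub_bimodule A (carrier A))" "m \<in> carrier P"
    then have a: "a \<in> carrier A" by simp
    have "finsum AP.T (\<lambda>i. h i (AP.pt a m) \<odot>\<^bsub>AP.T\<^esub> ?q i) I = finsum AP.T (\<lambda>i. AP.pt a (\<phi> i m \<odot>\<^bsub>P\<^esub> p i)) I"
    proof (rule AP.T.finsum_cong')
      fix i assume i: "i \<in> I"
      show "h i (AP.pt a m) \<odot>\<^bsub>AP.T\<^esub> ?q i = AP.pt a (\<phi> i m \<odot>\<^bsub>P\<^esub> p i)"
        using AP.pt_balanced[of a "p i" "\<phi> i m"] i a am(2) d(2,3)[OF i] \<phi>A[OF i] by (simp add: hp aq)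
    qed (use a am d in \<open>auto intro!: AP.pt_closed P.smult_closed\<close>)
    also have "\<dots> = AP.pt a (finsum P (\<lambda>i. \<phi> i m \<odot>\<^bsub>P\<^esub> p i) I)"
      using a am d by (intro AP.pt_finsum_r[symmetric]) (auto intro!: P.smult_closed)
    also have "\<dots> = AP.pt a m" using d(6)[OF am(2)] by simp
    finally show "finsum AP.T (\<lambda>i. h i (AP.pt a m) \<odot>\<^bsub>AP.T\<^esub> ?q i) I = AP.pt a m" .
  qed
  interpret N: left_module A N by (rule left_module_induced)
  have fN: "finsum N f S = finsum AP.T f S" if "f \<in> S \<rightarrow> carrier AP.T" for f and S :: "'i set"
    by (rule finsum_same[OF AP.T.abelian_monoid_axioms N.M.abelian_monoid_axioms]) (use that in auto)
  have db: "dual_basis A N I ?q \<phi>'" unfolding dual_basis_def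
  proof (intro conjI ballI)
    show "?q \<in> I \<rightarrow> carrier N" using q by simp
    fix x assume "x \<in> carrier N"
    then have x: "x \<in> carrier AP.T" by simp
    have "finsum N (\<lambda>i. \<phi>' i x \<odot>\<^bsub>N\<^esub> ?q i) I = finsum AP.T (\<lambda>i. h i x \<odot>\<^bsub>AP.T\<^esub> ?q i) I"
      using fN[of "\<lambda>i. h i x \<odot>\<^bsub>AP.T\<^esub> ?q i" I] hD(1) q x by (auto simp: e AP.TM.smult_closed)
    then show "x = finsum N (\<lambda>i. \<phi>' i x \<odot>\<^bsub>N\<^esub> ?q i) I" using ex[OF x] by simp
  qed (use d(1) lin in auto)
  \<comment> \<open>The components are defined as generated subgroups. Generators of degree g have
    coordinates in A_g; conversely the expansion writes x as a sum of the generators formed with its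
    own coordinates.\<close>
  have mp: "mpart N g = {x \<in> carrier N. \<forall>i\<in>I. \<phi>' i x \<in> rpart A g}" if g: "g \<in> carrier G" for g
  proof (intro equalityI subsetI)
    let ?gen = "{AP.pt a m | a m. a \<in> rpart A g \<and> m \<in> carrier P}"
    have hg: "h i (AP.pt a m) \<in> rpart A g" if "a \<in> rpart A g" "m \<in> carrier P" "i \<in> I" for i a m
      using that part_closed[OF g] part_mult_r[OF g] d(3) by (simp add: hp)
    have hpt: "AP.pt a m \<in> carrier AP.T" if "a \<in> rpart A g" "m \<in> carrier P" for a m
      using that part_closed[OF g] AP.pt_closed by simp
    fix x assume "x \<in> mpart N g"
    then have "x \<in> generate (add_monoid AP.T) ?gen" by simp
    then have "x \<in> carrier AP.T \<and> (\<forall>i\<in>I. h i x \<in> rpart A g)"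
    proof (induction rule: generate.induct)
      case one
      then show ?case using additive_map_zero[OF AP.abelian_group_T A.abelian_group_axioms h] part(2)[OF g] by simp
    next
      case (incl y)
      then show ?case using hg hpt by blast
    next
      case (inv y)
      then obtain a m where y: "y = AP.pt a m" "a \<in> rpart A g" "m \<in> carrier P" by blast
      then have "inv\<^bsub>add_monoid AP.T\<^esub> y = \<ominus>\<^bsub>AP.T\<^esub> y" by (simp add: a_inv_def)
      then show ?case using y hg hpt part(4)[OF g] additive_map_neg[OF AP.abelian_group_T A.abelian_group_axioms h]
        by simp
    next
      case (eng y z)
      then show ?case using hD part(3)[OF g] by simp
    qed
    then show "x \<in> {x \<in> carrier N. \<forall>i\<in>I. \<phi>' i x \<in> rpart A g}" by (simp add: e)
  next
    let ?gen = "{AP.pt a m | a m. a \<in> rpart A g \<and> m \<in> carrier P}"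
    fix x assume "x \<in> {x \<in> carrier N. \<forall>i\<in>I. \<phi>' i x \<in> rpart A g}"
    then have x: "x \<in> carrier AP.T" "\<And>i. i \<in> I \<Longrightarrow> h i x \<in> rpart A g" using e[of x] by simp_all
    have gens: "AP.pt (h i x) (p i) \<in> generate (add_monoid AP.T) ?gen" if "i \<in> I" for i
      using x(2) d(2) that by (intro generate.incl) blast
    have gc: "generate (add_monoid AP.T) ?gen \<subseteq> carrier AP.T"
      using group.generate_incl[OF AP.T.a_group, of ?gen] part_closed[OF g] AP.pt_closed by auto
    have "finsum AP.T (\<lambda>i. AP.pt (h i x) (p i)) I \<in> generate (add_monoid AP.T) ?gen"
    proof (rule AP.T.finsum_in_subset[OF _ _ gc])
      show "\<zero>\<^bsub>AP.T\<^esub> \<in> generate (add_monoid AP.T) ?gen" using generate.one[of "add_monoid AP.T"] by simp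
      show "u \<oplus>\<^bsub>AP.T\<^esub> v \<in> generate (add_monoid AP.T) ?gen"
        if "u \<in> generate (add_monoid AP.T) ?gen" "v \<in> generate (add_monoid AP.T) ?gen" for u v
        using generate.eng[OF that] by simp
    qed (use gens in blast)
    moreover have "finsum AP.T (\<lambda>i. AP.pt (h i x) (p i)) I = finsum AP.T (\<lambda>i. h i x \<odot>\<^bsub>AP.T\<^esub> ?q i) I"
      using x(1) hD(1) q by (intro AP.T.finsum_cong') (auto simp: aq intro!: AP.TM.smult_closed)
    ultimately show "x \<in> mpart N g" using ex[OF x(1)] by simp
  qed
  have "\<phi>' j (?q i) \<in> rpart A \<one>\<^bsub>G\<^esub>" if "i \<in> I" "j \<in> I" for i j
    using that q d(2,3) \<phi>A by (simp add: e hp)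
  then have "graded_dual_basis G A N I ?q \<phi>'"
    unfolding graded_dual_basis_def using left_module_induced db mp by blast
  then show thesis by (rule that) (simp add: e hp AP.pt_closed)
qed

end

end

end

subsection \<open>Homogeneous components\<close>

definition component :: "('a, 'r) ring_scheme \<Rightarrow> 'i set \<Rightarrow> ('i \<Rightarrow> 'a set) \<Rightarrow> 'a \<Rightarrow> 'i \<Rightarrow> 'a"
  where "component M I C x = (THE f. f \<in> (\<Pi>\<^sub>E i\<in>I. C i) \<and> finite {i\<in>I. f i \<noteq> \<zero>\<^bsub>M\<^esub>} \<and>
       x = finsum M f {i\<in>I. f i \<noteq> \<zero>\<^bsub>M\<^esub>})"

context
  fixes M :: "('a, 'r) ring_scheme" and I :: "'i set" and C
  assumes M: "abelian_group M" and dd: "direct_decomposition M I C"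
begin

interpretation M: abelian_group M by (rule M)

lemmas dd_sub = additive_subgroupD[OF direct_decompositionD(1)[OF M dd] M]

lemma component_spec:
  assumes "x \<in> carrier M"
  shows "component M I C x \<in> (\<Pi>\<^sub>E i\<in>I. C i)" "finite {i\<in>I. component M I C x i \<noteq> \<zero>\<^bsub>M\<^esub>}"
    "x = finsum M (component M I C x) {i\<in>I. component M I C x i \<noteq> \<zero>\<^bsub>M\<^esub>}"
proof -
  have "\<exists>!f. f \<in> (\<Pi>\<^sub>E i\<in>I. C i) \<and> finite {i\<in>I. f i \<noteq> \<zero>\<^bsub>M\<^esub>} \<and> x = finsum M f {i\<in>I. f i \<noteq> \<zero>\<^bsub>M\<^esub>}"
    using dd assms unfolding direct_decomposition_def by blast
  from theI'[OF this] show "component M I C x \<in> (\<Pi>\<^sub>E i\<in>I. C i)"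
    "finite {i\<in>I. component M I C x i \<noteq> \<zero>\<^bsub>M\<^esub>}"
    "x = finsum M (component M I C x) {i\<in>I. component M I C x i \<noteq> \<zero>\<^bsub>M\<^esub>}"
    unfolding component_def by blast+
qed

lemma component_closed:
  assumes "x \<in> carrier M" "i \<in> I"
  shows "component M I C x i \<in> C i" "component M I C x i \<in> carrier M"
proof -
  show "component M I C x i \<in> C i" using component_spec(1)[OF assms(1)] assms(2) by blast
  then show "component M I C x i \<in> carrier M" using dd_sub(1)[OF assms(2)] by blast
qed

lemma component_sum:
  assumes "x \<in> carrier M" "finite K" "{i\<in>I. component M I C x i \<noteq> \<zero>\<^bsub>M\<^esub>} \<subseteq> K" "K \<subseteq> I"
  shows "x = finsum M (component M I C x) K"
proof (subst component_spec(3)[OF assms(1)], rule M.add.finprod_mono_neutral_cong_left[OF assms(2,3)])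
  show "component M I C x \<in> K \<rightarrow> carrier M" using component_closed(2)[OF assms(1)] assms(4) by blast
qed (use assms in auto)

text \<open>\<open>K\<close> may exceed the support, so any convenient finite expression computes
  the components.\<close>

lemma component_eqI:
  assumes "finite K" "K \<subseteq> I" "\<And>i. i \<in> K \<Longrightarrow> z i \<in> C i" "x = finsum M z K" "i \<in> I"
  shows "component M I C x i = (if i \<in> K then z i else \<zero>\<^bsub>M\<^esub>)"
proof -
  have zc: "z \<in> K \<rightarrow> carrier M" using assms dd_sub(1) by blast
  then have x: "x \<in> carrier M" unfolding assms(4) by (rule M.finsum_closed)
  define g where "g = (\<lambda>i\<in>I. if i \<in> K then z i else \<zero>\<^bsub>M\<^esub>)"
  have g1: "g \<in> (\<Pi>\<^sub>E i\<in>I. C i)" using assms dd_sub(2) by (auto simp: g_def)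
  have g2: "finite {i\<in>I. g i \<noteq> \<zero>\<^bsub>M\<^esub>}" by (rule finite_subset[OF _ assms(1)]) (auto simp: g_def)
  have g3: "x = finsum M g {i\<in>I. g i \<noteq> \<zero>\<^bsub>M\<^esub>}" unfolding assms(4)
    using assms zc by (intro M.add.finprod_mono_neutral_cong_right) (auto simp: g_def)
  have "\<exists>!f. f \<in> (\<Pi>\<^sub>E i\<in>I. C i) \<and> finite {i\<in>I. f i \<noteq> \<zero>\<^bsub>M\<^esub>} \<and> x = finsum M f {i\<in>I. f i \<noteq> \<zero>\<^bsub>M\<^esub>}"
    using dd x unfolding direct_decomposition_def by blast
  then have "component M I C x = g" using component_spec[OF x] g1 g2 g3 by blast
  then show ?thesis using assms(5) by (simp add: g_def)
qed

lemma component_add: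
  assumes "x \<in> carrier M" "y \<in> carrier M" "i \<in> I"
  shows "component M I C (x \<oplus>\<^bsub>M\<^esub> y) i = component M I C x i \<oplus>\<^bsub>M\<^esub> component M I C y i"
proof -
  let ?K = "{i\<in>I. component M I C x i \<noteq> \<zero>\<^bsub>M\<^esub>} \<union> {i\<in>I. component M I C y i \<noteq> \<zero>\<^bsub>M\<^esub>}"
  have K: "finite ?K" "?K \<subseteq> I" using component_spec(2) assms by auto
  have "finsum M (\<lambda>i. component M I C x i \<oplus>\<^bsub>M\<^esub> component M I C y i) ?K =
      finsum M (component M I C x) ?K \<oplus>\<^bsub>M\<^esub> finsum M (component M I C y) ?K"
    by (rule M.finsum_addf) (use component_closed(2) assms in auto)
  also have "\<dots> = x \<oplus>\<^bsub>M\<^esub> y"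
    using component_sum[OF assms(1) K(1) _ K(2)] component_sum[OF assms(2) K(1) _ K(2)] by simp
  finally have "x \<oplus>\<^bsub>M\<^esub> y = finsum M (\<lambda>i. component M I C x i \<oplus>\<^bsub>M\<^esub> component M I C y i) ?K" by simp
  from component_eqI[OF K _ this assms(3)]
  have "component M I C (x \<oplus>\<^bsub>M\<^esub> y) i = (if i \<in> ?K then component M I C x i \<oplus>\<^bsub>M\<^esub> component M I C y i else \<zero>\<^bsub>M\<^esub>)"
    using component_closed(1)[OF assms(1)] component_closed(1)[OF assms(2)] dd_sub(3) by blast
  then show ?thesis using assms by auto
qed

lemma component_homogeneous:
  assumes "i \<in> I" "x \<in> C i" "j \<in> I"
  shows "component M I C x j = (if j = i then x else \<zero>\<^bsub>M\<^esub>)"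
  using component_eqI[of "{i}" "\<lambda>_. x" x j] assms dd_sub(1)[OF assms(1)] by auto

end

section \<open>A criterion for partial crossed products\<close>

text \<open>In the construction below every ideal D_g is zero or the whole ring, so these cases
  cover all products of ideals.\<close>

lemma set_prod_ring:
  assumes "ring S"
  shows "set_prod S (carrier S) (carrier S) = carrier S"
    and "X \<subseteq> carrier S \<Longrightarrow> X \<noteq> {} \<Longrightarrow> set_prod S {\<zero>\<^bsub>S\<^esub>} X = {\<zero>\<^bsub>S\<^esub>}"
    and "X \<subseteq> carrier S \<Longrightarrow> X \<noteq> {} \<Longrightarrow> set_prod S X {\<zero>\<^bsub>S\<^esub>} = {\<zero>\<^bsub>S\<^esub>}"
proof -
  interpret S: ring S by fact
  have cs: "additive_subgroup (carrier S) S" and zs: "additive_subgroup {\<zero>\<^bsub>S\<^esub>} S"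
    by (rule additive_subgroupI'[OF S.abelian_group_axioms]; simp)+
  show "set_prod S (carrier S) (carrier S) = carrier S"
  proof
    show "set_prod S (carrier S) (carrier S) \<subseteq> carrier S"
      by (rule set_prod_subset[OF cs S.abelian_group_axioms]) simp
    show "carrier S \<subseteq> set_prod S (carrier S) (carrier S)"
    proof
      fix x assume "x \<in> carrier S"
      then show "x \<in> set_prod S (carrier S) (carrier S)"
        using set_prod_incl[OF S.abelian_group_axioms, of x "carrier S" "\<one>\<^bsub>S\<^esub>" "carrier S"] by simp
    qed
  qed
  show "set_prod S {\<zero>\<^bsub>S\<^esub>} X = {\<zero>\<^bsub>S\<^esub>}" if X: "X \<subseteq> carrier S" "X \<noteq> {}"
  proof
    show "set_prod S {\<zero>\<^bsub>S\<^esub>} X \<subseteq> {\<zero>\<^bsub>S\<^esub>}"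
      by (rule set_prod_subset[OF zs S.abelian_group_axioms]) (use X in auto)
    obtain x where "x \<in> X" using X by blast
    then show "{\<zero>\<^bsub>S\<^esub>} \<subseteq> set_prod S {\<zero>\<^bsub>S\<^esub>} X"
      using set_prod_incl[OF S.abelian_group_axioms, of "\<zero>\<^bsub>S\<^esub>" "{\<zero>\<^bsub>S\<^esub>}" x X] X by auto
  qed
  show "set_prod S X {\<zero>\<^bsub>S\<^esub>} = {\<zero>\<^bsub>S\<^esub>}" if X: "X \<subseteq> carrier S" "X \<noteq> {}"
  proof
    show "set_prod S X {\<zero>\<^bsub>S\<^esub>} \<subseteq> {\<zero>\<^bsub>S\<^esub>}"
      by (rule set_prod_subset[OF zs S.abelian_group_axioms]) (use X in auto)
    obtain x where "x \<in> X" using X by blast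
    then show "{\<zero>\<^bsub>S\<^esub>} \<subseteq> set_prod S X {\<zero>\<^bsub>S\<^esub>}"
      using set_prod_incl[OF S.abelian_group_axioms, of x X "\<zero>\<^bsub>S\<^esub>" "{\<zero>\<^bsub>S\<^esub>}"] X by auto
  qed
qed

text \<open>With \<open>u\<close> and \<open>v\<close> zero off \<open>H\<close>, one formula each
  for the action and the twist serves zero and nonzero ideals alike. \<open>u\<close> is normalised
  in the neutral degree because the action there is the identity and the twist must be 1_g when one
  argument is neutral.\<close>

locale homogeneous_units = graded_unital G B
  for G :: "('g, 'h) monoid_scheme" and B :: "('g, 'b) graded_ring" (structure) +
  fixes H :: "'g set" and u v :: "'g \<Rightarrow> 'b"
  assumes H: "subgroup H G"
    and u_part: "g \<in> H \<Longrightarrow> u g \<in> rpart B g" and v_part: "g \<in> H \<Longrightarrow> v g \<in> rpart B (inv\<^bsub>G\<^esub> g)"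
    and uv: "g \<in> H \<Longrightarrow> u g \<otimes> v g = \<one>" and vu: "g \<in> H \<Longrightarrow> v g \<otimes> u g = \<one>"
    and u_one: "u \<one>\<^bsub>G\<^esub> = \<one>"
    and u_zero: "g \<notin> H \<Longrightarrow> u g = \<zero>" and v_zero: "g \<notin> H \<Longrightarrow> v g = \<zero>"
    and part_zero: "g \<in> carrier G \<Longrightarrow> g \<notin> H \<Longrightarrow> rpart B g = {\<zero>}"
begin

abbreviation "B1 \<equiv> rpart B \<one>\<^bsub>G\<^esub>"

text \<open>A plain record without grading, the type of coefficient ring that
  \<open>is_partial_crossed_product\<close> asks for.\<close>

definition S :: "'b ring"
  where "S = \<lparr>carrier = B1, monoid.mult = mult B, monoid.one = \<one>, ring.zero = \<zero>, ring.add = add B\<rparr>"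

definition e :: "'g \<Rightarrow> 'b" where "e g = (if g \<in> H then \<one> else \<zero>)"

definition \<alpha> :: "'g \<Rightarrow> 'b \<Rightarrow> 'b" where "\<alpha> g s = u g \<otimes> s \<otimes> v g"

definition \<omega> :: "'g \<Rightarrow> 'g \<Rightarrow> 'b" where "\<omega> g h = u g \<otimes> u h \<otimes> v (g \<otimes>\<^bsub>G\<^esub> h)"

lemma S_simps [simp]:
  "carrier S = B1" "mult S = mult B" "one S = \<one>" "\<zero>\<^bsub>S\<^esub> = \<zero>" "add S = add B"
  by (simp_all add: S_def)

lemma HG: "g \<in> H \<Longrightarrow> g \<in> carrier G"
  using subgroup.subset[OF H] by blast

lemma H_one: "\<one>\<^bsub>G\<^esub> \<in> H" and H_mult: "g \<in> H \<Longrightarrow> h \<in> H \<Longrightarrow> g \<otimes>\<^bsub>G\<^esub> h \<in> H" and H_inv: "g \<in> H \<Longrightarrow> inv\<^bsub>G\<^esub> g \<in> H"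
  using subgroup.one_closed[OF H] subgroup.m_closed[OF H] subgroup.m_inv_closed[OF H] by blast+

lemma H_inv_iff: "g \<in> carrier G \<Longrightarrow> inv\<^bsub>G\<^esub> g \<in> H \<longleftrightarrow> g \<in> H"
  using H_inv[of "inv\<^bsub>G\<^esub> g"] H_inv[of g] by auto

lemma H_mult_iff:
  assumes "g \<in> H" "h \<in> carrier G"
  shows "g \<otimes>\<^bsub>G\<^esub> h \<in> H \<longleftrightarrow> h \<in> H"
proof
  assume "g \<otimes>\<^bsub>G\<^esub> h \<in> H"
  then have "inv\<^bsub>G\<^esub> g \<otimes>\<^bsub>G\<^esub> (g \<otimes>\<^bsub>G\<^esub> h) \<in> H" using H_mult[OF H_inv[OF assms(1)]] by blast
  then show "h \<in> H" using assms HG[OF assms(1)] by (simp add: G.m_assoc[symmetric])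
qed (use H_mult assms in blast)

lemma u_closed [simp]: "u g \<in> carrier B" and v_closed [simp]: "v g \<in> carrier B"
  using u_part[of g] v_part[of g] u_zero[of g] v_zero[of g] part_closed[of g] part_closed[of "inv\<^bsub>G\<^esub> g"] HG[of g]
  by (cases "g \<in> H"; simp)+

lemma v_one: "v \<one>\<^bsub>G\<^esub> = \<one>"
  using uv[OF H_one] u_one v_closed[of "\<one>\<^bsub>G\<^esub>"] by simp

lemma B1_closed: "s \<in> B1 \<Longrightarrow> s \<in> carrier B"
  by (rule R_closed)

lemma ring_S: "ring S"
proof (rule ringI[OF abelian_groupI monoidI])
  note p = part[OF G.one_closed]
  show "\<exists>y\<in>carrier S. y \<oplus>\<^bsub>S\<^esub> x = \<zero>\<^bsub>S\<^esub>" if "x \<in> carrier S" for x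
    using that p(4) B1_closed by (intro bexI[of _ "\<ominus> x"]) (simp_all add: A.l_neg)
qed (use part[OF G.one_closed] part_mult_l[OF G.one_closed] one_part B1_closed in
    \<open>simp_all add: A.a_ac A.m_assoc A.l_distr A.r_distr\<close>)

interpretation S: ring S by (rule ring_S)

lemma e_closed: "e g \<in> B1"
  using one_part part(2)[OF G.one_closed] by (simp add: e_def)

lemma pa_ideal_e: "pa_ideal S e g = (if g \<in> H then B1 else {\<zero>})"
  using S.genideal_one S.genideal_zero by (simp add: pa_ideal_def e_def)

lemma \<omega>_eq_zero: "g \<notin> H \<or> h \<notin> H \<or> g \<otimes>\<^bsub>G\<^esub> h \<notin> H \<Longrightarrow> \<omega> g h = \<zero>"
  using u_zero v_zero by (auto simp: \<omega>_def)

lemma \<omega>_closed [simp]: "\<omega> g h \<in> carrier B"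
  by (simp add: \<omega>_def)

lemma \<alpha>_closed: "g \<in> carrier G \<Longrightarrow> s \<in> B1 \<Longrightarrow> \<alpha> g s \<in> B1"
proof (cases "g \<in> H")
  case True
  assume g: "g \<in> carrier G" and s: "s \<in> B1"
  have "u g \<otimes> s \<in> rpart B g" using part_mult_r[OF g s u_part[OF True]] .
  then have "u g \<otimes> s \<otimes> v g \<in> rpart B (g \<otimes>\<^bsub>G\<^esub> inv\<^bsub>G\<^esub> g)"
    using part_mult[OF g _ _ v_part[OF True]] g by simp
  then show ?thesis using g by (simp add: \<alpha>_def)
next
  case False
  assume "s \<in> B1"
  then show ?thesis using False u_zero v_zero B1_closed part(2)[OF G.one_closed] by (simp add: \<alpha>_def)
qed

lemma \<omega>_part:
  assumes g: "g \<in> carrier G" and h: "h \<in> carrier G"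
  shows "\<omega> g h \<in> B1"
proof (cases "g \<in> H \<and> h \<in> H")
  case True
  then have gh: "g \<otimes>\<^bsub>G\<^esub> h \<in> H" using H_mult by blast
  have "u g \<otimes> u h \<in> rpart B (g \<otimes>\<^bsub>G\<^esub> h)" using part_mult[OF g h] u_part True by blast
  then have "\<omega> g h \<in> rpart B ((g \<otimes>\<^bsub>G\<^esub> h) \<otimes>\<^bsub>G\<^esub> inv\<^bsub>G\<^esub> (g \<otimes>\<^bsub>G\<^esub> h))"
    unfolding \<omega>_def by (intro part_mult[OF _ _ _ v_part[OF gh]]) (use g h in auto)
  moreover have "(g \<otimes>\<^bsub>G\<^esub> h) \<otimes>\<^bsub>G\<^esub> inv\<^bsub>G\<^esub> (g \<otimes>\<^bsub>G\<^esub> h) = \<one>\<^bsub>G\<^esub>" using g h by (intro G.r_inv) simp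
  ultimately show ?thesis by simp
next
  case False
  then show ?thesis using \<omega>_eq_zero part(2)[OF G.one_closed] by metis
qed

lemma cancel:
  assumes "g \<in> H" "x \<in> carrier B"
  shows "u g \<otimes> (v g \<otimes> x) = x" "v g \<otimes> (u g \<otimes> x) = x"
  using assms uv vu by (simp_all add: A.m_assoc[symmetric])

text \<open>Inverse of the twist for degrees in \<open>H\<close>.\<close>

definition \<omega>' :: "'g \<Rightarrow> 'g \<Rightarrow> 'b" where "\<omega>' g h = u (g \<otimes>\<^bsub>G\<^esub> h) \<otimes> v h \<otimes> v g"

lemma \<omega>'_part:
  assumes g: "g \<in> H" and h: "h \<in> H"
  shows "\<omega>' g h \<in> B1"
proof -
  have gG: "g \<in> carrier G" and hG: "h \<in> carrier G" using HG g h by auto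
  have "u (g \<otimes>\<^bsub>G\<^esub> h) \<otimes> v h \<otimes> v g \<in> rpart B ((g \<otimes>\<^bsub>G\<^esub> h) \<otimes>\<^bsub>G\<^esub> inv\<^bsub>G\<^esub> h \<otimes>\<^bsub>G\<^esub> inv\<^bsub>G\<^esub> g)"
    by (intro part_mult u_part v_part) (use g h gG hG H_mult in auto)
  moreover have "(g \<otimes>\<^bsub>G\<^esub> h) \<otimes>\<^bsub>G\<^esub> inv\<^bsub>G\<^esub> h \<otimes>\<^bsub>G\<^esub> inv\<^bsub>G\<^esub> g = \<one>\<^bsub>G\<^esub>" using gG hG by (simp add: G.m_assoc)
  ultimately show ?thesis by (simp add: \<omega>'_def)
qed

lemma \<omega>_inverse:
  assumes g: "g \<in> H" and h: "h \<in> H"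
  shows "\<omega> g h \<otimes> \<omega>' g h = \<one>" "\<omega>' g h \<otimes> \<omega> g h = \<one>"
  using g h H_mult[OF g h] uv vu by (simp_all add: \<omega>_def \<omega>'_def A.m_assoc cancel)

lemma pa_ring2_e:
  assumes "g \<in> carrier G" "h \<in> carrier G"
  shows "carrier (pa_ring2 S e g h) = (if g \<in> H \<and> h \<in> H then B1 else {\<zero>})"
    "\<one>\<^bsub>pa_ring2 S e g h\<^esub> = (if g \<in> H \<and> h \<in> H then \<one> else \<zero>)" "mult (pa_ring2 S e g h) = mult B"
proof -
  have z: "\<zero> \<in> B1" using part(2)[OF G.one_closed] .
  then have ne: "B1 \<noteq> {}" by blast
  show "carrier (pa_ring2 S e g h) = (if g \<in> H \<and> h \<in> H then B1 else {\<zero>})"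
    using set_prod_ring(1)[OF ring_S] set_prod_ring(2,3)[OF ring_S, of B1] set_prod_ring(2)[OF ring_S, of "{\<zero>}"] ne z
    by (simp add: pa_ring2_def pa_ideal_e)
  show "\<one>\<^bsub>pa_ring2 S e g h\<^esub> = (if g \<in> H \<and> h \<in> H then \<one> else \<zero>)" "mult (pa_ring2 S e g h) = mult B"
    by (simp_all add: pa_ring2_def e_def)
qed

text \<open>The value of the inverse is needed because the condition on composites of the action
  mentions it. Where D_g D_gh is the zero ring its identity is 0, so 0 is a unit there with inverse
  0.\<close>

lemma \<omega>_unit:
  assumes g: "g \<in> carrier G" and h: "h \<in> carrier G"
  shows "\<omega> g h \<in> Units (pa_ring2 S e g (g \<otimes>\<^bsub>G\<^esub> h))"
    and "inv\<^bsub>pa_ring2 S e g (g \<otimes>\<^bsub>G\<^esub> h)\<^esub> \<omega> g h = (if g \<in> H \<and> h \<in> H then \<omega>' g h else \<zero>)"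
proof -
  let ?Q = "pa_ring2 S e g (g \<otimes>\<^bsub>G\<^esub> h)"
  note Q = pa_ring2_e[OF g G.m_closed[OF g h]]
  have iff: "g \<in> H \<and> g \<otimes>\<^bsub>G\<^esub> h \<in> H \<longleftrightarrow> g \<in> H \<and> h \<in> H" using H_mult_iff[OF _ h, of g] by blast
  let ?w = "if g \<in> H \<and> h \<in> H then \<omega>' g h else \<zero>"
  have w: "?w \<in> carrier ?Q" "\<omega> g h \<in> carrier ?Q" "\<omega> g h \<otimes>\<^bsub>?Q\<^esub> ?w = \<one>\<^bsub>?Q\<^esub>" "?w \<otimes>\<^bsub>?Q\<^esub> \<omega> g h = \<one>\<^bsub>?Q\<^esub>"
    unfolding Q iff using \<omega>'_part \<omega>_inverse \<omega>_part[OF g h] \<omega>_eq_zero by auto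
  show "\<omega> g h \<in> Units ?Q" unfolding Units_def using w by blast
  show "inv\<^bsub>?Q\<^esub> \<omega> g h = ?w" unfolding m_inv_def
  proof (rule the_equality)
    fix y assume y: "y \<in> carrier ?Q \<and> \<omega> g h \<otimes>\<^bsub>?Q\<^esub> y = \<one>\<^bsub>?Q\<^esub> \<and> y \<otimes>\<^bsub>?Q\<^esub> \<omega> g h = \<one>\<^bsub>?Q\<^esub>"
    show "y = ?w"
    proof (cases "g \<in> H \<and> h \<in> H")
      case True
      then have yc: "y \<in> B1" and yw: "y \<otimes> \<omega> g h = \<one>" using y unfolding Q iff by auto
      have "y \<otimes> (\<omega> g h \<otimes> \<omega>' g h) = \<omega>' g h"
        using yw B1_closed[OF yc] B1_closed[OF \<omega>'_part[of g h]] True by (simp add: A.m_assoc[symmetric])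
      then show ?thesis using \<omega>_inverse True B1_closed[OF yc] by simp
    next
      case False
      then show ?thesis using y unfolding Q iff by auto
    qed
  qed (use w in blast)
qed

lemma twisted_partial_action: "unital_twisted_partial_action G S e \<alpha> \<omega>"
  unfolding unital_twisted_partial_action_def
proof (intro conjI ballI)
  show "group G" "ring S" by (rule G.is_group ring_S)+
  fix g assume g: "g \<in> carrier G"
  show "e g \<in> carrier S" using e_closed by simp
  show "e g \<otimes>\<^bsub>S\<^esub> e g = e g" by (simp add: e_def)
  show "e g \<otimes>\<^bsub>S\<^esub> s = s \<otimes>\<^bsub>S\<^esub> e g" if "s \<in> carrier S" for s using that B1_closed by (simp add: e_def)
  show "\<alpha> g \<in> ring_iso (pa_ring S e (inv\<^bsub>G\<^esub> g)) (pa_ring S e g)"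
  proof (cases "g \<in> H")
    case True
    then have iH: "inv\<^bsub>G\<^esub> g \<in> H" by (rule H_inv)
    have "\<alpha> g \<in> ring_hom (pa_ring S e (inv\<^bsub>G\<^esub> g)) (pa_ring S e g)"
    proof (rule ring_hom_memI)
      fix x y assume "x \<in> carrier (pa_ring S e (inv\<^bsub>G\<^esub> g))" "y \<in> carrier (pa_ring S e (inv\<^bsub>G\<^esub> g))"
      then have xy: "x \<in> carrier B" "y \<in> carrier B" using iH B1_closed by (auto simp: pa_ring_def pa_ideal_e)
      show "\<alpha> g (x \<otimes>\<^bsub>pa_ring S e (inv\<^bsub>G\<^esub> g)\<^esub> y) = \<alpha> g x \<otimes>\<^bsub>pa_ring S e g\<^esub> \<alpha> g y"
        using xy True by (simp add: pa_ring_def \<alpha>_def A.m_assoc cancel)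
      show "\<alpha> g (x \<oplus>\<^bsub>pa_ring S e (inv\<^bsub>G\<^esub> g)\<^esub> y) = \<alpha> g x \<oplus>\<^bsub>pa_ring S e g\<^esub> \<alpha> g y"
        using xy by (simp add: pa_ring_def \<alpha>_def A.l_distr A.r_distr)
    qed (use True iH \<alpha>_closed[OF g] uv in \<open>auto simp: pa_ring_def pa_ideal_e e_def \<alpha>_def\<close>)
    moreover have "bij_betw (\<alpha> g) B1 B1"
    proof (rule bij_betw_byWitness[where f' = "\<lambda>s. v g \<otimes> s \<otimes> u g"])
      show "\<forall>s\<in>B1. v g \<otimes> \<alpha> g s \<otimes> u g = s"
        using True B1_closed vu by (auto simp: \<alpha>_def A.m_assoc cancel)
      show "\<forall>s\<in>B1. \<alpha> g (v g \<otimes> s \<otimes> u g) = s"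
        using True B1_closed uv by (auto simp: \<alpha>_def A.m_assoc cancel)
      show "\<alpha> g ` B1 \<subseteq> B1" using \<alpha>_closed[OF g] by blast
      have ig: "inv\<^bsub>G\<^esub> g \<in> carrier G" using g by simp
      have "v g \<otimes> s \<otimes> u g \<in> B1" if "s \<in> B1" for s
        using part_mult[OF ig g part_mult_r[OF ig that v_part[OF True]] u_part[OF True]] g by simp
      then show "(\<lambda>s. v g \<otimes> s \<otimes> u g) ` B1 \<subseteq> B1" by blast
    qed
    ultimately show ?thesis using True iH by (simp add: ring_iso_def pa_ring_def pa_ideal_e)
  next
    case False
    then have iH: "inv\<^bsub>G\<^esub> g \<notin> H" using H_inv_iff[OF g] by blast
    have "\<alpha> g \<zero> = \<zero>" by (simp add: \<alpha>_def)
    then show ?thesis using False iH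
      by (auto simp: ring_iso_def ring_hom_def pa_ring_def pa_ideal_e e_def bij_betw_def)
  qed
  show "\<omega> \<one>\<^bsub>G\<^esub> g = e g" "\<omega> g \<one>\<^bsub>G\<^esub> = e g"
    using g uv u_one u_zero v_zero by (cases "g \<in> H"; simp add: \<omega>_def e_def)+
  fix h assume h: "h \<in> carrier G"
  show "\<omega> g h \<in> Units (pa_ring2 S e g (g \<otimes>\<^bsub>G\<^esub> h))" by (rule \<omega>_unit[OF g h])
  show "\<alpha> g ` set_prod S (pa_ideal S e (inv\<^bsub>G\<^esub> g)) (pa_ideal S e h) = set_prod S (pa_ideal S e g) (pa_ideal S e (g \<otimes>\<^bsub>G\<^esub> h))"
  proof -
    have z: "\<alpha> g \<zero> = \<zero>" by (simp add: \<alpha>_def)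
    have ig: "inv\<^bsub>G\<^esub> g \<in> carrier G" using g by simp
    have sp: "set_prod S (pa_ideal S e a) (pa_ideal S e b) = (if a \<in> H \<and> b \<in> H then B1 else {\<zero>})"
      if "a \<in> carrier G" "b \<in> carrier G" for a b using pa_ring2_e(1)[OF that] by (simp add: pa_ring2_def)
    have "\<alpha> g ` B1 = B1" if gH: "g \<in> H"
    proof
      show "\<alpha> g ` B1 \<subseteq> B1" using \<alpha>_closed[OF g] by blast
      show "B1 \<subseteq> \<alpha> g ` B1"
      proof
        fix s assume s: "s \<in> B1"
        have "v g \<otimes> s \<otimes> u g \<in> B1"
          using part_mult[OF ig g part_mult_r[OF ig s v_part[OF gH]] u_part[OF gH]] g by simp
        moreover have "\<alpha> g (v g \<otimes> s \<otimes> u g) = s"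
          using gH B1_closed[OF s] uv by (simp add: \<alpha>_def A.m_assoc cancel)
        ultimately show "s \<in> \<alpha> g ` B1" by (metis imageI)
      qed
    qed
    then show ?thesis unfolding sp[OF ig h] sp[OF g G.m_closed[OF g h]]
      using H_inv_iff[OF g] H_mult_iff[OF _ h, of g] z by auto
  qed
  show "\<alpha> g (\<alpha> h t) = \<omega> g h \<otimes>\<^bsub>S\<^esub> \<alpha> (g \<otimes>\<^bsub>G\<^esub> h) t \<otimes>\<^bsub>S\<^esub> inv\<^bsub>pa_ring2 S e g (g \<otimes>\<^bsub>G\<^esub> h)\<^esub> \<omega> g h"
    if t: "t \<in> set_prod S (pa_ideal S e (inv\<^bsub>G\<^esub> h)) (pa_ideal S e (inv\<^bsub>G\<^esub> (g \<otimes>\<^bsub>G\<^esub> h)))" for t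
  proof -
    have ih: "inv\<^bsub>G\<^esub> h \<in> carrier G" and igh: "inv\<^bsub>G\<^esub> (g \<otimes>\<^bsub>G\<^esub> h) \<in> carrier G" using g h by auto
    have t': "t \<in> (if inv\<^bsub>G\<^esub> h \<in> H \<and> inv\<^bsub>G\<^esub> (g \<otimes>\<^bsub>G\<^esub> h) \<in> H then B1 else {\<zero>})"
      using t pa_ring2_e(1)[OF ih igh] by (simp add: pa_ring2_def)
    then have tB: "t \<in> carrier B" using B1_closed by (auto split: if_splits)
    show ?thesis unfolding \<omega>_unit(2)[OF g h]
    proof (cases "g \<in> H \<and> h \<in> H")
      case True
      then have "g \<otimes>\<^bsub>G\<^esub> h \<in> H" using H_mult by blast
      then show "\<alpha> g (\<alpha> h t) = \<omega> g h \<otimes>\<^bsub>S\<^esub> \<alpha> (g \<otimes>\<^bsub>G\<^esub> h) t \<otimes>\<^bsub>S\<^esub> (if g \<in> H \<and> h \<in> H then \<omega>' g h else \<zero>)"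
        using True tB by (simp add: \<alpha>_def \<omega>_def \<omega>'_def A.m_assoc cancel)
    next
      case False
      then have "\<alpha> g (\<alpha> h t) = \<zero>" using u_zero tB by (auto simp: \<alpha>_def)
      then show "\<alpha> g (\<alpha> h t) = \<omega> g h \<otimes>\<^bsub>S\<^esub> \<alpha> (g \<otimes>\<^bsub>G\<^esub> h) t \<otimes>\<^bsub>S\<^esub> (if g \<in> H \<and> h \<in> H then \<omega>' g h else \<zero>)"
        using False tB by (auto simp: \<alpha>_def)
    qed
  qed
  fix l assume l: "l \<in> carrier G"
  show "\<alpha> g (\<omega> h l \<otimes>\<^bsub>S\<^esub> e (inv\<^bsub>G\<^esub> g)) \<otimes>\<^bsub>S\<^esub> \<omega> g (h \<otimes>\<^bsub>G\<^esub> l) = \<omega> g h \<otimes>\<^bsub>S\<^esub> \<omega> (g \<otimes>\<^bsub>G\<^esub> h) l"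
  proof (cases "g \<in> H \<and> h \<in> H \<and> l \<in> H")
    case True
    then have "g \<otimes>\<^bsub>G\<^esub> h \<in> H" "h \<otimes>\<^bsub>G\<^esub> l \<in> H" "inv\<^bsub>G\<^esub> g \<in> H" using H_mult H_inv by blast+
    \<comment> \<open>Both sides cancel down to \<open>u g \<otimes> u h \<otimes> u l\<close> times
      the value of \<open>v\<close> at ghl.\<close>
    then show ?thesis using True g h l by (simp add: \<alpha>_def \<omega>_def e_def A.m_assoc cancel G.m_assoc)
  next
    case False
    have ee: "e (inv\<^bsub>G\<^esub> g) \<in> carrier B" using e_closed B1_closed by blast
    have "\<alpha> g (\<omega> h l \<otimes> e (inv\<^bsub>G\<^esub> g)) = \<zero> \<and> \<omega> g h \<otimes> \<omega> (g \<otimes>\<^bsub>G\<^esub> h) l = \<zero>"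
      using False ee \<omega>_eq_zero[of h l] \<omega>_eq_zero[of g h] \<omega>_eq_zero[of "g \<otimes>\<^bsub>G\<^esub> h" l] u_zero[of g]
      by (auto simp: \<alpha>_def)
    then show ?thesis by simp
  qed
next
  show "pa_ideal S e \<one>\<^bsub>G\<^esub> = carrier S" using H_one by (simp add: pa_ideal_e)
  show "\<alpha> \<one>\<^bsub>G\<^esub> s = s" if "s \<in> carrier S" for s using that B1_closed u_one v_one by (simp add: \<alpha>_def)
qed

section \<open>The graded isomorphism onto the crossed product\<close>

abbreviation "cp \<equiv> component B (carrier G) (rpart B)"
abbreviation "PCP \<equiv> partial_crossed_product G S e \<alpha> \<omega>"

text \<open>The symbol \<delta>_g is to correspond to \<open>u g\<close>, so the coefficient of a
  component is found by multiplying with \<open>v g\<close> on the right; off \<open>H\<close> the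
  component itself is zero.\<close>

definition F :: "'b \<Rightarrow> 'g \<Rightarrow> 'b" where "F b = (\<lambda>g\<in>carrier G. cp b g \<otimes> v g)"

lemmas cp_spec = component_spec[OF A.abelian_group_axioms part_decomposition]
lemmas cp_closed = component_closed[OF A.abelian_group_axioms part_decomposition]
lemmas cp_sum = component_sum[OF A.abelian_group_axioms part_decomposition]
lemmas cp_eqI = component_eqI[OF A.abelian_group_axioms part_decomposition]
lemmas cp_add = component_add[OF A.abelian_group_axioms part_decomposition]
lemmas cp_homogeneous = component_homogeneous[OF A.abelian_group_axioms part_decomposition]

lemma PCP_simps:
  "carrier PCP = {a \<in> (\<Pi>\<^sub>E g\<in>carrier G. pa_ideal S e g). finite {g\<in>carrier G. a g \<noteq> \<zero>}}"
  "\<one>\<^bsub>PCP\<^esub> = (\<lambda>g\<in>carrier G. if g = \<one>\<^bsub>G\<^esub> then \<one> else \<zero>)"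
  "a \<oplus>\<^bsub>PCP\<^esub> b = (\<lambda>g\<in>carrier G. a g \<oplus> b g)"
  "a \<otimes>\<^bsub>PCP\<^esub> b = (\<lambda>k\<in>carrier G.
       finsum S (\<lambda>(g, h). a g \<otimes> \<alpha> g (b h \<otimes> e (inv\<^bsub>G\<^esub> g)) \<otimes> \<omega> g h)
         {(g, h). g \<in> carrier G \<and> h \<in> carrier G \<and> g \<otimes>\<^bsub>G\<^esub> h = k \<and> a g \<noteq> \<zero> \<and> b h \<noteq> \<zero>})"
  "rpart PCP g = {a \<in> carrier PCP. \<forall>h\<in>carrier G. h \<noteq> g \<longrightarrow> a h = \<zero>}"
  by (simp_all add: partial_crossed_product_def Let_def cong: if_cong)

lemma cp_off_H: "b \<in> carrier B \<Longrightarrow> g \<in> carrier G \<Longrightarrow> g \<notin> H \<Longrightarrow> cp b g = \<zero>"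
  using cp_closed(1)[of b g] part_zero by auto

lemma F_part:
  assumes b: "b \<in> carrier B" and g: "g \<in> carrier G"
  shows "F b g \<in> pa_ideal S e g" and "F b g \<in> B1" and "F b g = \<zero> \<longleftrightarrow> cp b g = \<zero>"
    and "F b g \<otimes> u g = cp b g"
proof -
  note c = cp_closed[OF b g]
  have "cp b g \<otimes> v g \<in> B1" if "g \<in> H"
    using part_mult[OF g _ c(1) v_part[OF that]] g by simp
  then show 1: "F b g \<in> pa_ideal S e g" using g cp_off_H[OF b g] by (auto simp: F_def pa_ideal_e)
  then show "F b g \<in> B1" using part(2)[OF G.one_closed] by (auto simp: pa_ideal_e split: if_splits)
  show 2: "F b g \<otimes> u g = cp b g"
    using g c cp_off_H[OF b g] vu by (cases "g \<in> H") (simp_all add: F_def A.m_assoc)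
  show "F b g = \<zero> \<longleftrightarrow> cp b g = \<zero>"
    using 2 g c(2) by (auto simp: F_def)
qed

lemma F_closed: "b \<in> carrier B \<Longrightarrow> F b \<in> carrier PCP"
proof -
  assume b: "b \<in> carrier B"
  have "{g\<in>carrier G. F b g \<noteq> \<zero>} = {g\<in>carrier G. cp b g \<noteq> \<zero>}" using F_part(3)[OF b] by blast
  then have "finite {g\<in>carrier G. F b g \<noteq> \<zero>}" using cp_spec(2)[OF b] by simp
  moreover have "F b \<in> extensional (carrier G)" by (simp add: F_def)
  ultimately show ?thesis using F_part(1)[OF b] by (simp add: PCP_simps(1) PiE_iff)
qed

lemma F_bij: "bij_betw F (carrier B) (carrier PCP)"
proof (rule bij_betwI')
  fix b c assume b: "b \<in> carrier B" and c: "c \<in> carrier B"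
  show "F b = F c \<longleftrightarrow> b = c"
  proof
    assume eq: "F b = F c"
    have cpe: "cp b g = cp c g" if "g \<in> carrier G" for g using F_part(4)[OF b that] F_part(4)[OF c that] eq by simp
    let ?K = "{g\<in>carrier G. cp b g \<noteq> \<zero>}"
    have K: "{g\<in>carrier G. cp c g \<noteq> \<zero>} = ?K" using cpe by auto
    have "finsum B (cp b) ?K = finsum B (cp c) ?K"
      by (rule A.finsum_cong') (use cpe cp_closed(2)[OF c] in auto)
    then show "b = c" using cp_spec(3)[OF b] cp_spec(3)[OF c] K by simp
  qed simp
next
  fix a assume a: "a \<in> carrier PCP"
  let ?K = "{g\<in>carrier G. a g \<noteq> \<zero>}"
  have aB: "a g \<in> B1" "g \<notin> H \<Longrightarrow> a g = \<zero>" if "g \<in> carrier G" for g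
    using a that part(2)[OF G.one_closed] by (auto simp: PCP_simps(1) PiE_iff pa_ideal_e split: if_splits)
  have au: "a g \<otimes> u g \<in> rpart B g" if "g \<in> ?K" for g
    using that aB[of g] part_mult_l[of g "a g" "u g"] u_part[of g] by auto
  define b where "b = finsum B (\<lambda>g. a g \<otimes> u g) ?K"
  have b: "b \<in> carrier B" unfolding b_def
    by (rule A.finsum_closed) (use aB(1) B1_closed in auto)
  have fin: "finite ?K" using a by (simp add: PCP_simps(1))
  have c: "cp b g = (if g \<in> ?K then a g \<otimes> u g else \<zero>)" if "g \<in> carrier G" for g
    by (rule cp_eqI[OF fin _ au b_def that]) auto
  have "F b g = a g" if g: "g \<in> carrier G" for g
  proof (cases "a g = \<zero>")
    case True
    then show ?thesis using c[OF g] g by (simp add: F_def)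
  next
    case False
    then have "g \<in> H" using aB(2)[OF g] by blast
    then show ?thesis using c[OF g] g False uv B1_closed[OF aB(1)[OF g]] by (simp add: F_def A.m_assoc)
  qed
  moreover have "a \<in> extensional (carrier G)" using a by (simp add: PCP_simps(1) PiE_iff)
  ultimately have "F b = a" unfolding F_def by (intro extensionalityI[where A = "carrier G"]) auto
  then show "\<exists>x\<in>carrier B. a = F x" using b by blast
qed (rule F_closed)

text \<open>The product is expanded over pairs of degrees and sorted by their product k. For a
  single pair the crossed product formula telescopes: \<open>v g\<close> cancels against
  \<open>u g\<close>, and \<open>v h\<close> against \<open>u h\<close>, so that \<open>v k\<close>
  is left.\<close>

lemma F_mult:
  assumes b: "b \<in> carrier B" and c: "c \<in> carrier B"
  shows "F (b \<otimes> c) = F b \<otimes>\<^bsub>PCP\<^esub> F c"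
proof (rule extensionalityI[where A = "carrier G"])
  show "F (b \<otimes> c) \<in> extensional (carrier G)" "F b \<otimes>\<^bsub>PCP\<^esub> F c \<in> extensional (carrier G)"
    by (simp_all add: F_def PCP_simps(4))
  let ?P = "{g\<in>carrier G. cp b g \<noteq> \<zero>}" and ?Q = "{g\<in>carrier G. cp c g \<noteq> \<zero>}"
  let ?m = "\<lambda>(g, h). cp b g \<otimes> cp c h" and ?pr = "\<lambda>(g, h). g \<otimes>\<^bsub>G\<^esub> h"
  let ?f = "\<lambda>k. {z \<in> ?P \<times> ?Q. ?pr z = k}"
  have fin: "finite ?P" "finite ?Q" using cp_spec(2) b c by auto
  have mc: "?m z \<in> carrier B" if "z \<in> ?P \<times> ?Q" for z using that cp_closed(2) b c by auto
  have sub: "?pr ` (?P \<times> ?Q) \<subseteq> carrier G" by auto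
  have "b \<otimes> c = finsum B (cp b) ?P \<otimes> c" using cp_spec(3)[OF b] by simp
  also have "\<dots> = finsum B (\<lambda>g. cp b g \<otimes> c) ?P"
    by (rule A.finsum_ldistr[OF fin(1) c]) (use cp_closed(2) b in auto)
  also have "\<dots> = finsum B (\<lambda>g. finsum B (\<lambda>h. cp b g \<otimes> cp c h) ?Q) ?P"
  proof (rule A.finsum_cong')
    show "cp b g \<otimes> c = finsum B (\<lambda>h. cp b g \<otimes> cp c h) ?Q" if g: "g \<in> ?P" for g
    proof -
      have "cp b g \<otimes> c = cp b g \<otimes> finsum B (cp c) ?Q" using cp_spec(3)[OF c] by simp
      also have "\<dots> = finsum B (\<lambda>h. cp b g \<otimes> cp c h) ?Q"
        by (rule A.finsum_rdistr[OF fin(2)]) (use g cp_closed(2) b c in auto)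
      finally show ?thesis .
    qed
  qed (use cp_closed(2) b c in \<open>auto intro!: A.finsum_closed\<close>)
  also have "\<dots> = finsum B ?m (?P \<times> ?Q)"
    using A.finsum_Times[OF fin, of ?m] mc by auto
  also have "?P \<times> ?Q = (\<Union>k\<in>?pr ` (?P \<times> ?Q). ?f k)" by auto
  also have "finsum B ?m \<dots> = finsum B (\<lambda>k. finsum B ?m (?f k)) (?pr ` (?P \<times> ?Q))"
    by (rule A.add.finprod_UN_disjoint) (use fin mc in \<open>auto simp: pairwise_def disjnt_def\<close>)
  finally have bc: "b \<otimes> c = finsum B (\<lambda>k. finsum B ?m (?f k)) (?pr ` (?P \<times> ?Q))" .
  have part_f: "finsum B ?m (?f k) \<in> rpart B k" if k: "k \<in> carrier G" for k
    using k part_mult cp_closed(1) b c by (intro part_finsum) auto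
  have cpbc: "cp (b \<otimes> c) k = finsum B ?m (?f k)" if k: "k \<in> carrier G" for k
  proof -
    have 1: "cp (b \<otimes> c) k = (if k \<in> ?pr ` (?P \<times> ?Q) then finsum B ?m (?f k) else \<zero>)"
      by (rule cp_eqI[OF _ sub _ bc k]) (use fin part_f sub in auto)
    show ?thesis
    proof (cases "k \<in> ?pr ` (?P \<times> ?Q)")
      case False
      then have "?f k = {}" by blast
      then have "finsum B ?m (?f k) = \<zero>" by (simp only: A.finsum_empty)
      then show ?thesis using 1 False by simp
    qed (use 1 in simp)
  qed
  fix k assume k: "k \<in> carrier G"
  let ?N = "{(g, h). g \<in> carrier G \<and> h \<in> carrier G \<and> g \<otimes>\<^bsub>G\<^esub> h = k \<and> F b g \<noteq> \<zero> \<and> F c h \<noteq> \<zero>}"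
  let ?t = "\<lambda>(g, h). F b g \<otimes> \<alpha> g (F c h \<otimes> e (inv\<^bsub>G\<^esub> g)) \<otimes> \<omega> g h"
  have Nf: "?N = ?f k" using F_part(3)[OF b] F_part(3)[OF c] by auto
  have t: "?t z = ?m z \<otimes> v k \<and> ?t z \<in> B1" if z: "z \<in> ?f k" for z
  proof -
    obtain g h where gh: "z = (g, h)" "g \<in> carrier G" "h \<in> carrier G" "cp b g \<noteq> \<zero>" "cp c h \<noteq> \<zero>" "g \<otimes>\<^bsub>G\<^esub> h = k"
      using z by auto
    then have H: "g \<in> H" "h \<in> H" using cp_off_H b c by auto
    have cc: "cp b g \<in> carrier B" "cp c h \<in> carrier B" using cp_closed(2) b c gh by auto
    have Fc: "F c h \<in> carrier B" "F c h \<in> B1" using F_part(2)[OF c gh(3)] B1_closed by auto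
    have eg: "e (inv\<^bsub>G\<^esub> g) = \<one>" using H_inv[OF H(1)] by (simp add: e_def)
    have "?t z = F b g \<otimes> \<alpha> g (F c h) \<otimes> \<omega> g h" using gh(1) eg Fc by simp
    also have "\<dots> = cp b g \<otimes> (F c h \<otimes> u h) \<otimes> v k"
      using gh H cc Fc(1) by (simp add: F_def[of b] \<alpha>_def \<omega>_def A.m_assoc cancel)
    also have "\<dots> = ?m z \<otimes> v k" using F_part(4)[OF c gh(3)] gh(1) by simp
    finally have 1: "?t z = ?m z \<otimes> v k" .
    have "F b g \<otimes> \<alpha> g (F c h) \<otimes> \<omega> g h \<in> B1"
      by (intro part_mult_l[OF G.one_closed] F_part(2)[OF b gh(2)] \<alpha>_closed[OF gh(2) Fc(2)] \<omega>_part[OF gh(2,3)])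
    then show ?thesis using 1 gh(1) eg Fc by simp
  qed
  have "(F b \<otimes>\<^bsub>PCP\<^esub> F c) k = finsum S ?t (?f k)"
    using k Nf unfolding PCP_simps(4) by simp
  also have "\<dots> = finsum B ?t (?f k)"
    by (rule finsum_same[OF A.abelian_monoid_axioms ring.is_abelian_group[OF ring_S, THEN abelian_group.axioms(1)]])
      (use t B1_closed in auto)
  also have "\<dots> = finsum B (\<lambda>z. ?m z \<otimes> v k) (?f k)"
    by (rule A.finsum_cong') (use t mc in auto)
  also have "\<dots> = finsum B ?m (?f k) \<otimes> v k"
    by (rule A.finsum_ldistr[symmetric]) (use fin mc in auto)
  finally show "F (b \<otimes> c) k = (F b \<otimes>\<^bsub>PCP\<^esub> F c) k" using cpbc[OF k] k by (simp add: F_def)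
qed

lemma crossed_product: "is_partial_crossed_product G B"
proof -
  have hom: "F \<in> ring_hom B PCP"
  proof (rule ring_hom_memI)
    show "F b \<in> carrier PCP" if "b \<in> carrier B" for b using F_closed[OF that] .
    show "F (b \<otimes> c) = F b \<otimes>\<^bsub>PCP\<^esub> F c" if "b \<in> carrier B" "c \<in> carrier B" for b c using F_mult[OF that] .
    show "F (b \<oplus> c) = F b \<oplus>\<^bsub>PCP\<^esub> F c" if "b \<in> carrier B" "c \<in> carrier B" for b c
      unfolding F_def PCP_simps(3) using cp_add[OF that] cp_closed(2) that by (auto simp: A.l_distr)
    show "F \<one> = \<one>\<^bsub>PCP\<^esub>"
      unfolding F_def PCP_simps(2) using cp_homogeneous[OF G.one_closed one_part] v_one by auto
  qed
  have parts: "F ` rpart B g = rpart PCP g" if g: "g \<in> carrier G" for g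
  proof
    show "F ` rpart B g \<subseteq> rpart PCP g"
    proof
      fix a assume "a \<in> F ` rpart B g"
      then obtain b where b: "b \<in> rpart B g" "a = F b" by blast
      then have bB: "b \<in> carrier B" using part_closed[OF g] by blast
      show "a \<in> rpart PCP g" unfolding PCP_simps(5)
        using F_closed[OF bB] F_part(3)[OF bB] cp_homogeneous[OF g b(1)] b(2) by simp
    qed
    show "rpart PCP g \<subseteq> F ` rpart B g"
    proof
      fix a assume "a \<in> rpart PCP g"
      then have a: "a \<in> carrier PCP" "\<And>h. h \<in> carrier G \<Longrightarrow> h \<noteq> g \<Longrightarrow> a h = \<zero>" unfolding PCP_simps(5) by auto
      then obtain b where b: "b \<in> carrier B" "a = F b" using F_bij unfolding bij_betw_def by blast
      have "{h\<in>carrier G. cp b h \<noteq> \<zero>} \<subseteq> {g}" using a(2) b F_part(3)[OF b(1)] by auto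
      then have "b = finsum B (cp b) {g}" using cp_sum[OF b(1), of "{g}"] g by simp
      then have "b = cp b g" using cp_closed(2)[OF b(1) g] by simp
      then show "a \<in> F ` rpart B g" using cp_closed(1)[OF b(1) g] b(2) by auto
    qed
  qed
  have "graded_ring_iso G B PCP" unfolding graded_ring_iso_def
    using hom F_bij parts by (auto simp: ring_iso_def intro!: bexI[of _ F])
  then show ?thesis unfolding is_partial_crossed_product_def using graded twisted_partial_action by blast
qed

end

lemma partial_crossed_product_criterion:
  fixes B :: "('g, 'b) graded_ring"
  assumes B: "is_graded_ring G B" and one: "\<one>\<^bsub>B\<^esub> \<in> rpart B \<one>\<^bsub>G\<^esub>" and H: "subgroup H G"
    and units: "\<And>g. g \<in> H \<Longrightarrow> \<exists>u\<in>rpart B g. \<exists>v\<in>rpart B (inv\<^bsub>G\<^esub> g). u \<otimes>\<^bsub>B\<^esub> v = \<one>\<^bsub>B\<^esub> \<and> v \<otimes>\<^bsub>B\<^esub> u = \<one>\<^bsub>B\<^esub>"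
    and zero: "\<And>g. g \<in> carrier G \<Longrightarrow> g \<notin> H \<Longrightarrow> rpart B g = {\<zero>\<^bsub>B\<^esub>}"
  shows "is_partial_crossed_product G B"
proof -
  interpret graded_unital G B by unfold_locales (rule B one)+
  obtain u v where uv: "\<And>g. g \<in> H \<Longrightarrow> u g \<in> rpart B g \<and> v g \<in> rpart B (inv\<^bsub>G\<^esub> g) \<and>
      u g \<otimes>\<^bsub>B\<^esub> v g = \<one>\<^bsub>B\<^esub> \<and> v g \<otimes>\<^bsub>B\<^esub> u g = \<one>\<^bsub>B\<^esub>" using units by metis
  \<comment> \<open>The chosen units are normalised to 1 in the neutral degree and extended by 0 off
    \<open>H\<close>.\<close>
  let ?w = "\<lambda>f g. if g = \<one>\<^bsub>G\<^esub> then \<one>\<^bsub>B\<^esub> else if g \<in> H then f g else \<zero>\<^bsub>B\<^esub>"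
  interpret homogeneous_units G B H "?w u" "?w v"
    by (rule homogeneous_units.intro[OF graded_unital_axioms homogeneous_units_axioms.intro])
      (use H one uv zero subgroup.one_closed[OF H] in auto)
  show ?thesis by (rule crossed_product)
qed

section \<open>Graded equivalence with the endomorphism ring\<close>

lemma END_simps [simp]:
  "carrier (END G A N) = sum_of_parts (End_ring G A N) (carrier G) (Mor G A N)"
  "u \<otimes>\<^bsub>END G A N\<^esub> v = compose (carrier N) v u"
  "\<one>\<^bsub>END G A N\<^esub> = (\<lambda>x\<in>carrier N. x)"
  "\<zero>\<^bsub>END G A N\<^esub> = (\<lambda>x\<in>carrier N. \<zero>\<^bsub>N\<^esub>)"
  "u \<oplus>\<^bsub>END G A N\<^esub> v = (\<lambda>x\<in>carrier N. u x \<oplus>\<^bsub>N\<^esub> v x)"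
  "rpart (END G A N) = Mor G A N"
  by (simp_all add: END_def restrict_grading_def End_ring_def)

text \<open>Off \<open>H\<close> the morphisms vanish for reasons of coordinates: a map of degree g
  sends \<open>p i\<close> to an element with coordinates in A_g, which is zero there.\<close>

lemma (in graded_basis) END_crossed_product:
  assumes H: "subgroup H G"
    and units: "\<And>g. g \<in> H \<Longrightarrow> \<exists>u\<in>Mor G A N g. \<exists>v\<in>Mor G A N (inv\<^bsub>G\<^esub> g).
      compose (carrier N) v u = (\<lambda>x\<in>carrier N. x) \<and> compose (carrier N) u v = (\<lambda>x\<in>carrier N. x)"
    and zero: "\<And>g. g \<in> carrier G \<Longrightarrow> g \<notin> H \<Longrightarrow> rpart A g = {\<zero>}"
  shows "is_partial_crossed_product G (END G A N)"
proof (rule partial_crossed_product_criterion[OF is_graded_ring_END[OF G.is_group graded_module] _ H])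
  let ?z = "\<lambda>x\<in>carrier N. \<zero>\<^bsub>N\<^esub>"
  show "\<one>\<^bsub>END G A N\<^esub> \<in> rpart (END G A N) \<one>\<^bsub>G\<^esub>"
    using lin_mapsI[OF N.left_module_axioms, of "\<lambda>x. x" N] mpart_closed by (auto simp: Mor_def)
  show "\<exists>u\<in>rpart (END G A N) g. \<exists>v\<in>rpart (END G A N) (inv\<^bsub>G\<^esub> g).
      u \<otimes>\<^bsub>END G A N\<^esub> v = \<one>\<^bsub>END G A N\<^esub> \<and> v \<otimes>\<^bsub>END G A N\<^esub> u = \<one>\<^bsub>END G A N\<^esub>" if "g \<in> H" for g
    using units[OF that] by simp
  fix g assume g: "g \<in> carrier G" "g \<notin> H"
  interpret E: ring "End_ring G A N" by (rule ring_End_ring[OF N.left_module_axioms])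
  have zl: "?z \<in> lin_maps A N N" using E.zero_closed by simp
  show "rpart (END G A N) g = {\<zero>\<^bsub>END G A N\<^esub>}"
  proof (intro equalityI subsetI)
    fix f assume "f \<in> rpart (END G A N) g"
    then have f: "f \<in> lin_maps A N N" "\<And>h x. h \<in> carrier G \<Longrightarrow> x \<in> mpart N h \<Longrightarrow> f x \<in> mpart N (h \<otimes>\<^bsub>G\<^esub> g)"
      unfolding END_simps Mor_def by blast+
    have "f = ?z"
    proof (rule lin_maps_eq_on_p[OF f(1) zl])
      fix i assume i: "i \<in> I"
      have "f (p i) \<in> mpart N g" using f(2)[OF G.one_closed p_part[OF i]] g by simp
      then have fp: "f (p i) \<in> carrier N" "\<And>j. j \<in> I \<Longrightarrow> \<phi> j (f (p i)) = \<zero>"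
        using mpart_iff[OF g(1)] zero[OF g] by auto
      have "f (p i) = finsum N (\<lambda>j. \<phi> j (f (p i)) \<odot>\<^bsub>N\<^esub> p j) I" using d(6)[OF fp(1)] by simp
      also have "\<dots> = \<zero>\<^bsub>N\<^esub>" using fp(2) d(2) by (intro N.M.add.finprod_one_eqI) (simp add: N.smult_l_null)
      finally show "f (p i) = ?z (p i)" using d(2)[OF i] by simp
    qed
    then show "f \<in> {\<zero>\<^bsub>END G A N\<^esub>}" by simp
  next
    fix f assume "f \<in> {\<zero>\<^bsub>END G A N\<^esub>}"
    then have "f = ?z" by simp
    moreover have "?z ` mpart N h \<subseteq> mpart N (h \<otimes>\<^bsub>G\<^esub> g)" if "h \<in> carrier G" for h
      using mpart_closed[OF that] mpart(2)[of "h \<otimes>\<^bsub>G\<^esub> g"] that g by auto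
    ultimately show "f \<in> rpart (END G A N) g" using zl unfolding END_simps Mor_def by blast
  qed
qed

section \<open>Transport of endomorphism rings and traces along isomorphisms\<close>

definition conj_map :: "'b set \<Rightarrow> ('b \<Rightarrow> 'c) \<Rightarrow> ('c \<Rightarrow> 'b) \<Rightarrow> ('c \<Rightarrow> 'c) \<Rightarrow> 'b \<Rightarrow> 'b"
  where "conj_map X \<Phi> \<Psi> f = (\<lambda>x\<in>X. \<Psi> (f (\<Phi> x)))"

lemma conj_map_props:
  assumes N: "left_module A N" and N': "left_module A N'"
    and \<Phi>: "\<Phi> \<in> lin_maps A N N'" and \<Psi>: "\<Psi> \<in> lin_maps A N' N"
    and gr: "\<forall>g\<in>carrier G. \<Phi> ` mpart N g \<subseteq> mpart N' g" "\<forall>g\<in>carrier G. \<Psi> ` mpart N' g \<subseteq> mpart N g"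
    and sub: "\<forall>g\<in>carrier G. mpart N g \<subseteq> carrier N" and G: "group G"
  shows "additive_map (End_ring G A N') (End_ring G A N) (conj_map (carrier N) \<Phi> \<Psi>)"
    and "g \<in> carrier G \<Longrightarrow> conj_map (carrier N) \<Phi> \<Psi> ` Mor G A N' g \<subseteq> Mor G A N g"
    and "conj_map (carrier N) \<Phi> \<Psi> ` carrier (END G A N') \<subseteq> carrier (END G A N)"
proof -
  interpret N: left_module A N by fact
  interpret N': left_module A N' by fact
  interpret G: group G by fact
  interpret E: ring "End_ring G A N" by (rule ring_End_ring[OF N])
  interpret E': ring "End_ring G A N'" by (rule ring_End_ring[OF N'])
  let ?T = "conj_map (carrier N) \<Phi> \<Psi>"
  note p = lin_mapsD[OF \<Phi>] and q = lin_mapsD[OF \<Psi>]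
  have T: "?T f \<in> lin_maps A N N" if f: "f \<in> lin_maps A N' N'" for f
    unfolding conj_map_def
    by (rule lin_mapsI[OF N]) (use p q lin_mapsD[OF f] in auto)
  show add: "additive_map (End_ring G A N') (End_ring G A N) ?T"
  proof (rule additive_mapI)
    show "?T f \<in> carrier (End_ring G A N)" if "f \<in> carrier (End_ring G A N')" for f using T that by simp
    show "?T (f \<oplus>\<^bsub>End_ring G A N'\<^esub> f') = ?T f \<oplus>\<^bsub>End_ring G A N\<^esub> ?T f'"
      if "f \<in> carrier (End_ring G A N')" "f' \<in> carrier (End_ring G A N')" for f f'
      using that p(1) q(2) lin_mapsD(1)[of f A N' N'] lin_mapsD(1)[of f' A N' N']
      by (auto simp: conj_map_def intro!: restrict_ext)
  qed
  show M: "?T ` Mor G A N' g \<subseteq> Mor G A N g" if g: "g \<in> carrier G" for g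
  proof
    fix u assume "u \<in> ?T ` Mor G A N' g"
    then obtain f where f: "f \<in> lin_maps A N' N'" "\<And>h. h \<in> carrier G \<Longrightarrow> f ` mpart N' h \<subseteq> mpart N' (h \<otimes>\<^bsub>G\<^esub> g)" "u = ?T f"
      by (auto simp: Mor_def)
    have "?T f x \<in> mpart N (h \<otimes>\<^bsub>G\<^esub> g)" if h: "h \<in> carrier G" and x: "x \<in> mpart N h" for h x
    proof -
      have "\<Phi> x \<in> mpart N' h" using gr(1) h x by blast
      then have "f (\<Phi> x) \<in> mpart N' (h \<otimes>\<^bsub>G\<^esub> g)" using f(2)[OF h] by blast
      then have "\<Psi> (f (\<Phi> x)) \<in> mpart N (h \<otimes>\<^bsub>G\<^esub> g)" using gr(2) h g G.m_closed by blast
      then show ?thesis using sub h x by (auto simp: conj_map_def)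
    qed
    then show "u \<in> Mor G A N g" using T[OF f(1)] f(3) by (auto simp: Mor_def)
  qed
  show "?T ` carrier (END G A N') \<subseteq> carrier (END G A N)"
  proof
    fix u assume "u \<in> ?T ` carrier (END G A N')"
    then obtain F S where F: "finite S" "S \<subseteq> carrier G" "F \<in> (\<Pi> i\<in>S. Mor G A N' i)" "u = ?T (finsum (End_ring G A N') F S)"
      by (auto simp: sum_of_parts_def)
    have Fc: "F \<in> S \<rightarrow> carrier (End_ring G A N')" using F(3) by (auto simp: Mor_def Pi_iff)
    have "u = finsum (End_ring G A N) (\<lambda>i. ?T (F i)) S" unfolding F(4)
      by (rule additive_map_finsum[OF E'.abelian_group_axioms E.abelian_group_axioms add Fc])
    moreover have "(\<lambda>i. ?T (F i)) \<in> (\<Pi> i\<in>S. Mor G A N i)" using M F by blast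
    ultimately show "u \<in> carrier (END G A N)" using F(1,2) unfolding END_simps sum_of_parts_def by blast
  qed
qed

lemma mpart_subset:
  assumes N: "is_graded_module G A N" and g: "g \<in> carrier G"
  shows "mpart N g \<subseteq> carrier N"
proof -
  have lm: "left_module A N" and dd: "direct_decomposition N (carrier G) (mpart N)"
    using N by (auto simp: is_graded_module_def)
  have ab: "abelian_group N" using lm by (simp add: left_module_def)
  show ?thesis using additive_subgroupD(1)[OF direct_decompositionD(1)[OF ab dd g] ab] .
qed

lemma conj_map_inverse:
  assumes \<Phi>: "\<Phi> \<in> lin_maps A N N'" and \<Psi>: "\<Psi> \<in> lin_maps A N' N"
    and inv: "\<And>x. x \<in> carrier N \<Longrightarrow> \<Psi> (\<Phi> x) = x" and u: "u \<in> lin_maps A N N"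
  shows "conj_map (carrier N) \<Phi> \<Psi> (conj_map (carrier N') \<Psi> \<Phi> u) = u"
proof (rule PiE_ext[OF _ lin_mapsD(5)[OF u]])
  show "conj_map (carrier N) \<Phi> \<Psi> (conj_map (carrier N') \<Psi> \<Phi> u) \<in> carrier N \<rightarrow>\<^sub>E carrier N"
    using lin_mapsD(1)[OF \<Phi>] lin_mapsD(1)[OF u] inv by (auto simp: conj_map_def)
  show "conj_map (carrier N) \<Phi> \<Psi> (conj_map (carrier N') \<Psi> \<Phi> u) x = u x" if "x \<in> carrier N" for x
    using that lin_mapsD(1)[OF \<Phi>] lin_mapsD(1)[OF u] inv by (simp add: conj_map_def)
qed

lemma END_subset:
  assumes "left_module A N"
  shows "carrier (END G A N) \<subseteq> lin_maps A N N"
proof -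
  interpret E: ring "End_ring G A N" by (rule ring_End_ring[OF assms])
  show ?thesis
    using sum_of_parts_least[OF E.abelian_group_axioms, of "carrier (End_ring G A N)" "carrier G" "Mor G A N"]
      additive_subgroupI'[OF E.abelian_group_axioms, of "carrier (End_ring G A N)"] E.zero_closed E.a_closed E.a_inv_closed
    by (simp add: Mor_def)
qed

text \<open>Conjugation by an inverse pair of graded maps. It runs from \<open>N'\<close> to
  \<open>N\<close> because in \<open>graded_equivalent\<close> the endomorphism ring of the witness
  stands on the left.\<close>

lemma END_graded_iso:
  assumes G: "group G" and N: "is_graded_module G A N" and N': "is_graded_module G A N'"
    and \<Phi>: "\<Phi> \<in> lin_maps A N N'" and \<Psi>: "\<Psi> \<in> lin_maps A N' N"
    and inv: "\<And>x. x \<in> carrier N \<Longrightarrow> \<Psi> (\<Phi> x) = x" "\<And>y. y \<in> carrier N' \<Longrightarrow> \<Phi> (\<Psi> y) = y"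
    and gr: "\<forall>g\<in>carrier G. \<Phi> ` mpart N g \<subseteq> mpart N' g" "\<forall>g\<in>carrier G. \<Psi> ` mpart N' g \<subseteq> mpart N g"
  shows "graded_ring_iso G (END G A N') (END G A N)"
proof -
  have lN: "left_module A N" and lN': "left_module A N'" using N N' by (auto simp: is_graded_module_def)
  interpret N: left_module A N by fact
  interpret N': left_module A N' by fact
  have sub: "\<forall>g\<in>carrier G. mpart N g \<subseteq> carrier N" and sub': "\<forall>g\<in>carrier G. mpart N' g \<subseteq> carrier N'"
    using mpart_subset[OF N] mpart_subset[OF N'] by blast+
  let ?T = "conj_map (carrier N) \<Phi> \<Psi>" and ?T' = "conj_map (carrier N') \<Psi> \<Phi>"
  note p = lin_mapsD[OF \<Phi>] and q = lin_mapsD[OF \<Psi>]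
  note T = conj_map_props[OF lN lN' \<Phi> \<Psi> gr sub G] and T' = conj_map_props[OF lN' lN \<Psi> \<Phi> gr(2,1) sub' G]
  note TT' = conj_map_inverse[OF \<Phi> \<Psi> inv(1)] and T'T = conj_map_inverse[OF \<Psi> \<Phi> inv(2)]
  note EN = END_subset[OF lN] and EN' = END_subset[OF lN']
  have bij: "bij_betw ?T (carrier (END G A N')) (carrier (END G A N))"
    by (rule bij_betw_byWitness[where f' = ?T']) (use TT' T'T EN EN' T(3) T'(3) in blast)+
  have hom: "?T \<in> ring_hom (END G A N') (END G A N)"
  proof (rule ring_hom_memI)
    fix u w assume uw: "u \<in> carrier (END G A N')" "w \<in> carrier (END G A N')"
    then have u: "u \<in> lin_maps A N' N'" and w: "w \<in> lin_maps A N' N'" using EN' by blast+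
    show "?T (u \<otimes>\<^bsub>END G A N'\<^esub> w) = ?T u \<otimes>\<^bsub>END G A N\<^esub> ?T w"
      using p(1) q(1) lin_mapsD(1)[OF u] lin_mapsD(1)[OF w] inv
      by (auto simp: conj_map_def compose_def intro!: restrict_ext)
    show "?T (u \<oplus>\<^bsub>END G A N'\<^esub> w) = ?T u \<oplus>\<^bsub>END G A N\<^esub> ?T w"
      using additive_mapD(2)[OF T(1)] u w by simp
  qed (use T(3) p(1) inv in \<open>auto simp: conj_map_def intro!: restrict_ext\<close>)
  have "?T ` Mor G A N' g = Mor G A N g" if g: "g \<in> carrier G" for g
  proof
    show "?T ` Mor G A N' g \<subseteq> Mor G A N g" by (rule T(2)[OF g])
    show "Mor G A N g \<subseteq> ?T ` Mor G A N' g"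
    proof
      fix u assume u: "u \<in> Mor G A N g"
      then have "?T' u \<in> Mor G A N' g" "?T (?T' u) = u" using T'(2)[OF g] TT' by (auto simp: Mor_def)
      then show "u \<in> ?T ` Mor G A N' g" by (metis imageI)
    qed
  qed
  then show ?thesis unfolding graded_ring_iso_def ring_iso_def using hom bij by auto
qed

lemma trace_one_transport:
  assumes N: "left_module A N" and N': "left_module A N'"
    and \<Phi>: "\<Phi> \<in> lin_maps A N N'" and \<Psi>: "\<Psi> \<in> lin_maps A N' N"
    and inv: "\<And>x. x \<in> carrier N \<Longrightarrow> \<Psi> (\<Phi> x) = x" and t: "trace_one A N"
  shows "trace_one A N'"
proof -
  interpret A: ring A using N by (simp add: left_module_def)
  obtain n :: nat and f x where f: "\<And>j. j < n \<Longrightarrow> f j \<in> lin_maps A N (regular_module A)"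
    and x: "\<And>j. j < n \<Longrightarrow> x j \<in> carrier N" and 1: "finsum A (\<lambda>j. f j (x j)) {..<n} = \<one>\<^bsub>A\<^esub>"
    using t unfolding trace_one_def by blast
  note fc = lin_mapsD(1)[OF f]
  have "finsum A (\<lambda>j. compose (carrier N') (f j) \<Psi> (\<Phi> (x j))) {..<n} = finsum A (\<lambda>j. f j (x j)) {..<n}"
    by (rule A.finsum_cong') (use x inv fc lin_mapsD(1)[OF \<Phi>] in \<open>auto simp: compose_def\<close>)
  then show ?thesis unfolding trace_one_def
    using lin_maps_compose[OF N' \<Psi> f] x lin_mapsD(1)[OF \<Phi>] 1
    by (intro exI[of _ n] exI[of _ "\<lambda>j. compose (carrier N') (f j) \<Psi>"] exI[of _ "\<lambda>j. \<Phi> (x j)"]) simp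
qed

text \<open>A witness for \<open>graded_equivalent\<close> has elements of type
  \<open>nat \<Rightarrow> 'a\<close>, so \<open>N\<close> is copied into A^n by its coordinates;
  grading, dual basis and trace are carried along.\<close>

lemma graded_equivalent_END:
  fixes G :: "('g, 'h) monoid_scheme" and A :: "('g, 'a) graded_ring" and N :: "('g, 'a, 'b) graded_module"
  assumes "graded_basis G A N I p \<phi>" and I: "I = {..<n::nat}" and nz: "\<one>\<^bsub>A\<^esub> \<noteq> \<zero>\<^bsub>A\<^esub>" and t: "trace_one A N"
  shows "graded_equivalent G A (END G A N)"
proof -
  interpret graded_basis G A N I p \<phi> by fact
  define \<tau> where "\<tau> x = (\<lambda>i\<in>{..<n}. \<phi> i x)" for x
  define N' :: "('g, 'a, nat \<Rightarrow> 'a) graded_module" where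
    "N' = \<lparr>carrier = \<tau> ` carrier N, monoid.mult = undefined, monoid.one = undefined, ring.zero = \<tau> \<zero>\<^bsub>N\<^esub>,
      ring.add = (\<lambda>f g. \<lambda>i\<in>{..<n}. f i \<oplus>\<^bsub>A\<^esub> g i), module.smult = (\<lambda>a f. \<lambda>i\<in>{..<n}. a \<otimes>\<^bsub>A\<^esub> f i),
      mpart = (\<lambda>g. \<tau> ` mpart N g)\<rparr>"
  have N'_simps: "carrier N' = \<tau> ` carrier N" "\<zero>\<^bsub>N'\<^esub> = \<tau> \<zero>\<^bsub>N\<^esub>" "f \<oplus>\<^bsub>N'\<^esub> g = (\<lambda>i\<in>{..<n}. f i \<oplus>\<^bsub>A\<^esub> g i)"
    "a \<odot>\<^bsub>N'\<^esub> f = (\<lambda>i\<in>{..<n}. a \<otimes>\<^bsub>A\<^esub> f i)" "mpart N' h = \<tau> ` mpart N h" for f g a h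
    by (simp_all add: N'_def)
  have ta: "\<tau> (x \<oplus>\<^bsub>N\<^esub> y) = \<tau> x \<oplus>\<^bsub>N'\<^esub> \<tau> y" if "x \<in> carrier N" "y \<in> carrier N" for x y
    using d(4) that I by (auto simp: \<tau>_def N'_simps(3))
  have ts: "\<tau> (a \<odot>\<^bsub>N\<^esub> x) = a \<odot>\<^bsub>N'\<^esub> \<tau> x" if "a \<in> carrier A" "x \<in> carrier N" for x a
    using d(5) that I by (auto simp: \<tau>_def N'_simps(4))
  let ?F = "direct_sum {..<n} (\<lambda>_. regular_module A)"
  interpret F: left_module A ?F
    by (rule left_module_direct_sum[OF A.ring_axioms left_module_regular[OF A.ring_axioms]])
  have F_simps: "f \<oplus>\<^bsub>?F\<^esub> g = f \<oplus>\<^bsub>N'\<^esub> g" "a \<odot>\<^bsub>?F\<^esub> f = a \<odot>\<^bsub>N'\<^esub> f" for f g a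
    by (simp_all add: N'_simps)
  have t0: "\<tau> \<zero>\<^bsub>N\<^esub> = \<zero>\<^bsub>?F\<^esub>"
    using additive_map_zero[OF N.M.abelian_group_axioms A.abelian_group_axioms d(8)] I by (auto simp: \<tau>_def)
  have "submodule (\<tau> ` carrier N) A ?F"
  proof (rule F.submoduleI)
    show "\<tau> ` carrier N \<subseteq> carrier ?F" using d(3) I by (auto simp: \<tau>_def)
    show "\<zero>\<^bsub>?F\<^esub> \<in> \<tau> ` carrier N" unfolding t0[symmetric] by (rule imageI) simp
  qed (auto simp: F_simps ta[symmetric] ts[symmetric] N.smult_closed simp del: direct_sum_simps)
  then have lm': "left_module A N'"
    by (rule left_module_cong[OF F.left_module_submodule]) (auto simp: N'_simps t0 fun_eq_iff)
  interpret N': left_module A N' by (rule lm')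
  define \<Phi> where "\<Phi> = restrict \<tau> (carrier N)"
  have \<Phi>: "\<Phi> \<in> lin_maps A N N'" unfolding \<Phi>_def
    by (rule lin_mapsI[OF N.left_module_axioms]) (use ta ts N'_simps(1) in auto)
  have inj: "inj_on \<Phi> (carrier N)"
  proof (rule inj_onI)
    fix x y assume x: "x \<in> carrier N" and y: "y \<in> carrier N" and "\<Phi> x = \<Phi> y"
    then have "\<tau> x = \<tau> y" by (simp add: \<Phi>_def)
    then have e: "\<phi> i x = \<phi> i y" if "i \<in> I" for i using that I unfolding \<tau>_def by (metis restrict_apply')
    have "finsum N (\<lambda>i. \<phi> i x \<odot>\<^bsub>N\<^esub> p i) I = finsum N (\<lambda>i. \<phi> i y \<odot>\<^bsub>N\<^esub> p i) I"
      by (rule N.M.finsum_cong') (use e d(2,3) y in \<open>auto intro!: N.smult_closed\<close>)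
    then show "x = y" using d(6)[OF x] d(6)[OF y] by simp
  qed
  have bij: "bij_betw \<Phi> (carrier N) (carrier N')"
    using inj by (simp add: bij_betw_def N'_simps(1) \<Phi>_def)
  define \<Psi> where "\<Psi> = restrict (inv_into (carrier N) \<Phi>) (carrier N')"
  have \<Psi>: "\<Psi> \<in> lin_maps A N' N" unfolding \<Psi>_def by (rule lin_maps_inv[OF N.left_module_axioms lm' \<Phi> bij])
  have inv1: "\<Psi> (\<Phi> x) = x" if "x \<in> carrier N" for x
    using that bij lin_mapsD(1)[OF \<Phi>] by (simp add: \<Psi>_def bij_betw_inv_into_left)
  have inv2: "\<Phi> (\<Psi> y) = y" if "y \<in> carrier N'" for y
    using that bij by (simp add: \<Psi>_def bij_betw_inv_into_right)
  define \<phi>' where "\<phi>' i = compose (carrier N') (\<phi> i) \<Psi>" for i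
  have \<phi>': "\<phi>' i (\<Phi> x) = \<phi> i x" if "x \<in> carrier N" for x i
    using inv1[OF that] lin_mapsD(1)[OF \<Phi> that] by (simp add: \<phi>'_def compose_def)
  have db': "dual_basis A N' I (\<lambda>i. \<Phi> (p i)) \<phi>'"
    unfolding \<phi>'_def by (rule dual_basis_transport[OF N.left_module_axioms lm' \<Phi> \<Psi> inv2 db])
  have gr1: "\<Phi> ` mpart N g = mpart N' g" if "g \<in> carrier G" for g
    using mpart_closed[OF that] unfolding N'_simps(5) by (auto simp: \<Phi>_def intro!: image_cong)
  have mp: "mpart N' g = {y \<in> carrier N'. \<forall>i\<in>I. \<phi>' i y \<in> rpart A g}" if g: "g \<in> carrier G" for g
  proof (intro equalityI subsetI)
    fix y assume "y \<in> mpart N' g"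
    then obtain x where x: "x \<in> mpart N g" "y = \<Phi> x" using gr1[OF g] by blast
    then show "y \<in> {y \<in> carrier N'. \<forall>i\<in>I. \<phi>' i y \<in> rpart A g}"
      using mpart_iff[OF g] \<phi>' lin_mapsD(1)[OF \<Phi>] by auto
  next
    fix y assume y: "y \<in> {y \<in> carrier N'. \<forall>i\<in>I. \<phi>' i y \<in> rpart A g}"
    then obtain x where x: "x \<in> carrier N" "y = \<Phi> x" using bij by (auto simp: bij_betw_def)
    then have "x \<in> mpart N g" using y mpart_iff[OF g] \<phi>' by auto
    then show "y \<in> mpart N' g" using x gr1[OF g] by blast
  qed
  have "graded_dual_basis G A N' I (\<lambda>i. \<Phi> (p i)) \<phi>'"
    unfolding graded_dual_basis_def using lm' db' mp \<phi>' \<phi>_p d(2) by simp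
  then interpret N'': graded_basis G A N' I "\<lambda>i. \<Phi> (p i)" \<phi>' by unfold_locales
  have gr2: "\<Psi> ` mpart N' g \<subseteq> mpart N g" if g: "g \<in> carrier G" for g
    using gr1[OF g, symmetric] inv1 mpart_closed[OF g] by auto
  have iso: "graded_ring_iso G (END G A N') (END G A N)"
    by (rule END_graded_iso[OF G.is_group graded_module N''.graded_module \<Phi> \<Psi> inv1 inv2]) (use gr1 gr2 in auto)
  \<comment> \<open>\<open>progeneratorI\<close> takes a dual basis indexed by elements of the
    module's type. The unit vectors \<open>h k\<close> serve as names for the numbers k; they are
    distinct because 1 differs from 0.\<close>
  define h :: "nat \<Rightarrow> nat \<Rightarrow> 'a" where "h k = (\<lambda>i. if i = k then \<one>\<^bsub>A\<^esub> else \<zero>\<^bsub>A\<^esub>)" for k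
  have "inj h" using nz by (auto simp: inj_def h_def fun_eq_iff)
  then have "bij_betw h I (h ` I)" by (metis bij_betw_def inj_on_subset subset_UNIV)
  then have "dual_basis A N' (h ` I) ((\<lambda>i. \<Phi> (p i)) \<circ> inv_into I h) (\<phi>' \<circ> inv_into I h)"
    by (intro dual_basis_reindex[OF db' lm'] bij_betw_inv_into)
  then have "progenerator A N'"
    by (rule progeneratorI[OF lm']) (rule trace_one_transport[OF N.left_module_axioms lm' \<Phi> \<Psi> _ t], rule inv1)
  then show ?thesis unfolding graded_equivalent_def
    using graded is_graded_ring_END[OF G.is_group graded_module] N''.graded_module iso by blast
qed

section \<open>Components, trace and units of induced modules\<close>

context graded_unital
begin

context
  fixes P :: "('a, 'p, 'm) module_scheme" and I :: "'i set" and p \<phi>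
  assumes P: "left_module R P" and P_basis: "dual_basis R P I p \<phi>"
begin

interpretation P: left_module R P by (rule P)

interpretation AP: tensor_module R "sub_bimodule A (carrier A)" P A
  by (rule tensor_module_A[OF P])

lemmas d = dual_basisD[OF P_basis, simplified]

lemma \<phi>A: "i \<in> I \<Longrightarrow> m \<in> carrier P \<Longrightarrow> \<phi> i m \<in> carrier A"
  using d(3) R_closed by blast

context
  fixes \<phi>'
  assumes gdb: "graded_dual_basis G A (induced_module G A P) I (\<lambda>i. AP.pt \<one> (p i)) \<phi>'"
    and \<phi>': "\<And>i a m. i \<in> I \<Longrightarrow> a \<in> carrier A \<Longrightarrow> m \<in> carrier P \<Longrightarrow> \<phi>' i (AP.pt a m) = a \<otimes> \<phi> i m"
begin

interpretation N: graded_basis G A "induced_module G A P" I "\<lambda>i. AP.pt \<one> (p i)" \<phi>'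
  by unfold_locales (rule gdb)

abbreviation "NP \<equiv> induced_module G A P"

lemma finsum_NP: "f \<in> J \<rightarrow> carrier AP.T \<Longrightarrow> finsum NP f J = finsum AP.T f J"
  by (rule finsum_same[OF AP.T.abelian_monoid_axioms N.N.M.abelian_monoid_axioms]) auto

lemma expand_T: "x \<in> carrier AP.T \<Longrightarrow> finsum AP.T (\<lambda>i. AP.pt (\<phi>' i x) (p i)) I = x"
proof -
  assume x: "x \<in> carrier AP.T"
  then have x': "x \<in> carrier NP" by simp
  have e: "\<phi>' i x \<odot>\<^bsub>AP.T\<^esub> AP.pt \<one> (p i) = AP.pt (\<phi>' i x) (p i)" if "i \<in> I" for i
    using that N.d(3)[OF that x'] d(2)[OF that] by (simp add: AP.smult_pure)
  have c: "AP.pt (\<phi>' i x) (p i) \<in> carrier AP.T" if "i \<in> I" for i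
    using that N.d(3)[OF that x'] d(2)[OF that] AP.pt_closed by simp
  have "x = finsum NP (\<lambda>i. \<phi>' i x \<odot>\<^bsub>NP\<^esub> AP.pt \<one> (p i)) I" using N.d(6)[OF x'] by simp
  also have "\<dots> = finsum NP (\<lambda>i. AP.pt (\<phi>' i x) (p i)) I"
    by (rule N.N.M.finsum_cong') (use e c in auto)
  also have "\<dots> = finsum AP.T (\<lambda>i. AP.pt (\<phi>' i x) (p i)) I" by (rule finsum_NP) (use c in auto)
  finally show ?thesis by simp
qed

lemma pt_mpart: "g \<in> carrier G \<Longrightarrow> a \<in> rpart A g \<Longrightarrow> m \<in> carrier P \<Longrightarrow> AP.pt a m \<in> mpart NP g"
  using N.mpart_iff[of g "AP.pt a m"] part_closed[of g a] AP.pt_closed[of a m] part_mult_r[of g _ a] d(3) \<phi>' by simp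

text \<open>The degree-one part is the tensor product of \<open>R\<close> with \<open>P\<close>. The
  inverse of m to \<open>\<one> \<otimes> m\<close> rebuilds an element of \<open>P\<close> from
  coordinates, which lie in \<open>R\<close> for elements of degree one.\<close>

lemma base_iso: "module_iso R P (NP\<lparr>carrier := mpart NP \<one>\<^bsub>G\<^esub>\<rparr>)"
proof (rule module_isoI[OF P, where f = "AP.pt \<one>" and g = "\<lambda>x. finsum P (\<lambda>i. \<phi>' i x \<odot>\<^bsub>P\<^esub> p i) I"])
  let ?N1 = "NP\<lparr>carrier := mpart NP \<one>\<^bsub>G\<^esub>\<rparr>"
  show "AP.pt \<one> x \<in> carrier ?N1" if "x \<in> carrier P" for x
    using pt_mpart[OF G.one_closed one_part that] by simp
  show "AP.pt \<one> (x \<oplus>\<^bsub>P\<^esub> y) = AP.pt \<one> x \<oplus>\<^bsub>?N1\<^esub> AP.pt \<one> y"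
    if "x \<in> carrier P" "y \<in> carrier P" for x y using AP.pt_add_r[of "\<one>" x y] that by simp
  show "AP.pt \<one> (a \<odot>\<^bsub>P\<^esub> x) = a \<odot>\<^bsub>?N1\<^esub> AP.pt \<one> x"
    if "a \<in> carrier R" "x \<in> carrier P" for a x
    using AP.pt_balanced[of "\<one>" x a] that R_closed[of a] by (simp add: AP.smult_pure)
  show "finsum P (\<lambda>i. \<phi>' i (AP.pt \<one> x) \<odot>\<^bsub>P\<^esub> p i) I = x" if x: "x \<in> carrier P" for x
  proof -
    have "finsum P (\<lambda>i. \<phi>' i (AP.pt \<one> x) \<odot>\<^bsub>P\<^esub> p i) I = finsum P (\<lambda>i. \<phi> i x \<odot>\<^bsub>P\<^esub> p i) I"
      using d(2,3) \<phi>' \<phi>A x by (intro P.M.finsum_cong') (auto intro!: P.smult_closed)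
    then show ?thesis using d(6)[OF x] by simp
  qed
  fix y assume "y \<in> carrier ?N1"
  then have "y \<in> mpart NP \<one>\<^bsub>G\<^esub>" by simp
  then have y: "y \<in> carrier AP.T" "\<And>i. i \<in> I \<Longrightarrow> \<phi>' i y \<in> rpart A \<one>\<^bsub>G\<^esub>" using N.mpart_iff[OF G.one_closed] by auto
  then have yR: "\<And>i. i \<in> I \<Longrightarrow> \<phi>' i y \<in> carrier A" using R_closed by blast
  show "finsum P (\<lambda>i. \<phi>' i y \<odot>\<^bsub>P\<^esub> p i) I \<in> carrier P"
    using y(2) d(2) by (auto intro!: P.M.finsum_closed P.smult_closed)
  have "AP.pt \<one> (finsum P (\<lambda>i. \<phi>' i y \<odot>\<^bsub>P\<^esub> p i) I) = finsum AP.T (\<lambda>i. AP.pt \<one> (\<phi>' i y \<odot>\<^bsub>P\<^esub> p i)) I"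
    using y(2) d(2) by (intro AP.pt_finsum_r) (auto intro!: P.smult_closed)
  also have "\<dots> = finsum AP.T (\<lambda>i. AP.pt (\<phi>' i y) (p i)) I"
  proof (rule AP.T.finsum_cong')
    show "AP.pt \<one> (\<phi>' i y \<odot>\<^bsub>P\<^esub> p i) = AP.pt (\<phi>' i y) (p i)" if "i \<in> I" for i
      using AP.pt_balanced[of "\<one>" "p i" "\<phi>' i y"] y(2)[OF that] yR[OF that] d(2)[OF that] by simp
  qed (use yR d(2) AP.pt_closed in auto)
  finally show "AP.pt \<one> (finsum P (\<lambda>i. \<phi>' i y \<odot>\<^bsub>P\<^esub> p i) I) = y" using expand_T[OF y(1)] by simp
qed

text \<open>The tensor product with A_g is formed separately, with its own relations. That it embeds
  into the tensor product with \<open>A\<close> is shown by the explicit inverse \<open>k\<close>,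
  which rebuilds an element from its coordinates.\<close>

lemma component_iso:
  assumes g: "g \<in> carrier G"
  shows "module_iso R (component_tensor G A g P) (NP\<lparr>carrier := mpart NP g\<rparr>)"
    and "left_module R (component_tensor G A g P)"
proof -
  let ?Ag = "sub_bimodule A (rpart A g)"
  let ?Ng = "NP\<lparr>carrier := mpart NP g\<rparr>"
  interpret AgP: tensor_module R "?Ag" P R
    by (rule tensor_module_bimodule[OF bimodule_part[OF g] P])
  show "left_module R (component_tensor G A g P)"
    using AgP.TM.left_module_axioms by (simp add: component_tensor_def)
  interpret Ng: left_module R "?Ng" by (rule N.left_module_mpart[OF g])
  note pc = part_closed[OF g]
  obtain h where h: "additive_map AgP.T ?Ng h"
    and hp: "\<And>a m. a \<in> carrier ?Ag \<Longrightarrow> m \<in> carrier P \<Longrightarrow> h (AgP.pt a m) = AP.pt a m"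
  proof (rule AgP.tensor_universal[OF Ng.M.abelian_group_axioms, of AP.pt])
    show "AP.pt x m \<in> carrier ?Ng"
      if "x \<in> carrier ?Ag" "m \<in> carrier P" for x m using pt_mpart[OF g] that by simp
    show "AP.pt (x \<oplus>\<^bsub>?Ag\<^esub> y) m = AP.pt x m \<oplus>\<^bsub>?Ng\<^esub> AP.pt y m"
      if "x \<in> carrier ?Ag" "y \<in> carrier ?Ag" "m \<in> carrier P" for x y m
      using that AP.pt_add_l[of x y m] pc by simp
    show "AP.pt x (m \<oplus>\<^bsub>P\<^esub> n) = AP.pt x m \<oplus>\<^bsub>?Ng\<^esub> AP.pt x n"
      if "x \<in> carrier ?Ag" "m \<in> carrier P" "n \<in> carrier P" for x m n
      using that AP.pt_add_r[of x m n] pc by simp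
    show "AP.pt (rsmult ?Ag x r) m = AP.pt x (r \<odot>\<^bsub>P\<^esub> m)"
      if "x \<in> carrier ?Ag" "m \<in> carrier P" "r \<in> carrier R" for x m r
      using that AP.pt_balanced[of x m r] pc by simp
  qed (rule that)
  have cg: "carrier ?Ng = mpart NP g" "add ?Ng = add AP.T"
    "smult ?Ng = smult AP.T" by simp_all
  note hD = additive_mapD[OF h, unfolded cg]
  have mT: "x \<in> carrier AP.T" if "x \<in> mpart NP g" for x using N.mpart_closed[OF g that] by simp
  have hT: "additive_map AgP.T AP.T h" by (rule additive_mapI) (use hD mT in blast)+
  have mp: "\<phi>' i x \<in> rpart A g" if "x \<in> mpart NP g" "i \<in> I" for x i using N.mpart_iff[OF g] that by blast
  define k where "k x = finsum AgP.T (\<lambda>i. AgP.pt (\<phi>' i x) (p i)) I" for x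
  have ptk: "AgP.pt (\<phi>' i x) (p i) \<in> carrier AgP.T" if "x \<in> mpart NP g" "i \<in> I" for x i
    using mp[OF that] d(2)[OF that(2)] AgP.pt_closed by simp
  show "module_iso R (component_tensor G A g P) ?Ng"
    unfolding component_tensor_def
  proof (rule module_isoI[OF AgP.TM.left_module_axioms, where f = h and g = k])
    show "h x \<in> carrier ?Ng" if "x \<in> carrier AgP.T" for x unfolding cg by (rule hD(1)[OF that])
    show "h (x \<oplus>\<^bsub>AgP.T\<^esub> y) = h x \<oplus>\<^bsub>?Ng\<^esub> h y" if "x \<in> carrier AgP.T" "y \<in> carrier AgP.T" for x y
      unfolding cg by (rule hD(2)[OF that])
    show "h (a \<odot>\<^bsub>AgP.T\<^esub> t) = a \<odot>\<^bsub>?Ng\<^esub> h t" if a: "a \<in> carrier R" and t: "t \<in> carrier AgP.T" for a t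
      unfolding cg
    proof (rule AgP.tensor_map_eqI[OF AP.abelian_group_T _ _ _ t])
      have aA: "a \<in> carrier A" using a R_closed by simp
      show "additive_map AgP.T AP.T (\<lambda>t. h (a \<odot>\<^bsub>AgP.T\<^esub> t))"
        by (rule additive_mapI) (use a additive_mapD[OF hT] AgP.TM.smult_closed AgP.TM.smult_r_distr in auto)
      show "additive_map AgP.T AP.T (\<lambda>t. a \<odot>\<^bsub>AP.T\<^esub> h t)"
        by (rule additive_mapI) (use aA additive_mapD[OF hT] AP.TM.smult_closed AP.TM.smult_r_distr in auto)
      show "h (a \<odot>\<^bsub>AgP.T\<^esub> AgP.pt x m) = a \<odot>\<^bsub>AP.T\<^esub> h (AgP.pt x m)"
        if "x \<in> carrier ?Ag" "m \<in> carrier P" for x m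
        using that a aA pc part_mult_l[OF g] by (simp add: AgP.smult_pure AP.smult_pure hp)
    qed
    show "k y \<in> carrier AgP.T" if "y \<in> carrier ?Ng" for y
      unfolding k_def by (rule AgP.T.finsum_closed) (use ptk that in \<open>simp add: cg\<close>)
    show "h (k y) = y" if "y \<in> carrier ?Ng" for y
    proof -
      have y: "y \<in> mpart NP g" using that unfolding cg .
      have "h (k y) = finsum AP.T (\<lambda>i. h (AgP.pt (\<phi>' i y) (p i))) I" unfolding k_def
        by (rule additive_map_finsum[OF AgP.abelian_group_T AP.abelian_group_T hT]) (use ptk[OF y] in auto)
      also have "\<dots> = finsum AP.T (\<lambda>i. AP.pt (\<phi>' i y) (p i)) I"
        using mp[OF y] d(2) pc AP.pt_closed by (intro AP.T.finsum_cong') (auto simp: hp)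
      finally show ?thesis using expand_T[OF mT[OF y]] by simp
    qed
    show "k (h t) = t" if t: "t \<in> carrier AgP.T" for t
    proof (rule AgP.tensor_map_eqI[OF AgP.abelian_group_T _ _ _ t])
      show "additive_map AgP.T AgP.T (\<lambda>t. k (h t))"
      proof (rule additive_mapI)
        show "k (h x) \<in> carrier AgP.T" if "x \<in> carrier AgP.T" for x
          unfolding k_def by (rule AgP.T.finsum_closed) (use ptk hD(1)[OF that] in simp)
        fix x y assume x: "x \<in> carrier AgP.T" and y: "y \<in> carrier AgP.T"
        have "k (h (x \<oplus>\<^bsub>AgP.T\<^esub> y)) =
          finsum AgP.T (\<lambda>i. AgP.pt (\<phi>' i (h x)) (p i) \<oplus>\<^bsub>AgP.T\<^esub> AgP.pt (\<phi>' i (h y)) (p i)) I"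
          unfolding k_def
        proof (rule AgP.T.finsum_cong')
          fix i assume i: "i \<in> I"
          have "\<phi>' i (h (x \<oplus>\<^bsub>AgP.T\<^esub> y)) = \<phi>' i (h x) \<oplus> \<phi>' i (h y)"
            using N.d(4)[OF i, of "h x" "h y"] hD[OF x] hD(1)[OF y] y mT by simp
          then show "AgP.pt (\<phi>' i (h (x \<oplus>\<^bsub>AgP.T\<^esub> y))) (p i) =
            AgP.pt (\<phi>' i (h x)) (p i) \<oplus>\<^bsub>AgP.T\<^esub> AgP.pt (\<phi>' i (h y)) (p i)"
            using AgP.pt_add_l[of "\<phi>' i (h x)" "\<phi>' i (h y)" "p i"] mp[OF hD(1)[OF x] i] mp[OF hD(1)[OF y] i] d(2)[OF i] by simp
        qed (use ptk hD(1)[OF x] hD(1)[OF y] in auto)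
        also have "\<dots> = k (h x) \<oplus>\<^bsub>AgP.T\<^esub> k (h y)" unfolding k_def
          by (rule AgP.T.finsum_addf) (use ptk hD(1)[OF x] hD(1)[OF y] in auto)
        finally show "k (h (x \<oplus>\<^bsub>AgP.T\<^esub> y)) = k (h x) \<oplus>\<^bsub>AgP.T\<^esub> k (h y)" .
      qed
      show "additive_map AgP.T AgP.T (\<lambda>t. t)" by (rule additive_mapI) auto
      fix a m assume am: "a \<in> carrier ?Ag" "m \<in> carrier P"
      then have a: "a \<in> rpart A g" "a \<in> carrier A" using pc by auto
      have "k (h (AgP.pt a m)) = finsum AgP.T (\<lambda>i. AgP.pt a (\<phi> i m \<odot>\<^bsub>P\<^esub> p i)) I" unfolding k_def
      proof (rule AgP.T.finsum_cong')
        show "AgP.pt (\<phi>' i (h (AgP.pt a m))) (p i) = AgP.pt a (\<phi> i m \<odot>\<^bsub>P\<^esub> p i)" if i: "i \<in> I" for i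
          using AgP.pt_balanced[of a "p i" "\<phi> i m"] am a d(2,3)[OF i] \<phi>'[OF i] by (simp add: hp)
      qed (use am d AgP.pt_closed P.smult_closed in auto)
      also have "\<dots> = AgP.pt a (finsum P (\<lambda>i. \<phi> i m \<odot>\<^bsub>P\<^esub> p i) I)"
        using am d by (intro AgP.pt_finsum_r[symmetric]) (auto intro!: P.smult_closed)
      also have "\<dots> = AgP.pt a m" using d(6)[OF am(2)] by simp
      finally show "k (h (AgP.pt a m)) = AgP.pt a m" .
    qed
  qed
qed

text \<open>A functional f on \<open>P\<close> extends to the map sending
  \<open>a \<otimes> m\<close> to a times f(m). In coordinates this is the extension with values f(p
  i), and at \<open>\<one> \<otimes> x\<close> it takes the value f(x) again.\<close>

lemma trace_one_NP:
  assumes "trace_one R P"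
  shows "trace_one A NP"
proof -
  obtain n :: nat and f x where f: "\<And>j. j < n \<Longrightarrow> f j \<in> lin_maps R P (regular_module R)"
    and x: "\<And>j. j < n \<Longrightarrow> x j \<in> carrier P" and 1: "finsum R (\<lambda>j. f j (x j)) {..<n} = \<one>\<^bsub>R\<^esub>"
    using assms unfolding trace_one_def by blast
  note fD = lin_mapsD[OF f, simplified]
  define F where "F j = (\<lambda>y\<in>carrier NP. finsum (regular_module A) (\<lambda>i. \<phi>' i y \<odot>\<^bsub>regular_module A\<^esub> f j (p i)) I)" for j
  have Fl: "F j \<in> lin_maps A NP (regular_module A)" if "j < n" for j
    unfolding F_def
    by (rule dual_basis_extend[OF N.N.left_module_axioms left_module_regular[OF A.ring_axioms] N.db])
      (use fD(1)[OF that] d(2) R_closed in auto)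
  have ptc: "AP.pt \<one> (x j) \<in> carrier NP" if "j < n" for j using AP.pt_closed x[OF that] by simp
  have Fx: "F j (AP.pt \<one> (x j)) = f j (x j)" if j: "j < n" for j
  proof -
    have c: "\<phi> i (x j) \<otimes> f j (p i) \<in> rpart A \<one>\<^bsub>G\<^esub>" if "i \<in> I" for i
      using part_mult_l[OF G.one_closed d(3)[OF that x[OF j]] fD(1)[OF j d(2)[OF that]]] .
    have "F j (AP.pt \<one> (x j)) = finsum (regular_module A) (\<lambda>i. \<phi>' i (AP.pt \<one> (x j)) \<otimes> f j (p i)) I"
      using ptc[OF j] by (simp add: F_def)
    also have "\<dots> = finsum A (\<lambda>i. \<phi>' i (AP.pt \<one> (x j)) \<otimes> f j (p i)) I"
      by (rule finsum_regular[OF A.ring_axioms]) (use \<phi>' \<phi>A x[OF j] c R_closed in auto)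
    also have "\<dots> = finsum A (\<lambda>i. \<phi> i (x j) \<otimes> f j (p i)) I"
      by (rule A.finsum_cong') (use \<phi>' \<phi>A x[OF j] c R_closed in auto)
    also have "\<dots> = finsum R (\<lambda>i. \<phi> i (x j) \<otimes> f j (p i)) I" using finsum_R[of _ I] c by auto
    also have "\<dots> = finsum (regular_module R) (\<lambda>i. \<phi> i (x j) \<otimes> f j (p i)) I"
      using finsum_regular[OF ring_R, of _ I] c by auto
    also have "\<dots> = f j (x j)"
      using dual_basis_linear_eq[OF P left_module_regular[OF ring_R] P_basis f[OF j] x[OF j]] by simp
    finally show ?thesis .
  qed
  have fx: "f j (x j) \<in> rpart A \<one>\<^bsub>G\<^esub>" if "j < n" for j using fD(1)[OF that x[OF that]] .
  have "finsum A (\<lambda>j. F j (AP.pt \<one> (x j))) {..<n} = finsum A (\<lambda>j. f j (x j)) {..<n}"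
    by (rule A.finsum_cong') (use Fx fx R_closed in auto)
  also have "\<dots> = finsum R (\<lambda>j. f j (x j)) {..<n}" using finsum_R[of _ "{..<n}"] fx by auto
  finally have "finsum A (\<lambda>j. F j (AP.pt \<one> (x j))) {..<n} = \<one>" using 1 by simp
  then show ?thesis unfolding trace_one_def using Fl ptc
    by (intro exI[of _ n] exI[of _ F] exI[of _ "\<lambda>j. AP.pt \<one> (x j)"]) simp
qed

lemma Mor_unit_induced:
  assumes g: "g \<in> carrier G" and one: "\<one> \<in> set_prod A (rpart A (inv\<^bsub>G\<^esub> g)) (rpart A g)"
    and iso: "module_iso R (component_tensor G A g P) P"
  shows "\<exists>u\<in>Mor G A NP g. \<exists>v\<in>Mor G A NP (inv\<^bsub>G\<^esub> g).
      compose (carrier NP) v u = (\<lambda>x\<in>carrier NP. x) \<and> compose (carrier NP) u v = (\<lambda>x\<in>carrier NP. x)"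
proof -
  have "module_iso R (NP\<lparr>carrier := mpart NP \<one>\<^bsub>G\<^esub>\<rparr>) P"
    by (rule module_iso_sym[OF P N.left_module_mpart[OF G.one_closed] base_iso])
  moreover have "module_iso R P (component_tensor G A g P)"
    by (rule module_iso_sym[OF component_iso(2)[OF g] P iso])
  ultimately have "module_iso R (NP\<lparr>carrier := mpart NP \<one>\<^bsub>G\<^esub>\<rparr>) (NP\<lparr>carrier := mpart NP g\<rparr>)"
    using module_iso_trans[OF N.left_module_mpart[OF G.one_closed]] component_iso(1)[OF g] module_iso_trans[OF P] by blast
  from N.Mor_unit[OF g one this] show ?thesis by metis
qed

end

end

theorem END_induced_crossed_product:
  fixes P :: "('a, 'p, 'm) module_scheme" and I :: "'i set"
  assumes P: "left_module R P" "dual_basis R P I p \<phi>" and H: "subgroup H G"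
    and one: "\<And>g. g \<in> H \<Longrightarrow> \<one> \<in> set_prod A (rpart A (inv\<^bsub>G\<^esub> g)) (rpart A g)"
    and iso: "\<And>g. g \<in> H \<Longrightarrow> module_iso R (component_tensor G A g P) P"
    and zero: "\<And>g. g \<in> carrier G \<Longrightarrow> g \<notin> H \<Longrightarrow> rpart A g = {\<zero>}"
  shows "is_partial_crossed_product G (END_induced G A P)"
proof -
  obtain \<phi>' where gdb: "graded_dual_basis G A (induced_module G A P) I
      (\<lambda>i. pure_tensor R (sub_bimodule A (carrier A)) P \<one> (p i)) \<phi>'"
    and \<phi>': "\<And>i a m. i \<in> I \<Longrightarrow> a \<in> carrier A \<Longrightarrow> m \<in> carrier P \<Longrightarrow>
        \<phi>' i (pure_tensor R (sub_bimodule A (carrier A)) P a m) = a \<otimes> \<phi> i m"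
    by (rule induced_basis_ex[OF P]) (rule that)
  interpret N: graded_basis G A "induced_module G A P" I
    "\<lambda>i. pure_tensor R (sub_bimodule A (carrier A)) P \<one> (p i)" \<phi>'
    by unfold_locales (rule gdb)
  show ?thesis unfolding END_induced_def
    by (rule N.END_crossed_product[OF H Mor_unit_induced[OF P gdb \<phi>' _ one iso] zero])
      (use subgroup.subset[OF H] in blast)+
qed

theorem graded_equivalent_END_induced:
  fixes P :: "('a, 'p, 'm) module_scheme" and I :: "'i set"
  assumes P: "left_module R P" "dual_basis R P I p \<phi>" and t: "trace_one R P" and nz: "\<one> \<noteq> \<zero>"
  shows "graded_equivalent G A (END_induced G A P)"
proof -
  \<comment> \<open>The copy in A^n is made from a dual basis indexed by an initial segment of the
    natural numbers.\<close>
  obtain h where h: "bij_betw h {..<card I} I"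
    using ex_bij_betw_nat_finite[OF dual_basisD(1)[OF P(2)]] by (auto simp: atLeast0LessThan)
  note db = dual_basis_reindex[OF P(2,1) h]
  obtain \<phi>' where gdb: "graded_dual_basis G A (induced_module G A P) {..<card I}
      (\<lambda>i. pure_tensor R (sub_bimodule A (carrier A)) P \<one> ((p \<circ> h) i)) \<phi>'"
    and \<phi>': "\<And>i a m. i \<in> {..<card I} \<Longrightarrow> a \<in> carrier A \<Longrightarrow> m \<in> carrier P \<Longrightarrow>
        \<phi>' i (pure_tensor R (sub_bimodule A (carrier A)) P a m) = a \<otimes> (\<phi> \<circ> h) i m"
    by (rule induced_basis_ex[OF P(1) db]) (rule that)
  interpret N: graded_basis G A "induced_module G A P" "{..<card I}"
    "\<lambda>i. pure_tensor R (sub_bimodule A (carrier A)) P \<one> ((p \<circ> h) i)" \<phi>'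
    by unfold_locales (rule gdb)
  show ?thesis unfolding END_induced_def
    by (rule graded_equivalent_END[OF N.graded_basis_axioms refl nz trace_one_NP[OF P(1) db gdb \<phi>' t]])
qed

end

section \<open>Principal modules over semiperfect rings\<close>

context ring
begin

lemma primitive_idempotentD:
  assumes "primitive_idempotent R e"
  shows "e \<in> carrier R" "e \<otimes> e = e" "e \<noteq> \<zero>"
    and "\<lbrakk>a \<in> carrier R; b \<in> carrier R; a \<otimes> a = a; b \<otimes> b = b; a \<otimes> b = \<zero>; b \<otimes> a = \<zero>; e = a \<oplus> b\<rbrakk> \<Longrightarrow> a = \<zero> \<or> b = \<zero>"
  using assms unfolding primitive_idempotent_def by simp_all

text \<open>\<open>e\<close> is the sum of the orthogonal idempotents \<open>z\<close> and e -
  z.\<close>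

lemma primitive_corner:
  assumes e: "primitive_idempotent R e" and z: "z \<in> carrier R" "z \<otimes> z = z" "e \<otimes> z = z" "z \<otimes> e = z"
  shows "z = \<zero> \<or> z = e"
proof -
  note e = primitive_idempotentD[OF e]
  let ?y = "e \<oplus> \<ominus> z"
  have y: "?y \<in> carrier R" "?y \<otimes> ?y = ?y" "z \<otimes> ?y = \<zero>" "?y \<otimes> z = \<zero>"
    using e(1,2) z by (simp_all add: l_distr r_distr l_minus r_minus r_neg)
  have "e = z \<oplus> ?y" using a_lcomm[OF z(1) e(1) a_inv_closed[OF z(1)]] e(1) z(1) by (simp add: r_neg)
  then have "z = \<zero> \<or> ?y = \<zero>" by (rule e(4)[OF z(1) y(1) z(2) y(2-4)])
  then show ?thesis using minus_zero_iff[OF e(1) z(1)] by (auto simp: a_minus_def)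
qed

text \<open>A linear map out of Re is right multiplication by the image of \<open>e\<close>. So
  \<open>v\<close> is taken as the image of \<open>e\<close>, and \<open>u\<close> as the preimage
  of \<open>f\<close>.\<close>

lemma principal_iso_elements:
  assumes e: "e \<in> carrier R" "e \<otimes> e = e" and f: "f \<in> carrier R" "f \<otimes> f = f"
    and iso: "module_iso R (principal_module R e) (principal_module R f)"
  obtains u v where "u \<in> carrier R" "v \<in> carrier R" "u \<otimes> v = f" "v \<otimes> u = e"
proof -
  interpret E: left_module R "principal_module R e" by (rule left_module_principal[OF e(1)])
  interpret F: left_module R "principal_module R f" by (rule left_module_principal[OF f(1)])
  note Ei = principal_carrier_iff[OF e] and Fi = principal_carrier_iff[OF f]
  obtain \<theta> where \<theta>: "\<theta> \<in> lin_maps R (principal_module R e) (principal_module R f)"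
    "bij_betw \<theta> (carrier (principal_module R e)) (carrier (principal_module R f))"
    using iso by (auto simp: module_iso_def)
  note t = lin_mapsD[OF \<theta>(1)]
  have eE: "e \<in> carrier (principal_module R e)" and fF: "f \<in> carrier (principal_module R f)" using Ei Fi e f by blast+
  define v where "v = \<theta> e"
  have v: "v \<in> carrier R" "v \<otimes> f = v" using t(1)[OF eE] Fi unfolding v_def by blast+
  obtain u where u: "u \<in> carrier (principal_module R e)" "\<theta> u = f" using bij_betw_imp_surj_on[OF \<theta>(2)] fF by (metis imageE)
  then have uR: "u \<in> carrier R" "u \<otimes> e = u" using Ei by blast+
  have tr: "\<theta> r = r \<otimes> v" if "r \<in> carrier (principal_module R e)" for r
    using t(3)[OF _ eE, of r] that Ei[of r] by (simp add: v_def del: principal_module_simps(1))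
  have uv: "u \<otimes> v = f" using tr[OF u(1)] u(2) by simp
  have vu: "v \<otimes> u \<in> carrier (principal_module R e)" using Ei[of "v \<otimes> u"] uR v(1) e(1) m_assoc[of v u e] by simp
  have "\<theta> (v \<otimes> u) = v \<otimes> u \<otimes> v" using tr[OF vu] .
  also have "\<dots> = \<theta> e" unfolding v_def[symmetric] m_assoc[OF v(1) uR(1) v(1)] uv by (rule v(2))
  finally have "\<theta> (v \<otimes> u) = \<theta> e" .
  then have "v \<otimes> u = e" using \<theta>(2) vu eE unfolding bij_betw_def inj_on_def by blast
  then show thesis using that uR(1) v(1) uv by blast
qed

text \<open>\<open>u\<close> and \<open>v\<close> may lie outside the corners, so the maps multiply
  by ev and fu instead; ev = vf and fu = ue make them land in the right modules.\<close>

lemma elements_principal_iso: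
  assumes e: "e \<in> carrier R" "e \<otimes> e = e" and f: "f \<in> carrier R" "f \<otimes> f = f"
    and u: "u \<in> carrier R" "v \<in> carrier R" "u \<otimes> v = f" "v \<otimes> u = e"
  shows "module_iso R (principal_module R e) (principal_module R f)"
proof -
  note Ei = principal_carrier_iff[OF e] and Fi = principal_carrier_iff[OF f]
  have vf: "v \<otimes> f = e \<otimes> v" "f \<otimes> u = u \<otimes> e" using u by (simp_all add: m_assoc flip: u(3,4))
  note [simp del] = principal_module_simps(1)
  show ?thesis
  proof (rule module_isoI[OF left_module_principal[OF e(1)], where f = "\<lambda>x. x \<otimes> (e \<otimes> v)" and g = "\<lambda>x. x \<otimes> (f \<otimes> u)"])
    show "x \<otimes> (e \<otimes> v) \<in> carrier (principal_module R f)" if "x \<in> carrier (principal_module R e)" for x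
      using that Ei[of x] Fi[of "x \<otimes> (e \<otimes> v)"] u e f vf(1)[symmetric] by (simp add: m_assoc)
    show "y \<otimes> (f \<otimes> u) \<in> carrier (principal_module R e)" if "y \<in> carrier (principal_module R f)" for y
      using that Fi[of y] Ei[of "y \<otimes> (f \<otimes> u)"] u e f vf(2) by (simp add: m_assoc)
    show "y \<otimes> (f \<otimes> u) \<otimes> (e \<otimes> v) = y" if "y \<in> carrier (principal_module R f)" for y
    proof -
      have y: "y \<in> carrier R" "y \<otimes> f = y" using Fi that by blast+
      have "y \<otimes> (f \<otimes> u) \<otimes> (e \<otimes> v) = (y \<otimes> f) \<otimes> (u \<otimes> (e \<otimes> v))" using y(1) u(1,2) e(1) f(1) by (simp add: m_assoc)
      also have "u \<otimes> (e \<otimes> v) = (u \<otimes> v) \<otimes> f" using vf(1) u(1,2) f(1) by (simp add: m_assoc)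
      finally show ?thesis using y f u(3) by (simp add: m_assoc)
    qed
    show "x \<otimes> (e \<otimes> v) \<otimes> (f \<otimes> u) = x" if "x \<in> carrier (principal_module R e)" for x
    proof -
      have x: "x \<in> carrier R" "x \<otimes> e = x" using Ei that by blast+
      have "x \<otimes> (e \<otimes> v) \<otimes> (f \<otimes> u) = (x \<otimes> e) \<otimes> (v \<otimes> (f \<otimes> u))" using x(1) u(1,2) e(1) f(1) by (simp add: m_assoc)
      also have "v \<otimes> (f \<otimes> u) = (v \<otimes> u) \<otimes> e" using vf(2) u(1,2) e(1) by (simp add: m_assoc)
      finally show ?thesis using x e u(4) by (simp add: m_assoc)
    qed
    show "(x \<oplus>\<^bsub>principal_module R e\<^esub> y) \<otimes> (e \<otimes> v) = x \<otimes> (e \<otimes> v) \<oplus>\<^bsub>principal_module R f\<^esub> y \<otimes> (e \<otimes> v)"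
      if "x \<in> carrier (principal_module R e)" "y \<in> carrier (principal_module R e)" for x y
      using that Ei[of x] Ei[of y] u e by (simp add: l_distr)
    show "(a \<odot>\<^bsub>principal_module R e\<^esub> x) \<otimes> (e \<otimes> v) = a \<odot>\<^bsub>principal_module R f\<^esub> (x \<otimes> (e \<otimes> v))"
      if "a \<in> carrier R" "x \<in> carrier (principal_module R e)" for a x
      using that Ei[of x] u e by (simp add: m_assoc)
  qed
qed

lemma principal_projective:
  assumes f: "f \<in> carrier R" "f \<otimes> f = f"
  shows "projective_module R (principal_module R f)"
proof (rule dual_basis_projective[OF left_module_principal[OF f(1)]])
  interpret F: left_module R "principal_module R f" by (rule left_module_principal[OF f(1)])
  note Fi = principal_carrier_iff[OF f]
  note [simp del] = principal_module_simps(1)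
  show "dual_basis R (principal_module R f) {f} (\<lambda>_. f) (\<lambda>_. \<lambda>x\<in>carrier (principal_module R f). x)"
    unfolding dual_basis_def
  proof (intro conjI ballI)
    show "(\<lambda>x\<in>carrier (principal_module R f). x) \<in> lin_maps R (principal_module R f) (regular_module R)"
      by (rule lin_mapsI[OF left_module_principal[OF f(1)]]) (use Fi in auto)
    show "x = finsum (principal_module R f)
        (\<lambda>i. (\<lambda>x\<in>carrier (principal_module R f). x) x \<odot>\<^bsub>principal_module R f\<^esub> f) {f}"
      if "x \<in> carrier (principal_module R f)" for x
      using that Fi[of x] Fi[of f] f by simp
  qed (use Fi[of f] f in auto)
qed

text \<open>In a decomposition of Rf the components of \<open>f\<close> are orthogonal idempotents
  with sum \<open>f\<close>. One of them vanishes, and with it the summand that it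
  generates.\<close>

lemma primitive_indecomposable:
  assumes "primitive_idempotent R f"
  shows "indecomposable_module R (principal_module R f)"
proof -
  have f: "f \<in> carrier R" "f \<otimes> f = f" "f \<noteq> \<zero>" using assms by (auto simp: primitive_idempotent_def)
  interpret F: left_module R "principal_module R f" by (rule left_module_principal[OF f(1)])
  note Fi = principal_carrier_iff[OF f(1,2)]
  have fF: "f \<in> carrier (principal_module R f)" using Fi f by blast
  have "U = {\<zero>} \<or> V = {\<zero>}" if dec: "internal_direct_sum2 R (principal_module R f) U V" for U V
  proof -
    have sU: "submodule U R (principal_module R f)" and sV: "submodule V R (principal_module R f)" and UV: "U \<inter> V = {\<zero>}"
      and sum: "carrier (principal_module R f) = {u \<oplus> v | u v. u \<in> U \<and> v \<in> V}"
      using dec unfolding internal_direct_sum2_def principal_module_simps(2,3) by (simp_all only:)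
    note U = F.submoduleD[OF sU] and V = F.submoduleD[OF sV]
    have UR: "x \<in> carrier R" "x \<otimes> f = x" if "x \<in> U" for x using U(1) Fi that by blast+
    have VR: "x \<in> carrier R" "x \<otimes> f = x" if "x \<in> V" for x using V(1) Fi that by blast+
    have Um: "r \<otimes> x \<in> U" if "r \<in> carrier R" "x \<in> U" for r x using U(5)[OF that] by simp
    have Vm: "r \<otimes> x \<in> V" if "r \<in> carrier R" "x \<in> V" for r x using V(5)[OF that] by simp
    obtain a b where ab: "a \<in> U" "b \<in> V" "f = a \<oplus> b" using fF unfolding sum by blast
    have c: "a \<in> carrier R" "b \<in> carrier R" using ab UR VR by auto
    \<comment> \<open>x = xf = xa + xb, and xb = x - xa lies in both summands.\<close>
    have split: "x \<otimes> a = x \<and> x \<otimes> b = \<zero>" if x: "x \<in> U" for x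
    proof -
      have xR: "x \<in> carrier R" using UR x by blast
      have "x = x \<otimes> a \<oplus> x \<otimes> b" using UR(2)[OF x] ab(3) xR c by (simp add: r_distr)
      then have xb: "x \<otimes> b = \<ominus> (x \<otimes> a) \<oplus> x" using xR c by (metis m_closed r_neg1)
      have "\<ominus> (x \<otimes> a) = (\<ominus> x) \<otimes> a" using xR c by (simp add: l_minus)
      then have "\<ominus> (x \<otimes> a) \<in> U" using Um[OF a_inv_closed[OF xR] ab(1)] by simp
      then have "x \<otimes> b \<in> U" using U(3)[OF _ x] xb by simp
      then have "x \<otimes> b = \<zero>" using Vm[OF xR ab(2)] UV by blast
      then show ?thesis using \<open>x = x \<otimes> a \<oplus> x \<otimes> b\<close> xR c by simp
    qed
    have split': "x \<otimes> b = x \<and> x \<otimes> a = \<zero>" if x: "x \<in> V" for x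
    proof -
      have xR: "x \<in> carrier R" using VR x by blast
      have "x = x \<otimes> a \<oplus> x \<otimes> b" using VR(2)[OF x] ab(3) xR c by (simp add: r_distr)
      then have xa: "x \<otimes> a = x \<oplus> \<ominus> (x \<otimes> b)" using xR c by (metis m_closed add.inv_solve_right)
      have "\<ominus> (x \<otimes> b) = (\<ominus> x) \<otimes> b" using xR c by (simp add: l_minus)
      then have "\<ominus> (x \<otimes> b) \<in> V" using Vm[OF a_inv_closed[OF xR] ab(2)] by simp
      then have "x \<otimes> a \<in> V" using V(3)[OF x] xa by simp
      then have "x \<otimes> a = \<zero>" using Um[OF xR ab(1)] UV by blast
      then show ?thesis using \<open>x = x \<otimes> a \<oplus> x \<otimes> b\<close> xR c by simp
    qed
    have "a \<otimes> a = a" "b \<otimes> b = b" "a \<otimes> b = \<zero>" "b \<otimes> a = \<zero>"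
      using split[OF ab(1)] split'[OF ab(2)] by blast+
    then have "a = \<zero> \<or> b = \<zero>" by (rule primitive_idempotentD(4)[OF assms c _ _ _ _ ab(3)])
    then show ?thesis
    proof
      assume "a = \<zero>"
      then have "x = \<zero>" if "x \<in> U" for x using split[OF that] UR[OF that] by simp
      then have "U = {\<zero>}" using U(2) unfolding principal_module_simps(2) by blast
      then show ?thesis by blast
    next
      assume "b = \<zero>"
      then have "x = \<zero>" if "x \<in> V" for x using split'[OF that] VR[OF that] by simp
      then have "V = {\<zero>}" using V(2) unfolding principal_module_simps(2) by blast
      then show ?thesis by blast
    qed
  qed
  then show ?thesis unfolding indecomposable_module_def principal_module_simps(2) using F.left_module_axioms fF f(3)
    by blast
qed

lemma primitive_iso_rep:
  assumes E: "irredundant_indec_proj_reps R E" and f: "primitive_idempotent R f"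
  obtains e where "e \<in> E" "module_iso R (principal_module R f) (principal_module R e)"
proof -
  have "indecomposable_module R (principal_module R f)" by (rule primitive_indecomposable[OF f])
  moreover have "projective_module R (principal_module R f)"
    using principal_projective f by (auto simp: primitive_idempotent_def)
  ultimately have "\<exists>e\<in>E. module_iso R (principal_module R f) (principal_module R e)"
    using E unfolding irredundant_indec_proj_reps_def by blast
  then show thesis using that by blast
qed

end

text \<open>
  If every left endomorphism of \<open>P\<close> is a right multiplication, then \<open>End(Pe)\<close> is a quotient of the
  local ring \<open>eRe\<close>. So one of the summands of the identity of \<open>Pe\<close> given by the dual basis is
  invertible, and it factors through some \<open>Rf\<^sub>k\<close>.
\<close>

lemma (in semiperfect) right_multiples_principal:
  fixes P :: "('a, 'q, 'm) bimodule_scheme" and I :: "'i set"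
  assumes P: "bimodule R P" and db: "dual_basis R P I p \<phi>" and e: "primitive_idempotent R e"
    and endo: "\<And>h. h \<in> lin_maps R P P \<Longrightarrow> \<exists>a\<in>carrier R. \<forall>x\<in>carrier P. h x = rsmult P x a"
  defines "M \<equiv> P\<lparr>carrier := {rsmult P x e | x. x \<in> carrier P}\<rparr>"
  shows "carrier M = {\<zero>\<^bsub>P\<^esub>} \<or> (\<exists>f. primitive_idempotent R f \<and> module_iso R M (principal_module R f))"
proof -
  have ec: "e \<in> carrier R" "e \<otimes> e = e" using e by (auto simp: primitive_idempotent_def)
  note b = bimoduleD[OF P]
  interpret P: left_module R P by (rule b(1))
  interpret P': left_module "opposite_ring R" "right_part P" by (rule b(2))
  note d = dual_basisD[OF db]
  have M: "left_module R M" unfolding M_def by (rule P.left_module_submodule[OF submodule_right_multiples[OF P ec(1)]])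
  have Mi: "x \<in> carrier M \<longleftrightarrow> x \<in> carrier P \<and> rsmult P x e = x" for x
  proof
    assume "x \<in> carrier M"
    then obtain y where "y \<in> carrier P" "x = rsmult P y e" by (auto simp: M_def)
    then show "x \<in> carrier P \<and> rsmult P x e = x" using b(4,7) ec by (simp flip: b(7))
  next
    assume "x \<in> carrier P \<and> rsmult P x e = x"
    then show "x \<in> carrier M" by (auto simp: M_def intro!: exI[of _ x])
  qed
  obtain n :: nat and f where f: "\<And>k. k < n \<Longrightarrow> primitive_idempotent R (f k)" and f1: "finsum R f {..<n} = \<one>"
    by (rule one_sum_primitive) (rule that)
  have fc: "f k \<in> carrier R" "f k \<otimes> f k = f k" if "k < n" for k using f[OF that] by (auto simp: primitive_idempotent_def)
  let ?q = "\<lambda>i. rsmult P (p i) e"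
  have q: "?q i \<in> carrier P" "rsmult P (?q i) e = ?q i" if "i \<in> I" for i using d(2)[OF that] b(4,7) ec by (simp_all flip: b(7))
  \<comment> \<open>One term of the dual basis expansion on Pe, further cut by \<open>f k\<close>:
    this endomorphism factors through the principal module of \<open>f k\<close>.\<close>
  have "\<exists>a\<in>carrier R. \<forall>x\<in>carrier P. (\<phi> i (rsmult P x e) \<otimes> f k) \<odot>\<^bsub>P\<^esub> ?q i = rsmult P x a"
    if i: "i \<in> I" and k: "k < n" for i k
  proof -
    have "(\<lambda>x\<in>carrier P. (\<phi> i (rsmult P x e) \<otimes> f k) \<odot>\<^bsub>P\<^esub> ?q i) \<in> lin_maps R P P"
      by (rule lin_mapsI[OF b(1)])
        (use b(3-5) ec fc[OF k] d(3-5)[OF i] q(1)[OF i] in \<open>simp_all add: P.smult_closed P.smult_l_distr P.smult_assoc1 l_distr m_assoc\<close>)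
    from endo[OF this] show ?thesis by auto
  qed
  then obtain a where a: "\<And>i k. i \<in> I \<Longrightarrow> k < n \<Longrightarrow> a i k \<in> carrier R"
    and a_eq: "\<And>i k x. i \<in> I \<Longrightarrow> k < n \<Longrightarrow> x \<in> carrier P \<Longrightarrow> (\<phi> i (rsmult P x e) \<otimes> f k) \<odot>\<^bsub>P\<^esub> ?q i = rsmult P x (a i k)"
    by metis
  \<comment> \<open>Cutting \<open>a i k\<close> down to eRe does not change its action on Pe,
    because xe = x there and the image lies in Pe again.\<close>
  define c where "c i k = e \<otimes> a i k \<otimes> e" for i k
  have c: "c i k \<in> carrier R" "e \<otimes> c i k = c i k" "c i k \<otimes> e = c i k" if "i \<in> I" "k < n" for i k
    unfolding c_def using a[OF that] ec by (simp_all add: m_assoc[symmetric]) (simp add: m_assoc)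
  have xc: "rsmult P x (c i k) = (\<phi> i x \<otimes> f k) \<odot>\<^bsub>P\<^esub> ?q i" if i: "i \<in> I" and k: "k < n" and x: "x \<in> carrier M" for i k x
  proof -
    have xP: "x \<in> carrier P" "rsmult P x e = x" using Mi x by blast+
    have "rsmult P x (c i k) = rsmult P (rsmult P (rsmult P x e) (a i k)) e"
      unfolding c_def using xP(1) a[OF i k] ec b(4,7) by simp
    also have "\<dots> = rsmult P ((\<phi> i x \<otimes> f k) \<odot>\<^bsub>P\<^esub> ?q i) e" using xP a_eq[OF i k xP(1)] by simp
    also have "\<dots> = (\<phi> i x \<otimes> f k) \<odot>\<^bsub>P\<^esub> ?q i" using b(3)[OF _ ec(1) q(1)[OF i]] d(3)[OF i xP(1)] fc[OF k] q(2)[OF i] by simp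
    finally show ?thesis .
  qed
  show ?thesis
  proof (cases "\<forall>i\<in>I. \<forall>k<n. c i k \<in> J")
    case True
    \<comment> \<open>Summing over all i and k recovers the identity of Pe. If the sum lies in the
      radical, 1 minus it is a unit that annihilates Pe, so Pe is zero.\<close>
    let ?s = "finsum R (\<lambda>i. finsum R (c i) {..<n}) I"
    have "finsum R (c i) {..<n} \<in> J" if "i \<in> I" for i
      using True that by (intro finsum_in_subset[of J, OF J(2) J(3) J(1)]) auto
    then have s: "?s \<in> J" by (intro finsum_in_subset[of J, OF J(2) J(3) J(1)]) auto
    have sum_c: "rsmult P x ?s = x" if x: "x \<in> carrier M" for x
    proof -
      have xP: "x \<in> carrier P" "rsmult P x e = x" using Mi x by blast+
      have add: "additive_map R P (rsmult P x)" by (rule additive_mapI) (use xP b(4,6) in auto)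
      note fs = additive_map_finsum[OF abelian_group_axioms P.M.abelian_group_axioms add]
      have "rsmult P x ?s = finsum P (\<lambda>i. rsmult P x (finsum R (c i) {..<n})) I"
        by (rule fs) (use c in \<open>auto intro!: finsum_closed\<close>)
      also have "\<dots> = finsum P (\<lambda>i. rsmult P (\<phi> i x \<odot>\<^bsub>P\<^esub> p i) e) I"
      proof (rule P.M.finsum_cong')
        fix i assume i: "i \<in> I"
        have \<phi>x: "\<phi> i x \<in> carrier R" using d(3)[OF i xP(1)] .
        have "rsmult P x (finsum R (c i) {..<n}) = finsum P (\<lambda>k. rsmult P x (c i k)) {..<n}"
          by (rule fs) (use c i in auto)
        also have "\<dots> = finsum P (\<lambda>k. (\<phi> i x \<otimes> f k) \<odot>\<^bsub>P\<^esub> ?q i) {..<n}"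
          using xc[OF i _ x] \<phi>x fc q(1)[OF i] by (intro P.M.finsum_cong') (auto intro!: P.smult_closed)
        also have "\<dots> = finsum R (\<lambda>k. \<phi> i x \<otimes> f k) {..<n} \<odot>\<^bsub>P\<^esub> ?q i"
          using \<phi>x fc q(1)[OF i] by (intro P.finsum_smult_l[symmetric]) auto
        also have "finsum R (\<lambda>k. \<phi> i x \<otimes> f k) {..<n} = \<phi> i x \<otimes> finsum R f {..<n}"
          using \<phi>x fc by (intro finsum_rdistr[symmetric]) auto
        also have "(\<phi> i x \<otimes> finsum R f {..<n}) \<odot>\<^bsub>P\<^esub> ?q i = rsmult P (\<phi> i x \<odot>\<^bsub>P\<^esub> p i) e"
          using f1 \<phi>x b(3)[OF \<phi>x ec(1) d(2)[OF i]] by simp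
        finally show "rsmult P x (finsum R (c i) {..<n}) = rsmult P (\<phi> i x \<odot>\<^bsub>P\<^esub> p i) e" .
      qed (use d(2,3) xP(1) ec b(4) in \<open>auto intro!: P.smult_closed b(4)\<close>)
      also have "\<dots> = rsmult P (finsum P (\<lambda>i. \<phi> i x \<odot>\<^bsub>P\<^esub> p i) I) e"
        by (rule additive_map_finsum[symmetric, OF P.M.abelian_group_axioms P.M.abelian_group_axioms])
          (use d(2,3) xP(1) ec b(4,5) in \<open>auto intro!: P.smult_closed additive_mapI b(4)\<close>)
      also have "\<dots> = x" using d(6)[OF xP(1)] xP(2) by simp
      finally show ?thesis .
    qed
    obtain v where v: "v \<in> carrier R" "(\<one> \<oplus> \<ominus> ?s) \<otimes> v = \<one>" by (rule J_unit[OF J(5)[OF s]]) (rule that)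
    have sR: "?s \<in> carrier R" using s by simp
    have "x = \<zero>\<^bsub>P\<^esub>" if x: "x \<in> carrier M" for x
    proof -
      have xP: "x \<in> carrier P" using Mi x by blast
      have add: "additive_map R P (rsmult P x)" by (rule additive_mapI) (use xP b(4,6) in auto)
      have "rsmult P x (\<one> \<oplus> \<ominus> ?s) = x \<oplus>\<^bsub>P\<^esub> \<ominus>\<^bsub>P\<^esub> x"
        using b(6)[of \<one> "\<ominus> ?s" x] b(8)[OF xP] sum_c[OF x] sR xP
          additive_map_neg[OF abelian_group_axioms P.M.abelian_group_axioms add sR] by simp
      then have z: "rsmult P x (\<one> \<oplus> \<ominus> ?s) = \<zero>\<^bsub>P\<^esub>" using xP by (simp add: P.M.r_neg)
      have "x = rsmult P x ((\<one> \<oplus> \<ominus> ?s) \<otimes> v)" using v(2) b(8)[OF xP] by simp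
      also have "\<dots> = rsmult P \<zero>\<^bsub>P\<^esub> v" using b(7)[OF _ v(1) xP, of "\<one> \<oplus> \<ominus> ?s"] sR z by simp
      also have "\<dots> = \<zero>\<^bsub>P\<^esub>" using P'.smult_r_null[of v] v(1) by simp
      finally show ?thesis .
    qed
    moreover have "\<zero>\<^bsub>P\<^esub> \<in> carrier M" using Mi P'.smult_r_null[of e] ec by simp
    ultimately show ?thesis by blast
  next
    case False
    then obtain i k where i: "i \<in> I" and k: "k < n" and cJ: "c i k \<notin> J" by blast
    obtain y where y: "y \<in> carrier R" "e \<otimes> y = y" "y \<otimes> e = y" "y \<otimes> c i k = e"
      by (rule primitive_local[OF e c[OF i k] cJ]) (rule that)
    note fk = fc[OF k]
    note Fi = principal_carrier_iff[OF fk]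
    note [simp del] = principal_module_simps(1)
    interpret M: left_module R M by (rule M)
    \<comment> \<open>\<open>\<beta>\<close> after \<open>\<alpha>\<close> is right multiplication
      by \<open>y \<otimes> c i k\<close>, which is \<open>e\<close> and so the identity of Pe. Thus
      Pe is a retract of the principal module of \<open>f k\<close>.\<close>
    define \<beta> where "\<beta> r = r \<odot>\<^bsub>P\<^esub> ?q i" for r
    define \<alpha> where "\<alpha> x = \<phi> i (rsmult P x y) \<otimes> f k" for x
    have xy: "rsmult P x y \<in> carrier M" if "x \<in> carrier P" for x
      using that Mi b(4)[OF y(1) that] b(7)[OF y(1) ec(1) that] y(3) by simp
    have Ma: "add M = add P" "smult M = smult P" "\<zero>\<^bsub>M\<^esub> = \<zero>\<^bsub>P\<^esub>" by (simp_all add: M_def)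
    have \<phi>xy: "\<phi> i (rsmult P x y) \<in> carrier R" if "x \<in> carrier P" for x using xy[OF that] Mi d(3)[OF i] by blast
    have \<alpha>: "\<alpha> x \<in> carrier (principal_module R (f k))" if "x \<in> carrier P" for x
      unfolding \<alpha>_def using Fi \<phi>xy[OF that] fk by (simp add: m_assoc)
    have \<beta>: "\<beta> r \<in> carrier M" if "r \<in> carrier R" for r
      using Mi P.smult_closed[OF that q(1)[OF i]] b(3)[OF that ec(1) q(1)[OF i]] q(2)[OF i] by (simp add: \<beta>_def)
    have \<beta>\<alpha>: "\<beta> (\<alpha> x) = x" if x: "x \<in> carrier M" for x
    proof -
      have xP: "x \<in> carrier P" "rsmult P x e = x" using Mi x by blast+
      have "\<beta> (\<alpha> x) = rsmult P (rsmult P x y) (c i k)" using xc[OF i k xy[OF xP(1)]] by (simp add: \<beta>_def \<alpha>_def)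
      also have "\<dots> = x" using b(7)[OF y(1) c(1)[OF i k] xP(1)] y(4) xP(2) by simp
      finally show ?thesis .
    qed
    have \<alpha>s: "\<alpha> (r \<odot>\<^bsub>P\<^esub> x) = r \<otimes> \<alpha> x" if "r \<in> carrier R" "x \<in> carrier P" for r x
      using b(3)[OF that(1) y(1) that(2)] b(4)[OF y(1) that(2)] d(5)[OF i that(1)] \<phi>xy[OF that(2)] that fk
      by (simp add: \<alpha>_def m_assoc)
    \<comment> \<open>The composite in the other order is right multiplication by an idempotent
      \<open>z\<close> of the corner at \<open>f k\<close>. Primitivity leaves two cases: 0, where
      Pe is zero, and \<open>f k\<close>, where both maps are isomorphisms.\<close>
    define z where "z = f k \<otimes> \<alpha> (?q i)"
    have \<alpha>q: "\<alpha> (?q i) \<in> carrier R" "\<alpha> (?q i) \<otimes> f k = \<alpha> (?q i)" using \<alpha>[OF q(1)[OF i]] Fi by blast+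
    have z: "z \<in> carrier R" "f k \<otimes> z = z" "z \<otimes> f k = z" unfolding z_def using fk \<alpha>q
      by (simp_all add: m_assoc[symmetric]) (simp add: m_assoc)
    have \<alpha>\<beta>: "\<alpha> (\<beta> r) = r \<otimes> z" if "r \<in> carrier (principal_module R (f k))" for r
    proof -
      have r: "r \<in> carrier R" "r \<otimes> f k = r" using Fi that by blast+
      have "\<alpha> (\<beta> r) = r \<otimes> \<alpha> (?q i)" unfolding \<beta>_def by (rule \<alpha>s[OF r(1) q(1)[OF i]])
      also have "\<dots> = r \<otimes> f k \<otimes> \<alpha> (?q i)" using r by simp
      finally show ?thesis unfolding z_def using r(1) fk(1) \<alpha>q(1) by (simp add: m_assoc)
    qed
    have fF: "f k \<in> carrier (principal_module R (f k))" and zF: "z \<in> carrier (principal_module R (f k))" using Fi fk z by blast+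
    have "z \<otimes> z = \<alpha> (\<beta> z)" using \<alpha>\<beta>[OF zF] by simp
    also have "z = \<alpha> (\<beta> (f k))" using \<alpha>\<beta>[OF fF] z(2) by simp
    also have "\<alpha> (\<beta> (\<alpha> (\<beta> (f k)))) = \<alpha> (\<beta> (f k))" using \<beta>\<alpha>[OF \<beta>[OF fk(1)]] by simp
    finally have zz: "z \<otimes> z = z" using \<alpha>\<beta>[OF fF] z(2) by simp
    have "z = \<zero> \<or> z = f k" by (rule primitive_corner[OF f[OF k] z(1) zz z(2,3)])
    then show ?thesis
    proof
      assume z0: "z = \<zero>"
      have "x = \<zero>\<^bsub>P\<^esub>" if x: "x \<in> carrier M" for x
      proof -
        have xP: "x \<in> carrier P" using Mi x by blast
        have aR: "\<alpha> x \<in> carrier R" using \<alpha>[OF xP] Fi by blast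
        have "\<alpha> x = \<alpha> (\<beta> (\<alpha> x))" using \<beta>\<alpha>[OF x] by simp
        also have "\<dots> = \<zero>" using \<alpha>\<beta>[OF \<alpha>[OF xP]] z0 aR by simp
        finally have "x = \<beta> \<zero>" using \<beta>\<alpha>[OF x] by simp
        then show ?thesis using P.smult_l_null[OF q(1)[OF i]] by (simp add: \<beta>_def)
      qed
      moreover have "\<zero>\<^bsub>P\<^esub> \<in> carrier M" using Mi P'.smult_r_null[of e] ec by simp
      ultimately show ?thesis by blast
    next
      assume zf: "z = f k"
      have "module_iso R M (principal_module R (f k))"
      proof (rule module_isoI[OF M, where f = \<alpha> and g = \<beta>])
        show "\<alpha> x \<in> carrier (principal_module R (f k))" if "x \<in> carrier M" for x using \<alpha> Mi that by blast
        show "\<alpha> (x \<oplus>\<^bsub>M\<^esub> x') = \<alpha> x \<oplus>\<^bsub>principal_module R (f k)\<^esub> \<alpha> x'" if "x \<in> carrier M" "x' \<in> carrier M" for x x'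
        proof -
          have xP: "x \<in> carrier P" "x' \<in> carrier P" using Mi that by blast+
          show ?thesis unfolding Ma principal_module_simps \<alpha>_def b(5)[OF y(1) xP]
            using d(4)[OF i b(4)[OF y(1) xP(1)] b(4)[OF y(1) xP(2)]] \<phi>xy[OF xP(1)] \<phi>xy[OF xP(2)] fk
            by (simp add: l_distr)
        qed
        show "\<alpha> (r \<odot>\<^bsub>M\<^esub> x) = r \<odot>\<^bsub>principal_module R (f k)\<^esub> \<alpha> x" if "r \<in> carrier R" "x \<in> carrier M" for r x
          using \<alpha>s[OF that(1)] Mi that(2) unfolding Ma principal_module_simps by blast
        show "\<beta> r \<in> carrier M" if "r \<in> carrier (principal_module R (f k))" for r using \<beta> Fi that by blast
        show "\<alpha> (\<beta> r) = r" if "r \<in> carrier (principal_module R (f k))" for r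
          using \<alpha>\<beta>[OF that] zf Fi that by metis
        show "\<beta> (\<alpha> x) = x" if "x \<in> carrier M" for x using \<beta>\<alpha>[OF that] .
      qed
      then show ?thesis using f[OF k] by blast
    qed
  qed
qed

section \<open>Bimodules whose class lies in PicS\<close>

lemma bimodule_iso_refl:
  assumes "bimodule R P"
  shows "bimodule_iso R P P"
proof -
  note b = bimoduleD[OF assms]
  have "(\<lambda>x\<in>carrier P. x) \<in> lin_maps R P P" by (rule lin_mapsI[OF b(1)]) auto
  moreover have "(\<lambda>x\<in>carrier (right_part P). x) \<in> lin_maps (opposite_ring R) (right_part P) (right_part P)"
    by (rule lin_mapsI[OF b(2)]) auto
  ultimately have "(\<lambda>x\<in>carrier P. x) \<in> bimodule_homs R P P" by (simp add: bimodule_homs_def)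
  moreover have "bij_betw (\<lambda>x\<in>carrier P. x) (carrier P) (carrier P)" by (auto simp: bij_betw_def inj_on_def)
  ultimately show ?thesis unfolding bimodule_iso_def by blast
qed

text \<open>Membership concerns the class, so partial invertibility is known for some
  \<open>Q\<close> isomorphic to \<open>P\<close>. The dual basis and the endomorphisms are moved
  along the isomorphism, whose right linearity turns a right multiplication of \<open>Q\<close> into
  one of \<open>P\<close>.\<close>

lemma PicS_dual_basis:
  fixes P :: "('a, 'q) bimodule" and R :: "('a, 'r) ring_scheme"
  assumes P: "bimodule R P" and cl: "bimodule_class R P \<in> PicS R"
  obtains I :: "'q set" and p \<phi> where "dual_basis R P I p \<phi>"
    "\<And>h. h \<in> lin_maps R P P \<Longrightarrow> \<exists>a\<in>carrier R. \<forall>x\<in>carrier P. h x = rsmult P x a"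
proof -
  obtain Q where Q: "partially_invertible R Q" "bimodule_class R P = bimodule_class R Q"
    using cl by (auto simp: PicS_def)
  have "P \<in> bimodule_class R P" using P bimodule_iso_refl by (auto simp: bimodule_class_def)
  then have "bimodule_iso R Q P" using Q(2) by (auto simp: bimodule_class_def)
  then obtain F where F: "F \<in> lin_maps R Q P" "F \<in> lin_maps (opposite_ring R) (right_part Q) (right_part P)"
    "bij_betw F (carrier Q) (carrier P)" by (auto simp: bimodule_iso_def bimodule_homs_def)
  have lQ: "left_module R Q" using Q(1) bimoduleD(1) by (auto simp: partially_invertible_def)
  have lP: "left_module R P" using bimoduleD(1)[OF P] .
  interpret Q: left_module R Q by (rule lQ)
  interpret P: left_module R P by (rule lP)
  define K where "K = restrict (inv_into (carrier Q) F) (carrier P)"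
  have K: "K \<in> lin_maps R P Q" unfolding K_def by (rule lin_maps_inv[OF lQ lP F(1,3)])
  note f = lin_mapsD[OF F(1)] and k = lin_mapsD[OF K]
  have KF: "K (F x) = x" if "x \<in> carrier Q" for x using that F(3) f(1) by (simp add: K_def bij_betw_inv_into_left)
  have FK: "F (K y) = y" if "y \<in> carrier P" for y using that F(3) by (simp add: K_def bij_betw_inv_into_right)
  obtain I :: "'q set" and p \<phi> where db: "dual_basis R Q I p \<phi>"
    by (rule projective_dual_basis[of R Q]) (use Q(1) in \<open>auto simp: partially_invertible_def\<close>)
  have "dual_basis R P I (\<lambda>i. F (p i)) (\<lambda>i. compose (carrier P) (\<phi> i) K)"
    by (rule dual_basis_transport[OF lQ lP F(1) K FK db])
  moreover have "\<exists>a\<in>carrier R. \<forall>x\<in>carrier P. h x = rsmult P x a" if h: "h \<in> lin_maps R P P" for h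
  proof -
    define g where "g = compose (carrier Q) K (compose (carrier Q) h F)"
    have "g \<in> lin_maps R Q Q" unfolding g_def
      by (rule lin_maps_compose[OF lQ lin_maps_compose[OF lQ F(1) h] K])
    then have "g \<in> carrier (End_left R Q)" by (simp add: End_left_def)
    then have "g \<in> (\<lambda>a\<in>carrier R. \<lambda>x\<in>carrier Q. rsmult Q x a) ` carrier R"
      using Q(1) unfolding partially_invertible_def bimodule_epi_def by (simp add: End_left_def)
    then obtain a where a: "a \<in> carrier R" "g = (\<lambda>x\<in>carrier Q. rsmult Q x a)" by auto
    have "h y = rsmult P y a" if y: "y \<in> carrier P" for y
    proof -
      have Ky: "K y \<in> carrier Q" using k(1)[OF y] .
      have hy: "h y \<in> carrier P" using lin_mapsD(1)[OF h y] .
      have "g (K y) = rsmult Q (K y) a" using a Ky by simp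
      then have "K (h y) = rsmult Q (K y) a" using Ky FK[OF y] by (simp add: g_def compose_def)
      then have "h y = F (rsmult Q (K y) a)" using FK[OF hy] by simp
      also have "\<dots> = rsmult P (F (K y)) a" using lin_mapsD(3)[OF F(2), of a "K y"] a(1) Ky by simp
      finally show ?thesis using FK[OF y] by simp
    qed
    then show ?thesis using a(1) by blast
  qed
  ultimately show thesis by (rule that)
qed

lemma (in semiperfect) PicS_tensor_principal:
  fixes P :: "('a, 'q) bimodule"
  assumes P: "bimodule R P" "bimodule_class R P \<in> PicS R" and e: "primitive_idempotent R e"
    and E: "irredundant_indec_proj_reps R E"
  defines "T \<equiv> tensor R P (principal_module R e)"
  shows "carrier T = {\<zero>\<^bsub>T\<^esub>} \<or> (\<exists>f\<in>E. module_iso R T (principal_module R f))"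
proof -
  have ec: "e \<in> carrier R" "e \<otimes> e = e" using e by (auto simp: primitive_idempotent_def)
  let ?M = "P\<lparr>carrier := {rsmult P x e | x. x \<in> carrier P}\<rparr>"
  have T: "module_iso R T ?M" "left_module R T" unfolding T_def by (rule tensor_principal[OF P(1) ec])+
  interpret T: left_module R T by (rule T(2))
  obtain I :: "'q set" and p \<phi> where db: "dual_basis R P I p \<phi>"
    and endo: "\<And>h. h \<in> lin_maps R P P \<Longrightarrow> \<exists>a\<in>carrier R. \<forall>x\<in>carrier P. h x = rsmult P x a"
    by (rule PicS_dual_basis[OF P]) (rule that)
  from right_multiples_principal[OF P(1) db e endo] show ?thesis
  proof
    assume M0: "carrier ?M = {\<zero>\<^bsub>P\<^esub>}"
    obtain F where "bij_betw F (carrier T) (carrier ?M)" using T(1) by (auto simp: module_iso_def)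
    then have "inj_on F (carrier T)" "F ` carrier T = {\<zero>\<^bsub>P\<^esub>}" using M0 by (auto simp: bij_betw_def)
    then have "x = \<zero>\<^bsub>T\<^esub>" if "x \<in> carrier T" for x
      using inj_onD[of F "carrier T" x "\<zero>\<^bsub>T\<^esub>"] that T.M.zero_closed by (metis imageI singletonD)
    then have "carrier T = {\<zero>\<^bsub>T\<^esub>}" using T.M.zero_closed by blast
    then show ?thesis by blast
  next
    assume "\<exists>f. primitive_idempotent R f \<and> module_iso R ?M (principal_module R f)"
    then obtain f where f: "primitive_idempotent R f" "module_iso R ?M (principal_module R f)" by blast
    obtain e' where e': "e' \<in> E" "module_iso R (principal_module R f) (principal_module R e')"
      by (rule primitive_iso_rep[OF E f(1)]) (rule that)
    have M: "left_module R ?M"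
      using left_module.left_module_submodule[OF bimoduleD(1)[OF P(1)] submodule_right_multiples[OF P(1) ec(1)]] .
    show ?thesis using module_iso_trans[OF T(2,1) module_iso_trans[OF M f(2) e'(2)]] e'(1) by blast
  qed
qed

section \<open>Epsilon-strongly graded rings\<close>

text \<open>Each \<epsilon>_g has degree one, so \<epsilon>_1 fixes it from the left. Hence
  \<epsilon>_1 fixes every homogeneous a = \<epsilon>_g a, therefore every element of the ring, and
  equals 1.\<close>

lemma epsilon_strongly_graded_unital:
  assumes "epsilon_strongly_graded G A \<epsilon>"
  shows "graded_unital G A"
proof -
  have gr: "is_graded_ring G A" using assms by (simp add: epsilon_strongly_graded_def)
  interpret G: group G using gr by (simp add: is_graded_ring_def)
  interpret A: ring A using gr by (simp add: is_graded_ring_def)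
  have dec: "direct_decomposition A (carrier G) (rpart A)" using gr by (simp add: is_graded_ring_def)
  note sub = direct_decompositionD(1)[OF A.abelian_group_axioms dec]
  note part = additive_subgroupD[OF sub A.abelian_group_axioms]
  have \<epsilon>1: "\<epsilon> g \<in> rpart A \<one>\<^bsub>G\<^esub>" if g: "g \<in> carrier G" for g
  proof -
    have "\<epsilon> g \<in> set_prod A (rpart A g) (rpart A (inv\<^bsub>G\<^esub> g))" using assms g by (simp add: epsilon_strongly_graded_def)
    moreover have "set_prod A (rpart A g) (rpart A (inv\<^bsub>G\<^esub> g)) \<subseteq> rpart A (g \<otimes>\<^bsub>G\<^esub> inv\<^bsub>G\<^esub> g)"
      using gr g G.inv_closed unfolding is_graded_ring_def by blast
    ultimately show ?thesis using g by auto
  qed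
  have \<epsilon>: "\<epsilon> g \<otimes>\<^bsub>A\<^esub> a = a" if "g \<in> carrier G" "a \<in> rpart A g" for g a
    using assms that by (simp add: epsilon_strongly_graded_def)
  have ec: "\<epsilon> g \<in> carrier A" if "g \<in> carrier G" for g using \<epsilon>1[OF that] part(1)[OF G.one_closed] by blast
  let ?e = "\<epsilon> \<one>\<^bsub>G\<^esub>"
  have e: "?e \<in> carrier A" by (rule ec) simp
  have "sum_of_parts A (carrier G) (rpart A) \<subseteq> {a \<in> carrier A. ?e \<otimes>\<^bsub>A\<^esub> a = a}"
  proof (rule sum_of_parts_least[OF A.abelian_group_axioms])
    show "additive_subgroup {a \<in> carrier A. ?e \<otimes>\<^bsub>A\<^esub> a = a} A"
      by (rule additive_subgroupI'[OF A.abelian_group_axioms]) (use e in \<open>auto simp: A.r_distr A.r_minus\<close>)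
    fix g assume g: "g \<in> carrier G"
    show "rpart A g \<subseteq> {a \<in> carrier A. ?e \<otimes>\<^bsub>A\<^esub> a = a}"
    proof
      fix a assume a: "a \<in> rpart A g"
      have ac: "a \<in> carrier A" using part(1)[OF g] a by blast
      have "?e \<otimes>\<^bsub>A\<^esub> (\<epsilon> g \<otimes>\<^bsub>A\<^esub> a) = (?e \<otimes>\<^bsub>A\<^esub> \<epsilon> g) \<otimes>\<^bsub>A\<^esub> a" using e ec[OF g] ac by (simp add: A.m_assoc)
      also have "\<dots> = a" unfolding \<epsilon>[OF G.one_closed \<epsilon>1[OF g]] by (rule \<epsilon>[OF g a])
      finally show "a \<in> {a \<in> carrier A. ?e \<otimes>\<^bsub>A\<^esub> a = a}" using \<epsilon>[OF g a] ac by simp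
    qed
  qed
  then have "?e \<otimes>\<^bsub>A\<^esub> \<one>\<^bsub>A\<^esub> = \<one>\<^bsub>A\<^esub>"
    using direct_decompositionD(2)[OF A.abelian_group_axioms dec] A.one_closed by blast
  then have "\<one>\<^bsub>A\<^esub> \<in> rpart A \<one>\<^bsub>G\<^esub>" using \<epsilon>1[OF G.one_closed] e by simp
  then show ?thesis by unfold_locales (rule gr)
qed

context graded_unital
begin

lemma inv_part: "g \<in> carrier G \<Longrightarrow> rpart A (inv\<^bsub>G\<^esub> (inv\<^bsub>G\<^esub> g)) = rpart A g"
  by simp

lemma part_mult_inv:
  assumes "g \<in> carrier G" "x \<in> rpart A g" "y \<in> rpart A (inv\<^bsub>G\<^esub> g)"
  shows "x \<otimes> y \<in> rpart A \<one>\<^bsub>G\<^esub>" "y \<otimes> x \<in> rpart A \<one>\<^bsub>G\<^esub>"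
  using part_mult[of g "inv\<^bsub>G\<^esub> g" x y] part_mult[of "inv\<^bsub>G\<^esub> g" g y x] assms by simp_all

text \<open>
  For idempotents \<open>e\<close>, \<open>f\<close> of \<open>R\<close>, right multiplication by \<open>v\<close> identifies \<open>A\<^sub>ge\<close> with \<open>Rf\<close>, so this
  is \<open>A\<^sub>g \<otimes>\<^sub>R Re \<simeq> Rf\<close> in a form that makes the groupoid structure visible.
\<close>

definition linked :: "'g \<Rightarrow> 'a \<Rightarrow> 'a \<Rightarrow> bool"
  where "linked g e f \<longleftrightarrow> (\<exists>u\<in>rpart A g. \<exists>v\<in>rpart A (inv\<^bsub>G\<^esub> g). u \<otimes> v = f \<and> v \<otimes> u = e \<and>
    f \<otimes> u = u \<and> u \<otimes> e = u \<and> e \<otimes> v = v \<and> v \<otimes> f = v)"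

text \<open>The corner conditions in \<open>linked\<close> are reached by passing from u and v to ue
  and vf, which changes neither product.\<close>

lemma linkedI:
  assumes g: "g \<in> carrier G" and uv: "u \<in> rpart A g" "v \<in> rpart A (inv\<^bsub>G\<^esub> g)" "u \<otimes> v = f" "v \<otimes> u = e"
    and idem: "e \<otimes> e = e" "f \<otimes> f = f"
  shows "linked g e f"
proof -
  have ig: "inv\<^bsub>G\<^esub> g \<in> carrier G" using g by simp
  have c: "u \<in> carrier A" "v \<in> carrier A" using part_closed g ig uv by blast+
  have ef: "e \<in> rpart A \<one>\<^bsub>G\<^esub>" "f \<in> rpart A \<one>\<^bsub>G\<^esub>" using part_mult_inv[OF g uv(1,2)] uv(3,4) by simp_all
  note efc = ef[THEN R_closed]
  have ue: "f \<otimes> u = u \<otimes> e" "e \<otimes> v = v \<otimes> f" using c by (simp_all add: A.m_assoc flip: uv(3,4))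
  have u: "f \<otimes> (u \<otimes> e) = u \<otimes> e" "u \<otimes> e \<otimes> e = u \<otimes> e"
    using c efc ue idem by (simp_all add: A.m_assoc flip: A.m_assoc[of f u e])
  have v: "e \<otimes> (v \<otimes> f) = v \<otimes> f" "v \<otimes> f \<otimes> f = v \<otimes> f"
    using c efc ue idem by (simp_all add: A.m_assoc flip: A.m_assoc[of e v f])
  have "(u \<otimes> e) \<otimes> (v \<otimes> f) = u \<otimes> (v \<otimes> f)" using c efc v(1) by (simp add: A.m_assoc)
  also have "\<dots> = f" using c efc idem uv(3) by (simp flip: A.m_assoc)
  finally have 1: "(u \<otimes> e) \<otimes> (v \<otimes> f) = f" .
  have "(v \<otimes> f) \<otimes> (u \<otimes> e) = v \<otimes> (u \<otimes> e)" using c efc u(1) by (simp add: A.m_assoc)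
  also have "\<dots> = e" using c efc idem uv(4) by (simp flip: A.m_assoc)
  finally have 2: "(v \<otimes> f) \<otimes> (u \<otimes> e) = e" .
  show ?thesis unfolding linked_def
    by (rule bexI[of _ "u \<otimes> e"], rule bexI[of _ "v \<otimes> f"])
      (use 1 2 u v part_mult_r g ig uv ef in auto)
qed

lemma linkedE:
  assumes "g \<in> carrier G" "linked g e f"
  obtains u v where "u \<in> rpart A g" "v \<in> rpart A (inv\<^bsub>G\<^esub> g)" "u \<otimes> v = f" "v \<otimes> u = e"
    "f \<otimes> u = u" "u \<otimes> e = u" "e \<otimes> v = v" "v \<otimes> f = v" "u \<in> carrier A" "v \<in> carrier A"
proof -
  obtain u v where uv: "u \<in> rpart A g" "v \<in> rpart A (inv\<^bsub>G\<^esub> g)" "u \<otimes> v = f" "v \<otimes> u = e"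
    "f \<otimes> u = u" "u \<otimes> e = u" "e \<otimes> v = v" "v \<otimes> f = v"
    using assms(2) unfolding linked_def by (elim bexE conjE)
  show thesis by (rule that[OF uv]) (use part_closed uv(1,2) assms(1) G.inv_closed in blast)+
qed

lemma linked_sym:
  assumes "g \<in> carrier G" "linked g e f"
  shows "linked (inv\<^bsub>G\<^esub> g) f e"
  using assms unfolding linked_def inv_part[OF assms(1)] by blast

text \<open>Composition in the groupoid. The later link stands on the left of the earlier one,
  whence the order of the degrees.\<close>

lemma linked_trans:
  assumes g: "g \<in> carrier G" and h: "h \<in> carrier G" and ef: "linked g e f" and fk: "linked h f k"
  shows "linked (h \<otimes>\<^bsub>G\<^esub> g) e k"
proof -
  obtain u v where u: "u \<in> rpart A g" "v \<in> rpart A (inv\<^bsub>G\<^esub> g)" "u \<otimes> v = f" "v \<otimes> u = e"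
    "f \<otimes> u = u" "u \<otimes> e = u" "e \<otimes> v = v" "v \<otimes> f = v" "u \<in> carrier A" "v \<in> carrier A"
    by (rule linkedE[OF g ef])
  obtain w z where w: "w \<in> rpart A h" "z \<in> rpart A (inv\<^bsub>G\<^esub> h)" "w \<otimes> z = k" "z \<otimes> w = f"
    "k \<otimes> w = w" "w \<otimes> f = w" "f \<otimes> z = z" "z \<otimes> k = z" "w \<in> carrier A" "z \<in> carrier A"
    by (rule linkedE[OF h fk])
  have i: "inv\<^bsub>G\<^esub> (h \<otimes>\<^bsub>G\<^esub> g) = inv\<^bsub>G\<^esub> g \<otimes>\<^bsub>G\<^esub> inv\<^bsub>G\<^esub> h" by (rule G.inv_mult_group[OF h g])
  have c: "w \<otimes> u \<in> rpart A (h \<otimes>\<^bsub>G\<^esub> g)" "v \<otimes> z \<in> rpart A (inv\<^bsub>G\<^esub> (h \<otimes>\<^bsub>G\<^esub> g))"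
    unfolding i using part_mult g h u w by simp_all
  have "(w \<otimes> u) \<otimes> (v \<otimes> z) = w \<otimes> ((u \<otimes> v) \<otimes> z)" using u(9,10) w(9,10) by (simp only: A.m_assoc A.m_closed)
  also have "\<dots> = k" using u w by simp
  finally have 1: "(w \<otimes> u) \<otimes> (v \<otimes> z) = k" .
  have "(v \<otimes> z) \<otimes> (w \<otimes> u) = v \<otimes> ((z \<otimes> w) \<otimes> u)" using u(9,10) w(9,10) by (simp only: A.m_assoc A.m_closed)
  also have "\<dots> = e" using u w by simp
  finally have 2: "(v \<otimes> z) \<otimes> (w \<otimes> u) = e" .
  have "e \<otimes> e = v \<otimes> (u \<otimes> e)" using u(4,9,10) by (metis A.m_assoc A.m_closed)
  then have e: "e \<otimes> e = e" using u by simp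
  have "k \<otimes> k = (k \<otimes> w) \<otimes> z" using w(3,9,10) by (metis A.m_assoc A.m_closed)
  then have k: "k \<otimes> k = k" using w by simp
  show ?thesis by (rule linkedI[OF _ c 1 2 e k]) (use g h in simp)
qed

lemma linked_refl: "e \<in> rpart A \<one>\<^bsub>G\<^esub> \<Longrightarrow> e \<otimes> e = e \<Longrightarrow> linked \<one>\<^bsub>G\<^esub> e e"
  by (rule linkedI) simp_all

lemma linked_one_iff:
  assumes e: "e \<in> rpart A \<one>\<^bsub>G\<^esub>" "e \<otimes> e = e" and f: "f \<in> rpart A \<one>\<^bsub>G\<^esub>" "f \<otimes> f = f"
  shows "linked \<one>\<^bsub>G\<^esub> e f \<longleftrightarrow> module_iso R (principal_module R e) (principal_module R f)"
proof
  assume l: "linked \<one>\<^bsub>G\<^esub> e f"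
  obtain u v where "u \<in> rpart A \<one>\<^bsub>G\<^esub>" "v \<in> rpart A (inv\<^bsub>G\<^esub> \<one>\<^bsub>G\<^esub>)" "u \<otimes> v = f" "v \<otimes> u = e"
    by (rule linkedE[OF G.one_closed l])
  then show "module_iso R (principal_module R e) (principal_module R f)"
    using e f by (intro R.elements_principal_iso[of e f u v]) simp_all
next
  assume i: "module_iso R (principal_module R e) (principal_module R f)"
  obtain u v where "u \<in> carrier R" "v \<in> carrier R" "u \<otimes>\<^bsub>R\<^esub> v = f" "v \<otimes>\<^bsub>R\<^esub> u = e"
    by (rule R.principal_iso_elements[OF _ _ _ _ i]) (use e f in simp_all)
  then show "linked \<one>\<^bsub>G\<^esub> e f" using e f by (intro linkedI[of _ u v]) simp_all
qed

end

section \<open>The central idempotents \<epsilon>_g and the tensor products of A_g with principal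
  modules\<close>

locale epsilon_graded = graded_unital G A
  for G :: "('g, 'h) monoid_scheme" and A :: "('g, 'a) graded_ring" (structure) +
  fixes \<epsilon> :: "'g \<Rightarrow> 'a"
  assumes epsilon: "epsilon_strongly_graded G A \<epsilon>"
begin

lemma eps_prod: "g \<in> carrier G \<Longrightarrow> \<epsilon> g \<in> set_prod A (rpart A g) (rpart A (inv\<^bsub>G\<^esub> g))"
  using epsilon by (simp add: epsilon_strongly_graded_def)

lemma eps_l: "g \<in> carrier G \<Longrightarrow> a \<in> rpart A g \<Longrightarrow> \<epsilon> g \<otimes> a = a"
  and eps_r: "g \<in> carrier G \<Longrightarrow> a \<in> rpart A g \<Longrightarrow> a \<otimes> \<epsilon> (inv\<^bsub>G\<^esub> g) = a"
  using epsilon by (simp_all add: epsilon_strongly_graded_def)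

lemma eps_part: "g \<in> carrier G \<Longrightarrow> \<epsilon> g \<in> rpart A \<one>\<^bsub>G\<^esub>"
  by (rule subsetD[OF set_prod_subset[OF part_subgroup[OF G.one_closed] A.abelian_group_axioms part_mult_inv(1)] eps_prod])

lemma eps_closed: "g \<in> carrier G \<Longrightarrow> \<epsilon> g \<in> carrier A"
  using eps_part R_closed by blast

text \<open>Both products equal \<epsilon>_g r \<epsilon>_g. Write \<epsilon>_g as a sum of products
  xy: then yr has degree g^-1 and is fixed by \<epsilon>_g on the right, and rx has degree g and is
  fixed by \<epsilon>_g on the left.\<close>

lemma eps_central:
  assumes g: "g \<in> carrier G" and r: "r \<in> rpart A \<one>\<^bsub>G\<^esub>"
  shows "\<epsilon> g \<otimes> r = r \<otimes> \<epsilon> g"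
proof -
  have ig: "inv\<^bsub>G\<^esub> g \<in> carrier G" using g by simp
  have rc: "r \<in> carrier A" using R_closed r .
  note ec = eps_closed[OF g]
  let ?K = "{s \<in> carrier A. s \<otimes> r \<otimes> \<epsilon> g = s \<otimes> r \<and> \<epsilon> g \<otimes> (r \<otimes> s) = r \<otimes> s}"
  have K: "additive_subgroup ?K A"
    by (rule additive_subgroupI'[OF A.abelian_group_axioms])
      (use rc ec in \<open>auto simp: A.l_distr A.r_distr A.l_minus A.r_minus\<close>)
  have "set_prod A (rpart A g) (rpart A (inv\<^bsub>G\<^esub> g)) \<subseteq> ?K"
  proof (rule set_prod_subset[OF K A.abelian_group_axioms])
    fix x y assume xy: "x \<in> rpart A g" "y \<in> rpart A (inv\<^bsub>G\<^esub> g)"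
    have c: "x \<in> carrier A" "y \<in> carrier A" using part_closed g ig xy by blast+
    have "y \<otimes> r \<otimes> \<epsilon> g = y \<otimes> r" using eps_r[OF ig part_mult_r[OF ig r xy(2)]] g by simp
    moreover have "\<epsilon> g \<otimes> (r \<otimes> x) = r \<otimes> x" by (rule eps_l[OF g part_mult_l[OF g r xy(1)]])
    then have "\<epsilon> g \<otimes> (r \<otimes> x) \<otimes> y = r \<otimes> x \<otimes> y" by simp
    ultimately show "x \<otimes> y \<in> ?K" using c rc ec by (simp add: A.m_assoc)
  qed
  then have "\<epsilon> g \<otimes> r \<otimes> \<epsilon> g = \<epsilon> g \<otimes> r" "\<epsilon> g \<otimes> (r \<otimes> \<epsilon> g) = r \<otimes> \<epsilon> g"
    using eps_prod[OF g] by blast+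
  then show ?thesis using ec rc by (simp add: A.m_assoc)
qed

lemma eps_idem: "g \<in> carrier G \<Longrightarrow> \<epsilon> g \<otimes> \<epsilon> g = \<epsilon> g"
proof -
  assume g: "g \<in> carrier G"
  have "set_prod A (rpart A g) (rpart A (inv\<^bsub>G\<^esub> g)) \<subseteq> {s \<in> carrier A. \<epsilon> g \<otimes> s = s}"
  proof (rule set_prod_subset[OF _ A.abelian_group_axioms])
    show "additive_subgroup {s \<in> carrier A. \<epsilon> g \<otimes> s = s} A"
      by (rule additive_subgroupI'[OF A.abelian_group_axioms])
        (use eps_closed[OF g] in \<open>auto simp: A.r_distr A.r_minus\<close>)
    fix x y assume xy: "x \<in> rpart A g" "y \<in> rpart A (inv\<^bsub>G\<^esub> g)"
    then have "x \<in> carrier A" "y \<in> carrier A" using part_closed g G.inv_closed by blast+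
    then show "x \<otimes> y \<in> {s \<in> carrier A. \<epsilon> g \<otimes> s = s}"
      using eps_l[OF g xy(1)] eps_closed[OF g] by (simp flip: A.m_assoc)
  qed
  then show ?thesis using eps_prod[OF g] by blast
qed

lemma linked_eps:
  assumes g: "g \<in> carrier G" and l: "linked g e f"
  shows "\<epsilon> g \<otimes> f = f"
proof -
  obtain u v where u: "u \<in> rpart A g" "u \<otimes> v = f" "u \<in> carrier A" "v \<in> carrier A" by (rule linkedE[OF g l])
  show ?thesis unfolding u(2)[symmetric] using eps_l[OF g u(1)] eps_closed[OF g] u(3,4) by (simp flip: A.m_assoc)
qed

text \<open>The case of the bimodule A_g in \<open>tensor_principal\<close>: the tensor product with
  Re is A_g e, where computations take place inside \<open>A\<close>.\<close>

lemma component_principal: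
  assumes g: "g \<in> carrier G" and e: "e \<in> rpart A \<one>\<^bsub>G\<^esub>" "e \<otimes> e = e"
  defines "M \<equiv> (sub_bimodule A (rpart A g))\<lparr>carrier := {x \<otimes> e | x. x \<in> rpart A g}\<rparr>"
  shows "module_iso R (component_tensor G A g (principal_module R e)) M"
    and "left_module R (component_tensor G A g (principal_module R e))" and "left_module R M"
proof -
  have bim: "bimodule R (sub_bimodule A (rpart A g))" by (rule bimodule_part[OF g])
  show "module_iso R (component_tensor G A g (principal_module R e)) M"
    "left_module R (component_tensor G A g (principal_module R e))"
    unfolding component_tensor_def M_def using tensor_principal[OF bim, of e] e by simp_all
  show "left_module R M" unfolding M_def
    using left_module.left_module_submodule[OF bimoduleD(1)[OF bim] submodule_right_multiples[OF bim, of e]] e by simp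
qed

lemma linked_component_iso:
  assumes g: "g \<in> carrier G" and e: "e \<in> rpart A \<one>\<^bsub>G\<^esub>" "e \<otimes> e = e"
    and f: "f \<in> rpart A \<one>\<^bsub>G\<^esub>" "f \<otimes> f = f" and l: "linked g e f"
  shows "module_iso R (component_tensor G A g (principal_module R e)) (principal_module R f)"
proof -
  let ?M = "(sub_bimodule A (rpart A g))\<lparr>carrier := {x \<otimes> e | x. x \<in> rpart A g}\<rparr>"
  have Mc: "x \<in> rpart A g \<and> x \<otimes> e = x \<and> x \<in> carrier A" if "x \<in> carrier ?M" for x
    using that part_mult_r[OF g e(1)] part_closed[OF g] R_closed[OF e(1)] e(2) by (auto simp: A.m_assoc)
  note T = component_principal[OF g e]
  have Fi: "r \<in> carrier (principal_module R f) \<longleftrightarrow> r \<in> rpart A \<one>\<^bsub>G\<^esub> \<and> r \<otimes> f = r" for r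
    using R.principal_carrier_iff[of f r] f by simp
  note [simp del] = principal_module_simps(1)
  obtain u v where u: "u \<in> rpart A g" "v \<in> rpart A (inv\<^bsub>G\<^esub> g)" "u \<otimes> v = f" "v \<otimes> u = e"
    "f \<otimes> u = u" "u \<otimes> e = u" "e \<otimes> v = v" "v \<otimes> f = v" "u \<in> carrier A" "v \<in> carrier A"
    by (rule linkedE[OF g l])
  have fc: "f \<in> carrier A" using R_closed[OF f(1)] .
  have "module_iso R ?M (principal_module R f)"
  proof (rule module_isoI[OF T(3), where f = "\<lambda>x. x \<otimes> v" and g = "\<lambda>y. y \<otimes> u"])
    fix x assume x: "x \<in> carrier ?M"
    note x = Mc[OF x]
    show "x \<otimes> v \<in> carrier (principal_module R f)"
      using part_mult_inv(1)[OF g _ u(2), of x] u fc x by (simp add: Fi A.m_assoc)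
    show "x \<otimes> v \<otimes> u = x" using u x by (simp add: A.m_assoc)
  next
    fix y assume "y \<in> carrier (principal_module R f)"
    then have y: "y \<in> rpart A \<one>\<^bsub>G\<^esub>" "y \<otimes> f = y" "y \<in> carrier A" using Fi R_closed by blast+
    have "y \<otimes> u = (y \<otimes> u) \<otimes> e" using u y R_closed[OF e(1)] by (simp add: A.m_assoc)
    then show "y \<otimes> u \<in> carrier ?M" using part_mult_l[OF g y(1) u(1)] by auto
    show "y \<otimes> u \<otimes> v = y" using u y by (simp add: A.m_assoc)
  next
    fix x y assume "x \<in> carrier ?M" "y \<in> carrier ?M"
    from Mc[OF this(1)] Mc[OF this(2)]
    show "(x \<oplus>\<^bsub>?M\<^esub> y) \<otimes> v = x \<otimes> v \<oplus>\<^bsub>principal_module R f\<^esub> y \<otimes> v"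
      using u(10) by (simp add: A.l_distr)
  next
    fix a x assume a: "a \<in> carrier R" and x: "x \<in> carrier ?M"
    show "(a \<odot>\<^bsub>?M\<^esub> x) \<otimes> v = a \<odot>\<^bsub>principal_module R f\<^esub> (x \<otimes> v)"
      using Mc[OF x] a R_closed u(10) by (simp add: A.m_assoc)
  qed
  then show ?thesis by (rule module_iso_trans[OF T(2,1)])
qed

text \<open>Every x in A_g satisfies xe = x \<epsilon>_(g^-1) e, so A_g e would vanish, whereas Rf
  does not.\<close>

lemma eps_nonzero:
  assumes g: "g \<in> carrier G" and e: "e \<in> rpart A \<one>\<^bsub>G\<^esub>" "e \<otimes> e = e"
    and f: "f \<in> rpart A \<one>\<^bsub>G\<^esub>" "f \<otimes> f = f" "f \<noteq> \<zero>"
    and iso: "module_iso R (component_tensor G A g (principal_module R e)) (principal_module R f)"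
  shows "\<epsilon> (inv\<^bsub>G\<^esub> g) \<otimes> e \<noteq> \<zero>"
proof
  assume z: "\<epsilon> (inv\<^bsub>G\<^esub> g) \<otimes> e = \<zero>"
  let ?M = "(sub_bimodule A (rpart A g))\<lparr>carrier := {x \<otimes> e | x. x \<in> rpart A g}\<rparr>"
  note T = component_principal[OF g e]
  have "module_iso R ?M (principal_module R f)" using module_iso_trans[OF T(3) module_iso_sym[OF T(2,3,1)] iso] .
  then obtain h where h: "h ` carrier ?M = carrier (principal_module R f)" by (auto simp: module_iso_def bij_betw_def)
  have "x \<otimes> e = \<zero>" if x: "x \<in> rpart A g" for x
  proof -
    have "x \<otimes> e = x \<otimes> \<epsilon> (inv\<^bsub>G\<^esub> g) \<otimes> e" by (simp only: eps_r[OF g x])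
    then show ?thesis using part_closed[OF g x] eps_closed[OF G.inv_closed[OF g]] R_closed[OF e(1)] z by (simp add: A.m_assoc)
  qed
  then have M0: "y = \<zero>" if "y \<in> carrier ?M" for y using that by auto
  have F: "\<zero> \<in> h ` carrier ?M" "f \<in> h ` carrier ?M"
    unfolding h using R.principal_carrier_iff[of f] f part(2)[OF G.one_closed] R_closed[OF f(1)]
    by (simp_all del: principal_module_simps)
  obtain a b where "\<zero> = h a" "a \<in> carrier ?M" "f = h b" "b \<in> carrier ?M"
    by (rule imageE[OF F(1)], rule imageE[OF F(2)]) (rule that)
  then show False using M0[of a] M0[of b] f(3) by metis
qed

end

text \<open>The basis satisfies the relations that \<open>c i\<close> fixes \<open>p i\<close>, so a
  map may be prescribed on it by values that are fixed by the \<open>c i\<close>. \<open>U\<close>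
  sends the basis element at \<sigma>(i) to \<open>u i\<close> times \<open>p i\<close>, and
  \<open>V\<close> sends \<open>p i\<close> to \<open>v i\<close> times the basis element at
  \<sigma>(i). For sums of principal modules \<open>c i\<close> is the idempotent that serves as the
  index.\<close>

lemma (in graded_basis) Mor_permutation:
  assumes g: "g \<in> carrier G" and \<sigma>: "bij_betw \<sigma> I I"
    and c: "\<And>i j. i \<in> I \<Longrightarrow> j \<in> I \<Longrightarrow> \<phi> j (p i) = (if j = i then c i else \<zero>)"
    and u: "\<And>i. i \<in> I \<Longrightarrow> u i \<in> rpart A g" "\<And>i. i \<in> I \<Longrightarrow> c (\<sigma> i) \<otimes> u i = u i"
    and v: "\<And>i. i \<in> I \<Longrightarrow> v i \<in> rpart A (inv\<^bsub>G\<^esub> g)" "\<And>i. i \<in> I \<Longrightarrow> c i \<otimes> v i = v i"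
    and uv: "\<And>i. i \<in> I \<Longrightarrow> u i \<otimes> v i = c (\<sigma> i)" "\<And>i. i \<in> I \<Longrightarrow> v i \<otimes> u i = c i"
  shows "\<exists>U\<in>Mor G A N g. \<exists>V\<in>Mor G A N (inv\<^bsub>G\<^esub> g).
    compose (carrier N) V U = (\<lambda>x\<in>carrier N. x) \<and> compose (carrier N) U V = (\<lambda>x\<in>carrier N. x)"
proof -
  have ig: "inv\<^bsub>G\<^esub> g \<in> carrier G" using g by simp
  define \<tau> where "\<tau> = inv_into I \<sigma>"
  have \<sigma>I: "\<sigma> i \<in> I" "\<tau> (\<sigma> i) = i" if "i \<in> I" for i
    using \<sigma> that by (auto simp: \<tau>_def bij_betw_inv_into_left bij_betw_apply)
  have \<tau>I: "\<tau> i \<in> I" "\<sigma> (\<tau> i) = i" if "i \<in> I" for i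
    using \<sigma> that by (auto simp: \<tau>_def bij_betw_inv_into_right bij_betw_def inv_into_into)
  have uA: "u i \<in> carrier A" and vA: "v i \<in> carrier A" if "i \<in> I" for i
    using u(1)[OF that] v(1)[OF that] part_closed g ig by blast+
  have cA: "c i \<in> carrier A" if "i \<in> I" for i using uv(2)[OF that] uA[OF that] vA[OF that] A.m_closed by metis
  have cp: "c i \<odot>\<^bsub>N\<^esub> p i = p i" if i: "i \<in> I" for i
  proof -
    have "p i = finsum N (\<lambda>j. \<phi> j (p i) \<odot>\<^bsub>N\<^esub> p j) I" using d(6)[OF d(2)[OF i]] by simp
    also have "\<dots> = \<phi> i (p i) \<odot>\<^bsub>N\<^esub> p i"
      by (rule N.M.finsum_single) (use d(1,2) i c cA in \<open>auto simp: N.smult_l_null N.smult_closed\<close>)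
    finally show ?thesis using c[OF i i] by simp
  qed
  define ext where "ext q = (\<lambda>x\<in>carrier N. finsum N (\<lambda>i. \<phi> i x \<odot>\<^bsub>N\<^esub> q i) I)" for q
  \<comment> \<open>The coordinates of \<open>p i\<close> are \<open>c i\<close> at i and 0
    elsewhere, so the extension takes the value \<open>c i\<close> times \<open>q i\<close>
    there.\<close>
  have ext_p: "ext q (p i) = q i" if i: "i \<in> I" and q: "\<And>j. j \<in> I \<Longrightarrow> q j \<in> carrier N" "c i \<odot>\<^bsub>N\<^esub> q i = q i" for q i
  proof -
    have "ext q (p i) = \<phi> i (p i) \<odot>\<^bsub>N\<^esub> q i"
      unfolding ext_def restrict_apply'[OF d(2)[OF i]]
      by (rule N.M.finsum_single) (use d(1,2) i c cA q(1) in \<open>auto simp: N.smult_l_null N.smult_closed\<close>)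
    then show ?thesis using c[OF i i] q(2) by simp
  qed
  let ?qu = "\<lambda>j. u (\<tau> j) \<odot>\<^bsub>N\<^esub> p (\<tau> j)" and ?qv = "\<lambda>i. v i \<odot>\<^bsub>N\<^esub> p (\<sigma> i)"
  have qu: "?qu j \<in> mpart N g" and qv: "?qv j \<in> mpart N (inv\<^bsub>G\<^esub> g)" if "j \<in> I" for j
    using smult_p[OF g u(1) \<tau>I(1)] smult_p[OF ig v(1) \<sigma>I(1)] \<tau>I(1) that by blast+
  have quc: "?qu j \<in> carrier N" and qvc: "?qv j \<in> carrier N" if "j \<in> I" for j
    using qu qv mpart_closed g ig that by blast+
  have U: "ext ?qu \<in> Mor G A N g" and V: "ext ?qv \<in> Mor G A N (inv\<^bsub>G\<^esub> g)"
    unfolding ext_def by (rule Mor_extend[OF g], erule qu) (rule Mor_extend[OF ig], erule qv)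
  then have Ul: "ext ?qu \<in> lin_maps A N N" and Vl: "ext ?qv \<in> lin_maps A N N" by (auto simp: Mor_def)
  have Up: "ext ?qu (p j) = ?qu j" if j: "j \<in> I" for j
  proof (rule ext_p[OF j quc])
    show "c j \<odot>\<^bsub>N\<^esub> ?qu j = ?qu j"
      using N.smult_assoc1[OF cA[OF j] uA[OF \<tau>I(1)[OF j]] d(2)[OF \<tau>I(1)[OF j]]] u(2)[OF \<tau>I(1)[OF j]] \<tau>I(2)[OF j]
      by simp
  qed
  have Vp: "ext ?qv (p i) = ?qv i" if i: "i \<in> I" for i
  proof (rule ext_p[OF i qvc])
    show "c i \<odot>\<^bsub>N\<^esub> ?qv i = ?qv i"
      using N.smult_assoc1[OF cA[OF i] vA[OF i] d(2)[OF \<sigma>I(1)[OF i]]] v(2)[OF i] by simp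
  qed
  have idl: "(\<lambda>x\<in>carrier N. x) \<in> lin_maps A N N" by (rule lin_mapsI[OF N.left_module_axioms]) auto
  have "compose (carrier N) (ext ?qv) (ext ?qu) = (\<lambda>x\<in>carrier N. x)"
  proof (rule lin_maps_eq_on_p[OF lin_maps_compose[OF N.left_module_axioms Ul Vl] idl])
    fix j assume j: "j \<in> I"
    note t = \<tau>I[OF j]
    have "ext ?qv (ext ?qu (p j)) = u (\<tau> j) \<odot>\<^bsub>N\<^esub> ?qv (\<tau> j)"
      unfolding Up[OF j] using lin_mapsD(3)[OF Vl uA[OF t(1)] d(2)[OF t(1)]] Vp[OF t(1)] by simp
    also have "\<dots> = p j"
      using N.smult_assoc1[OF uA[OF t(1)] vA[OF t(1)] d(2)[OF j]] uv(1)[OF t(1)] cp[OF j] t(2) by simp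
    finally show "compose (carrier N) (ext ?qv) (ext ?qu) (p j) = (\<lambda>x\<in>carrier N. x) (p j)"
      using d(2)[OF j] by (simp add: compose_def)
  qed
  moreover have "compose (carrier N) (ext ?qu) (ext ?qv) = (\<lambda>x\<in>carrier N. x)"
  proof (rule lin_maps_eq_on_p[OF lin_maps_compose[OF N.left_module_axioms Vl Ul] idl])
    fix i assume i: "i \<in> I"
    note s = \<sigma>I[OF i]
    have "ext ?qu (ext ?qv (p i)) = v i \<odot>\<^bsub>N\<^esub> ?qu (\<sigma> i)"
      unfolding Vp[OF i] using lin_mapsD(3)[OF Ul vA[OF i] d(2)[OF s(1)]] Up[OF s(1)] by simp
    also have "\<dots> = p i"
      using N.smult_assoc1[OF vA[OF i] uA[OF i] d(2)[OF i]] uv(2)[OF i] cp[OF i] s(2) by simp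
    finally show "compose (carrier N) (ext ?qu) (ext ?qv) (p i) = (\<lambda>x\<in>carrier N. x) (p i)"
      using d(2)[OF i] by (simp add: compose_def)
  qed
  ultimately show ?thesis using U V by blast
qed

lemma (in ring) Q_sum_dual_basis:
  assumes X: "finite X" and idem: "\<And>e. e \<in> X \<Longrightarrow> e \<in> carrier R" "\<And>e. e \<in> X \<Longrightarrow> e \<otimes> e = e"
  shows "left_module R (Q_sum R X)"
    and "dual_basis R (Q_sum R X) X (\<lambda>e. \<lambda>x\<in>X. if x = e then e else \<zero>) (\<lambda>e. \<lambda>q\<in>carrier (Q_sum R X). q e)"
    and "q \<in> carrier (Q_sum R X) \<longleftrightarrow> q \<in> extensional X \<and> (\<forall>e\<in>X. q e \<in> carrier R \<and> q e \<otimes> e = q e)"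
proof -
  have pm: "left_module R (principal_module R e)" if "e \<in> X" for e by (rule left_module_principal[OF idem(1)[OF that]])
  have pc: "r \<in> carrier (principal_module R e) \<longleftrightarrow> r \<in> carrier R \<and> r \<otimes> e = r" if "e \<in> X" for e r
    by (rule principal_carrier_iff[OF idem(1)[OF that] idem(2)[OF that]])
  show Q: "left_module R (Q_sum R X)" unfolding Q_sum_def by (rule left_module_direct_sum[OF ring_axioms pm])
  interpret Q: left_module R "Q_sum R X" by (rule Q)
  note [simp del] = principal_module_simps(1)
  have Qc: "q \<in> carrier (Q_sum R X) \<longleftrightarrow> q \<in> extensional X \<and> (\<forall>e\<in>X. q e \<in> carrier R \<and> q e \<otimes> e = q e)" for q
    using X pc by (auto simp: Q_sum_def PiE_def Pi_iff)
  then show "q \<in> carrier (Q_sum R X) \<longleftrightarrow> q \<in> extensional X \<and> (\<forall>e\<in>X. q e \<in> carrier R \<and> q e \<otimes> e = q e)" .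
  have Qs: "q \<oplus>\<^bsub>Q_sum R X\<^esub> q' = (\<lambda>x\<in>X. q x \<oplus> q' x)" "a \<odot>\<^bsub>Q_sum R X\<^esub> q = (\<lambda>x\<in>X. a \<otimes> q x)" for a q q'
    by (simp_all add: Q_sum_def)
  let ?p = "\<lambda>e. \<lambda>x\<in>X. if x = e then e else \<zero>" and ?\<phi> = "\<lambda>e. \<lambda>q\<in>carrier (Q_sum R X). q e"
  have p: "?p e \<in> carrier (Q_sum R X)" if "e \<in> X" for e using that idem by (auto simp: Qc)
  show "dual_basis R (Q_sum R X) X ?p ?\<phi>"
    unfolding dual_basis_def
  proof (intro conjI ballI X)
    show "?p \<in> X \<rightarrow> carrier (Q_sum R X)" using p by blast
    show "?\<phi> e \<in> lin_maps R (Q_sum R X) (regular_module R)" if "e \<in> X" for e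
      by (rule lin_mapsI[OF Q]) (use that Qc in \<open>auto simp: Qs\<close>)
    fix q assume q: "q \<in> carrier (Q_sum R X)"
    have F: "(\<lambda>e. ?\<phi> e q \<odot>\<^bsub>Q_sum R X\<^esub> ?p e) \<in> X \<rightarrow> carrier (Q_sum R X)"
      using q Qc Q.smult_closed p by simp
    show "q = finsum (Q_sum R X) (\<lambda>e. ?\<phi> e q \<odot>\<^bsub>Q_sum R X\<^esub> ?p e) X" (is "_ = ?s")
    proof (rule extensionalityI[of _ X])
      show "q \<in> extensional X" using q Qc by blast
      show "?s \<in> extensional X" using Q.M.finsum_closed[OF F] Qc by blast
      fix x assume x: "x \<in> X"
      interpret P: left_module R "principal_module R x" by (rule pm[OF x])
      have qx: "q x \<in> carrier R" "q x \<otimes> x = q x" using q Qc x by blast+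
      have "?s x = finsum (principal_module R x) (\<lambda>e. (?\<phi> e q \<odot>\<^bsub>Q_sum R X\<^esub> ?p e) x) X"
        using finsum_direct_sum[of R X "principal_module R" "\<lambda>e. ?\<phi> e q \<odot>\<^bsub>Q_sum R X\<^esub> ?p e" X x] Q pm F x
        by (simp add: Q_sum_def[symmetric])
      also have "\<dots> = (?\<phi> x q \<odot>\<^bsub>Q_sum R X\<^esub> ?p x) x"
        by (rule P.M.finsum_single[OF X x]) (use q Qc x idem pc[OF x] in \<open>auto simp: Qs m_assoc\<close>)
      also have "\<dots> = q x" using q x qx by (simp add: Qs)
      finally show "q x = ?s x" by simp
    qed
  qed
qed

section \<open>Restriction to a subgroup of degrees\<close>

context graded_unital
begin

lemma restrict_subgroup:
  assumes H: "subgroup H G"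
  shows "graded_unital (G\<lparr>carrier := H\<rparr>) (restrict_grading A H)"
    and "base_ring (G\<lparr>carrier := H\<rparr>) (restrict_grading A H) = R"
proof -
  let ?G = "G\<lparr>carrier := H\<rparr>"
  have HG: "H \<subseteq> carrier G" by (rule subgroup.subset[OF H])
  have "is_graded_ring ?G (restrict_grading A (carrier ?G))"
  proof (rule is_graded_ring_restrict[OF subgroup.subgroup_is_group[OF H G.is_group] A.ring_axioms])
    show "independent_parts A (carrier ?G) (rpart A)" using part_ind HG unfolding independent_parts_def by auto
    show "x \<otimes> y \<in> rpart A (g \<otimes>\<^bsub>?G\<^esub> h)"
      if "g \<in> carrier ?G" "h \<in> carrier ?G" "x \<in> rpart A g" "y \<in> rpart A h" for g h x y
      using part_mult[of g h x y] that HG by auto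
  qed (use HG part_subgroup one_part in auto)
  then show "graded_unital ?G (restrict_grading A H)"
    by (intro graded_unital.intro) (simp_all add: restrict_grading_def one_part)
  show "base_ring ?G (restrict_grading A H) = R" by (simp add: base_ring_def restrict_grading_def)
qed

end

section \<open>Permutations of primitive idempotents\<close>

locale semiperfect_epsilon_graded = epsilon_graded G A \<epsilon>
  for G :: "('g, 'h) monoid_scheme" and A :: "('g, 'a) graded_ring" (structure) and \<epsilon> +
  fixes E :: "'a set"
  assumes semiperfect_base: "semiperfect_ring (base_ring G A)" and finite_E: "finite E"
    and primitive_E: "e \<in> E \<Longrightarrow> primitive_idempotent (base_ring G A) e"
    and reps_E: "irredundant_indec_proj_reps (base_ring G A) E"
begin

sublocale SR: semiperfect R
  by (intro semiperfect.intro semiperfect_axioms.intro R.ring_axioms semiperfect_base)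

lemma E: "e \<in> E \<Longrightarrow> e \<in> rpart A \<one>\<^bsub>G\<^esub>" "e \<in> E \<Longrightarrow> e \<otimes> e = e" "e \<in> E \<Longrightarrow> e \<noteq> \<zero>"
  using R.primitive_idempotentD(1-3)[OF primitive_E] by simp_all

lemma E_closed: "e \<in> E \<Longrightarrow> e \<in> carrier A"
  using E(1) R_closed by blast

text \<open>Going back along one link and forward along the other joins \<open>f\<close> to
  \<open>f'\<close> in the neutral degree, where links are isomorphisms of principal modules and
  irredundancy applies.\<close>

lemma linked_unique:
  assumes g: "g \<in> carrier G" and "e \<in> E" "f \<in> E" "f' \<in> E" "linked g e f" "linked g e f'"
  shows "f = f'"
proof -
  have "linked (g \<otimes>\<^bsub>G\<^esub> inv\<^bsub>G\<^esub> g) f f'"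
    by (rule linked_trans[OF G.inv_closed[OF g] g linked_sym[OF g assms(5)] assms(6)])
  then have "module_iso R (principal_module R f) (principal_module R f')"
    using linked_one_iff[of f f'] E assms g by simp
  then show ?thesis using reps_E assms(3,4) unfolding irredundant_indec_proj_reps_def by blast
qed

text \<open>The choice of targets is injective by uniqueness of links in the inverse degree, hence
  surjective by finiteness.\<close>

lemma linked_permutation:
  assumes X: "X \<subseteq> E" and g: "g \<in> carrier G" and l: "\<forall>e\<in>X. \<exists>f\<in>X. linked g e f"
  obtains \<sigma> where "bij_betw \<sigma> X X" "\<And>e. e \<in> X \<Longrightarrow> linked g e (\<sigma> e)"
proof -
  obtain \<sigma> where \<sigma>: "\<And>e. e \<in> X \<Longrightarrow> \<sigma> e \<in> X \<and> linked g e (\<sigma> e)" using l by metis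
  have "inj_on \<sigma> X"
  proof (rule inj_onI)
    fix e e' assume e: "e \<in> X" "e' \<in> X" "\<sigma> e = \<sigma> e'"
    have "linked (inv\<^bsub>G\<^esub> g) (\<sigma> e) e" "linked (inv\<^bsub>G\<^esub> g) (\<sigma> e) e'"
      using linked_sym[OF g] \<sigma>[OF e(1)] \<sigma>[OF e(2)] e(3) by simp_all
    then show "e = e'" using linked_unique[OF G.inv_closed[OF g]] \<sigma> e X by blast
  qed
  moreover have "\<sigma> ` X = X"
    using \<sigma> finite_subset[OF X finite_E] \<open>inj_on \<sigma> X\<close> by (intro endo_inj_surj) auto
  ultimately show thesis using that[of \<sigma>] \<sigma> by (simp add: bij_betw_def)
qed

text \<open>By centrality the product is an idempotent of eRe, so primitivity makes it 0 or
  \<open>e\<close>.\<close>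

lemma eps_idempotent:
  assumes g: "g \<in> carrier G" and e: "e \<in> E"
  shows "\<epsilon> g \<otimes> e = e \<longleftrightarrow> \<epsilon> g \<otimes> e \<noteq> \<zero>"
proof -
  note eR = E[OF e] E_closed[OF e] and cen = eps_central[OF g E(1)[OF e]] and \<epsilon>R = eps_closed[OF g]
  let ?z = "\<epsilon> g \<otimes> e"
  have ze: "e \<otimes> ?z = ?z" "?z \<otimes> e = ?z" using eR \<epsilon>R by (simp_all add: A.m_assoc) (simp add: cen flip: A.m_assoc)
  have "?z \<otimes> ?z = \<epsilon> g \<otimes> (e \<otimes> ?z)" using eR \<epsilon>R by (simp add: A.m_assoc)
  also have "\<dots> = ?z" unfolding ze(1) using eR \<epsilon>R eps_idem[OF g] by (simp flip: A.m_assoc)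
  finally have zz: "?z \<otimes> ?z = ?z" .
  have "?z = \<zero>\<^bsub>R\<^esub> \<or> ?z = e"
    by (rule R.primitive_corner[OF primitive_E[OF e]])
      (use ze zz part_mult_l[OF G.one_closed eps_part[OF g] eR(1)] in simp_all)
  then show ?thesis using eR(3) by auto
qed

text \<open>
  \<open>f\<close> is a sum of terms \<open>v f\<^sub>k u\<close> with \<open>v\<close> of degree \<open>g\<close> and \<open>u\<close> of degree \<open>g\<^sup>-\<^sup>1\<close>. One of them lies
  outside the radical, so it is invertible in the local ring \<open>fRf\<close>.
\<close>

lemma linked_of_eps:
  assumes g: "g \<in> carrier G" and f: "f \<in> E" and \<epsilon>f: "\<epsilon> g \<otimes> f = f"
  shows "\<exists>e\<in>E. linked (inv\<^bsub>G\<^esub> g) f e"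
proof -
  have ig: "inv\<^bsub>G\<^esub> g \<in> carrier G" using g by simp
  have fR: "f \<in> rpart A \<one>\<^bsub>G\<^esub>" "f \<otimes> f = f" "f \<in> carrier A" using E E_closed f by auto
  obtain n :: nat and h where h: "\<And>k. k < n \<Longrightarrow> primitive_idempotent R (h k)" and h1: "finsum R h {..<n} = \<one>\<^bsub>R\<^esub>"
    by (rule SR.one_sum_primitive) (rule that)
  have hR: "h k \<in> rpart A \<one>\<^bsub>G\<^esub>" "h k \<otimes> h k = h k" "h k \<in> carrier A" if "k < n" for k
    using R.primitive_idempotentD(1,2)[OF h[OF that]] R_closed by simp_all
  have h1A: "finsum A h {..<n} = \<one>" using finsum_R[of h "{..<n}"] h1 hR(1) by simp
  let ?J = "jacobson_radical R"
  have fJ: "f \<notin> ?J" using SR.primitive_not_J[OF primitive_E[OF f]] .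
  have "\<exists>a\<in>rpart A g. \<exists>b\<in>rpart A (inv\<^bsub>G\<^esub> g). \<exists>k<n. f \<otimes> a \<otimes> h k \<otimes> b \<otimes> f \<notin> ?J"
  proof (rule ccontr)
    assume "\<not> ?thesis"
    then have inJ: "f \<otimes> a \<otimes> h k \<otimes> b \<otimes> f \<in> ?J"
      if "a \<in> rpart A g" "b \<in> rpart A (inv\<^bsub>G\<^esub> g)" "k < n" for a b k using that by blast
    have sub: "additive_subgroup ?J R" by (rule ideal.axioms(1)[OF SR.J_ideal])
    note JD = additive_subgroupD[OF sub R.abelian_group_axioms, unfolded base_ring_simps]
    have Jneg: "\<ominus> x \<in> ?J" if x: "x \<in> ?J" for x
    proof -
      have xR: "x \<in> rpart A \<one>\<^bsub>G\<^esub>" using JD(1) x by blast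
      have "(\<ominus> \<one>) \<otimes>\<^bsub>R\<^esub> x \<in> ?J" using R.J(4)[OF _ x, of "\<ominus> \<one>"] part(4)[OF G.one_closed one_part] by simp
      then show ?thesis using R_closed[OF xR] by (simp add: A.l_minus)
    qed
    \<comment> \<open>If all such terms were in the radical, so would be fsf for every s in the
      product of A_g and A_(g^-1): insert 1 as the sum of the \<open>h k\<close> between the two
      factors. For s = \<epsilon>_g this puts \<open>f\<close> itself into the radical.\<close>
    have "set_prod A (rpart A g) (rpart A (inv\<^bsub>G\<^esub> g)) \<subseteq> {s \<in> carrier A. f \<otimes> s \<otimes> f \<in> ?J}"
    proof (rule set_prod_subset[OF _ A.abelian_group_axioms])
      show "additive_subgroup {s \<in> carrier A. f \<otimes> s \<otimes> f \<in> ?J} A"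
        by (rule additive_subgroupI'[OF A.abelian_group_axioms])
          (use fR(3) JD(2,3) Jneg in \<open>auto simp: A.l_distr A.r_distr A.l_minus A.r_minus\<close>)
      fix a b assume ab: "a \<in> rpart A g" "b \<in> rpart A (inv\<^bsub>G\<^esub> g)"
      have c: "a \<in> carrier A" "b \<in> carrier A" using ab part_closed g ig by blast+
      have m: "f \<otimes> a \<in> carrier A" "b \<otimes> f \<in> carrier A" using c fR(3) by simp_all
      have "f \<otimes> (a \<otimes> b) \<otimes> f = f \<otimes> a \<otimes> finsum A h {..<n} \<otimes> (b \<otimes> f)"
        unfolding h1A using c fR(3) by (simp add: A.m_assoc)
      also have "\<dots> = finsum A (\<lambda>k. f \<otimes> a \<otimes> h k) {..<n} \<otimes> (b \<otimes> f)"
        using A.finsum_rdistr[OF _ m(1), of "{..<n}" h] hR(3) by (simp add: Pi_def)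
      also have "\<dots> = finsum A (\<lambda>k. f \<otimes> a \<otimes> h k \<otimes> (b \<otimes> f)) {..<n}"
        using A.finsum_ldistr[OF _ m(2), of "{..<n}" "\<lambda>k. f \<otimes> a \<otimes> h k"] hR(3) m(1) by (simp add: Pi_def)
      also have "\<dots> \<in> ?J"
      proof (rule A.finsum_in_subset[of ?J])
        show "?J \<subseteq> carrier A" using JD(1) R_closed by blast
        have "f \<otimes> a \<otimes> h k \<otimes> (b \<otimes> f) = f \<otimes> a \<otimes> h k \<otimes> b \<otimes> f" if "k < n" for k
          using c m fR(3) hR(3)[OF that] by (simp add: A.m_assoc)
        then show "(\<lambda>k. f \<otimes> a \<otimes> h k \<otimes> (b \<otimes> f)) \<in> {..<n} \<rightarrow> ?J" using inJ[OF ab] by simp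
      qed (use JD(2,3) in blast)+
      finally show "a \<otimes> b \<in> {s \<in> carrier A. f \<otimes> s \<otimes> f \<in> ?J}" using c by simp
    qed
    then have "f \<otimes> \<epsilon> g \<otimes> f \<in> ?J" using eps_prod[OF g] by blast
    then show False using fJ eps_central[OF g fR(1)] \<epsilon>f fR by (simp add: A.m_assoc)
  qed
  then obtain a b k where ab: "a \<in> rpart A g" "b \<in> rpart A (inv\<^bsub>G\<^esub> g)" and k: "k < n"
    and nJ: "f \<otimes> a \<otimes> h k \<otimes> b \<otimes> f \<notin> ?J" by blast
  have c: "a \<in> carrier A" "b \<in> carrier A" using ab part_closed g ig by blast+
  note hk = hR[OF k]
  let ?t = "f \<otimes> a \<otimes> h k \<otimes> b \<otimes> f"
  have fah: "f \<otimes> a \<otimes> h k \<in> rpart A g" by (intro part_mult_r[OF g hk(1)] part_mult_l[OF g fR(1)] ab)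
  have hbf: "h k \<otimes> b \<otimes> f \<in> rpart A (inv\<^bsub>G\<^esub> g)" by (intro part_mult_r[OF ig fR(1)] part_mult_l[OF ig hk(1)] ab)
  have fahc: "f \<otimes> a \<otimes> h k \<in> carrier A" and hbfc: "h k \<otimes> b \<otimes> f \<in> carrier A" using c fR hk by simp_all
  have hh: "h k \<otimes> (h k \<otimes> x) = h k \<otimes> x" "f \<otimes> (f \<otimes> x) = f \<otimes> x" if "x \<in> carrier A" for x
    using that hk fR by (simp_all flip: A.m_assoc)
  have t: "?t = (f \<otimes> a \<otimes> h k) \<otimes> (h k \<otimes> b \<otimes> f)" using c fR hk hh by (simp add: A.m_assoc)
  obtain y where y: "y \<in> carrier R" "f \<otimes>\<^bsub>R\<^esub> y = y" "y \<otimes>\<^bsub>R\<^esub> f = y" "y \<otimes>\<^bsub>R\<^esub> ?t = f"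
  proof (rule SR.primitive_local[OF primitive_E[OF f], of ?t])
    show "?t \<in> carrier R" using part_mult_inv(1)[OF g fah hbf] t by simp
    show "f \<otimes>\<^bsub>R\<^esub> ?t = ?t" "?t \<otimes>\<^bsub>R\<^esub> f = ?t" using c fR hk hh by (simp_all add: A.m_assoc)
  qed (use nJ that in auto)
  have yR: "y \<in> rpart A \<one>\<^bsub>G\<^esub>" "y \<in> carrier A" using y(1) R_closed by simp_all
  \<comment> \<open>The idempotent \<open>h k\<close> is doubled and shared between the two factors,
    and \<open>y\<close> turns their product into \<open>f\<close>.\<close>
  define v where "v = y \<otimes> (f \<otimes> a \<otimes> h k)"
  define u where "u = h k \<otimes> b \<otimes> f"
  have u: "u \<in> rpart A (inv\<^bsub>G\<^esub> g)" "u \<in> carrier A" "h k \<otimes> u = u" unfolding u_def using hbf hbfc c fR hk hh by (simp_all add: A.m_assoc)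
  have v: "v \<in> rpart A g" "v \<in> carrier A" "v \<otimes> h k = v"
    unfolding v_def using part_mult_l[OF g yR(1) fah] fahc yR(2) c fR hk by (simp_all add: A.m_assoc)
  have vu: "v \<otimes> u = f" unfolding v_def u_def using y(4) yR(2) fahc hbfc t by (simp add: A.m_assoc)
  have uf: "u \<otimes> f = u" unfolding u_def using c fR hk by (simp add: A.m_assoc)
  \<comment> \<open>The opposite product is an idempotent in the corner at \<open>h k\<close>. It is
    nonzero because f = v(uv)u, so it is all of \<open>h k\<close>.\<close>
  let ?z = "u \<otimes> v"
  have "?z \<otimes> ?z = u \<otimes> (v \<otimes> u) \<otimes> v" using u(2) v(2) by (simp only: A.m_assoc A.m_closed)
  then have zz: "?z \<otimes> ?z = ?z" using vu uf by simp
  have "?z = \<zero>\<^bsub>R\<^esub> \<or> ?z = h k"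
  proof (rule R.primitive_corner[OF h[OF k]])
    show "?z \<in> carrier R" using part_mult_inv(2)[OF g v(1) u(1)] by simp
    show "h k \<otimes>\<^bsub>R\<^esub> ?z = ?z" using u v hk by (simp flip: A.m_assoc)
    show "?z \<otimes>\<^bsub>R\<^esub> h k = ?z" using u v hk by (simp add: A.m_assoc)
  qed (use zz in simp)
  moreover have "?z \<noteq> \<zero>"
  proof
    assume z: "?z = \<zero>"
    have "f = v \<otimes> u \<otimes> (v \<otimes> u)" using vu fR(2) by simp
    also have "\<dots> = v \<otimes> ?z \<otimes> u" using u(2) v(2) by (simp only: A.m_assoc A.m_closed)
    finally show False using z u(2) v(2) E(3)[OF f] by simp
  qed
  ultimately have "?z = h k" by simp
  then have l: "linked (inv\<^bsub>G\<^esub> g) f (h k)"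
    using u v vu fR hk g by (intro linkedI[OF ig, of u v]) simp_all
  obtain e where e: "e \<in> E" "module_iso R (principal_module R (h k)) (principal_module R e)"
    by (rule R.primitive_iso_rep[OF reps_E h[OF k]]) (rule that)
  have "linked \<one>\<^bsub>G\<^esub> (h k) e" using linked_one_iff[of "h k" e] hk E e by simp
  from linked_trans[OF ig G.one_closed l this] show ?thesis using e(1) ig by auto
qed

text \<open>An isomorphism is first used to see that \<epsilon>_(g^-1) e is nonzero, hence equal to
  \<open>e\<close>. This yields a link from \<open>e\<close> to some \<open>f'\<close> in
  \<open>E\<close>; comparing the isomorphism that it induces with the given one forces f' = f by
  irredundancy.\<close>

lemma linked_iff_component_iso:
  assumes g: "g \<in> carrier G" and e: "e \<in> E" and f: "f \<in> E"
  shows "module_iso R (component_tensor G A g (principal_module R e)) (principal_module R f) \<longleftrightarrow> linked g e f"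
proof
  let ?T = "component_tensor G A g (principal_module R e)"
  assume iso: "module_iso R ?T (principal_module R f)"
  have ig: "inv\<^bsub>G\<^esub> g \<in> carrier G" using g by simp
  have "\<epsilon> (inv\<^bsub>G\<^esub> g) \<otimes> e = e" using eps_idempotent[OF ig e] eps_nonzero[OF g E(1,2)[OF e] E[OF f] iso] by blast
  from linked_of_eps[OF ig e this] obtain f' where f': "f' \<in> E" "linked g e f'" using g by auto
  note T = component_principal(2)[OF g E(1,2)[OF e]]
  have "module_iso R ?T (principal_module R f')" by (rule linked_component_iso[OF g E(1,2)[OF e] E(1,2)[OF f'(1)] f'(2)])
  then have "module_iso R (principal_module R f') (principal_module R f)"
    using module_iso_sym[OF T R.left_module_principal, of f'] module_iso_trans[OF R.left_module_principal, of f'] iso E[OF f'(1)] by auto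
  then have "f' = f" using reps_E f'(1) f unfolding irredundant_indec_proj_reps_def by blast
  then show "linked g e f" using f'(2) by simp
qed (use linked_component_iso[OF g] E e f in blast)

lemma G_sub_linked:
  assumes "X \<subseteq> E"
  shows "G_sub G A X = {g \<in> carrier G. \<forall>e\<in>X. \<exists>f\<in>X. linked g e f}"
  unfolding G_sub_def using linked_iff_component_iso assms by blast

text \<open>Links in degree g permute \<open>X\<close>, so every member is the target of one, and
  that link can be reversed.\<close>

lemma linked_inv:
  assumes X: "X \<subseteq> E" and g: "g \<in> carrier G" and l: "\<forall>e\<in>X. \<exists>f\<in>X. linked g e f"
  shows "\<forall>e\<in>X. \<exists>f\<in>X. linked (inv\<^bsub>G\<^esub> g) e f"
proof
  fix f assume "f \<in> X"
  obtain \<sigma> where \<sigma>: "bij_betw \<sigma> X X" "\<And>e. e \<in> X \<Longrightarrow> linked g e (\<sigma> e)"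
    by (rule linked_permutation[OF X g l]) (rule that)
  obtain e where "e \<in> X" "f = \<sigma> e" using bij_betw_imp_surj_on[OF \<sigma>(1)] \<open>f \<in> X\<close> by blast
  then show "\<exists>e\<in>X. linked (inv\<^bsub>G\<^esub> g) f e" using linked_sym[OF g \<sigma>(2)] by blast
qed

lemma subgroup_G_sub:
  assumes X: "X \<subseteq> E"
  shows "subgroup (G_sub G A X) G"
  unfolding G_sub_linked[OF X]
proof (rule G.subgroupI)
  show "{g \<in> carrier G. \<forall>e\<in>X. \<exists>f\<in>X. linked g e f} \<noteq> {}"
    using linked_refl E X G.one_closed by blast
  fix g assume "g \<in> {g \<in> carrier G. \<forall>e\<in>X. \<exists>f\<in>X. linked g e f}"
  then have g: "g \<in> carrier G" "\<forall>e\<in>X. \<exists>f\<in>X. linked g e f" by auto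
  then show "inv\<^bsub>G\<^esub> g \<in> {g \<in> carrier G. \<forall>e\<in>X. \<exists>f\<in>X. linked g e f}" using linked_inv[OF X] by simp
  fix h assume "h \<in> {g \<in> carrier G. \<forall>e\<in>X. \<exists>f\<in>X. linked g e f}"
  then have h: "h \<in> carrier G" "\<forall>e\<in>X. \<exists>f\<in>X. linked h e f" by auto
  have "\<exists>k\<in>X. linked (g \<otimes>\<^bsub>G\<^esub> h) e k" if "e \<in> X" for e
    using linked_trans[OF h(1) g(1)] g(2) h(2) that by blast
  then show "g \<otimes>\<^bsub>G\<^esub> h \<in> {g \<in> carrier G. \<forall>e\<in>X. \<exists>f\<in>X. linked g e f}" using g h by simp
qed auto

lemma Q_sum_basis:
  assumes X: "X \<subseteq> E"
  shows "left_module R (Q_sum R X)"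
    and "dual_basis R (Q_sum R X) X (\<lambda>e. \<lambda>x\<in>X. if x = e then e else \<zero>) (\<lambda>e. \<lambda>q\<in>carrier (Q_sum R X). q e)"
    and "q \<in> carrier (Q_sum R X) \<longleftrightarrow> q \<in> extensional X \<and> (\<forall>e\<in>X. q e \<in> rpart A \<one>\<^bsub>G\<^esub> \<and> q e \<otimes> e = q e)"
proof -
  have idem: "e \<in> carrier R" "e \<otimes>\<^bsub>R\<^esub> e = e" if "e \<in> X" for e using E that X by auto
  note Q = R.Q_sum_dual_basis[OF finite_subset[OF X finite_E], OF idem, unfolded base_ring_simps]
  show "left_module R (Q_sum R X)"
    "dual_basis R (Q_sum R X) X (\<lambda>e. \<lambda>x\<in>X. if x = e then e else \<zero>) (\<lambda>e. \<lambda>q\<in>carrier (Q_sum R X). q e)"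
    "q \<in> carrier (Q_sum R X) \<longleftrightarrow> q \<in> extensional X \<and> (\<forall>e\<in>X. q e \<in> rpart A \<one>\<^bsub>G\<^esub> \<and> q e \<otimes> e = q e)"
    by (rule Q; assumption)+
qed

text \<open>The links of a degree in G_X supply the families \<open>u\<close> and \<open>v\<close>
  for \<open>Mor_permutation\<close>. Every degree of the restricted ring then carries a unit, so
  the criterion is applied with the whole group of degrees.\<close>

theorem END_Q_sum_crossed_product:
  assumes X: "X \<subseteq> E"
  shows "is_partial_crossed_product (G\<lparr>carrier := G_sub G A X\<rparr>)
    (END_induced (G\<lparr>carrier := G_sub G A X\<rparr>) (restrict_grading A (G_sub G A X)) (Q_sum R X))"
proof -
  let ?H = "G_sub G A X"
  let ?G = "G\<lparr>carrier := ?H\<rparr>" and ?B = "restrict_grading A ?H" and ?Q = "Q_sum R X"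
  note H = subgroup_G_sub[OF X]
  interpret B: graded_unital ?G ?B by (rule restrict_subgroup(1)[OF H])
  have BR: "base_ring ?G ?B = R" by (rule restrict_subgroup(2)[OF H])
  note Q = Q_sum_basis[OF X]
  let ?p = "\<lambda>e. \<lambda>x\<in>X. if x = e then e else \<zero>" and ?\<phi> = "\<lambda>e. \<lambda>q\<in>carrier ?Q. q e"
  let ?pt = "pure_tensor R (sub_bimodule ?B (carrier ?B)) ?Q"
  obtain \<phi>' where gdb: "graded_dual_basis ?G ?B (induced_module ?G ?B ?Q) X (\<lambda>i. ?pt \<one>\<^bsub>?B\<^esub> (?p i)) \<phi>'"
    and \<phi>': "\<And>i a m. i \<in> X \<Longrightarrow> a \<in> carrier ?B \<Longrightarrow> m \<in> carrier ?Q \<Longrightarrow> \<phi>' i (?pt a m) = a \<otimes>\<^bsub>?B\<^esub> ?\<phi> i m"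
    by (rule B.induced_basis_ex[unfolded BR, OF Q(1,2)]) (rule that)
  interpret N: graded_basis ?G ?B "induced_module ?G ?B ?Q" X "\<lambda>i. ?pt \<one>\<^bsub>?B\<^esub> (?p i)" \<phi>'
    by unfold_locales (rule gdb)
  have Bs: "mult ?B = mult A" "one ?B = one A" "\<zero>\<^bsub>?B\<^esub> = \<zero>" "rpart ?B = rpart A" by (simp_all add: restrict_grading_def)
  have c: "\<phi>' j (?pt \<one>\<^bsub>?B\<^esub> (?p i)) = (if j = i then i else \<zero>\<^bsub>?B\<^esub>)" if "i \<in> X" "j \<in> X" for i j
  proof -
    have "?p i \<in> carrier ?Q" using dual_basisD(2)[OF Q(2) that(1)] .
    then show ?thesis using \<phi>'[OF that(2) B.A.one_closed] that E_closed X by (auto simp: Bs)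
  qed
  show ?thesis unfolding END_induced_def
  proof (rule N.END_crossed_product[OF B.G.subgroup_self])
    fix g assume g: "g \<in> carrier ?G"
    then have gH: "g \<in> ?H" by simp
    then have gG: "g \<in> carrier G" and l: "\<forall>e\<in>X. \<exists>f\<in>X. linked g e f" unfolding G_sub_linked[OF X] by auto
    have inv: "inv\<^bsub>?G\<^esub> g = inv\<^bsub>G\<^esub> g" by (rule G.m_inv_consistent[OF H gH])
    obtain \<sigma> where \<sigma>: "bij_betw \<sigma> X X" "\<And>e. e \<in> X \<Longrightarrow> linked g e (\<sigma> e)"
      by (rule linked_permutation[OF X gG l]) (rule that)
    have "\<forall>e\<in>X. \<exists>u v. u \<in> rpart A g \<and> v \<in> rpart A (inv\<^bsub>G\<^esub> g) \<and> u \<otimes> v = \<sigma> e \<and> v \<otimes> u = e \<and>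
      \<sigma> e \<otimes> u = u \<and> e \<otimes> v = v"
      using \<sigma>(2) unfolding linked_def by blast
    then obtain u v where uv: "\<forall>e\<in>X. u e \<in> rpart A g \<and> v e \<in> rpart A (inv\<^bsub>G\<^esub> g) \<and> u e \<otimes> v e = \<sigma> e \<and>
      v e \<otimes> u e = e \<and> \<sigma> e \<otimes> u e = u e \<and> e \<otimes> v e = v e" by metis
    show "\<exists>U\<in>Mor ?G ?B (induced_module ?G ?B ?Q) g. \<exists>V\<in>Mor ?G ?B (induced_module ?G ?B ?Q) (inv\<^bsub>?G\<^esub> g).
      compose (carrier (induced_module ?G ?B ?Q)) V U = (\<lambda>x\<in>carrier (induced_module ?G ?B ?Q). x) \<and>
      compose (carrier (induced_module ?G ?B ?Q)) U V = (\<lambda>x\<in>carrier (induced_module ?G ?B ?Q). x)"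
      by (rule N.Mor_permutation[OF g \<sigma>(1), where c = "\<lambda>i. i" and u = u and v = v]) (use c uv in \<open>simp_all add: Bs inv\<close>)
  qed simp
qed

text \<open>For g in G_E the links permute \<open>E\<close>, so each f in \<open>E\<close> is the
  target of one and is fixed by \<epsilon>_g. Conversely these equations produce links in the
  inverse degree for all of \<open>E\<close>, and passing to inverses returns to g.\<close>

lemma G_sub_E:
  shows "G_sub G A E = {g \<in> carrier G. \<forall>e\<in>E. \<epsilon> g \<otimes> e = e}"
    and "{g \<in> carrier G. \<forall>e\<in>E. \<epsilon> g \<otimes> e = e} = {g \<in> carrier G. \<forall>e\<in>E. \<epsilon> g \<otimes> e \<noteq> \<zero>}"
proof -
  have 1: "\<epsilon> g \<otimes> f = f" if g: "g \<in> G_sub G A E" and f: "f \<in> E" for g f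
  proof -
    have gG: "g \<in> carrier G" and l: "\<forall>e\<in>E. \<exists>f\<in>E. linked g e f" using g unfolding G_sub_linked[OF subset_refl] by auto
    have ig: "inv\<^bsub>G\<^esub> g \<in> carrier G" using gG by simp
    obtain e where "linked (inv\<^bsub>G\<^esub> g) f e" using linked_inv[OF subset_refl gG l] f by blast
    from linked_sym[OF ig this] have "linked g e f" using gG by simp
    then show ?thesis by (rule linked_eps[OF gG])
  qed
  have 2: "g \<in> G_sub G A E" if g: "g \<in> carrier G" and \<epsilon>g: "\<forall>e\<in>E. \<epsilon> g \<otimes> e = e" for g
  proof -
    have "\<forall>f\<in>E. \<exists>e\<in>E. linked (inv\<^bsub>G\<^esub> g) f e" using linked_of_eps[OF g] \<epsilon>g by blast
    from linked_inv[OF subset_refl G.inv_closed[OF g] this] show ?thesis unfolding G_sub_linked[OF subset_refl] using g by simp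
  qed
  show "G_sub G A E = {g \<in> carrier G. \<forall>e\<in>E. \<epsilon> g \<otimes> e = e}"
    using 1 2 subgroup.subset[OF subgroup_G_sub[OF subset_refl]] by blast
  show "{g \<in> carrier G. \<forall>e\<in>E. \<epsilon> g \<otimes> e = e} = {g \<in> carrier G. \<forall>e\<in>E. \<epsilon> g \<otimes> e \<noteq> \<zero>}" using eps_idempotent by blast
qed

text \<open>1 is a sum of primitive \<open>h k\<close>, each tied to some \<open>e\<close> in
  \<open>E\<close> by uv = e and vu = h k. Then h k = veu is the value of a functional, evaluation
  at \<open>e\<close> followed by right multiplication with \<open>u\<close>, at \<open>v\<close>
  times the basis element of \<open>e\<close>.\<close>

lemma trace_one_Q_sum: "trace_one R (Q_sum R E)"
proof -
  note Q = Q_sum_basis[OF subset_refl] and d = dual_basisD[OF Q_sum_basis(2)[OF subset_refl]]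
  interpret Q: left_module R "Q_sum R E" by (rule Q(1))
  obtain n :: nat and h where h: "\<And>k. k < n \<Longrightarrow> primitive_idempotent R (h k)" and h1: "finsum R h {..<n} = \<one>\<^bsub>R\<^esub>"
    by (rule SR.one_sum_primitive) (rule that)
  have hR: "h k \<in> rpart A \<one>\<^bsub>G\<^esub>" "h k \<otimes> h k = h k" if "k < n" for k
    using R.primitive_idempotentD(1,2)[OF h[OF that]] by simp_all
  have "\<exists>F x. F \<in> lin_maps R (Q_sum R E) (regular_module R) \<and> x \<in> carrier (Q_sum R E) \<and> F x = h k" if k: "k < n" for k
  proof -
    obtain e where e: "e \<in> E" "module_iso R (principal_module R (h k)) (principal_module R e)"
      by (rule R.primitive_iso_rep[OF reps_E h[OF k]]) (rule that)
    obtain u v where uv: "u \<in> carrier R" "v \<in> carrier R" "u \<otimes>\<^bsub>R\<^esub> v = e" "v \<otimes>\<^bsub>R\<^esub> u = h k"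
      by (rule R.principal_iso_elements[OF _ _ _ _ e(2)]) (use hR[OF k] E e(1) in simp_all)
    let ?F = "\<lambda>q\<in>carrier (Q_sum R E). q e \<otimes>\<^bsub>R\<^esub> u"
    let ?x = "v \<odot>\<^bsub>Q_sum R E\<^esub> (\<lambda>x\<in>E. if x = e then e else \<zero>)"
    have qe: "q e \<in> carrier R" if "q \<in> carrier (Q_sum R E)" for q using Q(3) that e(1) by simp
    have "?F \<in> lin_maps R (Q_sum R E) (regular_module R)"
    proof (rule lin_mapsI[OF Q(1)], unfold regular_module_simps)
      show "q e \<otimes>\<^bsub>R\<^esub> u \<in> carrier R" if "q \<in> carrier (Q_sum R E)" for q using qe[OF that] uv(1) by (rule R.m_closed)
      show "(q \<oplus>\<^bsub>Q_sum R E\<^esub> q') e \<otimes>\<^bsub>R\<^esub> u = q e \<otimes>\<^bsub>R\<^esub> u \<oplus>\<^bsub>R\<^esub> q' e \<otimes>\<^bsub>R\<^esub> u"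
        if "q \<in> carrier (Q_sum R E)" "q' \<in> carrier (Q_sum R E)" for q q'
        using R.l_distr[OF qe[OF that(1)] qe[OF that(2)] uv(1)] e(1) by (simp add: Q_sum_def)
      show "(a \<odot>\<^bsub>Q_sum R E\<^esub> q) e \<otimes>\<^bsub>R\<^esub> u = a \<otimes>\<^bsub>R\<^esub> (q e \<otimes>\<^bsub>R\<^esub> u)"
        if "a \<in> carrier R" "q \<in> carrier (Q_sum R E)" for a q
        using R.m_assoc[OF that(1) qe[OF that(2)] uv(1)] e(1) by (simp add: Q_sum_def)
    qed
    moreover have x: "?x \<in> carrier (Q_sum R E)" by (rule Q.smult_closed[OF uv(2) d(2)[OF e(1)]])
    moreover have "?F ?x = h k"
    proof -
      have eR: "e \<in> carrier R" using E(1)[OF e(1)] by simp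
      have "?x e = v \<otimes>\<^bsub>R\<^esub> e" using e(1) by (simp add: Q_sum_def)
      then have "?F ?x = v \<otimes>\<^bsub>R\<^esub> (u \<otimes>\<^bsub>R\<^esub> v) \<otimes>\<^bsub>R\<^esub> u" using x uv(3) by simp
      also have "\<dots> = (v \<otimes>\<^bsub>R\<^esub> u) \<otimes>\<^bsub>R\<^esub> (v \<otimes>\<^bsub>R\<^esub> u)" using uv(1,2) by (simp only: R.m_assoc R.m_closed)
      finally show ?thesis using uv(4) hR[OF k] by simp
    qed
    ultimately show ?thesis by blast
  qed
  then obtain F x where F: "\<And>k. k < n \<Longrightarrow> F k \<in> lin_maps R (Q_sum R E) (regular_module R) \<and> x k \<in> carrier (Q_sum R E) \<and> F k (x k) = h k"
    by metis
  have "finsum R (\<lambda>k. F k (x k)) {..<n} = finsum R h {..<n}"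
    using hR F by (intro R.finsum_cong') auto
  then have "finsum R (\<lambda>k. F k (x k)) {..<n} = \<one>\<^bsub>R\<^esub>" using h1 by (rule trans)
  then show ?thesis unfolding trace_one_def using F by (intro exI[of _ n] exI[of _ F] exI[of _ x] conjI) blast+
qed

theorem graded_equivalent_Q_sum:
  assumes "E \<noteq> {}"
  shows "graded_equivalent (G\<lparr>carrier := G_sub G A E\<rparr>) (restrict_grading A (G_sub G A E))
    (END_induced (G\<lparr>carrier := G_sub G A E\<rparr>) (restrict_grading A (G_sub G A E)) (Q_sum R E))"
proof -
  note H = subgroup_G_sub[OF subset_refl]
  interpret B: graded_unital "G\<lparr>carrier := G_sub G A E\<rparr>" "restrict_grading A (G_sub G A E)"
    by (rule restrict_subgroup(1)[OF H])
  have "\<one> \<noteq> \<zero>" using assms E(3) E_closed A.one_zeroD by blast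
  then have nz: "\<one>\<^bsub>restrict_grading A (G_sub G A E)\<^esub> \<noteq> \<zero>\<^bsub>restrict_grading A (G_sub G A E)\<^esub>"
    by (simp add: restrict_grading_def)
  show ?thesis
    by (rule B.graded_equivalent_END_induced[unfolded restrict_subgroup(2)[OF H], OF Q_sum_basis(1,2)[OF subset_refl] trace_one_Q_sum nz])
qed

end

section \<open>Invariant progenerators\<close>

context epsilon_graded
begin

text \<open>
  \<open>\<epsilon>\<^sub>g\<close> acts as the identity on \<open>A\<^sub>g \<otimes>\<^sub>R P \<simeq> P\<close>, so \<open>\<epsilon>\<^sub>g = 1\<close> as \<open>P\<close> is a generator.
\<close>

lemma eps_invariant:
  fixes P :: "('a, 'p, 'm) module_scheme"
  assumes P: "left_module R P" "trace_one R P" and g: "g \<in> carrier G"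
    and iso: "module_iso R (component_tensor G A g P) P"
  shows "\<epsilon> g = \<one>"
proof -
  interpret P: left_module R P by (rule P(1))
  interpret T: tensor_module R "sub_bimodule A (rpart A g)" P R
    by (rule tensor_module_bimodule[OF bimodule_part[OF g] P(1)])
  have \<epsilon>R: "\<epsilon> g \<in> carrier R" using eps_part[OF g] by simp
  obtain F where F: "F \<in> lin_maps R T.T P" "bij_betw F (carrier T.T) (carrier P)"
    using iso unfolding module_iso_def component_tensor_def by blast
  have \<epsilon>t: "\<epsilon> g \<odot>\<^bsub>T.T\<^esub> t = t" if t: "t \<in> carrier T.T" for t
  proof (rule T.tensor_map_eqI[OF T.abelian_group_T _ _ _ t, where f = "\<lambda>t. \<epsilon> g \<odot>\<^bsub>T.T\<^esub> t" and g = "\<lambda>t. t"])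
    show "additive_map T.T T.T (\<lambda>t. \<epsilon> g \<odot>\<^bsub>T.T\<^esub> t)"
      by (rule additive_mapI) (use \<epsilon>R T.TM.smult_closed T.TM.smult_r_distr in blast)+
    show "additive_map T.T T.T (\<lambda>t. t)" by (rule additive_mapI, assumption, rule refl)
    show "\<epsilon> g \<odot>\<^bsub>T.T\<^esub> T.pt x m = T.pt x m" if "x \<in> carrier (sub_bimodule A (rpart A g))" "m \<in> carrier P" for x m
      using T.smult_pure[OF \<epsilon>R that] eps_l[OF g, of x] that(1) by simp
  qed
  have \<epsilon>m: "\<epsilon> g \<odot>\<^bsub>P\<^esub> m = m" if "m \<in> carrier P" for m
  proof -
    have "m \<in> F ` carrier T.T" unfolding bij_betw_imp_surj_on[OF F(2)] by (rule that)
    then obtain t where t: "m = F t" "t \<in> carrier T.T" by (rule imageE)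
    show ?thesis using lin_mapsD(3)[OF F(1) \<epsilon>R t(2)] unfolding \<epsilon>t[OF t(2)] t(1) by (rule sym)
  qed
  obtain n :: nat and f x where fx: "\<And>j. j < n \<Longrightarrow> f j \<in> lin_maps R P (regular_module R)" "\<And>j. j < n \<Longrightarrow> x j \<in> carrier P"
    and sum: "finsum R (\<lambda>j. f j (x j)) {..<n} = \<one>\<^bsub>R\<^esub>" using P(2) unfolding trace_one_def by blast
  have fc: "f j (x j) \<in> carrier R" if "j < n" for j using lin_mapsD(1)[OF fx(1)[OF that] fx(2)[OF that]] by simp
  have \<epsilon>f: "\<epsilon> g \<otimes>\<^bsub>R\<^esub> f j (x j) = f j (x j)" if "j < n" for j
    using lin_mapsD(3)[OF fx(1)[OF that] \<epsilon>R fx(2)[OF that]] \<epsilon>m[OF fx(2)[OF that]] by simp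
  have "\<epsilon> g = \<epsilon> g \<otimes>\<^bsub>R\<^esub> finsum R (\<lambda>j. f j (x j)) {..<n}" unfolding sum using \<epsilon>R R.r_one by metis
  also have "\<dots> = finsum R (\<lambda>j. \<epsilon> g \<otimes>\<^bsub>R\<^esub> f j (x j)) {..<n}" by (rule R.finsum_rdistr) (use \<epsilon>R fc in auto)
  also have "\<dots> = finsum R (\<lambda>j. f j (x j)) {..<n}" by (rule R.finsum_cong') (use fc \<epsilon>f in auto)
  finally show ?thesis using sum by simp
qed

text \<open>If A_(g^-1) were zero, so would be \<epsilon>_g = 1. If A_(gh) were zero, A_g would
  annihilate the product of A_h and A_(h^-1), which contains \<epsilon>_h = 1, and so would be zero
  itself.\<close>

lemma subgroup_support:
  assumes nz: "\<one> \<noteq> \<zero>" and eps: "\<And>g. g \<in> support G A \<Longrightarrow> \<epsilon> g = \<one>"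
  shows "subgroup (support G A) G"
proof (rule G.subgroupI)
  have nonzero: "rpart A (inv\<^bsub>G\<^esub> g) \<noteq> {\<zero>}" if g: "g \<in> support G A" for g
  proof
    assume z: "rpart A (inv\<^bsub>G\<^esub> g) = {\<zero>}"
    have gG: "g \<in> carrier G" using g by (simp add: support_def)
    have "set_prod A (rpart A g) {\<zero>} \<subseteq> {\<zero>}"
      by (rule set_prod_subset[OF additive_subgroupI'[OF A.abelian_group_axioms] A.abelian_group_axioms])
        (use part_closed[OF gG] in auto)
    then show False using eps_prod[OF gG] eps[OF g] nz unfolding z by auto
  qed
  show "support G A \<noteq> {}" using one_part nz by (auto simp: support_def)
  fix g assume g: "g \<in> support G A"
  then have gG: "g \<in> carrier G" by (simp add: support_def)
  show "inv\<^bsub>G\<^esub> g \<in> support G A" using nonzero[OF g] gG by (simp add: support_def)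
  fix h assume h: "h \<in> support G A"
  then have hG: "h \<in> carrier G" by (simp add: support_def)
  have "rpart A (g \<otimes>\<^bsub>G\<^esub> h) \<noteq> {\<zero>}"
  proof
    assume z: "rpart A (g \<otimes>\<^bsub>G\<^esub> h) = {\<zero>}"
    have "a = \<zero>" if a: "a \<in> rpart A g" for a
    proof -
      have ac: "a \<in> carrier A" by (rule part_closed[OF gG a])
      have "set_prod A (rpart A h) (rpart A (inv\<^bsub>G\<^esub> h)) \<subseteq> {s \<in> carrier A. a \<otimes> s = \<zero>}"
      proof (rule set_prod_subset[OF _ A.abelian_group_axioms])
        show "additive_subgroup {s \<in> carrier A. a \<otimes> s = \<zero>} A"
          by (rule additive_subgroupI'[OF A.abelian_group_axioms]) (use ac in \<open>auto simp: A.r_distr A.r_minus\<close>)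
        fix x y assume xy: "x \<in> rpart A h" "y \<in> rpart A (inv\<^bsub>G\<^esub> h)"
        have c: "x \<in> carrier A" "y \<in> carrier A" using xy part_closed hG G.inv_closed by blast+
        have "a \<otimes> x = \<zero>" using part_mult[OF gG hG a xy(1)] z by simp
        then show "x \<otimes> y \<in> {s \<in> carrier A. a \<otimes> s = \<zero>}" using c ac by (simp flip: A.m_assoc)
      qed
      then have "a \<otimes> \<epsilon> h = \<zero>" using eps_prod[OF hG] by blast
      then show ?thesis using eps[OF h] ac by simp
    qed
    then have "rpart A g = {\<zero>}" using part(2)[OF gG] by blast
    then show False using g by (simp add: support_def)
  qed
  then show "g \<otimes>\<^bsub>G\<^esub> h \<in> support G A" using gG hG by (simp add: support_def)
qed (auto simp: support_def)

theorem invariant_progenerator: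
  fixes P :: "('a, 'p, 'm) module_scheme"
  assumes P: "progenerator R P" and inv: "G_invariant G A P" and nz: "\<one> \<noteq> \<zero>"
  shows "is_partial_crossed_product G (END_induced G A P) \<and> graded_equivalent G A (END_induced G A P)"
proof -
  have lm: "left_module R P" using P by (simp add: progenerator_def fin_gen_module_def)
  have t: "trace_one R P" using P by (intro generator_trace_one) (simp add: progenerator_def)
  obtain I :: "'p set" and p \<phi> where db: "dual_basis R P I p \<phi>"
    by (rule projective_dual_basis[of R P]) (use P in \<open>auto simp: progenerator_def\<close>)
  have iso: "module_iso R (component_tensor G A g P) P" if "g \<in> support G A" for g
    using inv that by (simp add: G_invariant_def)
  have sG: "g \<in> carrier G" if "g \<in> support G A" for g using that by (simp add: support_def)
  have eps: "\<epsilon> g = \<one>" if "g \<in> support G A" for g by (rule eps_invariant[OF lm t sG[OF that] iso[OF that]])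
  have H: "subgroup (support G A) G" by (rule subgroup_support[OF nz eps])
  \<comment> \<open>The identity is \<epsilon> at g^-1, since the support is closed under inverses;
    this puts the factor of degree g^-1 first.\<close>
  have one: "\<one> \<in> set_prod A (rpart A (inv\<^bsub>G\<^esub> g)) (rpart A g)" if "g \<in> support G A" for g
    using eps_prod[OF G.inv_closed[OF sG[OF that]]] eps[OF subgroup.m_inv_closed[OF H that]] sG[OF that] by simp
  have "is_partial_crossed_product G (END_induced G A P)"
    by (rule END_induced_crossed_product[OF lm db H one iso]) (auto simp: support_def)
  moreover have "graded_equivalent G A (END_induced G A P)"
    by (rule graded_equivalent_END_induced[OF lm db t nz])
  ultimately show ?thesis by blast
qed

end

theorem theorem6p3:
  fixes G :: "('g, 'h) monoid_scheme"
    and A :: "('g, 'a) graded_ring"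
    and \<epsilon> :: "'g \<Rightarrow> 'a"
    and E X :: "'a set"
  assumes "group G"
    and "epsilon_strongly_graded G A \<epsilon>"
    and "semiperfect_ring (base_ring G A)"
    and "finite E"
    and "\<forall>e\<in>E. primitive_idempotent (base_ring G A) e"
    and "pairwise_orthogonal (base_ring G A) E"
    and "irredundant_indec_proj_reps (base_ring G A) E"
    and "X \<subseteq> E" and "X \<noteq> {}"
  shows "(\<forall>P :: ('a, 'p) module.
            progenerator (base_ring G A) P \<and> G_invariant G A P \<longrightarrow>
              is_partial_crossed_product G (END_induced G A P) \<and>
              graded_equivalent G A (END_induced G A P)) \<and>
         (\<forall>P :: ('a, 'q) bimodule. \<forall>e\<in>E.
            bimodule (base_ring G A) P \<and>
            bimodule_class (base_ring G A) P \<in> PicS (base_ring G A) \<longrightarrow>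
              (let T = tensor (base_ring G A) P (principal_module (base_ring G A) e) in
               carrier T = {\<zero>\<^bsub>T\<^esub>} \<or>
               (\<exists>f\<in>E. module_iso (base_ring G A) T (principal_module (base_ring G A) f)))) \<and>
         (subgroup (G_sub G A X) G \<and>
          is_partial_crossed_product (G\<lparr>carrier := G_sub G A X\<rparr>)
            (END_induced (G\<lparr>carrier := G_sub G A X\<rparr>) (restrict_grading A (G_sub G A X))
              (Q_sum (base_ring G A) X))) \<and>
         (G_sub G A E = {g \<in> carrier G. \<forall>e\<in>E. \<epsilon> g \<otimes>\<^bsub>A\<^esub> e = e} \<and>
          {g \<in> carrier G. \<forall>e\<in>E. \<epsilon> g \<otimes>\<^bsub>A\<^esub> e = e} =
            {g \<in> carrier G. \<forall>e\<in>E. \<epsilon> g \<otimes>\<^bsub>A\<^esub> e \<noteq> \<zero>\<^bsub>A\<^esub>}) \<and>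
         (is_partial_crossed_product (G\<lparr>carrier := G_sub G A E\<rparr>)
            (END_induced (G\<lparr>carrier := G_sub G A E\<rparr>) (restrict_grading A (G_sub G A E))
              (Q_sum (base_ring G A) E)) \<and>
          graded_equivalent (G\<lparr>carrier := G_sub G A E\<rparr>) (restrict_grading A (G_sub G A E))
            (END_induced (G\<lparr>carrier := G_sub G A E\<rparr>) (restrict_grading A (G_sub G A E))
              (Q_sum (base_ring G A) E)))"
proof -
  interpret epsilon_graded G A \<epsilon>
    by (intro epsilon_graded.intro epsilon_graded_axioms.intro epsilon_strongly_graded_unital[of _ _ \<epsilon>] assms(2))
  interpret semiperfect_epsilon_graded G A \<epsilon> E
    by unfold_locales (use assms(3-5,7) in blast)+
  have ne: "E \<noteq> {}" using assms(8,9) by blast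
  \<comment> \<open>A primitive idempotent is nonzero, so the ring is not the zero ring.\<close>
  have nz: "\<one>\<^bsub>A\<^esub> \<noteq> \<zero>\<^bsub>A\<^esub>" using ne E(3) E_closed A.one_zeroD by blast
  show ?thesis unfolding Let_def
  proof (intro conjI allI ballI impI)
    fix P :: "('a, 'p) module" assume P: "progenerator R P \<and> G_invariant G A P"
    show "is_partial_crossed_product G (END_induced G A P)" "graded_equivalent G A (END_induced G A P)"
      using invariant_progenerator[of P] P nz by blast+
  next
    fix P :: "('a, 'q) bimodule" and e
    assume e: "e \<in> E" and P: "bimodule R P \<and> bimodule_class R P \<in> PicS R"
    show "carrier (tensor R P (principal_module R e)) = {\<zero>\<^bsub>tensor R P (principal_module R e)\<^esub>} \<or>
      (\<exists>f\<in>E. module_iso R (tensor R P (principal_module R e)) (principal_module R f))"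
      using SR.PicS_tensor_principal[OF _ _ primitive_E[OF e] reps_E, of P] P by blast
  qed (fact subgroup_G_sub[OF assms(8)] END_Q_sum_crossed_product[OF assms(8)] G_sub_E
    END_Q_sum_crossed_product[OF subset_refl] graded_equivalent_Q_sum[OF ne])+
qed

end
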